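(* Let $1\leqslant k\leqslant n-1$ and $f:\Lambda^{k+1}\times\Lambda^{k-1}\rightarrow\mathbb{R}$. The following statements are equivalent: (i) $f$ is ext-int. polyaffine. (ii) $f$ is ext-int. quasiaffine. (iii) $f$ is ext-int. one affine. (iv) For all $0\leqslant s\leqslant\left[\frac{n}{k+1}\right]$ and $0\leqslant r\leqslant\left[\frac{n}{n-k+1}\right]$, there exist $c_s\in\Lambda^{(k+1)s}$, $d_r\in\Lambda^{(n-k+1)r}$ such that $$f(\xi,\eta)=\sum_{s=0}^{\left[\frac{n}{k+1}\right]}\langle c_s;\xi^s\rangle+\sum_{r=0}^{\left[\frac{n}{n-k+1}\right]}\langle d_r;(\ast\eta)^r\rangle,\quad\text{for all }\xi\in\Lambda^{k+1},\ \eta\in\Lambda^{k-1}.$$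
   Context: $\Lambda^k=\Lambda^k(\mathbb{R}^n)$ is the vector space of alternating $k$-linear maps on $\mathbb{R}^n$ (exterior $k$-forms), with $\Lambda^0=\mathbb{R}$ and $\Lambda^k=\{0\}$ for $k>n$; $\Lambda^1$ is identified with $\mathbb{R}^n$. The symbols $\wedge$, $\lrcorner$, $\langle\,;\rangle$, $\ast$ denote the exterior product, interior product, Euclidean scalar product and Hodge star ($\ast:\Lambda^k\to\Lambda^{n-k}$); for $a\in\Lambda^1$, $b\in\Lambda^k$, the form $a\lrcorner b\in\Lambda^{k-1}$ satisfies $\langle a\lrcorner b;c\rangle=\langle b;a\wedge c\rangle$ for all $c\in\Lambda^{k-1}$. Powers are exterior powers: $\xi^s=\xi\wedge\cdots\wedge\xi$ ($s$ times), $\xi^0=1$. $[x]$ denotes the integer part of $x$. $d$ and $\delta$ denote the exterior derivative and the codifferential on differential forms, $d\omega=\sum_{i}e^i\wedge\partial_i\omega$ and $\delta\omega=\sum_i e^i\lrcorner\,\partial_i\omega$, with $e^1,\dots,e^n$ the standard basis. $W^{1,\infty}_0(\Omega;\Lambda^k)$ is the usual space of $W^{1,\infty}$ $k$-forms on $\Omega$ vanishing on the boundary (i.e. $W^{1,\infty}\cap W^{1,1}_0$). Definitions, for $f:\Lambda^{k+1}\times\Lambda^{k-1}\to\mathbb{R}$: 1. $f$ is ext-int. one convex if for every $\xi\in\Lambda^{k+1}$, $\eta\in\Lambda^{k-1}$, $a\in\Lambda^1$, $b\in\Lambda^k$, the function $g:\mathbb{R}\to\mathbb{R}$, $g(t):=f(\xi+t\,a\wedge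 b,\ \eta+t\,a\lrcorner b)$, is convex. $f$ is ext-int. one affine if both $f$ and $-f$ are ext-int. one convex. 2. $f$ is ext-int. quasiconvex if $f$ is locally integrable, Borel measurable and $\int_\Omega f(\xi+d\omega,\eta+\delta\omega)\geqslant f(\xi,\eta)\operatorname{meas}\Omega$ for every open, bounded set $\Omega\subseteq\mathbb{R}^n$, $\xi\in\Lambda^{k+1}$, $\eta\in\Lambda^{k-1}$ and $\omega\in W^{1,\infty}_0(\Omega;\Lambda^k)$. $f$ is ext-int. quasiaffine if both $f$ and $-f$ are ext-int. quasiconvex. 3. $f$ is ext-int. polyconvex if there exists a convex function $F:\Lambda^{k+1}\times\cdots\times\Lambda^{(k+1)\left[\frac{n}{k+1}\right]}\times\Lambda^{n-k+1}\times\cdots\times\Lambda^{(n-k+1)\left[\frac{n}{n-k+1}\right]}\to\mathbb{R}$ such that, for all $\xi\in\Lambda^{k+1}$, $\eta\in\Lambda^{k-1}$, $f(\xi,\eta)=F\left(\xi,\ldots,\xi^{\left[\frac{n}{k+1}\right]},\ast\eta,\ldots,(\ast\eta)^{\left[\frac{n}{n-k+1}\right]}\right)$. $f$ is ext-int. polyaffine if both $f$ and $-f$ are ext-int. polyconvex. *)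

theory Defs
  imports "HOL-Analysis.Analysis" "HOL-Analysis.Finite_Function_Topology"
begin

section \<open>Exterior forms on \<open>\<real>\<^sup>n\<close>\<close>

text \<open>
  The space \<open>\<real>\<^sup>n\<close> is \<open>real^'n\<close> with \<open>n = CARD('n)\<close>; the linear order on \<open>'n\<close> orders the standard
  basis. An element of the type \<open>'n form\<close> is a family of alternating \<open>k\<close>-linear maps, one for each
  \<open>k\<close>: the \<open>k\<close>-th member is the restriction to argument lists of length \<open>k\<close>. Since the members
  with \<open>k > n\<close> vanish, the type is the direct sum of all the \<open>\<Lambda> k\<close>, and \<open>\<Lambda> k\<close> is the subspace
  of the families whose only nonzero member is the \<open>k\<close>-th one.
\<close>

definition alternating_form :: "((real^'n) list \<Rightarrow> real) \<Rightarrow> bool" where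
  "alternating_form \<phi> \<longleftrightarrow>
     (\<forall>us ws. linear (\<lambda>v. \<phi> (us @ v # ws))) \<and> (\<forall>vs. \<not> distinct vs \<longrightarrow> \<phi> vs = 0)"

lemma alternating_formI:
  assumes "\<And>us ws u v. \<phi> (us @ (u + v) # ws) = \<phi> (us @ u # ws) + \<phi> (us @ v # ws)"
    and "\<And>us ws c v. \<phi> (us @ (c *\<^sub>R v) # ws) = c * \<phi> (us @ v # ws)"
    and "\<And>vs. \<not> distinct vs \<Longrightarrow> \<phi> vs = 0"
  shows "alternating_form \<phi>"
  using assms unfolding alternating_form_def by (auto intro!: linearI)

lemma alternating_formD:
  assumes "alternating_form \<phi>"
  shows "\<phi> (us @ (u + v) # ws) = \<phi> (us @ u # ws) + \<phi> (us @ v # ws)"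
    and "\<phi> (us @ (c *\<^sub>R v) # ws) = c * \<phi> (us @ v # ws)"
    and "\<not> distinct vs \<Longrightarrow> \<phi> vs = 0"
  using assms linear_add[of "\<lambda>v. \<phi> (us @ v # ws)" u v] linear_scale[of "\<lambda>v. \<phi> (us @ v # ws)" c v]
  unfolding alternating_form_def by auto

lemma alternating_form_weighted:
  assumes "alternating_form \<phi>"
  shows "alternating_form (\<lambda>vs. w (length vs) * \<phi> vs)"
  by (rule alternating_formI) (simp_all add: alternating_formD[OF assms] algebra_simps)

lemma alternating_form_zero: "alternating_form (\<lambda>_. 0)"
  by (rule alternating_formI) auto

typedef (overloaded) 'n form = "{\<phi> :: (real^'n) list \<Rightarrow> real. alternating_form \<phi>}"
  morphisms app Abs_form
  using alternating_form_zero by blast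

setup_lifting type_definition_form

lemma alternating_form_app: "alternating_form (app \<omega>)"
  using app by blast

lemma app_Abs_form: "alternating_form \<phi> \<Longrightarrow> app (Abs_form \<phi>) = \<phi>"
  by (simp add: Abs_form_inverse)

lemma form_eqI: "(\<And>vs. app \<omega> vs = app \<theta> vs) \<Longrightarrow> \<omega> = \<theta>"
  by (simp add: app_inject[symmetric] fun_eq_iff)

lemma linear_app: "linear (\<lambda>v. app \<omega> (us @ v # ws))"
  using alternating_form_app[of \<omega>] unfolding alternating_form_def by blast

lemma app_add: "app \<omega> (us @ (u + v) # ws) = app \<omega> (us @ u # ws) + app \<omega> (us @ v # ws)"
  using linear_add[OF linear_app] by blast

lemma app_scale: "app \<omega> (us @ (c *\<^sub>R v) # ws) = c * app \<omega> (us @ v # ws)"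
  using linear_scale[OF linear_app] by force

lemma app_not_distinct: "\<not> distinct vs \<Longrightarrow> app \<omega> vs = 0"
  using alternating_form_app[of \<omega>] unfolding alternating_form_def by blast

instantiation form :: (finite) real_vector
begin

lift_definition zero_form :: "'a form" is "\<lambda>_. 0"
  by (rule alternating_form_zero)

lift_definition plus_form :: "'a form \<Rightarrow> 'a form \<Rightarrow> 'a form" is "\<lambda>\<phi> \<psi> vs. \<phi> vs + \<psi> vs"
  by (auto simp: alternating_form_def intro: linear_compose_add)

lift_definition uminus_form :: "'a form \<Rightarrow> 'a form" is "\<lambda>\<phi> vs. - \<phi> vs"
  by (auto simp: alternating_form_def intro: linear_compose_neg)

lift_definition minus_form :: "'a form \<Rightarrow> 'a form \<Rightarrow> 'a form" is "\<lambda>\<phi> \<psi> vs. \<phi> vs - \<psi> vs"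
  by (auto simp: alternating_form_def intro: linear_compose_sub)

lift_definition scaleR_form :: "real \<Rightarrow> 'a form \<Rightarrow> 'a form" is "\<lambda>c \<phi> vs. c * \<phi> vs"
  by (rule alternating_form_weighted)

instance
  by standard (transfer; simp add: fun_eq_iff algebra_simps)+

end

lemma app_zero [simp]: "app 0 vs = 0"
  and app_plus [simp]: "app (\<omega> + \<theta>) vs = app \<omega> vs + app \<theta> vs"
  and app_uminus [simp]: "app (- \<omega>) vs = - app \<omega> vs"
  and app_minus [simp]: "app (\<omega> - \<theta>) vs = app \<omega> vs - app \<theta> vs"
  and app_scaleR [simp]: "app (c *\<^sub>R \<omega>) vs = c * app \<omega> vs"
  by (transfer; simp)+

lemma app_sum [simp]: "app (sum f A) vs = (\<Sum>a\<in>A. app (f a) vs)"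
  by (induction A rule: infinite_finite_induct) auto

definition Lam :: "nat \<Rightarrow> 'n::finite form set" ("\<Lambda>") where
  "\<Lambda> k = {\<omega>. \<forall>vs. length vs \<noteq> k \<longrightarrow> app \<omega> vs = 0}"

lemma Lam_D: "\<omega> \<in> \<Lambda> k \<Longrightarrow> length vs \<noteq> k \<Longrightarrow> app \<omega> vs = 0"
  by (simp add: Lam_def)

lemma subspace_Lam: "subspace (\<Lambda> k)"
  by (auto simp: subspace_def Lam_def)

subsection \<open>Exterior product\<close>

text \<open>
  For \<open>\<alpha> \<in> \<Lambda> p\<close> and \<open>\<beta> \<in> \<Lambda> q\<close> this is the sum over all \<open>(p,q)\<close>-shuffles, normalised such that
  \<open>(e\<^sup>1 \<and> \<dots> \<and> e\<^sup>p) (e\<^sub>1, \<dots>, e\<^sub>p) = 1\<close>. The set \<open>S\<close> contains the positions of the arguments that go to \<open>\<alpha>\<close>.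
\<close>

definition shuffle_sign :: "nat set \<Rightarrow> real" where
  "shuffle_sign S = (- 1) ^ card {(i, j). i \<in> S \<and> j \<notin> S \<and> j < i}"

definition shuffle_prod :: "('a list \<Rightarrow> real) \<Rightarrow> ('a list \<Rightarrow> real) \<Rightarrow> 'a list \<Rightarrow> real" where
  "shuffle_prod \<phi> \<psi> vs =
     (\<Sum>S\<in>Pow {..<length vs}. shuffle_sign S * \<phi> (nths vs S) * \<psi> (nths vs (- S)))"

lemma shuffle_sign_insert_0:
  assumes "finite S"
  shows "shuffle_sign (insert 0 (Suc ` S)) = shuffle_sign S"
proof -
  have "{(i, j). i \<in> insert 0 (Suc ` S) \<and> j \<notin> insert 0 (Suc ` S) \<and> j < i}
      = (\<lambda>(i, j). (Suc i, Suc j)) ` {(i, j). i \<in> S \<and> j \<notin> S \<and> j < i}" (is "?L = ?R")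
  proof
    show "?L \<subseteq> ?R"
    proof
      fix p assume "p \<in> ?L"
      then obtain i j where "p = (Suc i, j)" "i \<in> S" "j \<notin> insert 0 (Suc ` S)" "j < Suc i"
        by auto
      then show "p \<in> ?R" by (cases j) (auto simp: image_iff)
    qed
  qed auto
  then show ?thesis
    unfolding shuffle_sign_def by (simp add: card_image inj_on_def)
qed

lemma shuffle_sign_Suc_image:
  assumes "finite S"
  shows "shuffle_sign (Suc ` S) = (- 1) ^ card S * shuffle_sign S"
proof -
  let ?T = "{(i, j). i \<in> S \<and> j \<notin> S \<and> j < i}"
  have fin: "finite ?T"
    by (rule finite_subset[of _ "Sigma S (\<lambda>i. {..<i})"]) (use assms in auto)
  have "{(i, j). i \<in> Suc ` S \<and> j \<notin> Suc ` S \<and> j < i}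
      = (\<lambda>i. (Suc i, 0)) ` S \<union> (\<lambda>(i, j). (Suc i, Suc j)) ` ?T" (is "?L = ?R")
  proof
    show "?L \<subseteq> ?R"
    proof
      fix p assume "p \<in> ?L"
      then obtain i j where "p = (Suc i, j)" "i \<in> S" "j \<notin> Suc ` S" "j < Suc i"
        by auto
      then show "p \<in> ?R" by (cases j) (auto simp: image_iff)
    qed
  qed auto
  moreover have "card ?R = card S + card ?T"
    using assms fin by (subst card_Un_disjoint) (auto simp: card_image inj_on_def)
  ultimately show ?thesis
    unfolding shuffle_sign_def by (simp add: power_add)
qed

lemma shuffle_prod_Nil: "shuffle_prod \<phi> \<psi> [] = \<phi> [] * \<psi> []"
  by (simp add: shuffle_prod_def shuffle_sign_def)

lemma shuffle_prod_Cons: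
  "shuffle_prod \<phi> \<psi> (v # vs) =
     shuffle_prod (\<lambda>xs. \<phi> (v # xs)) \<psi> vs
     + shuffle_prod (\<lambda>xs. (- 1) ^ length xs * \<phi> xs) (\<lambda>xs. \<psi> (v # xs)) vs"
proof -
  let ?n = "length vs"
  let ?g = "\<lambda>S. shuffle_sign S * \<phi> (nths (v # vs) S) * \<psi> (nths (v # vs) (- S))"
  have split: "Pow {..<Suc ?n}
      = (\<lambda>S. insert 0 (Suc ` S)) ` Pow {..<?n} \<union> (\<lambda>S. Suc ` S) ` Pow {..<?n}" (is "_ = ?R")
  proof
    show "Pow {..<Suc ?n} \<subseteq> ?R"
    proof
      fix A assume A: "A \<in> Pow {..<Suc ?n}"
      define S where "S = {j. Suc j \<in> A}"
      have "S \<in> Pow {..<?n}"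
        using A by (auto simp: S_def)
      moreover have iff: "i \<in> A \<longleftrightarrow> (0 \<in> A \<and> i = 0) \<or> i \<in> Suc ` S" for i
        by (cases i) (auto simp: S_def)
      have "A = insert 0 (Suc ` S) \<or> A = Suc ` S"
      proof (cases "0 \<in> A")
        case True
        then have "A = insert 0 (Suc ` S)" using iff by blast
        then show ?thesis ..
      next
        case False
        then have "A = Suc ` S" using iff by blast
        then show ?thesis ..
      qed
      ultimately show "A \<in> ?R" by blast
    qed
  qed auto
  have fin: "finite S" if "S \<in> Pow {..<?n}" for S
    using that finite_subset by auto
  have sets: "{j. Suc j \<in> insert 0 (Suc ` S)} = S" "{j. Suc j \<in> - insert 0 (Suc ` S)} = - S"
    "{j. Suc j \<in> Suc ` S} = S" "{j. Suc j \<in> - Suc ` S} = - S" for S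
    by auto
  have nths: "nths (v # vs) (insert 0 (Suc ` S)) = v # nths vs S"
    "nths (v # vs) (- insert 0 (Suc ` S)) = nths vs (- S)"
    "nths (v # vs) (Suc ` S) = nths vs S"
    "nths (v # vs) (- Suc ` S) = v # nths vs (- S)" for S
    by (simp_all only: nths_Cons sets) auto
  have len: "length (nths vs S) = card S" if "S \<in> Pow {..<?n}" for S
  proof -
    have "{i. i < ?n \<and> i \<in> S} = S" using that by auto
    then show ?thesis by (simp add: length_nths)
  qed
  have inj: "inj_on (\<lambda>S. insert 0 (Suc ` S)) A" "inj_on (\<lambda>S. Suc ` S) A" for A
    by (rule inj_on_inverseI[where g = "\<lambda>T. {j. Suc j \<in> T}"], simp only: sets)+
  have "shuffle_prod \<phi> \<psi> (v # vs) = sum ?g (Pow {..<Suc ?n})"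
    by (simp add: shuffle_prod_def)
  also have "\<dots> = sum ?g ((\<lambda>S. insert 0 (Suc ` S)) ` Pow {..<?n})
      + sum ?g ((\<lambda>S. Suc ` S) ` Pow {..<?n})"
    unfolding split by (rule sum.union_disjoint) auto
  also have "sum ?g ((\<lambda>S. insert 0 (Suc ` S)) ` Pow {..<?n})
      = shuffle_prod (\<lambda>xs. \<phi> (v # xs)) \<psi> vs"
    unfolding shuffle_prod_def
    by (subst sum.reindex[OF inj(1)], rule sum.cong)
       (simp_all only: nths shuffle_sign_insert_0 fin comp_apply)
  also have "sum ?g ((\<lambda>S. Suc ` S) ` Pow {..<?n})
      = shuffle_prod (\<lambda>xs. (- 1) ^ length xs * \<phi> xs) (\<lambda>xs. \<psi> (v # xs)) vs"
    unfolding shuffle_prod_def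
    by (subst sum.reindex[OF inj(2)], rule sum.cong)
       (simp_all only: nths shuffle_sign_Suc_image fin len comp_apply mult_ac)
  finally show ?thesis .
qed

lemma shuffle_prod_add_left:
  "shuffle_prod (\<lambda>xs. \<phi> xs + \<phi>' xs) \<psi> vs = shuffle_prod \<phi> \<psi> vs + shuffle_prod \<phi>' \<psi> vs"
  by (simp add: shuffle_prod_def algebra_simps sum.distrib)

lemma shuffle_prod_add_right:
  "shuffle_prod \<phi> (\<lambda>xs. \<psi> xs + \<psi>' xs) vs = shuffle_prod \<phi> \<psi> vs + shuffle_prod \<phi> \<psi>' vs"
  by (simp add: shuffle_prod_def algebra_simps sum.distrib)

lemma shuffle_prod_scale_left:
  "shuffle_prod (\<lambda>xs. c * \<phi> xs) \<psi> vs = c * shuffle_prod \<phi> \<psi> vs"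
  by (simp add: shuffle_prod_def sum_distrib_left mult_ac)

lemma shuffle_prod_scale_right:
  "shuffle_prod \<phi> (\<lambda>xs. c * \<psi> xs) vs = c * shuffle_prod \<phi> \<psi> vs"
  by (simp add: shuffle_prod_def sum_distrib_left mult_ac)

lemma alternating_form_Cons:
  assumes "alternating_form \<phi>"
  shows "alternating_form (\<lambda>xs. \<phi> (v # xs))"
proof (rule alternating_formI)
  fix us ws u w and c :: real
  show "\<phi> (v # us @ (u + w) # ws) = \<phi> (v # us @ u # ws) + \<phi> (v # us @ w # ws)"
    using alternating_formD(1)[OF assms, of "v # us"] by simp
  show "\<phi> (v # us @ (c *\<^sub>R w) # ws) = c * \<phi> (v # us @ w # ws)"
    using alternating_formD(2)[OF assms, of "v # us"] by simp
next
  show "\<phi> (v # vs) = 0" if "\<not> distinct vs" for vs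
    using that by (intro alternating_formD(3)[OF assms]) simp
qed

lemma alternating_form_sign:
  "alternating_form \<phi> \<Longrightarrow> alternating_form (\<lambda>xs. (- 1) ^ length xs * \<phi> xs)"
  by (rule alternating_form_weighted)

lemma alternating_form_adjacent:
  assumes lin: "\<And>us ws. linear (\<lambda>v. \<phi> (us @ v # ws))"
    and adj: "\<And>us u ws. \<phi> (us @ u # u # ws) = 0"
  shows "alternating_form \<phi>"
proof -
  note add = linear_add[OF lin]
  have swap: "\<phi> (us @ u # v # ws) = - \<phi> (us @ v # u # ws)" for us u v ws
  proof -
    have "0 = \<phi> (us @ (u + v) # (u + v) # ws)" by (simp add: adj)
    also have "\<dots> = \<phi> (us @ u # (u + v) # ws) + \<phi> (us @ v # (u + v) # ws)" by (rule add)
    also have "\<phi> (us @ u # (u + v) # ws) = \<phi> (us @ u # u # ws) + \<phi> (us @ u # v # ws)"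
      using add[of "us @ [u]" u v ws] by simp
    also have "\<phi> (us @ v # (u + v) # ws) = \<phi> (us @ v # u # ws) + \<phi> (us @ v # v # ws)"
      using add[of "us @ [v]" u v ws] by simp
    finally show ?thesis by (simp add: adj)
  qed
  have "\<phi> (us @ u # xs @ u # ws) = 0" for us u xs ws
  proof (induction xs arbitrary: us)
    case Nil
    then show ?case by (simp add: adj)
  next
    case (Cons x xs)
    show ?case using Cons[of "us @ [x]"] swap[of us u x "xs @ u # ws"] by simp
  qed
  then have "\<phi> vs = 0" if "\<not> distinct vs" for vs
    using not_distinct_decomp[OF that] by auto
  with lin show ?thesis by (simp add: alternating_form_def)
qed

lemma linear_shuffle_prod:
  assumes "alternating_form \<phi>" "alternating_form \<psi>"
  shows "linear (\<lambda>v. shuffle_prod \<phi> \<psi> (us @ v # ws))"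
  using assms
proof (induction us arbitrary: \<phi> \<psi>)
  case Nil
  have "linear (\<lambda>v. \<phi> (v # xs))" "linear (\<lambda>v. \<psi> (v # xs))" for xs
    using Nil by (auto simp: alternating_form_def dest: spec[of _ "[]"])
  note l = linear_add[OF this(1)] linear_scale[OF this(1)]
    linear_add[OF this(2)] linear_scale[OF this(2)]
  show ?case
    by (auto intro!: linearI simp: shuffle_prod_Cons l shuffle_prod_add_left shuffle_prod_add_right
        shuffle_prod_scale_left shuffle_prod_scale_right distrib_left)
next
  case (Cons u us)
  show ?case
    by (simp only: append_Cons shuffle_prod_Cons)
       (intro linear_compose_add Cons.IH alternating_form_Cons alternating_form_sign Cons.prems)
qed

lemma shuffle_prod_adjacent:
  assumes "alternating_form \<phi>" "alternating_form \<psi>"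
  shows "shuffle_prod \<phi> \<psi> (us @ u # u # ws) = 0"
  using assms
proof (induction us arbitrary: \<phi> \<psi>)
  case Nil
  then have z: "\<phi> (u # u # xs) = 0" "\<psi> (u # u # xs) = 0" for xs
    by (auto simp: alternating_form_def)
  have "shuffle_prod (\<lambda>xs. 0) \<theta> ws = 0" "shuffle_prod \<theta> (\<lambda>xs. 0) ws = 0" for \<theta> :: "(real, 'a) vec list \<Rightarrow> real"
    by (auto simp: shuffle_prod_def)
  with z shuffle_prod_scale_left[of "- 1" "\<lambda>xs. (- 1) ^ length xs * \<phi> (u # xs)" "\<lambda>xs. \<psi> (u # xs)" ws]
  show ?case by (simp add: shuffle_prod_Cons mult.assoc)
next
  case (Cons x us)
  have "shuffle_prod (\<lambda>xs. \<phi> (x # xs)) \<psi> (us @ u # u # ws) = 0"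
    by (intro Cons.IH alternating_form_Cons Cons.prems)
  moreover have "shuffle_prod (\<lambda>xs. (- 1) ^ length xs * \<phi> xs) (\<lambda>xs. \<psi> (x # xs)) (us @ u # u # ws) = 0"
    by (intro Cons.IH alternating_form_Cons alternating_form_sign Cons.prems)
  ultimately show ?case
    by (simp add: shuffle_prod_Cons)
qed

lemma alternating_form_shuffle_prod:
  assumes "alternating_form \<phi>" "alternating_form \<psi>"
  shows "alternating_form (shuffle_prod \<phi> \<psi>)"
  using linear_shuffle_prod[OF assms] shuffle_prod_adjacent[OF assms]
  by (rule alternating_form_adjacent)

lift_definition wedge :: "'n::finite form \<Rightarrow> 'n form \<Rightarrow> 'n form" (infixr "\<and>\<^sub>\<Lambda>" 75)
  is shuffle_prod
  by (rule alternating_form_shuffle_prod)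

lemma app_wedge_Nil: "app (\<alpha> \<and>\<^sub>\<Lambda> \<beta>) [] = app \<alpha> [] * app \<beta> []"
  by (simp add: wedge.rep_eq shuffle_prod_Nil)

lemma wedge_add_left: "(\<alpha> + \<alpha>') \<and>\<^sub>\<Lambda> \<beta> = \<alpha> \<and>\<^sub>\<Lambda> \<beta> + \<alpha>' \<and>\<^sub>\<Lambda> \<beta>"
  by (rule form_eqI) (simp add: wedge.rep_eq shuffle_prod_def algebra_simps sum.distrib)

lemma wedge_add_right: "\<alpha> \<and>\<^sub>\<Lambda> (\<beta> + \<beta>') = \<alpha> \<and>\<^sub>\<Lambda> \<beta> + \<alpha> \<and>\<^sub>\<Lambda> \<beta>'"
  by (rule form_eqI) (simp add: wedge.rep_eq shuffle_prod_def algebra_simps sum.distrib)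

lemma wedge_scaleR_left: "(c *\<^sub>R \<alpha>) \<and>\<^sub>\<Lambda> \<beta> = c *\<^sub>R (\<alpha> \<and>\<^sub>\<Lambda> \<beta>)"
  by (rule form_eqI) (simp add: wedge.rep_eq shuffle_prod_def sum_distrib_left mult_ac)

lemma wedge_scaleR_right: "\<alpha> \<and>\<^sub>\<Lambda> (c *\<^sub>R \<beta>) = c *\<^sub>R (\<alpha> \<and>\<^sub>\<Lambda> \<beta>)"
  by (rule form_eqI) (simp add: wedge.rep_eq shuffle_prod_def sum_distrib_left mult_ac)

lemma bilinear_wedge: "bilinear (\<and>\<^sub>\<Lambda>)"
  by (auto simp: bilinear_def intro!: linearI
      simp: wedge_add_left wedge_add_right wedge_scaleR_left wedge_scaleR_right)

lemma wedge_zero_right [simp]: "\<alpha> \<and>\<^sub>\<Lambda> 0 = 0"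
  using wedge_scaleR_right[of \<alpha> 0 0] by simp

lemma wedge_Lam:
  assumes "\<alpha> \<in> \<Lambda> p" "\<beta> \<in> \<Lambda> q"
  shows "\<alpha> \<and>\<^sub>\<Lambda> \<beta> \<in> \<Lambda> (p + q)"
  unfolding Lam_def
proof (intro CollectI allI impI)
  fix vs :: "(real^'a) list" assume vs: "length vs \<noteq> p + q"
  have "app \<alpha> (nths vs S) * app \<beta> (nths vs (- S)) = 0" for S
  proof -
    have "length (nths vs S) + length (nths vs (- S)) = length vs"
    proof -
      have "length (nths vs S) + length (nths vs (- S))
          = card ({i. i < length vs \<and> i \<in> S} \<union> {i. i < length vs \<and> i \<in> - S})"
        unfolding length_nths by (rule card_Un_disjoint[symmetric]) auto
      also have "{i. i < length vs \<and> i \<in> S} \<union> {i. i < length vs \<and> i \<in> - S} = {..<length vs}"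
        by auto
      finally show ?thesis by simp
    qed
    then show ?thesis
      using vs Lam_D[OF assms(1)] Lam_D[OF assms(2)] by (metis mult_eq_0_iff)
  qed
  then show "app (\<alpha> \<and>\<^sub>\<Lambda> \<beta>) vs = 0"
    unfolding wedge.rep_eq shuffle_prod_def mult.assoc by (intro sum.neutral) simp
qed

lift_definition unit_form :: "'n::finite form" is "\<lambda>vs. if vs = [] then 1 else 0"
  by (rule alternating_formI) auto

primrec wedge_power :: "'n::finite form \<Rightarrow> nat \<Rightarrow> 'n form" where
  "wedge_power \<xi> 0 = unit_form"
| "wedge_power \<xi> (Suc s) = \<xi> \<and>\<^sub>\<Lambda> wedge_power \<xi> s"

subsection \<open>One-forms and interior product\<close>

text \<open>The identification of \<open>\<real>\<^sup>n\<close> with \<open>\<Lambda> 1\<close>.\<close>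

lift_definition one_form :: "real^'n \<Rightarrow> 'n::finite form"
  is "\<lambda>a vs. if length vs = 1 then a \<bullet> hd vs else 0"
proof (rule alternating_formI)
  fix a :: "real^'n" and us ws :: "(real^'n) list" and u v c
  show "(if length (us @ (u + v) # ws) = 1 then a \<bullet> hd (us @ (u + v) # ws) else 0) =
    (if length (us @ u # ws) = 1 then a \<bullet> hd (us @ u # ws) else 0) +
    (if length (us @ v # ws) = 1 then a \<bullet> hd (us @ v # ws) else 0)"
    by (cases us) (auto simp: inner_add_right)
  show "(if length (us @ (c *\<^sub>R v) # ws) = 1 then a \<bullet> hd (us @ (c *\<^sub>R v) # ws) else 0) =
    c * (if length (us @ v # ws) = 1 then a \<bullet> hd (us @ v # ws) else 0)"
    by (cases us) auto
next
  fix a :: "real^'n" and vs :: "(real^'n) list" assume "\<not> distinct vs"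
  then show "(if length vs = 1 then a \<bullet> hd vs else 0) = 0"
    by (auto simp: length_Suc_conv)
qed

lift_definition int_prod :: "real^'n \<Rightarrow> 'n::finite form \<Rightarrow> 'n form" (infixr "\<lrcorner>" 75)
  is "\<lambda>a \<phi> vs. \<phi> (a # vs)"
  by (rule alternating_form_Cons)

lemma app_unit_wedge:
  "shuffle_prod (\<lambda>xs. if xs = [] then c else 0) \<psi> vs = c * \<psi> vs"
proof (induction vs arbitrary: \<psi>)
  case Nil
  then show ?case by (simp add: shuffle_prod_Nil)
next
  case (Cons v vs)
  have "(\<lambda>xs :: 'a list. (- 1) ^ length xs * (if xs = [] then c else 0)) = (\<lambda>xs. if xs = [] then c else 0)"
    by auto
  moreover have "shuffle_prod (\<lambda>xs. 0) \<psi> vs = 0"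
    by (simp add: shuffle_prod_def)
  ultimately show ?case
    by (simp add: shuffle_prod_Cons Cons.IH)
qed

lemma unit_wedge [simp]: "unit_form \<and>\<^sub>\<Lambda> \<beta> = \<beta>"
  by (rule form_eqI) (simp add: wedge.rep_eq unit_form.rep_eq app_unit_wedge)

lemma app_one_wedge_Nil [simp]: "app (one_form a \<and>\<^sub>\<Lambda> \<beta>) [] = 0"
  by (simp add: app_wedge_Nil one_form.rep_eq)

lemma app_one_wedge_Cons:
  "app (one_form a \<and>\<^sub>\<Lambda> \<beta>) (v # vs) = (a \<bullet> v) * app \<beta> vs - app (one_form a \<and>\<^sub>\<Lambda> (v \<lrcorner> \<beta>)) vs"
proof -
  have 1: "(\<lambda>xs. app (one_form a) (v # xs)) = (\<lambda>xs. if xs = [] then a \<bullet> v else 0)"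
    by (auto simp: one_form.rep_eq)
  have 2: "(\<lambda>xs. (- 1) ^ length xs * app (one_form a) xs) = (\<lambda>xs. (- 1) * app (one_form a) xs)"
    by (auto simp: one_form.rep_eq fun_eq_iff)
  have 3: "(\<lambda>xs. app \<beta> (v # xs)) = app (v \<lrcorner> \<beta>)"
    by (simp add: int_prod.rep_eq)
  show ?thesis
    unfolding wedge.rep_eq shuffle_prod_Cons 1 2 3 app_unit_wedge shuffle_prod_scale_left by simp
qed

lemma app_int_prod: "app (a \<lrcorner> \<omega>) vs = app \<omega> (a # vs)"
  by (simp add: int_prod.rep_eq)

lemma int_prod_one_wedge:
  "v \<lrcorner> (one_form a \<and>\<^sub>\<Lambda> \<beta>) = (a \<bullet> v) *\<^sub>R \<beta> - one_form a \<and>\<^sub>\<Lambda> (v \<lrcorner> \<beta>)"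
  by (rule form_eqI) (simp add: app_int_prod app_one_wedge_Cons)

lemma wedge_diff_right: "\<alpha> \<and>\<^sub>\<Lambda> (\<beta> - \<beta>') = \<alpha> \<and>\<^sub>\<Lambda> \<beta> - \<alpha> \<and>\<^sub>\<Lambda> \<beta>'"
  using wedge_add_right[of \<alpha> "\<beta> - \<beta>'" \<beta>'] by (simp add: algebra_simps)

lemma one_wedge_anticommute:
  "one_form a \<and>\<^sub>\<Lambda> one_form b \<and>\<^sub>\<Lambda> \<beta> = - (one_form b \<and>\<^sub>\<Lambda> one_form a \<and>\<^sub>\<Lambda> \<beta>)"
proof (rule form_eqI)
  fix vs
  show "app (one_form a \<and>\<^sub>\<Lambda> one_form b \<and>\<^sub>\<Lambda> \<beta>) vs = app (- (one_form b \<and>\<^sub>\<Lambda> one_form a \<and>\<^sub>\<Lambda> \<beta>)) vs"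
  proof (induction vs arbitrary: \<beta>)
    case (Cons v vs)
    then show ?case
      by (simp add: app_one_wedge_Cons int_prod_one_wedge wedge_diff_right wedge_scaleR_right)
  qed simp
qed

subsection \<open>Euclidean structure and Hodge star\<close>

text \<open>
  The basis forms \<open>e\<^sup>I = e\<^sup>i\<^sup>1 \<and> \<dots> \<and> e\<^sup>i\<^sup>k\<close> (\<open>I = {i1 < \<dots> < ik}\<close>) are orthonormal, and the coefficient
  of \<open>e\<^sup>I\<close> in \<open>\<omega>\<close> is \<open>\<omega> (e\<^sub>i\<^sub>1, \<dots>, e\<^sub>i\<^sub>k)\<close>.
\<close>

definition basis_vectors :: "'n set \<Rightarrow> (real^('n::{finite,linorder})) list" where
  "basis_vectors I = map (\<lambda>i. axis i 1) (sorted_list_of_set I)"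

definition wedge_list :: "'n::finite list \<Rightarrow> 'n form" where
  "wedge_list js = foldr (\<lambda>i \<omega>. one_form (axis i 1) \<and>\<^sub>\<Lambda> \<omega>) js unit_form"

definition basis_form :: "'n::{finite,linorder} set \<Rightarrow> 'n form" where
  "basis_form I = wedge_list (sorted_list_of_set I)"

lemma wedge_list_simps [simp]:
  "wedge_list [] = unit_form"
  "wedge_list (i # js) = one_form (axis i 1) \<and>\<^sub>\<Lambda> wedge_list js"
  by (simp_all add: wedge_list_def)

lemma app_swap: "app \<omega> (us @ u # v # ws) = - app \<omega> (us @ v # u # ws)"
proof -
  have z: "app \<omega> (us @ w # w # ws) = 0" for w
    by (rule app_not_distinct) simp
  have "0 = app \<omega> (us @ (u + v) # (u + v) # ws)" by (simp add: z)
  also have "\<dots> = app \<omega> (us @ u # (u + v) # ws) + app \<omega> (us @ v # (u + v) # ws)" by (rule app_add)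
  also have "app \<omega> (us @ u # (u + v) # ws) = app \<omega> (us @ u # v # ws)"
    using app_add[of \<omega> "us @ [u]" u v ws] by (simp add: z)
  also have "app \<omega> (us @ v # (u + v) # ws) = app \<omega> (us @ v # u # ws)"
    using app_add[of \<omega> "us @ [v]" u v ws] by (simp add: z)
  finally show ?thesis by simp
qed

lemma insort_sign:
  fixes js :: "'n::{finite,linorder} list"
  shows "\<exists>\<epsilon>\<in>{- 1, 1 :: real}.
    (\<forall>\<omega> us. app \<omega> (us @ map (\<lambda>j. axis j 1) (i # js)) =
        \<epsilon> * app \<omega> (us @ map (\<lambda>j. axis j 1) (insort i js))) \<and>
    wedge_list (i # js) = \<epsilon> *\<^sub>R wedge_list (insort i js)"
proof (induction js)
  case Nil
  show ?case by (rule bexI[of _ 1]) auto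
next
  case (Cons j js)
  show ?case
  proof (cases "i \<le> j")
    case True
    then show ?thesis by (intro bexI[of _ 1]) auto
  next
    case False
    from Cons.IH obtain \<epsilon> :: real where e: "\<epsilon> \<in> {- 1, 1}"
      and app: "\<And>\<omega> us. app \<omega> (us @ map (\<lambda>j. axis j 1) (i # js)) =
        \<epsilon> * app \<omega> (us @ map (\<lambda>j. axis j 1) (insort i js))"
      and wl: "wedge_list (i # js) = \<epsilon> *\<^sub>R wedge_list (insort i js)"
      by blast
    have "app \<omega> (us @ map (\<lambda>j. axis j 1) (i # j # js)) =
        - \<epsilon> * app \<omega> (us @ map (\<lambda>j. axis j 1) (insort i (j # js)))" for \<omega> us
      using app[of \<omega> "us @ [axis j 1]"] False app_swap[of \<omega> us "axis i 1" "axis j 1"] by simp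
    moreover have "wedge_list (i # j # js) = - \<epsilon> *\<^sub>R wedge_list (insort i (j # js))"
      using False wl one_wedge_anticommute[of "axis i 1" "axis j 1" "wedge_list js"]
      by (simp add: wedge_scaleR_right)
    ultimately show ?thesis
      using e by (intro bexI[of _ "- \<epsilon>"]) auto
  qed
qed

lemma app_sort:
  fixes js :: "'n::{finite,linorder} list"
  shows "\<exists>\<epsilon>\<in>{- 1, 1 :: real}. \<forall>\<omega> us.
    app \<omega> (us @ map (\<lambda>j. axis j 1) js) = \<epsilon> * app \<omega> (us @ map (\<lambda>j. axis j 1) (sort js))"
proof (induction js)
  case Nil
  show ?case by (rule bexI[of _ 1]) auto
next
  case (Cons j js)
  from Cons.IH obtain \<epsilon> :: real where e: "\<epsilon> \<in> {- 1, 1}"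
    and app: "\<And>\<omega> us. app \<omega> (us @ map (\<lambda>j. axis j 1) js) =
      \<epsilon> * app \<omega> (us @ map (\<lambda>j. axis j 1) (sort js))"
    by blast
  obtain \<delta> :: real where d: "\<delta> \<in> {- 1, 1}"
    and app': "\<And>\<omega> us. app \<omega> (us @ map (\<lambda>j. axis j 1) (j # sort js)) =
      \<delta> * app \<omega> (us @ map (\<lambda>j. axis j 1) (insort j (sort js)))"
    using insort_sign[of j "sort js"] by blast
  have "app \<omega> (us @ map (\<lambda>j. axis j 1) (j # js)) =
      (\<epsilon> * \<delta>) * app \<omega> (us @ map (\<lambda>j. axis j 1) (sort (j # js)))" for \<omega> us
    using app[of \<omega> "us @ [axis j 1]"] app'[of \<omega> us] by simp
  then show ?case
    using e d by (intro bexI[of _ "\<epsilon> * \<delta>"]) auto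
qed

lemma form_eq_0I:
  fixes \<omega> :: "'n::{finite,linorder} form"
  assumes "\<And>I. app \<omega> (basis_vectors I) = 0"
  shows "\<omega> = 0"
proof (rule form_eqI)
  fix vs
  have basis: "app \<omega> (map (\<lambda>j. axis j 1) js) = 0" for js
  proof (cases "distinct js")
    case True
    then have "sort js = sorted_list_of_set (set js)"
      by (simp add: sorted_list_of_set_sort_remdups distinct_remdups_id)
    then show ?thesis
      using app_sort[of js] assms[of "set js"] unfolding basis_vectors_def
      by (metis append_Nil mult_zero_right)
  next
    case False
    then show ?thesis by (intro app_not_distinct) (auto simp: distinct_map)
  qed
  have "app \<omega> (map (\<lambda>j. axis j 1) js @ vs) = 0" for js
  proof (induction vs arbitrary: js)
    case Nil
    show ?case by (simp add: basis)
  next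
    case (Cons v vs)
    let ?f = "\<lambda>v. app \<omega> (map (\<lambda>j. axis j 1) js @ v # vs)"
    have "?f v = ?f (\<Sum>i\<in>UNIV. (v $ i) *\<^sub>R axis i 1)"
      using basis_expansion[of v] by (simp add: scalar_mult_eq_scaleR)
    also have "\<dots> = (\<Sum>i\<in>UNIV. (v $ i) *\<^sub>R ?f (axis i 1))"
      by (simp add: linear_sum[OF linear_app] linear_scale[OF linear_app])
    also have "\<dots> = 0"
      using Cons.IH[of "js @ [i]" for i] by simp
    finally show ?case .
  qed
  from this[of "[]"] show "app \<omega> vs = app 0 vs" by simp
qed

instantiation form :: ("{finite,linorder}") real_inner
begin

definition inner_form :: "'a form \<Rightarrow> 'a form \<Rightarrow> real" where
  "inner_form \<omega> \<theta> = (\<Sum>I\<in>UNIV. app \<omega> (basis_vectors I) * app \<theta> (basis_vectors I))"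

definition norm_form :: "'a form \<Rightarrow> real" where
  "norm_form \<omega> = sqrt (inner \<omega> \<omega>)"

definition dist_form :: "'a form \<Rightarrow> 'a form \<Rightarrow> real" where
  "dist_form \<omega> \<theta> = norm (\<omega> - \<theta>)"

definition sgn_form :: "'a form \<Rightarrow> 'a form" where
  "sgn_form \<omega> = \<omega> /\<^sub>R norm \<omega>"

definition uniformity_form :: "('a form \<times> 'a form) filter" where
  "uniformity_form = (INF e\<in>{0 <..}. principal {(\<omega>, \<theta>). dist \<omega> \<theta> < e})"

definition open_form :: "'a form set \<Rightarrow> bool" where
  "open_form U \<longleftrightarrow> (\<forall>\<omega>\<in>U. eventually (\<lambda>(\<omega>', \<theta>). \<omega>' = \<omega> \<longrightarrow> \<theta> \<in> U) uniformity)"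

instance
proof
  fix \<omega> \<theta> \<eta> :: "'a form" and c :: real
  show "inner \<omega> \<theta> = inner \<theta> \<omega>"
    by (simp add: inner_form_def mult.commute)
  show "inner (\<omega> + \<theta>) \<eta> = inner \<omega> \<eta> + inner \<theta> \<eta>"
    by (simp add: inner_form_def algebra_simps sum.distrib)
  show "inner (c *\<^sub>R \<omega>) \<theta> = c * inner \<omega> \<theta>"
    by (simp add: inner_form_def sum_distrib_left mult.assoc)
  show "0 \<le> inner \<omega> \<omega>"
    by (simp add: inner_form_def sum_nonneg)
  show "inner \<omega> \<omega> = 0 \<longleftrightarrow> \<omega> = 0"
    by (auto simp: inner_form_def sum_nonneg_eq_0_iff intro: form_eq_0I)
qed (simp_all add: norm_form_def dist_form_def sgn_form_def uniformity_form_def open_form_def)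

end

lemma int_prod_wedge_list:
  assumes "j \<notin> set js"
  shows "axis j 1 \<lrcorner> wedge_list js = 0"
  using assms
proof (induction js)
  case Nil
  show ?case by (rule form_eqI) (simp add: app_int_prod unit_form.rep_eq)
next
  case (Cons i js)
  then show ?case by (auto simp: int_prod_one_wedge inner_axis_axis)
qed

lemma app_one_wedge_orthogonal:
  assumes "\<forall>v\<in>set vs. a \<bullet> v = 0"
  shows "app (one_form a \<and>\<^sub>\<Lambda> \<beta>) vs = 0"
  using assms by (induction vs arbitrary: \<beta>) (simp_all add: app_one_wedge_Cons)

lemma app_wedge_list_sorted:
  fixes ks js :: "'n::{finite,linorder} list"
  assumes "sorted_wrt (<) ks" "sorted_wrt (<) js"
  shows "app (wedge_list ks) (map (\<lambda>j. axis j 1) js) = (if ks = js then 1 else 0)"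
  using assms
proof (induction ks arbitrary: js)
  case Nil
  show ?case by (simp add: unit_form.rep_eq)
next
  case (Cons i ks js)
  show ?case
  proof (cases js)
    case Nil
    then show ?thesis by simp
  next
    case js: (Cons j js')
    consider "i = j" | "i < j" | "j < i" by fastforce
    then show ?thesis
    proof cases
      case 1
      have "axis j 1 \<lrcorner> wedge_list ks = 0"
        using Cons.prems 1 by (intro int_prod_wedge_list) auto
      then show ?thesis
        using Cons.prems Cons.IH[of js'] js 1
        by (simp add: app_one_wedge_Cons inner_axis_axis)
    next
      case 2
      then have "app (wedge_list (i # ks)) (map (\<lambda>j. axis j 1) js) = 0"
        using Cons.prems js by (fastforce intro!: app_one_wedge_orthogonal simp: inner_axis_axis)
      then show ?thesis using js 2 by auto
    next
      case 3
      have "axis j 1 \<lrcorner> wedge_list (i # ks) = 0"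
        using Cons.prems 3 by (intro int_prod_wedge_list) auto
      then have "app (wedge_list (i # ks)) (map (\<lambda>j. axis j 1) js) = 0"
        by (metis app_int_prod app_zero js list.simps(9))
      then show ?thesis using js 3 by auto
    qed
  qed
qed

lemma app_basis_form: "app (basis_form I) (basis_vectors J) = (if I = J then 1 else 0)"
proof -
  have "sorted_list_of_set I = sorted_list_of_set J \<longleftrightarrow> I = J"
    by (metis finite set_sorted_list_of_set)
  then show ?thesis
    using app_wedge_list_sorted[of "sorted_list_of_set I" "sorted_list_of_set J"]
    by (simp add: basis_form_def basis_vectors_def)
qed

lemma inner_basis_form: "\<omega> \<bullet> basis_form I = app \<omega> (basis_vectors I)"
  by (simp add: inner_form_def app_basis_form if_distrib cong: if_cong)

instantiation form :: ("{finite,linorder}") euclidean_space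
begin

definition Basis_form :: "'a form set" where
  "Basis_form = range basis_form"

instance
proof
  fix u v \<omega> :: "'a form"
  show "inner u v = (if u = v then 1 else 0)" if uv: "u \<in> Basis" "v \<in> Basis"
  proof -
    from uv obtain I J where "u = basis_form I" "v = basis_form J"
      by (auto simp: Basis_form_def)
    moreover have "basis_form I = basis_form J \<longleftrightarrow> I = J"
      by (metis app_basis_form zero_neq_one)
    ultimately show ?thesis
      by (simp add: inner_basis_form app_basis_form)
  qed
  show "(\<forall>u\<in>Basis. inner \<omega> u = 0) \<longleftrightarrow> \<omega> = 0"
    by (auto simp: Basis_form_def inner_basis_form intro: form_eq_0I)
qed (auto simp: Basis_form_def)

end

lemma inj_basis_form: "inj basis_form"
  by (metis app_basis_form injI zero_neq_one)

lemma basis_form_in_Lam: "basis_form I \<in> \<Lambda> (card I)"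
proof -
  have "wedge_list js \<in> \<Lambda> (length js)" for js :: "'a list"
  proof (induction js)
    case Nil
    show ?case by (simp add: Lam_def unit_form.rep_eq)
  next
    case (Cons j js)
    have "one_form (axis j 1) \<in> \<Lambda> 1"
      by (simp add: Lam_def one_form.rep_eq)
    from wedge_Lam[OF this Cons.IH] show ?case by simp
  qed
  from this[of "sorted_list_of_set I"] show ?thesis by (simp add: basis_form_def)
qed

lemma one_wedge_wedge_list_eq_0:
  assumes "i \<in> set js"
  shows "one_form (axis i 1) \<and>\<^sub>\<Lambda> wedge_list js = 0"
  using assms
proof (induction js)
  case (Cons j js)
  show ?case
  proof (cases "i = j")
    case True
    have "2 *\<^sub>R (one_form (axis i 1) \<and>\<^sub>\<Lambda> one_form (axis i 1) \<and>\<^sub>\<Lambda> wedge_list js) = 0"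
      using one_wedge_anticommute[of "axis i 1" "axis i 1" "wedge_list js"]
      unfolding scaleR_2 by (metis add.right_inverse)
    with True show ?thesis by simp
  next
    case False
    with Cons show ?thesis
      using one_wedge_anticommute[of "axis i 1" "axis j 1" "wedge_list js"] by simp
  qed
qed simp

lemma linear_one_form: "linear one_form"
  by (rule linearI; rule form_eqI) (simp_all add: one_form.rep_eq inner_add_left)

lemma linear_int_prod_left: "linear (\<lambda>a. a \<lrcorner> \<omega>)"
  by (rule linearI; rule form_eqI)
     (simp_all add: app_int_prod app_add[where us = "[]", simplified] app_scale[where us = "[]", simplified])

lemma linear_wedge_left: "linear (\<lambda>\<alpha>. \<alpha> \<and>\<^sub>\<Lambda> \<beta>)"
  and linear_wedge_right: "linear (\<lambda>\<beta>. \<alpha> \<and>\<^sub>\<Lambda> \<beta>)"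
  using bilinear_wedge unfolding bilinear_def by blast+

lemma inner_int_prod:
  fixes \<omega> \<theta> :: "'n::{finite,linorder} form"
  shows "(a \<lrcorner> \<omega>) \<bullet> \<theta> = \<omega> \<bullet> (one_form a \<and>\<^sub>\<Lambda> \<theta>)"
proof -
  have basis: "(axis i 1 \<lrcorner> \<omega>) \<bullet> basis_form J = \<omega> \<bullet> (one_form (axis i 1) \<and>\<^sub>\<Lambda> basis_form J)"
    for i and J :: "'n set"
  proof (cases "i \<in> J")
    case True
    have "app \<omega> (axis i 1 # basis_vectors J) = 0"
      using True by (intro app_not_distinct) (auto simp: basis_vectors_def)
    moreover have "one_form (axis i 1) \<and>\<^sub>\<Lambda> basis_form J = 0"
      using True by (simp add: basis_form_def one_wedge_wedge_list_eq_0)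
    ultimately show ?thesis by (simp add: inner_basis_form app_int_prod)
  next
    case False
    obtain \<epsilon> :: real where
      app: "\<And>us. app \<omega> (us @ map (\<lambda>j. axis j 1) (i # sorted_list_of_set J)) =
        \<epsilon> * app \<omega> (us @ map (\<lambda>j. axis j 1) (insort i (sorted_list_of_set J)))"
      and wl: "wedge_list (i # sorted_list_of_set J) = \<epsilon> *\<^sub>R wedge_list (insort i (sorted_list_of_set J))"
      using insort_sign[of i "sorted_list_of_set J"] by blast
    have "insort i (sorted_list_of_set J) = sorted_list_of_set (insert i J)"
      using False by simp
    then have "app \<omega> (axis i 1 # basis_vectors J) = \<epsilon> * app \<omega> (basis_vectors (insert i J))"
      and "one_form (axis i 1) \<and>\<^sub>\<Lambda> basis_form J = \<epsilon> *\<^sub>R basis_form (insert i J)"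
      using app[of "[]"] wl by (simp_all add: basis_vectors_def basis_form_def)
    then show ?thesis by (simp add: inner_basis_form app_int_prod)
  qed
  have axis: "(axis i 1 \<lrcorner> \<omega>) \<bullet> \<theta> = \<omega> \<bullet> (one_form (axis i 1) \<and>\<^sub>\<Lambda> \<theta>)" for i
  proof -
    have "(\<lambda>\<theta>. (axis i 1 \<lrcorner> \<omega>) \<bullet> \<theta>) = (\<lambda>\<theta>. \<omega> \<bullet> (one_form (axis i 1) \<and>\<^sub>\<Lambda> \<theta>))"
      by (rule linear_eq_stdbasis)
         (auto simp: Basis_form_def basis intro!: linear_compose[OF linear_wedge_right, unfolded comp_def]
            bounded_linear.linear[OF bounded_linear_inner_right])
    then show ?thesis by (rule fun_cong)
  qed
  have "(\<lambda>a. (a \<lrcorner> \<omega>) \<bullet> \<theta>) = (\<lambda>a. \<omega> \<bullet> (one_form a \<and>\<^sub>\<Lambda> \<theta>))"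
  proof (rule linear_eq_stdbasis)
    show "linear (\<lambda>a. (a \<lrcorner> \<omega>) \<bullet> \<theta>)"
      using linear_compose[OF linear_int_prod_left bounded_linear.linear[OF bounded_linear_inner_left]]
      by (simp add: comp_def)
    have "linear (\<lambda>a. one_form a \<and>\<^sub>\<Lambda> \<theta>)"
      using linear_compose[OF linear_one_form linear_wedge_left] by (simp add: comp_def)
    from linear_compose[OF this bounded_linear.linear[OF bounded_linear_inner_right]]
    show "linear (\<lambda>a. \<omega> \<bullet> (one_form a \<and>\<^sub>\<Lambda> \<theta>))"
      by (simp add: comp_def)
  qed (auto simp: Basis_vec_def axis)
  then show ?thesis by (rule fun_cong)
qed

definition volume_form :: "'n::{finite,linorder} form" where
  "volume_form = basis_form UNIV"

text \<open>
  For \<open>\<omega> \<in> \<Lambda> k\<close>, the form \<open>\<star> \<omega> \<in> \<Lambda> (n - k)\<close> is determined by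
  \<open>\<omega> \<and> \<theta> = \<langle>\<star> \<omega>; \<theta>\<rangle> e\<^sup>1 \<and> \<dots> \<and> e\<^sup>n\<close> for all \<open>\<theta> \<in> \<Lambda> (n - k)\<close>.
\<close>

definition hodge :: "'n::{finite,linorder} form \<Rightarrow> 'n form" ("\<star>") where
  "hodge \<omega> = (\<Sum>b\<in>Basis. ((\<omega> \<and>\<^sub>\<Lambda> b) \<bullet> volume_form) *\<^sub>R b)"

lemma inner_hodge: "\<star> \<omega> \<bullet> \<theta> = (\<omega> \<and>\<^sub>\<Lambda> \<theta>) \<bullet> volume_form"
proof -
  have "\<star> \<omega> \<bullet> \<theta> = (\<Sum>b\<in>Basis. (\<theta> \<bullet> b) * ((\<omega> \<and>\<^sub>\<Lambda> b) \<bullet> volume_form))"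
    unfolding hodge_def inner_sum_left
    by (rule sum.cong) (simp_all add: inner_commute[of \<theta>] mult.commute)
  also have "\<dots> = (\<omega> \<and>\<^sub>\<Lambda> (\<Sum>b\<in>Basis. (\<theta> \<bullet> b) *\<^sub>R b)) \<bullet> volume_form"
    by (simp add: linear_sum[OF linear_wedge_right] wedge_scaleR_right inner_sum_left)
  finally show ?thesis by (simp add: euclidean_representation)
qed

lemma Lam_top:
  fixes \<omega> :: "'n::{finite,linorder} form"
  assumes "\<omega> \<in> \<Lambda> CARD('n)"
  shows "\<omega> = (\<omega> \<bullet> volume_form) *\<^sub>R volume_form"
proof (rule euclidean_eqI)
  fix b :: "'n form" assume "b \<in> Basis"
  then obtain I where b: "b = basis_form I" by (auto simp: Basis_form_def)
  show "\<omega> \<bullet> b = ((\<omega> \<bullet> volume_form) *\<^sub>R volume_form) \<bullet> b"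
  proof (cases "I = UNIV")
    case False
    then have "card I \<noteq> CARD('n)"
      by (metis card_subset_eq finite subset_UNIV)
    then have "app \<omega> (basis_vectors I) = 0"
      using assms by (intro Lam_D) (auto simp: basis_vectors_def)
    with False show ?thesis
      by (simp add: b volume_form_def inner_basis_form app_basis_form)
  qed (simp add: b volume_form_def inner_basis_form app_basis_form)
qed

lemma wedge_eq_hodge:
  fixes \<omega> \<theta> :: "'n::{finite,linorder} form"
  assumes "\<omega> \<in> \<Lambda> k" "\<theta> \<in> \<Lambda> (CARD('n) - k)" "k \<le> CARD('n)"
  shows "\<omega> \<and>\<^sub>\<Lambda> \<theta> = (\<star> \<omega> \<bullet> \<theta>) *\<^sub>R volume_form"
  using Lam_top[of "\<omega> \<and>\<^sub>\<Lambda> \<theta>"] wedge_Lam[OF assms(1,2)] assms(3) by (simp add: inner_hodge)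

lemma hodge_in_Lam:
  fixes \<omega> :: "'n::{finite,linorder} form"
  assumes "\<omega> \<in> \<Lambda> k" "k \<le> CARD('n)"
  shows "\<star> \<omega> \<in> \<Lambda> (CARD('n) - k)"
proof -
  have "((\<omega> \<and>\<^sub>\<Lambda> basis_form I) \<bullet> volume_form) *\<^sub>R basis_form I \<in> \<Lambda> (CARD('n) - k)" for I :: "'n set"
  proof (cases "k + card I = CARD('n)")
    case True
    then have "CARD('n) - k = card I" by simp
    then show ?thesis
      by (simp add: subspace_scale[OF subspace_Lam] basis_form_in_Lam)
  next
    case False
    have "\<omega> \<and>\<^sub>\<Lambda> basis_form I \<in> \<Lambda> (k + card I)"
      by (rule wedge_Lam[OF assms(1) basis_form_in_Lam])
    then have "(\<omega> \<and>\<^sub>\<Lambda> basis_form I) \<bullet> volume_form = 0"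
      using False by (auto simp: volume_form_def inner_basis_form basis_vectors_def intro!: Lam_D)
    then show ?thesis by (simp add: subspace_0[OF subspace_Lam])
  qed
  then show ?thesis
    unfolding hodge_def by (intro subspace_sum[OF subspace_Lam]) (auto simp: Basis_form_def)
qed

section \<open>Sobolev spaces of forms\<close>

definition locally_integrable :: "'a measure \<Rightarrow> 'a::topological_space set
    \<Rightarrow> ('a \<Rightarrow> 'b::{banach,second_countable_topology}) \<Rightarrow> bool" where
  "locally_integrable M V f \<longleftrightarrow> (\<forall>K. compact K \<and> K \<subseteq> V \<longrightarrow> set_integrable M K f)"

definition partial_deriv :: "'n \<Rightarrow> (real^'n \<Rightarrow> 'b::real_normed_vector) \<Rightarrow> real^'n \<Rightarrow> 'b" where
  "partial_deriv i u x = frechet_derivative u (at x) (axis i 1)"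

definition C1_compact :: "(real^'n) set \<Rightarrow> (real^'n \<Rightarrow> 'b::real_normed_vector) set" where
  "C1_compact \<Omega> = {\<phi>. (\<forall>x. \<phi> differentiable at x) \<and> (\<forall>i. continuous_on UNIV (partial_deriv i \<phi>))
     \<and> compact (closure {x. \<phi> x \<noteq> 0}) \<and> closure {x. \<phi> x \<noteq> 0} \<subseteq> \<Omega>}"

text \<open>
  Weak derivatives are tested with \<open>C\<^sup>1\<close> functions of compact support, and \<open>W\<^sub>0\<^sup>1\<^sup>,\<^sup>1\<close> is the closure of
  these functions in \<open>W\<^sup>1\<^sup>,\<^sup>1\<close> (the convention of Gilbarg and Trudinger). By mollification, this is the
  same as using \<open>C\<^sup>\<infinity>\<close> functions of compact support.
\<close>

definition is_weak_deriv :: "(real^'n) set \<Rightarrow> 'n \<Rightarrow> (real^'n \<Rightarrow> 'b::euclidean_space)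
    \<Rightarrow> (real^'n \<Rightarrow> 'b) \<Rightarrow> bool" where
  "is_weak_deriv \<Omega> i u v \<longleftrightarrow>
     locally_integrable lebesgue \<Omega> u \<and> locally_integrable lebesgue \<Omega> v \<and>
     (\<forall>\<phi> :: real^'n \<Rightarrow> real. \<phi> \<in> C1_compact \<Omega> \<longrightarrow>
        (LINT x:\<Omega>|lebesgue. partial_deriv i \<phi> x *\<^sub>R u x) = - (LINT x:\<Omega>|lebesgue. \<phi> x *\<^sub>R v x))"

text \<open>The weak derivative is unique only up to null sets in \<open>\<Omega>\<close>; this picks one representative.\<close>

definition weak_deriv :: "(real^'n) set \<Rightarrow> 'n \<Rightarrow> (real^'n \<Rightarrow> 'b::euclidean_space) \<Rightarrow> real^'n \<Rightarrow> 'b" where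
  "weak_deriv \<Omega> i u = (SOME v. is_weak_deriv \<Omega> i u v)"

definition L_infinity :: "(real^'n) set \<Rightarrow> (real^'n \<Rightarrow> 'b::euclidean_space) set" where
  "L_infinity \<Omega> = {u. set_borel_measurable lebesgue \<Omega> u \<and>
     (\<exists>C. AE x in lebesgue. x \<in> \<Omega> \<longrightarrow> norm (u x) \<le> C)}"

type_synonym 'n form_field = "(real, 'n) vec \<Rightarrow> 'n form"

definition W_1_infinity ::
    "(real^('n::{finite,linorder})) set \<Rightarrow> nat \<Rightarrow> 'n form_field set" where
  "W_1_infinity \<Omega> k = {\<omega>. (\<forall>x\<in>\<Omega>. \<omega> x \<in> \<Lambda> k) \<and> \<omega> \<in> L_infinity \<Omega> \<and>
     (\<forall>i. \<exists>v\<in>L_infinity \<Omega>. is_weak_deriv \<Omega> i \<omega> v)}"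

definition W_1_1 ::
    "(real^('n::{finite,linorder})) set \<Rightarrow> nat \<Rightarrow> 'n form_field set" where
  "W_1_1 \<Omega> k = {\<omega>. (\<forall>x\<in>\<Omega>. \<omega> x \<in> \<Lambda> k) \<and> set_integrable lebesgue \<Omega> \<omega> \<and>
     (\<forall>i. \<exists>v. set_integrable lebesgue \<Omega> v \<and> is_weak_deriv \<Omega> i \<omega> v)}"

definition W_1_1_0 ::
    "(real^('n::{finite,linorder})) set \<Rightarrow> nat \<Rightarrow> 'n form_field set" where
  "W_1_1_0 \<Omega> k = {\<omega> \<in> W_1_1 \<Omega> k. \<exists>\<phi> :: nat \<Rightarrow> 'n form_field.
     (\<forall>m. \<phi> m \<in> C1_compact \<Omega> \<and> (\<forall>x. \<phi> m x \<in> \<Lambda> k)) \<and>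
     (\<lambda>m. LINT x:\<Omega>|lebesgue. norm (\<phi> m x - \<omega> x)) \<longlonglongrightarrow> 0 \<and>
     (\<forall>i. (\<lambda>m. LINT x:\<Omega>|lebesgue. norm (partial_deriv i (\<phi> m) x - weak_deriv \<Omega> i \<omega> x))
        \<longlonglongrightarrow> 0)}"

definition W_1_infinity_0 ::
    "(real^('n::{finite,linorder})) set \<Rightarrow> nat \<Rightarrow> 'n form_field set" where
  "W_1_infinity_0 \<Omega> k = W_1_infinity \<Omega> k \<inter> W_1_1_0 \<Omega> k"

definition ext_deriv ::
    "(real^('n::{finite,linorder})) set \<Rightarrow> 'n form_field \<Rightarrow> 'n form_field" where
  "ext_deriv \<Omega> \<omega> x = (\<Sum>i\<in>UNIV. one_form (axis i 1) \<and>\<^sub>\<Lambda> weak_deriv \<Omega> i \<omega> x)"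

definition codifferential ::
    "(real^('n::{finite,linorder})) set \<Rightarrow> 'n form_field \<Rightarrow> 'n form_field" where
  "codifferential \<Omega> \<omega> x = (\<Sum>i\<in>UNIV. axis i 1 \<lrcorner> weak_deriv \<Omega> i \<omega> x)"

section \<open>Ext-int. convexity notions\<close>

text \<open>
  A function on \<open>\<Lambda>\<^sup>k\<^sup>+\<^sup>1 \<times> \<Lambda>\<^sup>k\<^sup>-\<^sup>1\<close> is represented by a function on pairs of forms, of which only the
  values on \<open>\<Lambda> (k + 1) \<times> \<Lambda> (k - 1)\<close> are used.
\<close>

definition ext_int_one_convex ::
    "nat \<Rightarrow> ('n::{finite,linorder} form \<times> 'n form \<Rightarrow> real) \<Rightarrow> bool" where
  "ext_int_one_convex k f \<longleftrightarrow>
     (\<forall>\<xi>\<in>\<Lambda> (k + 1). \<forall>\<eta>\<in>\<Lambda> (k - 1). \<forall>a. \<forall>b\<in>\<Lambda> k.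
        convex_on UNIV (\<lambda>t. f (\<xi> + t *\<^sub>R (one_form a \<and>\<^sub>\<Lambda> b), \<eta> + t *\<^sub>R (a \<lrcorner> b))))"

definition ext_int_one_affine ::
    "nat \<Rightarrow> ('n::{finite,linorder} form \<times> 'n form \<Rightarrow> real) \<Rightarrow> bool" where
  "ext_int_one_affine k f \<longleftrightarrow> ext_int_one_convex k f \<and> ext_int_one_convex k (\<lambda>x. - f x)"

text \<open>
  Lebesgue measure of the subspace spanned by the members of \<open>Basis\<close> that it contains; each
  \<open>\<Lambda> p \<times> \<Lambda> q\<close> is such a subspace.
\<close>

definition coordinate_lborel :: "'a::euclidean_space set \<Rightarrow> 'a measure" where
  "coordinate_lborel V =
     distr (\<Pi>\<^sub>M b\<in>Basis \<inter> V. lborel) borel (\<lambda>x. \<Sum>b\<in>Basis \<inter> V. x b *\<^sub>R b)"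

lemma coordinate_lborel_UNIV: "coordinate_lborel UNIV = lborel"
  unfolding coordinate_lborel_def Int_UNIV_right by (rule lborel_eq[symmetric])

text \<open>The inequality includes that the integral on its left-hand side exists and is finite.\<close>

definition ext_int_quasiconvex ::
    "nat \<Rightarrow> ('n::{finite,linorder} form \<times> 'n form \<Rightarrow> real) \<Rightarrow> bool" where
  "ext_int_quasiconvex k f \<longleftrightarrow>
     locally_integrable (coordinate_lborel (\<Lambda> (k + 1) \<times> \<Lambda> (k - 1))) (\<Lambda> (k + 1) \<times> \<Lambda> (k - 1)) f \<and>
     f \<in> borel_measurable (restrict_space borel (\<Lambda> (k + 1) \<times> \<Lambda> (k - 1))) \<and>
     (\<forall>\<Omega> \<xi> \<eta> \<omega>. open \<Omega> \<and> bounded \<Omega> \<and> \<xi> \<in> \<Lambda> (k + 1) \<and> \<eta> \<in> \<Lambda> (k - 1) \<and> \<omega> \<in> W_1_infinity_0 \<Omega> k \<longrightarrow>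
        set_integrable lebesgue \<Omega> (\<lambda>x. f (\<xi> + ext_deriv \<Omega> \<omega> x, \<eta> + codifferential \<Omega> \<omega> x)) \<and>
        (LINT x:\<Omega>|lebesgue. f (\<xi> + ext_deriv \<Omega> \<omega> x, \<eta> + codifferential \<Omega> \<omega> x))
          \<ge> f (\<xi>, \<eta>) * measure lebesgue \<Omega>)"

definition ext_int_quasiaffine ::
    "nat \<Rightarrow> ('n::{finite,linorder} form \<times> 'n form \<Rightarrow> real) \<Rightarrow> bool" where
  "ext_int_quasiaffine k f \<longleftrightarrow> ext_int_quasiconvex k f \<and> ext_int_quasiconvex k (\<lambda>x. - f x)"

text \<open>
  A tuple in \<open>\<Lambda>\<^sup>p \<times> \<Lambda>\<^sup>2\<^sup>p \<times> \<dots> \<times> \<Lambda>\<^sup>N\<^sup>p\<close> is a finitely supported family indexed by \<open>{1..N}\<close>.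
\<close>

definition form_tuples :: "nat \<Rightarrow> nat \<Rightarrow> (nat \<Rightarrow>\<^sub>0 'n::{finite,linorder} form) set" where
  "form_tuples p N = {X. Poly_Mapping.keys X \<subseteq> {1..N} \<and>
     (\<forall>s\<in>{1..N}. Poly_Mapping.lookup X s \<in> \<Lambda> (p * s))}"

definition power_tuple :: "nat \<Rightarrow> 'n::{finite,linorder} form \<Rightarrow> nat \<Rightarrow>\<^sub>0 'n form" where
  "power_tuple N \<xi> = (\<Sum>s=1..N. Poly_Mapping.single s (wedge_power \<xi> s))"

definition ext_int_polyconvex ::
    "nat \<Rightarrow> ('n::{finite,linorder} form \<times> 'n form \<Rightarrow> real) \<Rightarrow> bool" where
  "ext_int_polyconvex k f \<longleftrightarrow>
     (let n = CARD('n); N = n div (k + 1); M = n div (n - k + 1) in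
      \<exists>F. convex_on (form_tuples (k + 1) N \<times> form_tuples (n - k + 1) M) F \<and>
        (\<forall>\<xi>\<in>\<Lambda> (k + 1). \<forall>\<eta>\<in>\<Lambda> (k - 1). f (\<xi>, \<eta>) = F (power_tuple N \<xi>, power_tuple M (\<star> \<eta>))))"

definition ext_int_polyaffine ::
    "nat \<Rightarrow> ('n::{finite,linorder} form \<times> 'n form \<Rightarrow> real) \<Rightarrow> bool" where
  "ext_int_polyaffine k f \<longleftrightarrow> ext_int_polyconvex k f \<and> ext_int_polyconvex k (\<lambda>x. - f x)"

end

theory Submission
  imports Defs
begin

text \<open>
  Call \<open>f\<close> a power sum if it is a linear combination of the exterior powers of \<open>\<xi>\<close> and \<open>\<star> \<eta>\<close>, as in the
  last of the four conditions. The proof shows that power sums are polyaffine and quasiaffine, that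
  polyaffine and quasiaffine functions are one affine, and that one affine functions are power sums.

  Polyaffine functions are one affine because \<open>a \<and> a = 0\<close>: every power of \<open>\<xi> + t (a \<and> b)\<close> is affine
  in \<open>t\<close> (\<open>wedge_power_rank_one_affine\<close>), and the Hodge star turns \<open>a \<lrcorner> b\<close> into \<open>\<plusminus> a \<and> \<star> b\<close>
  (\<open>hodge_int_prod\<close>), so that the powers of \<open>\<star> \<eta>\<close> behave in the same way.

  Let \<open>f\<close> be one affine. For a fixed \<open>a\<close>, every direction \<open>(a \<and> \<gamma>, a \<lrcorner> \<delta>)\<close> has the form
  \<open>(a \<and> b, a \<lrcorner> b)\<close>. A basis form \<open>e\<^sup>I\<close> of degree \<open>k + 1\<close> and a basis form \<open>e\<^sup>J\<close> of degree \<open>k - 1\<close> always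
  share such an \<open>a\<close>, namely \<open>e\<^sub>i\<close> with \<open>i \<in> I - J\<close>. Hence the mixed second difference of \<open>f\<close> in \<open>\<xi>\<close> and
  \<open>\<eta>\<close> vanishes and \<open>f (\<xi>, \<eta>) = f (\<xi>, 0) + f (0, \<eta>) - f (0, 0)\<close>. What remains is a function \<open>g\<close> on some
  \<open>\<Lambda> p\<close> that is affine along all \<open>a \<and> \<gamma>\<close>. Its derivatives along \<open>a \<and> \<gamma>\<close> and \<open>a \<and> \<delta>\<close> annihilate
  it when they are composed. Therefore the iterated derivative of \<open>g\<close> at \<open>0\<close> along the products of \<open>s\<close>
  consecutive blocks of \<open>p\<close> vectors is alternating in all \<open>p s\<close> vectors, that is, a form of
  degree \<open>p s\<close>; its inner product with \<open>\<xi>\<^sup>s\<close> is the \<open>s\<close>-th derivative of \<open>g\<close> along \<open>\<xi>\<close>. Such forms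
  vanish for \<open>p s > n\<close>, and Maclaurin's formula represents \<open>g\<close> (\<open>wedge_affine_power_sum\<close>).

  Power sums are quasiaffine because exterior derivatives are closed. A bounded field \<open>\<Psi>\<close> is called
  weakly closed if \<open>\<integral> du \<and> \<Psi> = 0\<close> for all compactly supported \<open>u\<close> of class \<open>C\<^sup>1\<close>. Constant fields are
  weakly closed, and \<open>d\<omega> \<and> \<Psi>\<close> is weakly closed if \<open>\<Psi>\<close> is (\<open>weakly_closed_exterior_field\<close>). In a product
  \<open>d\<omega> \<and> \<dots> \<and> d\<omega>\<close> only one factor at a time is replaced by an approximation, while the other factors
  stay bounded; so the \<open>L\<^sup>1\<close> convergence of the gradients that \<open>W\<^sub>0\<^sup>1\<^sup>,\<^sup>1\<close> provides is enough. It
  follows that \<open>(\<zeta> + d\<omega>)\<^sup>s - \<zeta>\<^sup>s\<close> has integral \<open>0\<close> (\<open>integral_power_exterior_field\<close>).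

  Finally, let \<open>f\<close> be quasiaffine and \<open>F w = f (\<xi> + w \<and> b, \<eta> + w \<lrcorner> b)\<close>. The test fields \<open>u b\<close>, where \<open>u\<close> is
  a pyramid, i.e. the minimum of finitely many affine functions on the polytope where it is positive,
  have only finitely many gradients. They give \<open>F w\<close> as a weighted mean of the values \<open>F (w + g)\<close> at
  the gradients \<open>g\<close> of \<open>u\<close>, and the same weights give the mean \<open>0\<close> for the gradients themselves. If the points
  \<open>w + g\<close> are the vertices of a simplex, this says that \<open>F\<close> coincides inside the simplex with the
  affine interpolation of its vertex values. Since simplices exhaust the space, \<open>F\<close> is affine; this
  argument uses no continuity of \<open>f\<close> (\<open>quasiaffine_imp_one_affine\<close>).
\<close>

section \<open>Exterior algebra\<close>

text \<open>
  The grade involution. It carries the signs of the commutation rules, which thereby hold for forms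
  without a fixed degree.
\<close>

lift_definition grade_inv :: "'n::finite form \<Rightarrow> 'n form"
  is "\<lambda>\<phi> vs. (- 1) ^ length vs * \<phi> vs"
  by (rule alternating_form_sign)

lemma app_grade_inv: "app (grade_inv \<omega>) vs = (- 1) ^ length vs * app \<omega> vs"
  by (simp add: grade_inv.rep_eq)

lemma grade_inv_grade_inv [simp]: "grade_inv (grade_inv \<omega>) = \<omega>"
  by (rule form_eqI) (simp add: app_grade_inv mult.assoc[symmetric] power_add[symmetric] mult_2[symmetric])

lemma linear_grade_inv: "linear grade_inv"
  by (rule linearI; rule form_eqI) (simp_all add: app_grade_inv algebra_simps)

lemma grade_inv_Lam:
  assumes "\<omega> \<in> \<Lambda> k"
  shows "grade_inv \<omega> = (- 1) ^ k *\<^sub>R \<omega>"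
  by (rule form_eqI) (metis Lam_D app_grade_inv app_scaleR assms mult_zero_right)

lemma linear_int_prod_right: "linear (\<lambda>\<omega>. a \<lrcorner> \<omega>)"
  by (rule linearI; rule form_eqI) (simp_all add: app_int_prod)

lemma int_prod_grade_inv: "a \<lrcorner> grade_inv \<omega> = - grade_inv (a \<lrcorner> \<omega>)"
  by (rule form_eqI) (simp add: app_int_prod app_grade_inv)

lemma grade_inv_one_form: "grade_inv (one_form a) = - one_form a"
  by (rule form_eqI) (simp add: app_grade_inv one_form.rep_eq)

text \<open>
  The recursion for shuffle products is the Leibniz rule for interior products. The algebraic
  identities below follow from it by induction over the list of arguments.
\<close>

lemma int_prod_wedge: "a \<lrcorner> (\<alpha> \<and>\<^sub>\<Lambda> \<beta>) = (a \<lrcorner> \<alpha>) \<and>\<^sub>\<Lambda> \<beta> + grade_inv \<alpha> \<and>\<^sub>\<Lambda> (a \<lrcorner> \<beta>)"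
  by (rule form_eqI) (simp add: app_int_prod wedge.rep_eq shuffle_prod_Cons int_prod.rep_eq grade_inv.rep_eq)

lemma wedge_minus_left: "(- \<alpha>) \<and>\<^sub>\<Lambda> \<beta> = - (\<alpha> \<and>\<^sub>\<Lambda> \<beta>)"
  using wedge_scaleR_left[of "- 1" \<alpha> \<beta>] by simp

lemma wedge_minus_right: "\<alpha> \<and>\<^sub>\<Lambda> (- \<beta>) = - (\<alpha> \<and>\<^sub>\<Lambda> \<beta>)"
  using wedge_scaleR_right[of \<alpha> "- 1" \<beta>] by simp

lemma wedge_zero_left [simp]: "0 \<and>\<^sub>\<Lambda> \<beta> = 0"
  using wedge_scaleR_left[of 0 0 \<beta>] by simp

lemma grade_inv_wedge: "grade_inv (\<alpha> \<and>\<^sub>\<Lambda> \<beta>) = grade_inv \<alpha> \<and>\<^sub>\<Lambda> grade_inv \<beta>"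
proof (rule form_eqI)
  fix vs
  show "app (grade_inv (\<alpha> \<and>\<^sub>\<Lambda> \<beta>)) vs = app (grade_inv \<alpha> \<and>\<^sub>\<Lambda> grade_inv \<beta>) vs"
  proof (induction vs arbitrary: \<alpha> \<beta>)
    case Nil
    show ?case by (simp add: app_grade_inv app_wedge_Nil)
  next
    case (Cons v vs)
    have "app (grade_inv (\<alpha> \<and>\<^sub>\<Lambda> \<beta>)) (v # vs) = app (v \<lrcorner> grade_inv (\<alpha> \<and>\<^sub>\<Lambda> \<beta>)) vs"
      by (simp add: app_int_prod)
    also have "\<dots> = - (app (grade_inv ((v \<lrcorner> \<alpha>) \<and>\<^sub>\<Lambda> \<beta>)) vs + app (grade_inv (grade_inv \<alpha> \<and>\<^sub>\<Lambda> (v \<lrcorner> \<beta>))) vs)"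
      by (simp add: int_prod_grade_inv int_prod_wedge linear_add[OF linear_grade_inv])
    also have "\<dots> = app (v \<lrcorner> (grade_inv \<alpha> \<and>\<^sub>\<Lambda> grade_inv \<beta>)) vs"
      by (simp add: Cons.IH int_prod_wedge int_prod_grade_inv wedge_minus_left wedge_minus_right)
    finally show ?case by (simp add: app_int_prod)
  qed
qed

text \<open>Both sides satisfy the same Leibniz rule and agree on the empty argument list.\<close>

lemma wedge_assoc: "(\<alpha> \<and>\<^sub>\<Lambda> \<beta>) \<and>\<^sub>\<Lambda> \<gamma> = \<alpha> \<and>\<^sub>\<Lambda> (\<beta> \<and>\<^sub>\<Lambda> \<gamma>)"
proof (rule form_eqI)
  fix vs
  show "app ((\<alpha> \<and>\<^sub>\<Lambda> \<beta>) \<and>\<^sub>\<Lambda> \<gamma>) vs = app (\<alpha> \<and>\<^sub>\<Lambda> (\<beta> \<and>\<^sub>\<Lambda> \<gamma>)) vs"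
  proof (induction vs arbitrary: \<alpha> \<beta> \<gamma>)
    case Nil
    show ?case by (simp add: app_wedge_Nil)
  next
    case (Cons v vs)
    have "app (v \<lrcorner> ((\<alpha> \<and>\<^sub>\<Lambda> \<beta>) \<and>\<^sub>\<Lambda> \<gamma>)) vs = app (v \<lrcorner> (\<alpha> \<and>\<^sub>\<Lambda> (\<beta> \<and>\<^sub>\<Lambda> \<gamma>))) vs"
      by (simp add: int_prod_wedge wedge_add_left wedge_add_right Cons.IH grade_inv_wedge)
    then show ?case by (simp add: app_int_prod)
  qed
qed

lemma wedge_unit [simp]: "\<alpha> \<and>\<^sub>\<Lambda> unit_form = \<alpha>"
proof (rule form_eqI)
  fix vs
  show "app (\<alpha> \<and>\<^sub>\<Lambda> unit_form) vs = app \<alpha> vs"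
  proof (induction vs arbitrary: \<alpha>)
    case Nil
    show ?case by (simp add: app_wedge_Nil unit_form.rep_eq)
  next
    case (Cons v vs)
    have "v \<lrcorner> unit_form = (0 :: 'a form)"
      by (rule form_eqI) (simp add: app_int_prod unit_form.rep_eq)
    then have "app (v \<lrcorner> (\<alpha> \<and>\<^sub>\<Lambda> unit_form)) vs = app (v \<lrcorner> \<alpha>) vs"
      by (simp add: int_prod_wedge Cons.IH)
    then show ?case by (simp add: app_int_prod)
  qed
qed

lemma one_form_wedge_self: "one_form a \<and>\<^sub>\<Lambda> one_form a \<and>\<^sub>\<Lambda> \<beta> = 0"
proof -
  have "2 *\<^sub>R (one_form a \<and>\<^sub>\<Lambda> one_form a \<and>\<^sub>\<Lambda> \<beta>) = 0"
    using one_wedge_anticommute[of a a \<beta>] unfolding scaleR_2 by (metis add.right_inverse)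
  then show ?thesis by simp
qed

lemma one_form_commute: "one_form a \<and>\<^sub>\<Lambda> \<beta> = grade_inv \<beta> \<and>\<^sub>\<Lambda> one_form a"
proof (rule form_eqI)
  fix vs
  show "app (one_form a \<and>\<^sub>\<Lambda> \<beta>) vs = app (grade_inv \<beta> \<and>\<^sub>\<Lambda> one_form a) vs"
  proof (induction vs arbitrary: \<beta>)
    case Nil
    show ?case by (simp add: app_wedge_Nil one_form.rep_eq)
  next
    case (Cons v vs)
    have 1: "v \<lrcorner> one_form a = (a \<bullet> v) *\<^sub>R unit_form"
      by (rule form_eqI) (auto simp: app_int_prod one_form.rep_eq unit_form.rep_eq)
    have "app (v \<lrcorner> (one_form a \<and>\<^sub>\<Lambda> \<beta>)) vs = app (v \<lrcorner> (grade_inv \<beta> \<and>\<^sub>\<Lambda> one_form a)) vs"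
      by (simp add: int_prod_wedge 1 grade_inv_one_form wedge_minus_left wedge_minus_right Cons.IH
          int_prod_grade_inv wedge_scaleR_left wedge_scaleR_right)
    then show ?case by (simp add: app_int_prod)
  qed
qed

lemma one_form_in_Lam: "one_form a \<in> \<Lambda> 1"
  by (simp add: Lam_def one_form.rep_eq)

lemma unit_form_in_Lam: "unit_form \<in> \<Lambda> 0"
  by (simp add: Lam_def unit_form.rep_eq)

lemma one_form_wedge_Lam: "\<beta> \<in> \<Lambda> k \<Longrightarrow> one_form a \<and>\<^sub>\<Lambda> \<beta> \<in> \<Lambda> (k + 1)"
  using wedge_Lam[OF one_form_in_Lam[of a], of \<beta> k] by (simp add: add.commute)

lemma int_prod_Lam: "\<beta> \<in> \<Lambda> k \<Longrightarrow> 1 \<le> k \<Longrightarrow> a \<lrcorner> \<beta> \<in> \<Lambda> (k - 1)"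
  unfolding Lam_def by (auto simp: app_int_prod)

lemma int_prod_int_prod: "a \<lrcorner> a \<lrcorner> \<beta> = 0"
  by (rule form_eqI) (simp add: app_int_prod app_not_distinct)

lemma wedge_power_Lam: "\<xi> \<in> \<Lambda> p \<Longrightarrow> wedge_power \<xi> s \<in> \<Lambda> (p * s)"
proof (induction s)
  case (Suc s)
  then show ?case using wedge_Lam[of \<xi> p "wedge_power \<xi> s" "p * s"] by (simp add: algebra_simps)
qed (simp add: unit_form_in_Lam)

lemma Lam_above_dim:
  fixes \<omega> :: "'n::{finite,linorder} form"
  assumes "\<omega> \<in> \<Lambda> k" "CARD('n) < k"
  shows "\<omega> = 0"
proof (rule form_eq_0I)
  fix I :: "'n set"
  have "card I \<le> CARD('n)" by (simp add: card_mono)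
  then show "app \<omega> (basis_vectors I) = 0"
    using assms by (intro Lam_D) (auto simp: basis_vectors_def)
qed

text \<open>
  All terms of higher order in \<open>t\<close> contain \<open>a\<close> twice. The induction needs that the linear coefficient
  again has \<open>a\<close> as a factor.
\<close>

lemma wedge_power_rank_one_affine:
  "\<exists>\<theta>. \<forall>t. wedge_power (\<xi> + t *\<^sub>R (one_form a \<and>\<^sub>\<Lambda> \<beta>)) s = wedge_power \<xi> s + t *\<^sub>R (one_form a \<and>\<^sub>\<Lambda> \<theta>)"
proof (induction s)
  case 0
  show ?case by (rule exI[of _ 0]) simp
next
  case (Suc s)
  then obtain \<theta> where \<theta>: "\<And>t. wedge_power (\<xi> + t *\<^sub>R (one_form a \<and>\<^sub>\<Lambda> \<beta>)) s
      = wedge_power \<xi> s + t *\<^sub>R (one_form a \<and>\<^sub>\<Lambda> \<theta>)" by blast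
  have swap: "\<xi> \<and>\<^sub>\<Lambda> one_form a \<and>\<^sub>\<Lambda> \<theta> = one_form a \<and>\<^sub>\<Lambda> grade_inv \<xi> \<and>\<^sub>\<Lambda> \<theta>"
    by (simp add: wedge_assoc[symmetric] one_form_commute[of a "grade_inv \<xi>"])
  have zero: "one_form a \<and>\<^sub>\<Lambda> \<beta> \<and>\<^sub>\<Lambda> one_form a \<and>\<^sub>\<Lambda> \<theta> = 0"
    by (metis grade_inv_grade_inv one_form_commute one_form_wedge_self wedge_assoc)
  show ?case
    by (rule exI[of _ "\<beta> \<and>\<^sub>\<Lambda> wedge_power \<xi> s + grade_inv \<xi> \<and>\<^sub>\<Lambda> \<theta>"])
       (simp add: \<theta> wedge_add_left wedge_add_right wedge_scaleR_left wedge_scaleR_right swap zero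
          wedge_assoc scaleR_add_right)
qed

section \<open>The Hodge star\<close>

lemma linear_hodge: "linear \<star>"
  by (rule linearI)
     (simp_all add: hodge_def wedge_add_left wedge_scaleR_left inner_add_left scaleR_add_left
       sum.distrib scaleR_sum_right)

text \<open>
  This is the Leibniz rule for \<open>a \<lrcorner> (\<beta> \<and> \<theta>)\<close>, whose left-hand side has no component of degree \<open>n\<close>.
\<close>

lemma hodge_int_prod:
  fixes \<beta> :: "'n::{finite,linorder} form"
  assumes "\<beta> \<in> \<Lambda> k"
  shows "\<star> (a \<lrcorner> \<beta>) = (- 1) ^ (k + 1) *\<^sub>R (one_form a \<and>\<^sub>\<Lambda> \<star> \<beta>)"
proof -
  have "\<star> (a \<lrcorner> \<beta>) \<bullet> \<theta> = ((- 1) ^ (k + 1) *\<^sub>R (one_form a \<and>\<^sub>\<Lambda> \<star> \<beta>)) \<bullet> \<theta>" for \<theta>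
  proof -
    \<comment> \<open>An interior product has no component of top degree: pairing it with the volume form gives an
      \<open>(n + 1)\<close>-form.\<close>
    have "one_form a \<and>\<^sub>\<Lambda> volume_form = (0 :: 'n form)"
      using one_form_wedge_Lam[OF basis_form_in_Lam[of UNIV], of a]
      by (intro Lam_above_dim[where k = "CARD('n) + 1"]) (auto simp: volume_form_def)
    then have "(a \<lrcorner> (\<beta> \<and>\<^sub>\<Lambda> \<theta>)) \<bullet> volume_form = 0"
      by (simp add: inner_int_prod)
    then have "((a \<lrcorner> \<beta>) \<and>\<^sub>\<Lambda> \<theta>) \<bullet> volume_form = - ((grade_inv \<beta> \<and>\<^sub>\<Lambda> (a \<lrcorner> \<theta>)) \<bullet> volume_form)"
      by (simp add: int_prod_wedge inner_add_left)
    also have "\<dots> = (- 1) ^ (k + 1) * (\<star> \<beta> \<bullet> (a \<lrcorner> \<theta>))"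
      by (simp add: grade_inv_Lam[OF assms] wedge_scaleR_left inner_hodge)
    also have "\<star> \<beta> \<bullet> (a \<lrcorner> \<theta>) = (one_form a \<and>\<^sub>\<Lambda> \<star> \<beta>) \<bullet> \<theta>"
      by (metis inner_commute inner_int_prod)
    finally show ?thesis by (simp add: inner_hodge)
  qed
  then show ?thesis by (meson vector_eq_rdot)
qed

lemma hodge_volume_form: "\<star> volume_form = (unit_form :: 'n::{finite,linorder} form)"
proof -
  have "\<star> volume_form \<bullet> basis_form I = unit_form \<bullet> basis_form I" for I :: "'n set"
  proof (cases "I = {}")
    case True
    then show ?thesis
      using app_basis_form[of UNIV "UNIV :: 'n set"] app_basis_form[of "{}" "{} :: 'n set"]
      by (simp add: inner_hodge basis_form_def[of "{}"])
         (simp add: volume_form_def inner_basis_form[symmetric] basis_form_def[of "{}"])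
  next
    case False
    have "volume_form \<and>\<^sub>\<Lambda> basis_form I = (0 :: 'n form)"
      using wedge_Lam[OF basis_form_in_Lam[of UNIV] basis_form_in_Lam[of I]] False
      by (intro Lam_above_dim[where k = "CARD('n) + card I"]) (auto simp: volume_form_def card_gt_0_iff)
    moreover have "app unit_form (basis_vectors I) = (0 :: real)"
      using False by (simp add: unit_form.rep_eq basis_vectors_def)
    ultimately show ?thesis
      unfolding inner_hodge by (simp add: inner_basis_form)
  qed
  then show ?thesis
    by - (rule euclidean_eqI, auto simp: Basis_form_def)
qed

text \<open>
  The star maps the volume form to the unit, and by \<open>hodge_int_prod\<close> each interior product with \<open>e\<^sub>j\<close>
  before the star adds a factor \<open>e\<^sup>j\<close> behind it, up to a sign.
\<close>

lemma wedge_list_hodge_image: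
  fixes js :: "'n::{finite,linorder} list"
  assumes "length js \<le> CARD('n)"
  shows "\<exists>\<beta>\<in>\<Lambda> (CARD('n) - length js). \<star> \<beta> = wedge_list js"
  using assms
proof (induction js)
  case Nil
  have "(volume_form :: 'n form) \<in> \<Lambda> CARD('n)"
    using basis_form_in_Lam[of UNIV] by (simp add: volume_form_def)
  with hodge_volume_form show ?case by force
next
  case (Cons j js)
  define m where "m = CARD('n) - length js"
  from Cons obtain \<beta> where \<beta>: "\<beta> \<in> \<Lambda> m" "\<star> \<beta> = wedge_list js"
    by (auto simp: m_def)
  have "1 \<le> m" using Cons.prems by (auto simp: m_def)
  then have "(- 1) ^ (m + 1) *\<^sub>R (axis j 1 \<lrcorner> \<beta>) \<in> \<Lambda> (m - 1)"
    using \<beta> by (intro subspace_scale[OF subspace_Lam] int_prod_Lam)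
  moreover have "\<star> ((- 1) ^ (m + 1) *\<^sub>R (axis j 1 \<lrcorner> \<beta>)) = wedge_list (j # js)"
    unfolding linear_scale[OF linear_hodge] hodge_int_prod[OF \<beta>(1)] \<beta>(2)
    by (simp flip: power_add mult_2)
  ultimately show ?case by (auto simp: m_def)
qed

lemma Lam_basis_expansion:
  fixes \<omega> :: "'n::{finite,linorder} form"
  assumes "\<omega> \<in> \<Lambda> k"
  shows "\<omega> = (\<Sum>I | card I = k. (\<omega> \<bullet> basis_form I) *\<^sub>R basis_form I)"
proof -
  have "\<omega> = (\<Sum>I\<in>UNIV. (\<omega> \<bullet> basis_form I) *\<^sub>R basis_form I)"
    using euclidean_representation[of \<omega>] by (simp add: Basis_form_def sum.reindex[OF inj_basis_form])
  also have "\<dots> = (\<Sum>I | card I = k. (\<omega> \<bullet> basis_form I) *\<^sub>R basis_form I)"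
    by (rule sum.mono_neutral_right)
       (auto simp: inner_basis_form basis_vectors_def intro!: Lam_D[OF assms])
  finally show ?thesis .
qed

lemma hodge_surj_Lam:
  fixes \<zeta> :: "'n::{finite,linorder} form"
  assumes "\<zeta> \<in> \<Lambda> (CARD('n) - k)" "k \<le> CARD('n)"
  shows "\<exists>\<beta>\<in>\<Lambda> k. \<star> \<beta> = \<zeta>"
proof -
  have "\<exists>\<beta>\<in>\<Lambda> k. \<star> \<beta> = basis_form I" if "card I = CARD('n) - k" for I :: "'n set"
    using wedge_list_hodge_image[of "sorted_list_of_set I"] that assms(2)
    by (auto simp: basis_form_def)
  then have "\<forall>I :: 'n set. \<exists>\<beta>. card I = CARD('n) - k \<longrightarrow> \<beta> \<in> \<Lambda> k \<and> \<star> \<beta> = basis_form I"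
    by blast
  then obtain B where B: "\<And>I :: 'n set. card I = CARD('n) - k \<Longrightarrow> B I \<in> \<Lambda> k \<and> \<star> (B I) = basis_form I"
    by metis
  let ?\<beta> = "\<Sum>I | card I = CARD('n) - k. (\<zeta> \<bullet> basis_form I) *\<^sub>R B I"
  have "?\<beta> \<in> \<Lambda> k"
    by (auto intro!: subspace_sum[OF subspace_Lam] subspace_scale[OF subspace_Lam] simp: B)
  moreover have "\<star> ?\<beta> = \<zeta>"
    by (subst (2) Lam_basis_expansion[OF assms(1)])
       (simp add: linear_sum[OF linear_hodge] linear_scale[OF linear_hodge] B)
  ultimately show ?thesis by blast
qed

lemma inj_hodge: "inj (\<star> :: 'n::{finite,linorder} form \<Rightarrow> 'n form)"
proof (rule linear_surj_imp_inj[OF linear_hodge])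
  have "\<zeta> \<in> range \<star>" for \<zeta> :: "'n form"
  proof -
    have "basis_form I \<in> range \<star>" for I :: "'n set"
    proof -
      have "card I \<le> CARD('n)" by (simp add: card_mono)
      then show ?thesis
        using hodge_surj_Lam[of "basis_form I" "CARD('n) - card I"] basis_form_in_Lam[of I]
        by (auto simp: image_iff) metis
    qed
    then have "span (range basis_form) \<subseteq> range (\<star> :: 'n form \<Rightarrow> 'n form)"
      by (intro span_minimal linear_subspace_image[OF linear_hodge]) auto
    then show ?thesis
      using span_Basis[where 'a = "'n form"] by (auto simp: Basis_form_def)
  qed
  then show "surj (\<star> :: 'n form \<Rightarrow> 'n form)" by blast
qed

lemma hodge_inverse_Lam:
  fixes \<omega> :: "'n::{finite,linorder} form"
  assumes "\<omega> \<in> \<Lambda> (CARD('n) - k)" "k \<le> CARD('n)"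
  shows "inv \<star> \<omega> \<in> \<Lambda> k" and "\<star> (inv \<star> \<omega>) = \<omega>"
  using hodge_surj_Lam[OF assms] inv_f_f[OF inj_hodge] by metis+

section \<open>Functions that are affine along exterior rank-one directions\<close>

definition line_affine :: "('a::real_vector \<Rightarrow> real) \<Rightarrow> 'a \<Rightarrow> bool" where
  "line_affine g d \<longleftrightarrow> (\<forall>x t. g (x + t *\<^sub>R d) = g x + t * (g (x + d) - g x))"

lemma line_affineD: "line_affine g d \<Longrightarrow> g (x + t *\<^sub>R d) = g x + t * (g (x + d) - g x)"
  unfolding line_affine_def by blast

text \<open>The centre of the parallelogram is the midpoint of both diagonals.\<close>

lemma line_affine_parallelogram:
  assumes "line_affine g (u + v)" "line_affine g (u - v)"
  shows "g (x + u + v) + g x = g (x + u) + g (x + v)"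
proof -
  have 1: "g (x + (1/2) *\<^sub>R (u + v)) = g x + 1/2 * (g (x + (u + v)) - g x)"
    by (rule line_affineD[OF assms(1)])
  have 2: "g ((x + v) + (1/2) *\<^sub>R (u - v)) = g (x + v) + 1/2 * (g ((x + v) + (u - v)) - g (x + v))"
    by (rule line_affineD[OF assms(2)])
  have 3: "(x + v) + (1/2) *\<^sub>R (u - v) = x + (1/2) *\<^sub>R (u + v)"
  proof -
    have "v = (1/2) *\<^sub>R v + (1/2) *\<^sub>R v" by (simp flip: scaleR_add_left)
    then show ?thesis by (simp add: algebra_simps)
  qed
  have 4: "(x + v) + (u - v) = x + u" by simp
  show ?thesis using 1 2 unfolding 3 4 by (simp add: add.assoc field_simps)
qed

text \<open>
  For a function that is affine along each basis vector, this is the derivative at \<open>x\<close> in the direction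
  \<open>d\<close>. The form as a sum of differences makes it evident that it is linear in \<open>d\<close> and in \<open>g\<close> and commutes
  with translations.
\<close>

definition dir_deriv :: "'a::euclidean_space \<Rightarrow> ('a \<Rightarrow> real) \<Rightarrow> 'a \<Rightarrow> real" where
  "dir_deriv d g x = (\<Sum>b\<in>Basis. (d \<bullet> b) * (g (x + b) - g x))"

lemma dir_deriv_add: "dir_deriv (d + e) g = (\<lambda>x. dir_deriv d g x + dir_deriv e g x)"
  by (simp add: dir_deriv_def fun_eq_iff inner_add_left distrib_right sum.distrib)

lemma dir_deriv_scale: "dir_deriv (c *\<^sub>R d) g = (\<lambda>x. c * dir_deriv d g x)"
  by (simp add: dir_deriv_def fun_eq_iff sum_distrib_left mult.assoc)

lemma dir_deriv_fun_add: "dir_deriv d (\<lambda>x. g x + h x) = (\<lambda>x. dir_deriv d g x + dir_deriv d h x)"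
  by (simp add: dir_deriv_def fun_eq_iff algebra_simps sum.distrib sum_subtractf)

lemma dir_deriv_fun_scale: "dir_deriv d (\<lambda>x. c * g x) = (\<lambda>x. c * dir_deriv d g x)"
  by (simp add: dir_deriv_def fun_eq_iff sum_distrib_left algebra_simps)

lemma dir_deriv_zero_fun [simp]: "dir_deriv d (\<lambda>x. 0) = (\<lambda>x. 0)"
  by (simp add: dir_deriv_def fun_eq_iff)

lemma dir_deriv_zero [simp]: "dir_deriv 0 g = (\<lambda>x. 0)"
  by (simp add: dir_deriv_def fun_eq_iff)

lemma dir_deriv_translate: "dir_deriv d (\<lambda>x. g (x + y)) = (\<lambda>x. dir_deriv d g (x + y))"
  by (simp add: dir_deriv_def fun_eq_iff algebra_simps)

text \<open>
  By induction over the basis vectors that contribute to \<open>d\<close>: since \<open>g\<close> is affine along one of them, it is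
  a combination of two translates in which only the other vectors occur.
\<close>

lemma has_real_derivative_dir_deriv:
  fixes g :: "'a::euclidean_space \<Rightarrow> real"
  assumes "\<And>b. b \<in> Basis \<Longrightarrow> line_affine g b"
  shows "((\<lambda>t. g (x + t *\<^sub>R d)) has_real_derivative dir_deriv d g x) (at 0)"
proof -
  have "((\<lambda>t. g (x + t *\<^sub>R (\<Sum>b\<in>S. (d \<bullet> b) *\<^sub>R b))) has_real_derivative
      (\<Sum>b\<in>S. (d \<bullet> b) * (g (x + b) - g x))) (at 0)" if "finite S" "S \<subseteq> Basis" for S
    using that
  proof (induction S arbitrary: x rule: finite_induct)
    case empty
    show ?case by simp
  next
    case (insert b S)
    let ?w = "\<Sum>b\<in>S. (d \<bullet> b) *\<^sub>R b"
    have eq: "g (x + t *\<^sub>R (\<Sum>b\<in>insert b S. (d \<bullet> b) *\<^sub>R b))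
        = g (x + t *\<^sub>R ?w) + t * (d \<bullet> b) * (g ((x + b) + t *\<^sub>R ?w) - g (x + t *\<^sub>R ?w))" for t
    proof -
      have "g (x + t *\<^sub>R (\<Sum>b\<in>insert b S. (d \<bullet> b) *\<^sub>R b)) = g ((x + t *\<^sub>R ?w) + (t * (d \<bullet> b)) *\<^sub>R b)"
        using insert.hyps by (simp add: algebra_simps)
      also have "\<dots> = g (x + t *\<^sub>R ?w) + t * (d \<bullet> b) * (g ((x + t *\<^sub>R ?w) + b) - g (x + t *\<^sub>R ?w))"
        by (rule line_affineD) (use assms insert.prems in auto)
      finally show ?thesis by (simp add: algebra_simps)
    qed
    note IH = insert.IH[of x] insert.IH[of "x + b"]
    show ?case
      unfolding eq using insert.prems insert.hyps
      by (auto intro!: derivative_eq_intros IH)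
  qed
  from this[of Basis] show ?thesis
    by (simp add: euclidean_representation dir_deriv_def)
qed

lemma dir_deriv_line_affine:
  fixes g :: "'a::euclidean_space \<Rightarrow> real"
  assumes "\<And>b. b \<in> Basis \<Longrightarrow> line_affine g b" "line_affine g d"
  shows "dir_deriv d g x = g (x + d) - g x"
proof -
  have "((\<lambda>t. g x + t * (g (x + d) - g x)) has_real_derivative dir_deriv d g x) (at 0)"
    using has_real_derivative_dir_deriv[OF assms(1), of x d] line_affineD[OF assms(2), of x] by simp
  moreover have "((\<lambda>t. g x + t * (g (x + d) - g x)) has_real_derivative g (x + d) - g x) (at 0)"
    by (auto intro!: derivative_eq_intros)
  ultimately show ?thesis by (rule DERIV_unique)
qed

subsection \<open>Homogeneous components\<close>

text \<open>
  Composition with this projection extends a function on \<open>\<Lambda> p\<close> to all forms, so that the following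
  statements need no restriction of their variables to \<open>\<Lambda> p\<close>.
\<close>

lift_definition deg_part :: "nat \<Rightarrow> 'n::finite form \<Rightarrow> 'n form"
  is "\<lambda>p \<phi> vs. of_bool (length vs = p) * \<phi> vs"
  by (rule alternating_form_weighted)

lemma app_deg_part: "app (deg_part p \<omega>) vs = (if length vs = p then app \<omega> vs else 0)"
  by (simp add: deg_part.rep_eq)

lemma linear_deg_part: "linear (deg_part p)"
  by (rule linearI; rule form_eqI) (simp_all add: app_deg_part)

lemma deg_part_in_Lam: "deg_part p \<omega> \<in> \<Lambda> p"
  by (simp add: Lam_def app_deg_part)

lemma deg_part_Lam: "\<omega> \<in> \<Lambda> p \<Longrightarrow> deg_part p \<omega> = \<omega>"
  by (rule form_eqI) (simp add: app_deg_part Lam_D)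

lemma deg_part_Lam_other: "\<omega> \<in> \<Lambda> q \<Longrightarrow> p \<noteq> q \<Longrightarrow> deg_part p \<omega> = 0"
  by (rule form_eqI) (simp add: app_deg_part Lam_D)

text \<open>
  The values of \<open>a \<and> \<beta>\<close> on lists of length \<open>p + 1\<close> involve only the values of \<open>\<beta>\<close> on lists of length \<open>p\<close>.
\<close>

lemma deg_part_one_wedge: "deg_part (Suc p) (one_form a \<and>\<^sub>\<Lambda> \<beta>) = one_form a \<and>\<^sub>\<Lambda> deg_part p \<beta>"
proof (rule form_eqI)
  fix vs
  have "app (one_form a \<and>\<^sub>\<Lambda> \<beta>) vs = app (one_form a \<and>\<^sub>\<Lambda> deg_part p \<beta>) vs" if "length vs = Suc p"
    using that
  proof (induction vs arbitrary: p \<beta>)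
    case (Cons v vs)
    show ?case
    proof (cases p)
      case 0
      with Cons.prems show ?thesis by (simp add: app_one_wedge_Cons app_deg_part)
    next
      case (Suc q)
      have "v \<lrcorner> deg_part p \<beta> = deg_part q (v \<lrcorner> \<beta>)"
        by (rule form_eqI) (simp add: app_int_prod app_deg_part Suc)
      moreover have "app (one_form a \<and>\<^sub>\<Lambda> (v \<lrcorner> \<beta>)) vs = app (one_form a \<and>\<^sub>\<Lambda> deg_part q (v \<lrcorner> \<beta>)) vs"
        by (rule Cons.IH) (use Cons.prems Suc in simp)
      ultimately show ?thesis
        using Cons.prems unfolding app_one_wedge_Cons by (simp add: app_deg_part)
    qed
  qed simp
  moreover have "app (one_form a \<and>\<^sub>\<Lambda> deg_part p \<beta>) vs = 0" if "length vs \<noteq> Suc p"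
    using that one_form_wedge_Lam[OF deg_part_in_Lam, of a p \<beta>] by (intro Lam_D) auto
  ultimately show "app (deg_part (Suc p) (one_form a \<and>\<^sub>\<Lambda> \<beta>)) vs = app (one_form a \<and>\<^sub>\<Lambda> deg_part p \<beta>) vs"
    by (simp add: app_deg_part)
qed

subsection \<open>Wedge-affine functions are linear combinations of exterior powers\<close>

text \<open>
  The second condition says that \<open>g\<close> is a function on \<open>\<Lambda> p\<close>, extended to all forms.
\<close>

definition wedge_affine :: "nat \<Rightarrow> ('n::{finite,linorder} form \<Rightarrow> real) \<Rightarrow> bool" where
  "wedge_affine p g \<longleftrightarrow> (\<forall>a \<gamma>. line_affine g (one_form a \<and>\<^sub>\<Lambda> \<gamma>)) \<and> (\<forall>x. g x = g (deg_part p x))"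

lemma wedge_affine_line: "wedge_affine p g \<Longrightarrow> line_affine g (one_form a \<and>\<^sub>\<Lambda> \<gamma>)"
  by (simp add: wedge_affine_def)

lemma wedge_affine_deg: "wedge_affine p g \<Longrightarrow> g x = g (deg_part p x)"
  by (simp add: wedge_affine_def)

lemma wedge_affine_add_other:
  assumes "wedge_affine p g" "b \<in> \<Lambda> q" "q \<noteq> p"
  shows "g (x + b) = g x"
  using wedge_affine_deg[OF assms(1), of "x + b"] wedge_affine_deg[OF assms(1), of x]
    deg_part_Lam_other[OF assms(2)] assms(3) by (simp add: linear_add[OF linear_deg_part])

lemma basis_form_eq_one_wedge:
  assumes "I \<noteq> {}"
  shows "\<exists>i \<gamma>. basis_form I = one_form (axis i 1) \<and>\<^sub>\<Lambda> \<gamma>"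
proof (cases "sorted_list_of_set I")
  case Nil
  with assms show ?thesis by simp
next
  case (Cons i js)
  then show ?thesis by (auto simp: basis_form_def)
qed

lemma wedge_affine_Basis:
  fixes g :: "'n::{finite,linorder} form \<Rightarrow> real"
  assumes "wedge_affine p g" "1 \<le> p" "b \<in> Basis"
  shows "line_affine g b"
proof -
  from assms(3) obtain I :: "'n set" where b: "b = basis_form I" by (auto simp: Basis_form_def)
  show ?thesis
  proof (cases "I = {}")
    case True
    then have "b \<in> \<Lambda> 0" using basis_form_in_Lam[of I] b by simp
    then have "c *\<^sub>R b \<in> \<Lambda> 0" for c by (rule subspace_scale[OF subspace_Lam])
    with wedge_affine_add_other[OF assms(1), of _ 0] \<open>b \<in> \<Lambda> 0\<close> assms(2) show ?thesis
      by (auto simp: line_affine_def)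
  next
    case False
    with b basis_form_eq_one_wedge[of I] wedge_affine_line[OF assms(1)] show ?thesis by metis
  qed
qed

text \<open>
  The class of wedge-affine functions contains translates and linear combinations, hence also
  directional derivatives, which can therefore be iterated.
\<close>

lemma wedge_affine_dir_deriv:
  fixes g :: "'n::{finite,linorder} form \<Rightarrow> real"
  assumes "wedge_affine p g"
  shows "wedge_affine p (dir_deriv d g)"
  unfolding wedge_affine_def
proof (intro conjI allI)
  fix a :: "(real, 'n) vec" and \<gamma> :: "'n form"
  let ?e = "one_form a \<and>\<^sub>\<Lambda> \<gamma>"
  show "line_affine (dir_deriv d g) ?e"
    unfolding line_affine_def
  proof (intro allI)
    fix x t
    define \<Delta> where "\<Delta> b y = g (y + b) - g y" for b y
    have \<Delta>: "\<Delta> b (x + t *\<^sub>R ?e) = \<Delta> b x + t * (\<Delta> b (x + ?e) - \<Delta> b x)" for b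
      unfolding \<Delta>_def
      using line_affineD[OF wedge_affine_line[OF assms], of "x + b" t a \<gamma>]
        line_affineD[OF wedge_affine_line[OF assms], of x t a \<gamma>] by (simp add: algebra_simps)
    then show "dir_deriv d g (x + t *\<^sub>R ?e)
        = dir_deriv d g x + t * (dir_deriv d g (x + ?e) - dir_deriv d g x)"
      unfolding dir_deriv_def \<Delta>_def[symmetric] \<Delta>
      by (simp add: sum_distrib_left algebra_simps sum.distrib sum_subtractf)
  qed
next
  fix x
  have "g (x + b) - g x = g (deg_part p x + b) - g (deg_part p x)" for b
    using wedge_affine_deg[OF assms, of "x + b"] wedge_affine_deg[OF assms, of "deg_part p x + b"]
      wedge_affine_deg[OF assms, of x]
    by (simp add: linear_add[OF linear_deg_part] deg_part_Lam[OF deg_part_in_Lam])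
  then show "dir_deriv d g x = dir_deriv d g (deg_part p x)"
    by (simp add: dir_deriv_def)
qed

lemma wedge_affine_translate:
  fixes g :: "'n::{finite,linorder} form \<Rightarrow> real"
  assumes "wedge_affine p g"
  shows "wedge_affine p (\<lambda>x. g (x + y))"
  unfolding wedge_affine_def
proof (intro conjI allI)
  fix a :: "(real, 'n) vec" and \<gamma> :: "'n form"
  show "line_affine (\<lambda>x. g (x + y)) (one_form a \<and>\<^sub>\<Lambda> \<gamma>)"
    unfolding line_affine_def
  proof (intro allI)
    fix x t
    show "g (x + t *\<^sub>R (one_form a \<and>\<^sub>\<Lambda> \<gamma>) + y)
        = g (x + y) + t * (g (x + one_form a \<and>\<^sub>\<Lambda> \<gamma> + y) - g (x + y))"
      using line_affineD[OF wedge_affine_line[OF assms], of "x + y" t a \<gamma>] by (simp add: ac_simps)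
  qed
next
  fix x
  show "g (x + y) = g (deg_part p x + y)"
    using wedge_affine_deg[OF assms, of "x + y"] wedge_affine_deg[OF assms, of "deg_part p x + y"]
    by (simp add: linear_add[OF linear_deg_part] deg_part_Lam[OF deg_part_in_Lam])
qed

lemma wedge_affine_dir_deriv_other:
  fixes g :: "'n::{finite,linorder} form \<Rightarrow> real"
  assumes "wedge_affine p g" "d \<in> \<Lambda> q" "q \<noteq> p"
  shows "dir_deriv d g = (\<lambda>x. 0)"
proof (rule ext)
  fix x
  have "(d \<bullet> basis_form I) * (g (x + basis_form I) - g x) = 0" for I :: "'n set"
  proof (cases "card I = p")
    case True
    then show ?thesis using assms by (simp add: inner_basis_form basis_vectors_def Lam_D)
  next
    case False
    then show ?thesis using wedge_affine_add_other[OF assms(1) basis_form_in_Lam[of I]] by simp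
  qed
  then show "dir_deriv d g x = 0"
    unfolding dir_deriv_def by (intro sum.neutral) (auto simp: Basis_form_def)
qed

text \<open>
  The iterated derivative is a second difference over a parallelogram whose diagonals have the factor \<open>a\<close>.
\<close>

lemma wedge_affine_dir_deriv_same:
  fixes g :: "'n::{finite,linorder} form \<Rightarrow> real"
  assumes "wedge_affine p g" "1 \<le> p"
  shows "dir_deriv (one_form a \<and>\<^sub>\<Lambda> \<gamma>) (dir_deriv (one_form a \<and>\<^sub>\<Lambda> \<delta>) g) = (\<lambda>x. 0)"
proof (rule ext)
  fix x
  let ?u = "one_form a \<and>\<^sub>\<Lambda> \<gamma>" and ?v = "one_form a \<and>\<^sub>\<Lambda> \<delta>"
  note W = wedge_affine_dir_deriv[OF assms(1), of ?v]
  have 1: "dir_deriv ?v g y = g (y + ?v) - g y" for y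
    using wedge_affine_Basis[OF assms] wedge_affine_line[OF assms(1)] by (rule dir_deriv_line_affine)
  have 2: "dir_deriv ?u (dir_deriv ?v g) x = dir_deriv ?v g (x + ?u) - dir_deriv ?v g x"
    using wedge_affine_Basis[OF W assms(2)] wedge_affine_line[OF W] by (rule dir_deriv_line_affine)
  have "line_affine g (?u + ?v)" "line_affine g (?u - ?v)"
    using wedge_affine_line[OF assms(1)] by (simp_all flip: wedge_add_right wedge_diff_right)
  from line_affine_parallelogram[OF this, of x] show "dir_deriv ?u (dir_deriv ?v g) x = 0"
    unfolding 2 1 by simp
qed

definition wedge_vectors :: "(real^'n::finite) list \<Rightarrow> 'n form" where
  "wedge_vectors us = foldr (\<lambda>u \<omega>. one_form u \<and>\<^sub>\<Lambda> \<omega>) us unit_form"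

lemma wedge_vectors_simps [simp]:
  "wedge_vectors [] = unit_form"
  "wedge_vectors (u # us) = one_form u \<and>\<^sub>\<Lambda> wedge_vectors us"
  by (simp_all add: wedge_vectors_def)

lemma wedge_vectors_append: "wedge_vectors (us @ ws) = wedge_vectors us \<and>\<^sub>\<Lambda> wedge_vectors ws"
  by (induction us) (simp_all add: wedge_assoc)

lemma wedge_vectors_snoc: "wedge_vectors (us @ [u]) = one_form u \<and>\<^sub>\<Lambda> grade_inv (wedge_vectors us)"
  by (simp add: wedge_vectors_append one_form_commute)

lemma wedge_vectors_in_Lam: "wedge_vectors us \<in> \<Lambda> (length us)"
proof (induction us)
  case (Cons u us)
  then show ?case using one_form_wedge_Lam[OF Cons, of u] by simp
qed (simp add: unit_form_in_Lam)

lemma basis_form_eq_wedge_vectors: "basis_form I = wedge_vectors (basis_vectors I)"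
proof -
  have "wedge_list js = wedge_vectors (map (\<lambda>i. axis i 1) js)" for js :: "'a list"
    by (induction js) simp_all
  then show ?thesis by (simp add: basis_form_def basis_vectors_def)
qed

lemma wedge_vectors_add:
  "wedge_vectors (us @ (u + v) # ws) = wedge_vectors (us @ u # ws) + wedge_vectors (us @ v # ws)"
  by (simp add: wedge_vectors_append linear_add[OF linear_one_form] wedge_add_left wedge_add_right)

lemma wedge_vectors_scale:
  "wedge_vectors (us @ (c *\<^sub>R v) # ws) = c *\<^sub>R wedge_vectors (us @ v # ws)"
  by (simp add: wedge_vectors_append linear_scale[OF linear_one_form] wedge_scaleR_left wedge_scaleR_right)

lemma wedge_vectors_adjacent: "wedge_vectors (us @ u # u # ws) = 0"
  by (simp add: wedge_vectors_append one_form_wedge_self)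

text \<open>
  Moving the vectors \<open>us\<close> to the other side of the inner product inserts them into \<open>\<omega>\<close>.
\<close>

lemma inner_wedge_vectors_wedge:
  fixes \<omega> \<omega>' \<theta> :: "'n::{finite,linorder} form"
  assumes "\<And>ws. app \<omega>' ws = app \<omega> (us @ ws)"
  shows "\<omega> \<bullet> (wedge_vectors us \<and>\<^sub>\<Lambda> \<theta>) = \<omega>' \<bullet> \<theta>"
  using assms
proof (induction us arbitrary: \<omega>)
  case Nil
  then have "\<omega>' = \<omega>" by (intro form_eqI) simp
  then show ?case by simp
next
  case (Cons u us)
  have "(u \<lrcorner> \<omega>) \<bullet> (wedge_vectors us \<and>\<^sub>\<Lambda> \<theta>) = \<omega>' \<bullet> \<theta>"
    by (rule Cons.IH) (simp add: app_int_prod Cons.prems)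
  then show ?case by (simp add: wedge_assoc inner_int_prod)
qed

text \<open>
  The list of vectors is cut into \<open>s\<close> blocks of length \<open>p\<close>. Each block contributes a derivative along the
  product of its vectors, and the result is evaluated at \<open>0\<close>.
\<close>

primrec block_deriv :: "nat \<Rightarrow> nat \<Rightarrow> ('n form \<Rightarrow> real) \<Rightarrow> (real^('n::{finite,linorder})) list \<Rightarrow> real" where
  "block_deriv p 0 g us = (if us = [] then g 0 else 0)"
| "block_deriv p (Suc s) g us = block_deriv p s (dir_deriv (wedge_vectors (take p us)) g) (drop p us)"

lemma block_deriv_fun_add:
  "block_deriv p s (\<lambda>x. g x + h x) us = block_deriv p s g us + block_deriv p s h us"
  by (induction s arbitrary: g h us) (simp_all add: dir_deriv_fun_add)

lemma block_deriv_fun_scale: "block_deriv p s (\<lambda>x. c * g x) us = c * block_deriv p s g us"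
  by (induction s arbitrary: g us) (simp_all add: dir_deriv_fun_scale)

lemma block_deriv_zero [simp]: "block_deriv p s (\<lambda>x. 0) us = 0"
  by (induction s arbitrary: us) simp_all

lemma linear_block_deriv_dir: "linear (\<lambda>\<xi>. block_deriv p s (dir_deriv \<xi> g) us)"
  by (rule linearI) (simp_all add: dir_deriv_add dir_deriv_scale block_deriv_fun_add block_deriv_fun_scale)

lemma take_drop_append_Cons:
  "take p (us @ v # ws) = (if length us < p then us @ v # take (p - length us - 1) ws else take p us)"
  "drop p (us @ v # ws) = (if length us < p then drop (p - length us - 1) ws else drop p us @ v # ws)"
  by (auto simp: take_Cons' drop_Cons')

lemma linear_block_deriv: "linear (\<lambda>v. block_deriv p s g (us @ v # ws))"
proof (induction s arbitrary: g us)
  case 0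
  show ?case by (simp add: linear_iff)
next
  case (Suc s)
  show ?case
  proof (cases "length us < p")
    case True
    then show ?thesis
      by (intro linearI)
         (simp_all add: take_drop_append_Cons wedge_vectors_add wedge_vectors_scale dir_deriv_add
           dir_deriv_scale block_deriv_fun_add block_deriv_fun_scale del: take_append drop_append)
  next
    case False
    then show ?thesis using Suc.IH by simp
  qed
qed

text \<open>
  Two equal neighbours in one block make its product vanish. Two equal neighbours in consecutive
  blocks give two derivatives along forms with a common factor.
\<close>

lemma block_deriv_adjacent:
  assumes "wedge_affine p g" "1 \<le> p"
  shows "block_deriv p s g (us @ u # u # ws) = 0"
  using assms(1)
proof (induction s arbitrary: g us)
  case 0
  show ?case by simp
next
  case (Suc s)
  consider "length us + 2 \<le> p" | "length us + 1 = p" | "p \<le> length us" by linarith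
  then show ?case
  proof cases
    case 1
    then have "take p (us @ u # u # ws) = us @ u # u # take (p - length us - 2) ws"
      by (auto simp: take_Cons')
    then show ?thesis by (simp add: wedge_vectors_adjacent)
  next
    case 2
    then have td: "take p (us @ u # u # ws) = us @ [u]" "drop p (us @ u # u # ws) = u # ws"
      by auto
    show ?thesis
    proof (cases s)
      case 0
      with td show ?thesis by simp
    next
      case (Suc r)
      obtain q where p: "p = Suc q" using assms(2) by (cases p) auto
      have "block_deriv p (Suc s) g (us @ u # u # ws) = block_deriv p r (dir_deriv
          (wedge_vectors (take p (u # ws))) (dir_deriv (wedge_vectors (us @ [u])) g)) (drop p (u # ws))"
        by (simp only: block_deriv.simps td Suc)
      then show ?thesis
        by (simp add: p wedge_vectors_snoc wedge_affine_dir_deriv_same[OF Suc.prems assms(2)])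
    qed
  next
    case 3
    then show ?thesis
      using Suc.IH[OF wedge_affine_dir_deriv[OF Suc.prems]] by simp
  qed
qed

text \<open>
  A block that is too short would be a derivative along a form of degree less than \<open>p\<close>, on which \<open>g\<close> does
  not depend.
\<close>

lemma block_deriv_length:
  assumes "wedge_affine p g" "1 \<le> p" "length us \<noteq> p * s"
  shows "block_deriv p s g us = 0"
  using assms(1,3)
proof (induction s arbitrary: g us)
  case (Suc s)
  show ?case
  proof (cases "length us < p")
    case True
    then have "dir_deriv (wedge_vectors (take p us)) g = (\<lambda>x. 0)"
      using wedge_vectors_in_Lam[of us] by (intro wedge_affine_dir_deriv_other[OF Suc.prems(1)]) auto
    then show ?thesis by simp
  next
    case False
    with Suc.prems have "length (drop p us) \<noteq> p * s" by auto
    with Suc.IH[OF wedge_affine_dir_deriv[OF Suc.prems(1)]] show ?thesis by simp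
  qed
qed simp

definition block_form :: "nat \<Rightarrow> nat \<Rightarrow> ('n::{finite,linorder} form \<Rightarrow> real) \<Rightarrow> 'n form" where
  "block_form p s g = Abs_form (block_deriv p s g)"

lemma app_block_form:
  assumes "wedge_affine p g" "1 \<le> p"
  shows "app (block_form p s g) = block_deriv p s g"
  unfolding block_form_def
  by (intro app_Abs_form alternating_form_adjacent linear_block_deriv block_deriv_adjacent[OF assms])

lemma block_form_in_Lam:
  assumes "wedge_affine p g" "1 \<le> p"
  shows "block_form p s g \<in> \<Lambda> (p * s)"
  using block_deriv_length[OF assms] by (simp add: Lam_def app_block_form[OF assms])

text \<open>
  Both sides are linear in the first factor \<open>\<xi>\<close>. For a basis form, which is a product of vectors, the
  inner product inserts these vectors into the block form, and they form its first block.
\<close>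

lemma block_form_inner_power:
  fixes g :: "'n::{finite,linorder} form \<Rightarrow> real"
  assumes "wedge_affine p g" "1 \<le> p" and \<xi>: "\<xi> \<in> \<Lambda> p"
  shows "block_form p s g \<bullet> wedge_power \<xi> s = (dir_deriv \<xi> ^^ s) g 0"
  using assms(1)
proof (induction s arbitrary: g)
  case 0
  have "block_form p 0 g \<bullet> basis_form {} = g 0"
    by (simp add: inner_basis_form app_block_form[OF 0 assms(2)] basis_vectors_def)
  then show ?case by (simp add: basis_form_def)
next
  case (Suc s)
  let ?\<theta> = "wedge_power \<xi> s"
  note W = wedge_affine_dir_deriv[OF Suc.prems]
  have lin1: "linear (\<lambda>\<xi>. block_form p (Suc s) g \<bullet> (\<xi> \<and>\<^sub>\<Lambda> ?\<theta>))"
    by (intro linearI) (simp_all add: wedge_add_left wedge_scaleR_left inner_add_right)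
  have lin2: "linear (\<lambda>\<xi>. block_form p s (dir_deriv \<xi> g) \<bullet> ?\<theta>)"
    by (intro linearI)
       (simp_all add: inner_form_def app_block_form[OF W assms(2)] sum.distrib sum_distrib_left algebra_simps
         linear_add[OF linear_block_deriv_dir] linear_scale[OF linear_block_deriv_dir])
  have "block_form p (Suc s) g \<bullet> (basis_form I \<and>\<^sub>\<Lambda> ?\<theta>) = block_form p s (dir_deriv (basis_form I) g) \<bullet> ?\<theta>"
    if "card I = p" for I
    unfolding basis_form_eq_wedge_vectors
    by (rule inner_wedge_vectors_wedge)
       (use that in \<open>simp add: app_block_form[OF Suc.prems assms(2)] app_block_form[OF W assms(2)]
          basis_vectors_def\<close>)
  then have "block_form p (Suc s) g \<bullet> (\<xi> \<and>\<^sub>\<Lambda> ?\<theta>) = block_form p s (dir_deriv \<xi> g) \<bullet> ?\<theta>"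
    by (subst (1 3) Lam_basis_expansion[OF \<xi>])
       (simp add: linear_sum[OF lin1] linear_sum[OF lin2] linear_scale[OF lin1] linear_scale[OF lin2])
  also have "\<dots> = (dir_deriv \<xi> ^^ s) (dir_deriv \<xi> g) 0"
    by (rule Suc.IH[OF W])
  finally show ?case by (simp add: funpow_swap1)
qed

lemma wedge_affine_funpow: "wedge_affine p g \<Longrightarrow> wedge_affine p ((dir_deriv \<xi> ^^ s) g)"
  by (induction s) (simp_all add: wedge_affine_dir_deriv)

text \<open>
  The derivatives at \<open>y\<close> are those at \<open>0\<close> of a translate of \<open>g\<close>, and these come from a form of degree
  greater than \<open>n\<close>.
\<close>

lemma dir_deriv_funpow_eq_0:
  fixes g :: "'n::{finite,linorder} form \<Rightarrow> real"
  assumes "wedge_affine p g" "1 \<le> p" "\<xi> \<in> \<Lambda> p" "CARD('n) < p * s"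
  shows "(dir_deriv \<xi> ^^ s) g y = 0"
proof -
  have "(dir_deriv \<xi> ^^ m) (\<lambda>x. g (x + y)) = (\<lambda>x. (dir_deriv \<xi> ^^ m) g (x + y))" for m
    by (induction m) (simp_all add: dir_deriv_translate)
  moreover note W = wedge_affine_translate[OF assms(1), of y]
  have "block_form p s (\<lambda>x. g (x + y)) = 0"
    using Lam_above_dim[OF block_form_in_Lam[OF W assms(2)] assms(4)] .
  ultimately show ?thesis
    using block_form_inner_power[OF W assms(2,3), of s] by simp
qed

text \<open>
  Maclaurin's formula for \<open>t \<mapsto> g (t \<xi>)\<close>, in which the remainder vanishes.
\<close>

theorem wedge_affine_power_sum:
  fixes g :: "'n::{finite,linorder} form \<Rightarrow> real"
  assumes "wedge_affine p g" "1 \<le> p"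
  shows "\<exists>c. (\<forall>s. c s \<in> \<Lambda> (p * s)) \<and>
    (\<forall>\<xi>\<in>\<Lambda> p. g \<xi> = (\<Sum>s=0..CARD('n) div p. c s \<bullet> wedge_power \<xi> s))"
proof (intro exI[of _ "\<lambda>s. (1 / fact s) *\<^sub>R block_form p s g"] conjI allI ballI)
  show "(1 / fact s) *\<^sub>R block_form p s g \<in> \<Lambda> (p * s)" for s
    by (intro subspace_scale[OF subspace_Lam] block_form_in_Lam assms)
next
  fix \<xi> :: "'n form" assume \<xi>: "\<xi> \<in> \<Lambda> p"
  let ?N = "CARD('n) div p"
  define diff where "diff m t = (dir_deriv \<xi> ^^ m) g (t *\<^sub>R \<xi>)" for m t
  have "DERIV (diff m) t :> diff (Suc m) t" for m t
  proof -
    have "((\<lambda>h. (dir_deriv \<xi> ^^ m) g (t *\<^sub>R \<xi> + h *\<^sub>R \<xi>)) has_real_derivative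
        dir_deriv \<xi> ((dir_deriv \<xi> ^^ m) g) (t *\<^sub>R \<xi>)) (at 0)"
      by (rule has_real_derivative_dir_deriv)
         (rule wedge_affine_Basis[OF wedge_affine_funpow[OF assms(1)] assms(2)])
    then have "((\<lambda>h. diff m (h + t)) has_real_derivative diff (Suc m) t) (at 0)"
      by (simp add: diff_def algebra_simps)
    then show ?thesis using DERIV_shift[of "diff m" _ 0 t] by simp
  qed
  then obtain t where t: "diff 0 1 = (\<Sum>m<Suc ?N. (diff m 0 / fact m) * 1 ^ m)
      + (diff (Suc ?N) t / fact (Suc ?N)) * 1 ^ Suc ?N"
    using Maclaurin_all_le[of diff "diff 0" 1 "Suc ?N"] by blast
  have "CARD('n) < p * Suc ?N"
    using dividend_less_times_div[of p "CARD('n)"] assms(2) by simp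
  then have "diff (Suc ?N) t = 0"
    unfolding diff_def by (rule dir_deriv_funpow_eq_0[OF assms \<xi>])
  with t have "g \<xi> = (\<Sum>m<Suc ?N. (dir_deriv \<xi> ^^ m) g 0 / fact m)"
    by (simp add: diff_def)
  also have "\<dots> = (\<Sum>s=0..?N. ((1 / fact s) *\<^sub>R block_form p s g) \<bullet> wedge_power \<xi> s)"
    by (rule sum.cong) (auto simp: block_form_inner_power[OF assms \<xi>])
  finally show "g \<xi> = (\<Sum>s=0..?N. ((1 / fact s) *\<^sub>R block_form p s g) \<bullet> wedge_power \<xi> s)" .
qed

section \<open>Ext-int. one affine functions\<close>

lemma one_form_wedge_int_prod:
  "one_form a \<and>\<^sub>\<Lambda> (a \<lrcorner> \<beta>) = (a \<bullet> a) *\<^sub>R \<beta> - a \<lrcorner> (one_form a \<and>\<^sub>\<Lambda> \<beta>)"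
  by (simp add: int_prod_one_wedge)

text \<open>
  If \<open>b\<close> is split into the part \<open>P b\<close> that has the factor \<open>a\<close> and the rest, then \<open>a \<and> b\<close> depends only on the
  rest and \<open>a \<lrcorner> b\<close> depends only on \<open>P b\<close>; so the two products can be prescribed independently.
\<close>

lemma ext_int_split:
  assumes "\<gamma>1 \<in> \<Lambda> k" "\<gamma>2 \<in> \<Lambda> k" "1 \<le> k"
  shows "\<exists>b\<in>\<Lambda> k. one_form a \<and>\<^sub>\<Lambda> b = one_form a \<and>\<^sub>\<Lambda> \<gamma>1 \<and> a \<lrcorner> b = a \<lrcorner> \<gamma>2"
proof (cases "a = 0")
  case True
  then show ?thesis
    using assms(1) by (intro bexI[of _ \<gamma>1]) (simp_all add: linear_0[OF linear_int_prod_left])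
next
  case False
  define P where "P \<gamma> = (1 / (a \<bullet> a)) *\<^sub>R (one_form a \<and>\<^sub>\<Lambda> (a \<lrcorner> \<gamma>))" for \<gamma> :: "'a form"
  have P_Lam: "P \<gamma> \<in> \<Lambda> k" if "\<gamma> \<in> \<Lambda> k" for \<gamma>
    using one_form_wedge_Lam[OF int_prod_Lam[OF that assms(3)], of a a] assms(3)
    by (simp add: P_def subspace_scale[OF subspace_Lam])
  have wedge_P: "one_form a \<and>\<^sub>\<Lambda> P \<gamma> = 0" for \<gamma>
    by (simp add: P_def wedge_scaleR_right one_form_wedge_self)
  have int_P: "a \<lrcorner> P \<gamma> = a \<lrcorner> \<gamma>" for \<gamma>
    using False by (simp add: P_def linear_scale[OF linear_int_prod_right] int_prod_one_wedge int_prod_int_prod)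
  show ?thesis
  proof (intro bexI[of _ "\<gamma>1 - P \<gamma>1 + P \<gamma>2"] conjI)
    show "\<gamma>1 - P \<gamma>1 + P \<gamma>2 \<in> \<Lambda> k"
      by (intro subspace_add[OF subspace_Lam] subspace_diff[OF subspace_Lam] P_Lam assms)
  qed (simp_all add: wedge_add_right wedge_diff_right wedge_P linear_add[OF linear_int_prod_right]
      linear_diff[OF linear_int_prod_right] int_P)
qed

text \<open>
  Equality holds in the convexity inequality between any two points. Outside of \<open>[0, 1]\<close>, one of the points
  \<open>0\<close> and \<open>1\<close> lies between \<open>t\<close> and the other one.
\<close>

lemma convex_both_signs_affine:
  fixes h :: "real \<Rightarrow> real"
  assumes "convex_on UNIV h" "convex_on UNIV (\<lambda>t. - h t)"
  shows "h t = h 0 + t * (h 1 - h 0)"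
proof -
  have eq: "h ((1 - s) * x + s * y) = (1 - s) * h x + s * h y" if "0 \<le> s" "s \<le> 1" for s x y
    using convex_onD[OF assms(1), of s x y] convex_onD[OF assms(2), of s x y] that by simp
  consider "0 \<le> t \<and> t \<le> 1" | "1 < t" | "t < 0" by linarith
  then show ?thesis
  proof cases
    case 1
    then show ?thesis using eq[of t 0 1] by (simp add: algebra_simps)
  next
    case 2
    then show ?thesis using eq[of "1 / t" 0 t] by (simp add: field_simps)
  next
    case 3
    define s where "s = - t / (1 - t)"
    have s: "0 \<le> s" "s \<le> 1" "s * (1 - t) = - t"
      using 3 by (simp_all add: s_def field_simps)
    have "h ((1 - s) * t + s * 1) = (1 - s) * h t + s * h 1"
      by (rule eq[OF s(1,2)])
    moreover have "(1 - s) * t + s * 1 = 0"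
      using s(3) by (simp add: algebra_simps)
    ultimately have h0: "h 0 = (1 - s) * h t + s * h 1"
      by simp
    have "(1 - t) * h 0 = ((1 - t) - s * (1 - t)) * h t + (s * (1 - t)) * h 1"
      unfolding h0 by (simp add: algebra_simps)
    then show ?thesis unfolding s(3) by (simp add: algebra_simps)
  qed
qed

lemma ext_int_one_affineD:
  assumes "ext_int_one_affine k f" "\<xi> \<in> \<Lambda> (k + 1)" "\<eta> \<in> \<Lambda> (k - 1)" "b \<in> \<Lambda> k"
  shows "f (\<xi> + t *\<^sub>R (one_form a \<and>\<^sub>\<Lambda> b), \<eta> + t *\<^sub>R (a \<lrcorner> b))
    = f (\<xi>, \<eta>) + t * (f (\<xi> + one_form a \<and>\<^sub>\<Lambda> b, \<eta> + a \<lrcorner> b) - f (\<xi>, \<eta>))"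
  using convex_both_signs_affine[of "\<lambda>t. f (\<xi> + t *\<^sub>R (one_form a \<and>\<^sub>\<Lambda> b), \<eta> + t *\<^sub>R (a \<lrcorner> b))" t] assms
  by (simp add: ext_int_one_affine_def ext_int_one_convex_def)

lemma deg_part_int_prod: "deg_part p (a \<lrcorner> \<beta>) = a \<lrcorner> deg_part (Suc p) \<beta>"
  by (rule form_eqI) (simp add: app_deg_part app_int_prod)

lemma deg_part_idem [simp]: "deg_part p (deg_part p x) = deg_part p x"
  by (rule deg_part_Lam[OF deg_part_in_Lam])

lemma ext_int_one_affine_line:
  fixes f :: "'n::{finite,linorder} form \<times> 'n form \<Rightarrow> real"
  assumes "ext_int_one_affine k f" "1 \<le> k"
  shows "line_affine (\<lambda>(x, y). f (deg_part (k + 1) x, deg_part (k - 1) y))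
    (one_form a \<and>\<^sub>\<Lambda> \<gamma>1, a \<lrcorner> \<gamma>2)"
proof -
  obtain b where b: "b \<in> \<Lambda> k" "one_form a \<and>\<^sub>\<Lambda> b = one_form a \<and>\<^sub>\<Lambda> deg_part k \<gamma>1"
    "a \<lrcorner> b = a \<lrcorner> deg_part k \<gamma>2"
    using ext_int_split[OF deg_part_in_Lam deg_part_in_Lam assms(2)] by blast
  have "deg_part (k + 1) (one_form a \<and>\<^sub>\<Lambda> \<gamma>1) = one_form a \<and>\<^sub>\<Lambda> b"
    "deg_part (k - 1) (a \<lrcorner> \<gamma>2) = a \<lrcorner> b"
    using assms(2) by (simp_all add: b deg_part_one_wedge deg_part_int_prod)
  then show ?thesis
    using ext_int_one_affineD[OF assms(1) deg_part_in_Lam deg_part_in_Lam b(1)]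
    by (simp add: line_affine_def linear_add[OF linear_deg_part] linear_scale[OF linear_deg_part])
qed

lemma basis_form_eq_wedge_int:
  assumes "i \<in> I"
  shows "basis_form I = one_form (axis i 1) \<and>\<^sub>\<Lambda> (axis i 1 \<lrcorner> basis_form I)"
proof -
  have "one_form (axis i 1) \<and>\<^sub>\<Lambda> basis_form I = 0"
    using assms by (simp add: basis_form_def one_wedge_wedge_list_eq_0)
  then show ?thesis
    by (simp add: one_form_wedge_int_prod inner_axis_axis linear_0[OF linear_int_prod_right])
qed

lemma basis_form_eq_int_wedge:
  assumes "i \<notin> J"
  shows "basis_form J = axis i 1 \<lrcorner> (one_form (axis i 1) \<and>\<^sub>\<Lambda> basis_form J)"
proof -
  have "axis i 1 \<lrcorner> basis_form J = 0"
    using assms by (simp add: basis_form_def int_prod_wedge_list)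
  then show ?thesis
    by (simp add: int_prod_one_wedge inner_axis_axis)
qed

text \<open>
  Quantification over all base points makes this condition on a mixed difference additive in both
  directions.
\<close>

definition decoupled :: "('a::ab_group_add \<times> 'b::ab_group_add \<Rightarrow> real) \<Rightarrow> 'a \<Rightarrow> 'b \<Rightarrow> bool" where
  "decoupled F u v \<longleftrightarrow> (\<forall>x y. F (x + u, y + v) + F (x, y) = F (x + u, y) + F (x, y + v))"

lemma decoupled_sum_left:
  assumes "\<And>i. i \<in> A \<Longrightarrow> decoupled F (u i) v"
  shows "decoupled F (\<Sum>i\<in>A. u i) v"
  using assms
proof (induction A rule: infinite_finite_induct)
  case (insert i A)
  then have i: "decoupled F (u i) v" and A: "decoupled F (\<Sum>i\<in>A. u i) v" by auto
  show ?case
    unfolding decoupled_def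
  proof (intro allI)
    fix x y
    show "F (x + (\<Sum>i\<in>insert i A. u i), y + v) + F (x, y) = F (x + (\<Sum>i\<in>insert i A. u i), y) + F (x, y + v)"
      using i[unfolded decoupled_def, rule_format, of x y] A[unfolded decoupled_def, rule_format, of "x + u i" y]
        insert.hyps by (simp add: add.assoc)
  qed
qed (simp_all add: decoupled_def)

lemma decoupled_sum_right:
  assumes "\<And>i. i \<in> A \<Longrightarrow> decoupled F u (v i)"
  shows "decoupled F u (\<Sum>i\<in>A. v i)"
  using assms
proof (induction A rule: infinite_finite_induct)
  case (insert i A)
  then have i: "decoupled F u (v i)" and A: "decoupled F u (\<Sum>i\<in>A. v i)" by auto
  show ?case
    unfolding decoupled_def
  proof (intro allI)
    fix x y
    show "F (x + u, y + (\<Sum>i\<in>insert i A. v i)) + F (x, y) = F (x + u, y) + F (x, y + (\<Sum>i\<in>insert i A. v i))"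
      using i[unfolded decoupled_def, rule_format, of x y] A[unfolded decoupled_def, rule_format, of x "y + v i"]
        insert.hyps by (simp add: add.assoc)
  qed
qed (simp_all add: decoupled_def)

lemma ext_int_one_affine_decoupled:
  fixes f :: "'n::{finite,linorder} form \<times> 'n form \<Rightarrow> real"
  assumes "ext_int_one_affine k f" "1 \<le> k" "\<xi> \<in> \<Lambda> (k + 1)" "\<eta> \<in> \<Lambda> (k - 1)"
  shows "f (\<xi>, \<eta>) + f (0, 0) = f (\<xi>, 0) + f (0, \<eta>)"
proof -
  let ?F = "\<lambda>(x, y). f (deg_part (k + 1) x, deg_part (k - 1) y)"
  have basis: "decoupled ?F (s *\<^sub>R basis_form I) (t *\<^sub>R basis_form J)"
    if "card I = k + 1" "card J = k - 1" for I J :: "'n set" and s t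
  proof -
    \<comment> \<open>A common direction for both variables exists because \<open>I\<close> is larger than \<open>J\<close>.\<close>
    have "\<not> I \<subseteq> J"
      using that card_mono[of J I] by auto
    then obtain i where i: "i \<in> I" "i \<notin> J" by blast
    have line: "line_affine ?F (s *\<^sub>R basis_form I, t *\<^sub>R basis_form J)" for t
      using ext_int_one_affine_line[OF assms(1,2), of "axis i 1" "s *\<^sub>R (axis i 1 \<lrcorner> basis_form I)"
          "t *\<^sub>R (one_form (axis i 1) \<and>\<^sub>\<Lambda> basis_form J)"]
      by (simp add: wedge_scaleR_right linear_scale[OF linear_int_prod_right]
          flip: basis_form_eq_wedge_int[OF i(1)] basis_form_eq_int_wedge[OF i(2)])
    have "?F ((x, y) + (s *\<^sub>R basis_form I, 0) + (0, t *\<^sub>R basis_form J)) + ?F (x, y)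
        = ?F ((x, y) + (s *\<^sub>R basis_form I, 0)) + ?F ((x, y) + (0, t *\<^sub>R basis_form J))" for x y
      by (rule line_affine_parallelogram) (use line[of t] line[of "- t"] in simp_all)
    then show ?thesis by (simp add: decoupled_def)
  qed
  have "decoupled ?F (\<Sum>I | card I = k + 1. (\<xi> \<bullet> basis_form I) *\<^sub>R basis_form I)
      (\<Sum>J | card J = k - 1. (\<eta> \<bullet> basis_form J) *\<^sub>R basis_form J)"
    by (intro decoupled_sum_left decoupled_sum_right basis) auto
  then have "decoupled ?F \<xi> \<eta>"
    by (simp only: flip: Lam_basis_expansion[OF assms(3)] Lam_basis_expansion[OF assms(4)])
  then show ?thesis
    using assms(3,4) by (auto simp: decoupled_def deg_part_Lam linear_0[OF linear_deg_part] dest!: spec[of _ 0])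
qed

definition exterior_power_sum :: "nat \<Rightarrow> ('n::{finite,linorder} form \<times> 'n form \<Rightarrow> real) \<Rightarrow> bool" where
  "exterior_power_sum k f \<longleftrightarrow>
     (\<exists>c d :: nat \<Rightarrow> 'n form.
        (\<forall>s\<in>{0..CARD('n) div (k + 1)}. c s \<in> \<Lambda> ((k + 1) * s)) \<and>
        (\<forall>r\<in>{0..CARD('n) div (CARD('n) - k + 1)}. d r \<in> \<Lambda> ((CARD('n) - k + 1) * r)) \<and>
        (\<forall>\<xi>\<in>\<Lambda> (k + 1). \<forall>\<eta>\<in>\<Lambda> (k - 1).
          f (\<xi>, \<eta>) = (\<Sum>s=0..CARD('n) div (k + 1). c s \<bullet> wedge_power \<xi> s)
            + (\<Sum>r=0..CARD('n) div (CARD('n) - k + 1). d r \<bullet> wedge_power (\<star> \<eta>) r)))"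

lemma linear_inv_hodge: "linear (inv (\<star> :: 'n::{finite,linorder} form \<Rightarrow> 'n form))"
  by (rule inj_linear_imp_inv_linear[OF linear_hodge inj_hodge])

lemma unit_form_inner_self: "unit_form \<bullet> (unit_form :: 'n::{finite,linorder} form) = 1"
  using inner_basis_form[of "basis_form {}" "{} :: 'n set"] app_basis_form[of "{}" "{} :: 'n set"]
  by (simp add: basis_form_def)

text \<open>
  The star carries the second variable to \<open>\<Lambda> (n - k + 1)\<close>, where the directions \<open>a \<lrcorner> b\<close> become \<open>a \<and> \<gamma>\<close>.
\<close>

lemma ext_int_one_affine_imp_power_sum:
  fixes f :: "'n::{finite,linorder} form \<times> 'n form \<Rightarrow> real"
  assumes "ext_int_one_affine k f" "1 \<le> k" "k \<le> CARD('n)"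
  shows "exterior_power_sum k f"
proof -
  let ?n = "CARD('n)"
  define F where "F = (\<lambda>(x, y). f (deg_part (k + 1) x, deg_part (k - 1) y))"
  define G where "G x = F (x, 0)" for x
  define H where "H z = F (0, inv \<star> (deg_part (?n - k + 1) z))" for z
  have line: "line_affine F (one_form a \<and>\<^sub>\<Lambda> \<gamma>1, a \<lrcorner> \<gamma>2)" for a \<gamma>1 \<gamma>2
    unfolding F_def by (rule ext_int_one_affine_line[OF assms(1,2)])
  have G: "wedge_affine (k + 1) G"
    unfolding wedge_affine_def
  proof (intro conjI allI)
    show "line_affine G (one_form a \<and>\<^sub>\<Lambda> \<gamma>)" for a \<gamma>
      using line[of a \<gamma> 0] by (simp add: G_def line_affine_def linear_0[OF linear_int_prod_right])
    show "G x = G (deg_part (k + 1) x)" for x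
      by (simp add: G_def F_def)
  qed
  have H: "wedge_affine (?n - k + 1) H"
    unfolding wedge_affine_def
  proof (intro conjI allI)
    fix a and \<gamma> :: "'n form"
    define b where "b = (- 1) ^ (k + 1) *\<^sub>R inv \<star> (deg_part (?n - k) \<gamma>)"
    have b: "inv \<star> (deg_part (?n - k) \<gamma>) \<in> \<Lambda> k" "\<star> (inv \<star> (deg_part (?n - k) \<gamma>)) = deg_part (?n - k) \<gamma>"
      using hodge_inverse_Lam[OF deg_part_in_Lam assms(3)] by auto
    have "\<star> (a \<lrcorner> b) = one_form a \<and>\<^sub>\<Lambda> deg_part (?n - k) \<gamma>"
      unfolding b_def linear_scale[OF linear_int_prod_right] linear_scale[OF linear_hodge]
        hodge_int_prod[OF b(1)] b(2) by (simp flip: power_add mult_2)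
    then have "inv \<star> (one_form a \<and>\<^sub>\<Lambda> deg_part (?n - k) \<gamma>) = a \<lrcorner> b"
      by (metis inv_f_f inj_hodge)
    then show "line_affine H (one_form a \<and>\<^sub>\<Lambda> \<gamma>)"
      using line[of a 0 b] by (simp add: H_def line_affine_def deg_part_one_wedge linear_add[OF linear_deg_part]
          linear_scale[OF linear_deg_part] linear_add[OF linear_inv_hodge] linear_scale[OF linear_inv_hodge])
  next
    show "H z = H (deg_part (?n - k + 1) z)" for z
      by (simp add: H_def)
  qed
  obtain c where c: "\<And>s. c s \<in> \<Lambda> ((k + 1) * s)"
    "\<And>\<xi>. \<xi> \<in> \<Lambda> (k + 1) \<Longrightarrow> G \<xi> = (\<Sum>s=0..?n div (k + 1). c s \<bullet> wedge_power \<xi> s)"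
    using wedge_affine_power_sum[OF G] by auto
  obtain d where d: "\<And>r. d r \<in> \<Lambda> ((?n - k + 1) * r)"
    "\<And>\<zeta>. \<zeta> \<in> \<Lambda> (?n - k + 1) \<Longrightarrow> H \<zeta> = (\<Sum>r=0..?n div (?n - k + 1). d r \<bullet> wedge_power \<zeta> r)"
    using wedge_affine_power_sum[OF H] by auto
  \<comment> \<open>Both sums contain the constant \<open>f (0, 0)\<close>; it is removed from one of them.\<close>
  define c' where "c' s = (if s = 0 then c 0 - f (0, 0) *\<^sub>R unit_form else c s)" for s
  have c': "c' s \<in> \<Lambda> ((k + 1) * s)" for s
    using c(1)[of s] c(1)[of 0] unit_form_in_Lam
    by (auto simp: c'_def intro!: subspace_diff[OF subspace_Lam] subspace_scale[OF subspace_Lam])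
  have sum_c': "(\<Sum>s=0..N. c' s \<bullet> wedge_power \<xi> s) = (\<Sum>s=0..N. c s \<bullet> wedge_power \<xi> s) - f (0, 0)" for N \<xi>
    by (simp add: sum.atLeast_Suc_atMost c'_def inner_diff_left unit_form_inner_self)
  have "f (\<xi>, \<eta>) = (\<Sum>s=0..?n div (k + 1). c' s \<bullet> wedge_power \<xi> s)
      + (\<Sum>r=0..?n div (?n - k + 1). d r \<bullet> wedge_power (\<star> \<eta>) r)"
    if "\<xi> \<in> \<Lambda> (k + 1)" "\<eta> \<in> \<Lambda> (k - 1)" for \<xi> \<eta>
  proof -
    have "?n - (k - 1) = ?n - k + 1" using assms by simp
    then have hodge: "\<star> \<eta> \<in> \<Lambda> (?n - k + 1)"
      using hodge_in_Lam[OF that(2)] assms(3) by simp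
    have "f (\<xi>, 0) = G \<xi>" "f (0, \<eta>) = H (\<star> \<eta>)"
      using that hodge inv_f_f[OF inj_hodge, of \<eta>]
      by (simp_all add: G_def H_def F_def deg_part_Lam linear_0[OF linear_deg_part])
    with ext_int_one_affine_decoupled[OF assms(1,2) that] show ?thesis
      unfolding sum_c' using c(2)[OF that(1)] d(2)[OF hodge] by simp
  qed
  with c' d(1) show ?thesis
    unfolding exterior_power_sum_def by blast
qed

section \<open>Polyaffine functions\<close>

lemma lookup_scaleR: "Poly_Mapping.lookup (c *\<^sub>R X) s = c *\<^sub>R Poly_Mapping.lookup X s"
proof -
  have "finite {i. c *\<^sub>R Poly_Mapping.lookup X i \<noteq> 0}"
    by (rule finite_subset[OF _ finite_lookup[of X]]) auto
  then show ?thesis by (simp add: scaleR_poly_mapping_def)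
qed

lemma lookup_power_tuple:
  "Poly_Mapping.lookup (power_tuple N \<xi>) s = (if s \<in> {1..N} then wedge_power \<xi> s else 0)"
  by (simp add: power_tuple_def lookup_sum lookup_single when_def)

lemma form_tuples_iff:
  "X \<in> form_tuples p N \<longleftrightarrow> (\<forall>s. Poly_Mapping.lookup X s \<in> (if s \<in> {1..N} then \<Lambda> (p * s) else {0}))"
  unfolding form_tuples_def subset_iff in_keys_iff mem_Collect_eq by (metis singleton_iff)

lemma power_tuple_in_form_tuples: "\<xi> \<in> \<Lambda> p \<Longrightarrow> power_tuple N \<xi> \<in> form_tuples p N"
  by (simp add: form_tuples_iff lookup_power_tuple wedge_power_Lam)

lemma convex_form_tuples: "convex (form_tuples p N)"
proof (rule convexI)
  fix X Y :: "nat \<Rightarrow>\<^sub>0 'a form" and u v :: real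
  assume X: "X \<in> form_tuples p N" and Y: "Y \<in> form_tuples p N"
  show "u *\<^sub>R X + v *\<^sub>R Y \<in> form_tuples p N"
    unfolding form_tuples_iff
  proof
    fix s
    show "Poly_Mapping.lookup (u *\<^sub>R X + v *\<^sub>R Y) s \<in> (if s \<in> {1..N} then \<Lambda> (p * s) else {0})"
      using X[unfolded form_tuples_iff, rule_format, of s] Y[unfolded form_tuples_iff, rule_format, of s]
      by (auto simp: lookup_add lookup_scaleR split: if_splits
          intro!: subspace_add[OF subspace_Lam] subspace_scale[OF subspace_Lam])
  qed
qed

text \<open>A power sum is an affine function of the tuples of powers.\<close>

lemma exterior_power_sum_imp_polyconvex:
  fixes f :: "'n::{finite,linorder} form \<times> 'n form \<Rightarrow> real"
  assumes "exterior_power_sum k f"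
  shows "ext_int_polyconvex k f"
proof -
  let ?N = "CARD('n) div (k + 1)" and ?M = "CARD('n) div (CARD('n) - k + 1)"
  obtain c d :: "nat \<Rightarrow> 'n form" where f: "\<And>\<xi> \<eta>. \<xi> \<in> \<Lambda> (k + 1) \<Longrightarrow> \<eta> \<in> \<Lambda> (k - 1) \<Longrightarrow>
      f (\<xi>, \<eta>) = (\<Sum>s=0..?N. c s \<bullet> wedge_power \<xi> s) + (\<Sum>r=0..?M. d r \<bullet> wedge_power (\<star> \<eta>) r)"
    using assms unfolding exterior_power_sum_def by blast
  define L where "L = (\<lambda>(X, Y). (\<Sum>s=1..?N. c s \<bullet> Poly_Mapping.lookup X s)
      + (\<Sum>r=1..?M. d r \<bullet> Poly_Mapping.lookup Y r))"
  define F where "F = (\<lambda>Z. c 0 \<bullet> unit_form + d 0 \<bullet> unit_form + L Z)"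
  have L: "L (u *\<^sub>R Z + v *\<^sub>R Z') = u * L Z + v * L Z'" for u v Z Z'
    by (cases Z; cases Z') (simp add: L_def lookup_add lookup_scaleR inner_add_right sum.distrib
        sum_distrib_left algebra_simps)
  have "convex_on (form_tuples (k + 1) ?N \<times> form_tuples (CARD('n) - k + 1) ?M) F"
  proof (rule convex_onI)
    show "convex (form_tuples (k + 1) ?N \<times> form_tuples (CARD('n) - k + 1) ?M :: (_ \<times> (_ \<Rightarrow>\<^sub>0 'n form)) set)"
      by (intro convex_Times convex_form_tuples)
  next
    show "F ((1 - t) *\<^sub>R x + t *\<^sub>R y) \<le> (1 - t) * F x + t * F y" for t x y
      unfolding F_def L by (simp add: algebra_simps)
  qed
  moreover have "f (\<xi>, \<eta>) = F (power_tuple ?N \<xi>, power_tuple ?M (\<star> \<eta>))"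
    if "\<xi> \<in> \<Lambda> (k + 1)" "\<eta> \<in> \<Lambda> (k - 1)" for \<xi> \<eta>
    by (simp add: f[OF that] F_def L_def lookup_power_tuple sum.atLeast_Suc_atMost[of 0])
  ultimately show ?thesis
    unfolding ext_int_polyconvex_def Let_def by blast
qed

lemma exterior_power_sum_uminus:
  assumes "exterior_power_sum k f"
  shows "exterior_power_sum k (\<lambda>x. - f x)"
proof -
  obtain c d where "\<forall>s\<in>{0..CARD('a) div (k + 1)}. c s \<in> \<Lambda> ((k + 1) * s)"
    "\<forall>r\<in>{0..CARD('a) div (CARD('a) - k + 1)}. d r \<in> \<Lambda> ((CARD('a) - k + 1) * r)"
    "\<forall>\<xi>\<in>\<Lambda> (k + 1). \<forall>\<eta>\<in>\<Lambda> (k - 1).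
          f (\<xi>, \<eta>) = (\<Sum>s=0..CARD('a) div (k + 1). c s \<bullet> wedge_power \<xi> s)
            + (\<Sum>r=0..CARD('a) div (CARD('a) - k + 1). d r \<bullet> wedge_power (\<star> \<eta>) r)"
    using assms unfolding exterior_power_sum_def by blast
  then show ?thesis
    unfolding exterior_power_sum_def
    by (intro exI[of _ "\<lambda>s. - c s"] exI[of _ "\<lambda>r. - d r"])
       (auto simp: sum_negf intro!: subspace_neg[OF subspace_Lam])
qed

lemma power_tuple_rank_one_affine:
  "\<exists>B. \<forall>t. power_tuple N (\<xi> + t *\<^sub>R (one_form a \<and>\<^sub>\<Lambda> \<beta>)) = power_tuple N \<xi> + t *\<^sub>R B"
proof -
  obtain \<theta> where \<theta>: "\<And>s t. wedge_power (\<xi> + t *\<^sub>R (one_form a \<and>\<^sub>\<Lambda> \<beta>)) s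
      = wedge_power \<xi> s + t *\<^sub>R (one_form a \<and>\<^sub>\<Lambda> \<theta> s)"
    using wedge_power_rank_one_affine[of \<xi> a \<beta>] by metis
  define B where "B = (\<Sum>s=1..N. Poly_Mapping.single s (one_form a \<and>\<^sub>\<Lambda> \<theta> s))"
  have "Poly_Mapping.lookup B s = (if s \<in> {1..N} then one_form a \<and>\<^sub>\<Lambda> \<theta> s else 0)" for s
    by (simp add: B_def lookup_sum lookup_single when_def)
  then have "power_tuple N (\<xi> + t *\<^sub>R (one_form a \<and>\<^sub>\<Lambda> \<beta>)) = power_tuple N \<xi> + t *\<^sub>R B" for t
    by (intro poly_mapping_eqI) (simp add: lookup_add lookup_scaleR lookup_power_tuple \<theta>)
  then show ?thesis by blast
qed

text \<open>
  The tuples of powers move along a straight line when the arguments do so in a direction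
  \<open>(a \<and> b, a \<lrcorner> b)\<close>.
\<close>

lemma polyconvex_imp_one_convex:
  fixes f :: "'n::{finite,linorder} form \<times> 'n form \<Rightarrow> real"
  assumes "ext_int_polyconvex k f" "1 \<le> k" "k \<le> CARD('n)"
  shows "ext_int_one_convex k f"
  unfolding ext_int_one_convex_def
proof (intro ballI allI)
  let ?N = "CARD('n) div (k + 1)" and ?M = "CARD('n) div (CARD('n) - k + 1)"
  fix \<xi> \<eta> b :: "'n form" and a
  assume \<xi>: "\<xi> \<in> \<Lambda> (k + 1)" and \<eta>: "\<eta> \<in> \<Lambda> (k - 1)" and b: "b \<in> \<Lambda> k"
  obtain F where F: "convex_on (form_tuples (k + 1) ?N \<times> form_tuples (CARD('n) - k + 1) ?M) F"
    "\<And>\<xi> \<eta>. \<xi> \<in> \<Lambda> (k + 1) \<Longrightarrow> \<eta> \<in> \<Lambda> (k - 1) \<Longrightarrow> f (\<xi>, \<eta>) = F (power_tuple ?N \<xi>, power_tuple ?M (\<star> \<eta>))"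
    using assms(1) unfolding ext_int_polyconvex_def Let_def by blast
  let ?\<xi> = "\<lambda>t. \<xi> + t *\<^sub>R (one_form a \<and>\<^sub>\<Lambda> b)" and ?\<eta> = "\<lambda>t. \<eta> + t *\<^sub>R (a \<lrcorner> b)"
  define T where "T t = (power_tuple ?N (?\<xi> t), power_tuple ?M (\<star> (?\<eta> t)))" for t
  obtain B1 where B1: "\<And>t. power_tuple ?N (?\<xi> t) = power_tuple ?N \<xi> + t *\<^sub>R B1"
    using power_tuple_rank_one_affine[of ?N \<xi> a b] by blast
  have "\<star> (?\<eta> t) = \<star> \<eta> + t *\<^sub>R (one_form a \<and>\<^sub>\<Lambda> ((- 1) ^ (k + 1) *\<^sub>R \<star> b))" for t
    by (simp only: linear_add[OF linear_hodge] linear_scale[OF linear_hodge] hodge_int_prod[OF b]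
        wedge_scaleR_right)
  then obtain B2 where B2: "\<And>t. power_tuple ?M (\<star> (?\<eta> t)) = power_tuple ?M (\<star> \<eta>) + t *\<^sub>R B2"
    using power_tuple_rank_one_affine[of ?M "\<star> \<eta>" a "(- 1) ^ (k + 1) *\<^sub>R \<star> b"] by auto
  have Lam: "?\<xi> t \<in> \<Lambda> (k + 1)" "?\<eta> t \<in> \<Lambda> (k - 1)" for t
    using \<xi> \<eta> one_form_wedge_Lam[OF b, of a] int_prod_Lam[OF b assms(2), of a]
    by (auto intro!: subspace_add[OF subspace_Lam] subspace_scale[OF subspace_Lam])
  have "\<star> (?\<eta> t) \<in> \<Lambda> (CARD('n) - k + 1)" for t
  proof -
    have "CARD('n) - (k - 1) = CARD('n) - k + 1" using assms by simp
    then show ?thesis using hodge_in_Lam[OF Lam(2)[of t]] assms(3) by simp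
  qed
  then have T_in: "T t \<in> form_tuples (k + 1) ?N \<times> form_tuples (CARD('n) - k + 1) ?M" for t
    using Lam by (auto simp: T_def intro!: power_tuple_in_form_tuples)
  have T_affine: "T ((1 - s) * x + s * y) = (1 - s) *\<^sub>R T x + s *\<^sub>R T y" for s x y
    unfolding T_def B1 B2 by (simp add: algebra_simps)
  show "convex_on UNIV (\<lambda>t. f (?\<xi> t, ?\<eta> t))"
  proof (rule convex_onI)
    fix s x y :: real assume "0 < s" "s < 1"
    then show "f (?\<xi> ((1 - s) *\<^sub>R x + s *\<^sub>R y), ?\<eta> ((1 - s) *\<^sub>R x + s *\<^sub>R y))
        \<le> (1 - s) * f (?\<xi> x, ?\<eta> x) + s * f (?\<xi> y, ?\<eta> y)"
      using convex_onD[OF F(1), of s "T x" "T y"] T_in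
      by (simp only: F(2)[OF Lam] real_scaleR_def T_def[symmetric] T_affine)
  qed simp
qed

section \<open>Functions with continuous partial derivatives and weak derivatives\<close>

lemma partial_deriv_eqI:
  assumes "(u has_derivative u') (at x)"
  shows "partial_deriv i u x = u' (axis i 1)"
  using frechet_derivative_at[OF assms] by (simp add: partial_deriv_def)

definition C1 :: "(real^'n \<Rightarrow> 'b::real_normed_vector) \<Rightarrow> bool" where
  "C1 u \<longleftrightarrow> (\<forall>x. u differentiable at x) \<and> (\<forall>i. continuous_on UNIV (partial_deriv i u))"

lemma C1_I:
  assumes "\<And>x. (u has_derivative u' x) (at x)" "\<And>i. continuous_on UNIV (\<lambda>x. u' x (axis i 1))"
  shows "C1 u"
  unfolding C1_def using assms(2) partial_deriv_eqI[OF assms(1)]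
  by (auto simp: differentiable_def intro: assms(1) cong: continuous_on_cong)

lemma C1_has_derivative: "C1 u \<Longrightarrow> (u has_derivative frechet_derivative u (at x)) (at x)"
  by (simp add: C1_def frechet_derivative_works)

lemma C1_continuous: "C1 u \<Longrightarrow> continuous_on UNIV u"
  by (simp add: C1_def continuous_on_eq_continuous_at differentiable_imp_continuous_within)

lemma C1_continuous_partial: "C1 u \<Longrightarrow> continuous_on UNIV (partial_deriv i u)"
  by (simp add: C1_def)

lemma frechet_derivative_expansion:
  assumes "C1 u"
  shows "frechet_derivative u (at x) h = (\<Sum>i\<in>UNIV. h $ i *\<^sub>R partial_deriv i u x)"
proof -
  note lin = has_derivative_linear[OF C1_has_derivative[OF assms, of x]]
  have "frechet_derivative u (at x) h = frechet_derivative u (at x) (\<Sum>i\<in>UNIV. h $ i *\<^sub>R axis i 1)"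
    using basis_expansion[of h] by (simp add: scalar_mult_eq_scaleR)
  then show ?thesis
    by (simp add: linear_sum[OF lin] linear_scale[OF lin] partial_deriv_def)
qed

lemma C1_has_vector_derivative_line:
  assumes "C1 u"
  shows "((\<lambda>t. u (x + t *\<^sub>R axis i 1)) has_vector_derivative partial_deriv i u (x + t *\<^sub>R axis i 1)) (at t)"
proof -
  have "((\<lambda>t. u (x + t *\<^sub>R axis i 1)) has_derivative
      (\<lambda>h. frechet_derivative u (at (x + t *\<^sub>R axis i 1)) (h *\<^sub>R axis i 1))) (at t)"
    by (rule has_derivative_compose[OF _ C1_has_derivative[OF assms], of "\<lambda>t. x + t *\<^sub>R axis i 1"])
       (auto intro!: derivative_eq_intros)
  then show ?thesis
    using linear_scale[OF has_derivative_linear[OF C1_has_derivative[OF assms]]]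
    by (simp add: has_vector_derivative_def partial_deriv_def)
qed

text \<open>
  An arbitrary compact set that contains the support is easier to handle than the support itself.
\<close>

lemma C1_compact_iff:
  "u \<in> C1_compact \<Omega> \<longleftrightarrow> C1 u \<and> (\<exists>K. compact K \<and> K \<subseteq> \<Omega> \<and> (\<forall>x. x \<notin> K \<longrightarrow> u x = 0))"
proof
  assume "u \<in> C1_compact \<Omega>"
  moreover have "\<forall>x. x \<notin> closure {x. u x \<noteq> 0} \<longrightarrow> u x = 0"
    using closure_subset[of "{x. u x \<noteq> 0}"] by blast
  ultimately show "C1 u \<and> (\<exists>K. compact K \<and> K \<subseteq> \<Omega> \<and> (\<forall>x. x \<notin> K \<longrightarrow> u x = 0))"
    unfolding C1_compact_def C1_def by blast
next
  assume u: "C1 u \<and> (\<exists>K. compact K \<and> K \<subseteq> \<Omega> \<and> (\<forall>x. x \<notin> K \<longrightarrow> u x = 0))"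
  then obtain K where K: "compact K" "K \<subseteq> \<Omega>" "\<And>x. x \<notin> K \<Longrightarrow> u x = 0" by blast
  then have sub: "closure {x. u x \<noteq> 0} \<subseteq> K"
    by (intro closure_minimal) (auto intro: compact_imp_closed)
  moreover have "compact (closure {x. u x \<noteq> 0})"
    using compact_Int_closed[OF K(1), of "closure {x. u x \<noteq> 0}"] sub by (simp add: Int_absorb1)
  ultimately show "u \<in> C1_compact \<Omega>"
    using u K(2) unfolding C1_compact_def C1_def by blast
qed

lemma C1_compact_mono: "u \<in> C1_compact \<Omega> \<Longrightarrow> \<Omega> \<subseteq> \<Omega>' \<Longrightarrow> u \<in> C1_compact \<Omega>'"
  by (auto simp: C1_compact_def)

lemma partial_deriv_outside:
  assumes "compact K" "\<And>x. x \<notin> K \<Longrightarrow> u x = 0" "x \<notin> K"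
  shows "partial_deriv i u x = 0"
proof -
  have "(u has_derivative (\<lambda>h. 0)) (at x)"
    by (rule has_derivative_transform_within_open[where f = "\<lambda>x. 0" and s = "- K"])
       (use assms compact_imp_closed in auto)
  then show ?thesis by (rule partial_deriv_eqI)
qed

lemma compact_support_integrable:
  fixes f :: "'a::euclidean_space \<Rightarrow> 'b::euclidean_space"
  assumes "continuous_on UNIV f" "compact K" "\<And>x. x \<notin> K \<Longrightarrow> f x = 0"
  shows "integrable lebesgue f" and "\<exists>B. \<forall>x. norm (f x) \<le> B"
proof -
  have "(\<lambda>x. indicator K x *\<^sub>R f x) = f"
    using assms(3) by (auto simp: fun_eq_iff indicator_def)
  moreover have "integrable lborel (\<lambda>x. indicator K x *\<^sub>R f x)"
    by (rule borel_integrable_compact[OF assms(2)]) (rule continuous_on_subset[OF assms(1)], simp)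
  ultimately show "integrable lebesgue f"
    using assms(1) by (simp add: integrable_completion borel_measurable_continuous_onI)
  have "bounded (f ` K)"
    using assms by (intro compact_imp_bounded compact_continuous_image) (auto intro: continuous_on_subset)
  then obtain B where "\<And>x. x \<in> K \<Longrightarrow> norm (f x) \<le> B"
    by (auto simp: bounded_iff)
  then have "norm (f x) \<le> max B 0" for x
    using assms(3)[of x] by (cases "x \<in> K") (auto simp: le_max_iff_disj)
  then show "\<exists>B. \<forall>x. norm (f x) \<le> B" by blast
qed

lemma C1_compact_partial:
  fixes u :: "real^'n \<Rightarrow> 'b::euclidean_space"
  assumes "u \<in> C1_compact \<Omega>"
  shows "continuous_on UNIV (partial_deriv i u)" "integrable lebesgue (partial_deriv i u)"
    "\<exists>B. \<forall>x. norm (partial_deriv i u x) \<le> B" "x \<notin> \<Omega> \<Longrightarrow> partial_deriv i u x = 0"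
proof -
  obtain K where u: "C1 u" "compact K" "K \<subseteq> \<Omega>" "\<And>x. x \<notin> K \<Longrightarrow> u x = 0"
    using assms unfolding C1_compact_iff by blast
  have out: "partial_deriv i u x = 0" if "x \<notin> K" for x
    using u(2,4) that by (rule partial_deriv_outside)
  show cont: "continuous_on UNIV (partial_deriv i u)"
    by (rule C1_continuous_partial[OF u(1)])
  show "integrable lebesgue (partial_deriv i u)" "\<exists>B. \<forall>x. norm (partial_deriv i u x) \<le> B"
    using compact_support_integrable[OF cont u(2)] out by blast+
  show "partial_deriv i u x = 0" if "x \<notin> \<Omega>"
    using out that u(3) by blast
qed

lemma C1_compact_function:
  fixes u :: "real^'n \<Rightarrow> 'b::euclidean_space"
  assumes "u \<in> C1_compact \<Omega>"
  shows "continuous_on UNIV u" "integrable lebesgue u"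
    "\<exists>B. \<forall>x. norm (u x) \<le> B" "x \<notin> \<Omega> \<Longrightarrow> u x = 0"
proof -
  obtain K where u: "C1 u" "compact K" "K \<subseteq> \<Omega>" "\<And>x. x \<notin> K \<Longrightarrow> u x = 0"
    using assms unfolding C1_compact_iff by blast
  show cont: "continuous_on UNIV u"
    by (rule C1_continuous[OF u(1)])
  show "integrable lebesgue u" "\<exists>B. \<forall>x. norm (u x) \<le> B"
    using compact_support_integrable[OF cont u(2)] u(4) by blast+
  show "u x = 0" if "x \<notin> \<Omega>"
    using u that by blast
qed

lemma borel_measurable_lebesgue_continuous:
  fixes f :: "'a::euclidean_space \<Rightarrow> 'b::euclidean_space"
  assumes "continuous_on UNIV f"
  shows "f \<in> borel_measurable lebesgue"
  using borel_measurable_continuous_onI[OF assms] by (simp add: measurable_completion)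

lemma partial_deriv_mult:
  fixes \<phi> :: "real^'n \<Rightarrow> real"
  assumes "C1 \<phi>" "C1 u"
  shows "partial_deriv i (\<lambda>x. \<phi> x *\<^sub>R u x) x = partial_deriv i \<phi> x *\<^sub>R u x + \<phi> x *\<^sub>R partial_deriv i u x"
    and "C1 (\<lambda>x. \<phi> x *\<^sub>R u x)"
proof -
  have deriv: "((\<lambda>x. \<phi> x *\<^sub>R u x) has_derivative
      (\<lambda>h. \<phi> x *\<^sub>R frechet_derivative u (at x) h + frechet_derivative \<phi> (at x) h *\<^sub>R u x)) (at x)" for x
    by (intro has_derivative_scaleR C1_has_derivative assms)
  show eq: "partial_deriv i (\<lambda>x. \<phi> x *\<^sub>R u x) x = partial_deriv i \<phi> x *\<^sub>R u x + \<phi> x *\<^sub>R partial_deriv i u x" for i x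
    using partial_deriv_eqI[OF deriv, of i x] by (simp add: partial_deriv_def)
  show "C1 (\<lambda>x. \<phi> x *\<^sub>R u x)"
    unfolding C1_def
  proof (intro conjI allI)
    show "(\<lambda>x. \<phi> x *\<^sub>R u x) differentiable at x" for x
      using deriv by (auto simp: differentiable_def)
    show "continuous_on UNIV (partial_deriv i (\<lambda>x. \<phi> x *\<^sub>R u x))" for i
      by (subst eq[abs_def]) (intro continuous_intros C1_continuous_partial C1_continuous assms)
  qed
qed

lemma C1_compact_mult:
  fixes \<phi> :: "real^'n \<Rightarrow> real"
  assumes "\<phi> \<in> C1_compact \<Omega>" "C1 u"
  shows "(\<lambda>x. \<phi> x *\<^sub>R u x) \<in> C1_compact \<Omega>"
proof -
  obtain K where u: "C1 \<phi>" "compact K" "K \<subseteq> \<Omega>" "\<forall>x. x \<notin> K \<longrightarrow> \<phi> x = 0"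
    using assms(1) unfolding C1_compact_iff by blast
  then have "\<forall>x. x \<notin> K \<longrightarrow> \<phi> x *\<^sub>R u x = 0" by simp
  with u partial_deriv_mult(2)[OF u(1) assms(2)] show ?thesis
    unfolding C1_compact_iff by blast
qed

lemma bounded_linear_partial_deriv:
  assumes "bounded_linear T" "C1 u"
  shows "partial_deriv i (\<lambda>x. T (u x)) x = T (partial_deriv i u x)" and "C1 (\<lambda>x. T (u x))"
proof -
  have deriv: "((\<lambda>x. T (u x)) has_derivative (\<lambda>h. T (frechet_derivative u (at x) h))) (at x)" for x
    by (intro bounded_linear.has_derivative[OF assms(1)] C1_has_derivative assms(2))
  show eq: "partial_deriv i (\<lambda>x. T (u x)) x = T (partial_deriv i u x)" for i x
    using partial_deriv_eqI[OF deriv, of i x] by (simp add: partial_deriv_def)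
  show "C1 (\<lambda>x. T (u x))"
    unfolding C1_def
  proof (intro conjI allI)
    show "(\<lambda>x. T (u x)) differentiable at x" for x
      using deriv by (auto simp: differentiable_def)
    show "continuous_on UNIV (partial_deriv i (\<lambda>x. T (u x)))" for i
      unfolding eq[abs_def]
      using C1_continuous_partial[OF assms(2)] by (rule bounded_linear.continuous_on[OF assms(1)])
  qed
qed

lemma bounded_linear_C1_compact:
  assumes "bounded_linear T" "u \<in> C1_compact \<Omega>"
  shows "(\<lambda>x. T (u x)) \<in> C1_compact \<Omega>"
proof -
  obtain K where u: "C1 u" "compact K" "K \<subseteq> \<Omega>" "\<forall>x. x \<notin> K \<longrightarrow> u x = 0"
    using assms(2) unfolding C1_compact_iff by blast
  then have "\<forall>x. x \<notin> K \<longrightarrow> T (u x) = 0"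
    by (simp add: linear_0[OF bounded_linear.linear[OF assms(1)]])
  with u bounded_linear_partial_deriv(2)[OF assms(1) u(1)] show ?thesis
    unfolding C1_compact_iff by blast
qed

lemma integral_translate_lebesgue:
  fixes f :: "'a::euclidean_space \<Rightarrow> 'b::euclidean_space"
  assumes "continuous_on UNIV f"
  shows "integral\<^sup>L lebesgue (\<lambda>x. f (c + x)) = integral\<^sup>L lebesgue f"
proof -
  have f: "f \<in> borel_measurable borel" "(\<lambda>x. f (c + x)) \<in> borel_measurable borel"
    using assms by (auto intro!: borel_measurable_continuous_onI continuous_intros
        continuous_on_compose2[OF assms])
  have "integral\<^sup>L lborel f = integral\<^sup>L (distr lborel borel ((+) c)) f"
    by (simp add: lborel_distr_plus)
  also have "\<dots> = integral\<^sup>L lborel (\<lambda>x. f (c + x))"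
    by (rule integral_distr) (use f in auto)
  finally show ?thesis
    using f by (simp add: integral_completion)
qed

lemma C1_difference_bound:
  fixes u :: "real^'n \<Rightarrow> 'b::euclidean_space"
  assumes "C1 u" "\<And>x. norm (partial_deriv i u x) \<le> B"
  shows "norm (u (x + h *\<^sub>R axis i 1) - u x) \<le> B * \<bar>h\<bar>"
proof -
  have "norm ((\<lambda>t. u (x + t *\<^sub>R axis i 1)) h - (\<lambda>t. u (x + t *\<^sub>R axis i 1)) 0) \<le> B * norm (h - 0)"
  proof (rule differentiable_bound[of UNIV])
    fix t :: real
    show "((\<lambda>t. u (x + t *\<^sub>R axis i 1)) has_derivative (\<lambda>h. h *\<^sub>R partial_deriv i u (x + t *\<^sub>R axis i 1))) (at t within UNIV)"
      using C1_has_vector_derivative_line[OF assms(1), of x i t] by (simp add: has_vector_derivative_def)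
    show "onorm (\<lambda>h. h *\<^sub>R partial_deriv i u (x + t *\<^sub>R axis i 1)) \<le> B"
      by (rule onorm_le) (simp add: mult.commute[of B] mult_left_mono assms(2))
  qed auto
  then show ?thesis by simp
qed

lemma has_vector_derivative_difference_quotient:
  assumes "(f has_vector_derivative v) (at 0)"
  shows "((\<lambda>t. (f t - f 0) /\<^sub>R t) \<longlongrightarrow> v) (at 0)"
proof -
  have lim: "((\<lambda>h. norm (f h - f 0 - h *\<^sub>R v) / norm h) \<longlongrightarrow> 0) (at 0)"
    using assms by (simp add: has_vector_derivative_def has_derivative_at)
  have quot: "norm (f h - f 0 - h *\<^sub>R v) / norm h = norm ((f h - f 0) /\<^sub>R h - v)" if "h \<noteq> 0" for h
  proof -
    have "(f h - f 0) /\<^sub>R h - v = (f h - f 0 - h *\<^sub>R v) /\<^sub>R h"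
      using that by (simp add: algebra_simps)
    then show ?thesis by (simp add: divide_inverse mult.commute)
  qed
  from lim have "((\<lambda>h. norm ((f h - f 0) /\<^sub>R h - v)) \<longlongrightarrow> 0) (at 0)"
    by (elim Lim_transform_eventually) (simp add: eventually_at_filter quot[unfolded real_norm_def])
  then show ?thesis
    using LIM_zero_cancel tendsto_norm_zero_iff by blast
qed

text \<open>
  Difference quotients have integral zero, because the integral is invariant under translations, and
  they converge boundedly to the partial derivative, with supports in a fixed compact set.
\<close>

lemma integral_partial_deriv_eq_0:
  fixes u :: "real^'n \<Rightarrow> 'b::euclidean_space"
  assumes "u \<in> C1_compact UNIV"
  shows "integral\<^sup>L lebesgue (partial_deriv i u) = 0"
proof -
  obtain K where u: "C1 u" "compact K" "\<And>x. x \<notin> K \<Longrightarrow> u x = 0"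
    using assms unfolding C1_compact_iff by blast
  obtain B where B: "\<And>x. norm (partial_deriv i u x) \<le> B"
    using C1_compact_partial(3)[OF assms] by blast
  then have "0 \<le> B" by (meson norm_ge_zero order_trans)
  define K' where "K' = {x + y | x y. x \<in> K \<and> y \<in> cball (0 :: real^'n) 1}"
  have K': "compact K'"
    unfolding K'_def by (rule compact_sums[OF u(2) compact_cball])
  define D where "D m x = real (Suc m) *\<^sub>R (u (x + (1 / real (Suc m)) *\<^sub>R axis i 1) - u x)" for m x
  have D_cont: "continuous_on UNIV (D m)" for m
    unfolding D_def
    by (intro continuous_intros continuous_on_compose2[OF C1_continuous[OF u(1)]]) auto
  have int_u: "integrable lebesgue u" "integrable lebesgue (\<lambda>x. u (c + x))" for c
  proof -
    show "integrable lebesgue u" by (rule C1_compact_function(2)[OF assms])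
    show "integrable lebesgue (\<lambda>x. u (c + x))"
    proof (rule compact_support_integrable(1))
      show "continuous_on UNIV (\<lambda>x. u (c + x))"
        by (intro continuous_intros continuous_on_compose2[OF C1_continuous[OF u(1)]]) auto
      show "compact ((\<lambda>x. x - c) ` K)"
        by (intro compact_continuous_image continuous_intros u(2))
      show "u (c + x) = 0" if "x \<notin> (\<lambda>x. x - c) ` K" for x
        using that by (intro u(3)) (auto simp: image_iff dest!: bspec[of _ _ "c + x"])
    qed
  qed
  have "integral\<^sup>L lebesgue (D m) = 0" for m
    unfolding D_def
    using int_u(1) int_u(2)[of "(1 / real (Suc m)) *\<^sub>R axis i 1"]
      integral_translate_lebesgue[OF C1_continuous[OF u(1)], of "(1 / real (Suc m)) *\<^sub>R axis i 1"]
    by (simp add: add.commute[of _ "_ *\<^sub>R axis i 1"])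
  moreover have "(\<lambda>m. integral\<^sup>L lebesgue (D m)) \<longlonglongrightarrow> integral\<^sup>L lebesgue (partial_deriv i u)"
  proof (rule integral_dominated_convergence[where w = "\<lambda>x. indicator K' x * B"])
    show "partial_deriv i u \<in> borel_measurable lebesgue"
      by (intro borel_measurable_lebesgue_continuous C1_continuous_partial u(1))
    show "D m \<in> borel_measurable lebesgue" for m
      by (intro borel_measurable_lebesgue_continuous D_cont)
    show "integrable lebesgue (\<lambda>x. indicator K' x * B)"
      using lmeasurable_compact[OF K'] by (simp add: lmeasurable_iff_integrable)
    show "AE x in lebesgue. (\<lambda>m. D m x) \<longlonglongrightarrow> partial_deriv i u x"
    proof (rule AE_I2)
      fix x
      have "((\<lambda>t. (u (x + t *\<^sub>R axis i 1) - u x) /\<^sub>R t) \<longlongrightarrow> partial_deriv i u x) (at 0)"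
        using has_vector_derivative_difference_quotient[OF C1_has_vector_derivative_line[OF u(1), of x i 0]]
        by simp
      moreover have "filterlim (\<lambda>m. 1 / real (Suc m)) (at 0) sequentially"
        unfolding filterlim_at using LIMSEQ_inverse_real_of_nat by (simp add: inverse_eq_divide)
      ultimately have "(\<lambda>m. (u (x + (1 / real (Suc m)) *\<^sub>R axis i 1) - u x) /\<^sub>R (1 / real (Suc m)))
          \<longlonglongrightarrow> partial_deriv i u x"
        by (rule filterlim_compose)
      then show "(\<lambda>m. D m x) \<longlonglongrightarrow> partial_deriv i u x"
        by (simp add: D_def)
    qed
    show "AE x in lebesgue. norm (D m x) \<le> indicator K' x * B" for m
    proof (rule AE_I2)
      fix x
      let ?h = "(1 / real (Suc m)) *\<^sub>R axis i 1 :: real^'n"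
      show "norm (D m x) \<le> indicator K' x * B"
      proof (cases "x \<in> K'")
        case True
        have "norm (D m x) \<le> real (Suc m) * (B * \<bar>1 / real (Suc m)\<bar>)"
          unfolding D_def norm_scaleR abs_of_nat
          by (intro mult_left_mono C1_difference_bound[OF u(1) B]) simp
        with True show ?thesis by simp
      next
        case False
        have small: "norm ?h \<le> 1" by (simp add: divide_simps)
        have "x \<notin> K"
          using False unfolding K'_def by (force dest: spec[of _ x] spec[of _ 0])
        moreover have "x + ?h \<notin> K"
        proof
          assume "x + ?h \<in> K"
          moreover have "x = (x + ?h) + (- ?h)" "- ?h \<in> cball 0 1" using small by (auto simp: dist_norm)
          ultimately show False using False unfolding K'_def by blast
        qed
        ultimately show ?thesis using False u(3) by (simp add: D_def)
      qed
    qed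
  qed
  ultimately show ?thesis
    by (simp add: LIMSEQ_const_iff)
qed

lemma partial_deriv_compose_real:
  fixes g g' :: "real \<Rightarrow> real"
  assumes "C1 u" "\<And>t. (g has_real_derivative g' t) (at t)" "continuous_on UNIV g'"
  shows "partial_deriv i (\<lambda>x. g (u x)) x = g' (u x) * partial_deriv i u x" and "C1 (\<lambda>x. g (u x))"
proof -
  have deriv: "((\<lambda>x. g (u x)) has_derivative (\<lambda>h. g' (u x) * frechet_derivative u (at x) h)) (at x)" for x
    by (rule has_derivative_compose[OF C1_has_derivative[OF assms(1)]])
       (use assms(2) in \<open>simp add: has_field_derivative_def\<close>)
  show eq: "partial_deriv i (\<lambda>x. g (u x)) x = g' (u x) * partial_deriv i u x" for i x
    using partial_deriv_eqI[OF deriv, of i x] by (simp add: partial_deriv_def)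
  show "C1 (\<lambda>x. g (u x))"
    unfolding C1_def
  proof (intro conjI allI)
    show "(\<lambda>x. g (u x)) differentiable at x" for x
      using deriv by (auto simp: differentiable_def)
    show "continuous_on UNIV (partial_deriv i (\<lambda>x. g (u x)))" for i
      unfolding eq[abs_def]
      by (intro continuous_intros C1_continuous_partial continuous_on_compose2[OF assms(3)]
          C1_continuous assms(1)) auto
  qed
qed

lemma C1_mult:
  fixes u v :: "real^'n \<Rightarrow> real"
  assumes "C1 u" "C1 v"
  shows "C1 (\<lambda>x. u x * v x)"
  using partial_deriv_mult(2)[OF assms] by simp

lemma C1_prod:
  fixes u :: "'i \<Rightarrow> real^'n \<Rightarrow> real"
  assumes "\<And>j. j \<in> J \<Longrightarrow> C1 (u j)"
  shows "C1 (\<lambda>x. \<Prod>j\<in>J. u j x)"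
  using assms
proof (induction J rule: infinite_finite_induct)
  case (insert j J)
  then show ?case using C1_mult[of "u j" "\<lambda>x. \<Prod>j\<in>J. u j x"] by simp
qed (auto intro!: C1_I[where u' = "\<lambda>x h. 0"])

lemma C1_affine: "C1 (\<lambda>x :: real^'n. c + g \<bullet> x)"
  by (rule C1_I[where u' = "\<lambda>x h. g \<bullet> h"]) (auto intro!: derivative_eq_intros)

lemma has_real_derivative_power_pos:
  "((\<lambda>t. (max 0 t) ^ Suc (Suc n)) has_real_derivative real (Suc (Suc n)) * (max 0 t) ^ Suc n) (at t)"
proof -
  consider "t < 0" | "t > 0" | "t = 0" by linarith
  then show ?thesis
  proof cases
    case 1
    have "((\<lambda>t. 0) has_real_derivative 0) (at t)" by simp
    then have "((\<lambda>t. (max 0 t) ^ Suc (Suc n)) has_real_derivative 0) (at t)"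
      by (rule has_field_derivative_transform_within_open[where S = "{..<0}"]) (use 1 in auto)
    with 1 show ?thesis by simp
  next
    case 2
    have "((\<lambda>t. t ^ Suc (Suc n)) has_real_derivative real (Suc (Suc n)) * t ^ Suc n) (at t)"
      using DERIV_pow[of "Suc (Suc n)" t] by simp
    then have "((\<lambda>t. (max 0 t) ^ Suc (Suc n)) has_real_derivative real (Suc (Suc n)) * t ^ Suc n) (at t)"
      by (rule has_field_derivative_transform_within_open[where S = "{0<..}"]) (use 2 in auto)
    with 2 show ?thesis by (simp add: max_absorb2)
  next
    case 3
    have "((\<lambda>h. (max 0 (h::real)) ^ Suc (Suc n) / h) \<longlongrightarrow> 0) (at 0)"
    proof (rule Lim_null_comparison)
      have "norm ((max 0 h) ^ Suc (Suc n) / h) \<le> \<bar>h\<bar> ^ Suc n" for h :: real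
      proof (cases "h \<le> 0")
        case True
        then have "(max 0 h) ^ Suc (Suc n) / h = 0" by (simp add: max_absorb1)
        then show ?thesis by (metis abs_ge_zero norm_zero zero_le_power)
      qed (simp add: max_absorb2)
      then show "\<forall>\<^sub>F h in at 0. norm ((max 0 (h::real)) ^ Suc (Suc n) / h) \<le> \<bar>h\<bar> ^ Suc n"
        by (rule always_eventually[OF allI])
      have "((\<lambda>h::real. \<bar>h\<bar> ^ Suc n) \<longlongrightarrow> \<bar>0\<bar> ^ Suc n) (at 0)"
        by (intro tendsto_intros)
      then show "((\<lambda>h::real. \<bar>h\<bar> ^ Suc n) \<longlongrightarrow> 0) (at 0)" by simp
    qed
    with 3 show ?thesis by (simp add: DERIV_def)
  qed
qed

lemma has_real_derivative_square_pos:
  "((\<lambda>t. (max 0 t)\<^sup>2) has_real_derivative 2 * max 0 t) (at t)"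
  using has_real_derivative_power_pos[of 0 t] by (simp add: numeral_2_eq_2)

subsection \<open>The fundamental lemma of the calculus of variations\<close>

text \<open>
  A nonnegative function of class \<open>C\<^sup>1\<close> that is positive exactly on the open box.
\<close>

definition box_bump :: "real^'n \<Rightarrow> real^'n \<Rightarrow> real^'n \<Rightarrow> real" where
  "box_bump a b x = (\<Prod>j\<in>UNIV. (max 0 (x $ j - a $ j))\<^sup>2 * (max 0 (b $ j - x $ j))\<^sup>2)"

lemma C1_box_bump: "C1 (box_bump a b)"
  unfolding box_bump_def
proof (intro C1_prod C1_mult)
  fix j
  have "continuous_on UNIV (\<lambda>t::real. 2 * max 0 t)" by (intro continuous_intros)
  note C = partial_deriv_compose_real(2)[OF _ has_real_derivative_square_pos this]
  show "C1 (\<lambda>x. (max 0 (x $ j - a $ j))\<^sup>2)"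
    using C[OF C1_affine[of "- a $ j" "axis j 1"]] by (simp add: inner_axis')
  show "C1 (\<lambda>x. (max 0 (b $ j - x $ j))\<^sup>2)"
    using C[OF C1_affine[of "b $ j" "- axis j 1"]] by (simp add: inner_axis')
qed

lemma box_bump_eq_0_iff: "box_bump a b x = 0 \<longleftrightarrow> x \<notin> box a b"
proof -
  have "(max 0 p)\<^sup>2 * (max 0 q)\<^sup>2 = 0 \<longleftrightarrow> \<not> (0 < p \<and> 0 < q)" for p q :: real
    by (auto simp: max_def)
  then show ?thesis by (simp add: box_bump_def mem_box_cart del: mult_eq_0_iff)
qed

lemma locally_integrable_scaleR:
  fixes v :: "real^'n \<Rightarrow> 'b::euclidean_space" and \<phi> :: "real^'n \<Rightarrow> real"
  assumes "locally_integrable lebesgue \<Omega> v" "continuous_on UNIV \<phi>" "compact K" "K \<subseteq> \<Omega>"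
    "\<And>x. x \<notin> K \<Longrightarrow> \<phi> x = 0"
  shows "set_integrable lebesgue \<Omega> (\<lambda>x. \<phi> x *\<^sub>R v x)"
proof -
  obtain B where B: "\<And>x. norm (\<phi> x) \<le> B"
    using compact_support_integrable(2)[OF assms(2,3,5)] by blast
  have v: "integrable lebesgue (\<lambda>x. indicator K x *\<^sub>R v x)"
    using assms(1,3,4) by (simp add: locally_integrable_def set_integrable_def)
  have eq: "(\<lambda>x. indicator \<Omega> x *\<^sub>R \<phi> x *\<^sub>R v x) = (\<lambda>x. \<phi> x *\<^sub>R indicator K x *\<^sub>R v x)"
    using assms(4,5) by (auto simp: fun_eq_iff indicator_def)
  show ?thesis
    unfolding set_integrable_def eq
  proof (rule Bochner_Integration.integrable_bound)
    show "integrable lebesgue (\<lambda>x. B * norm (indicator K x *\<^sub>R v x))"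
      using v by (intro integrable_mult_right integrable_norm)
    show "(\<lambda>x. \<phi> x *\<^sub>R indicator K x *\<^sub>R v x) \<in> borel_measurable lebesgue"
      using borel_measurable_integrable[OF v] borel_measurable_lebesgue_continuous[OF assms(2)]
      by (rule borel_measurable_scaleR[rotated])
    have "norm (\<phi> x *\<^sub>R indicator K x *\<^sub>R v x) \<le> norm (B * norm (indicator K x *\<^sub>R v x))" for x
      using B[of x] by (auto simp: indicator_def mult_right_mono abs_mult intro: order_trans[OF _ abs_ge_self])
    then show "AE x in lebesgue. norm (\<phi> x *\<^sub>R indicator K x *\<^sub>R v x) \<le> norm (B * norm (indicator K x *\<^sub>R v x))"
      by simp
  qed
qed

text \<open>
  With the bump function \<open>P\<close> of the box, the test functions \<open>P\<^sup>2 / (1 / m + P\<^sup>2)\<close> converge to the indicator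
  function of the open box.
\<close>

lemma test_integral_zero_imp_box_integral_zero:
  fixes w :: "real^'n \<Rightarrow> 'b::euclidean_space"
  assumes w: "locally_integrable lebesgue \<Omega> w" and sub: "cbox a b \<subseteq> \<Omega>"
    and zero: "\<And>\<phi> :: real^'n \<Rightarrow> real. \<phi> \<in> C1_compact \<Omega> \<Longrightarrow> (LINT x:\<Omega>|lebesgue. \<phi> x *\<^sub>R w x) = 0"
  shows "(LINT x:box a b|lebesgue. w x) = 0"
proof -
  define g where "g e t = t\<^sup>2 / (e + t\<^sup>2)" for e t :: real
  define \<phi> where "\<phi> m x = g (1 / real (Suc m)) (box_bump a b x)" for m x
  have C1: "C1 (\<phi> m)" for m
  proof -
    define e where "e = 1 / real (Suc m)"
    have pos: "e + t\<^sup>2 > 0" for t :: real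
      by (simp add: e_def add_pos_nonneg)
    have deriv: "(g e has_real_derivative (2 * t * (e + t\<^sup>2) - t\<^sup>2 * (2 * t)) / (e + t\<^sup>2)\<^sup>2) (at t)" for t
      unfolding g_def using pos[of t]
      by (auto intro!: derivative_eq_intros simp: power2_eq_square)
    have "continuous_on UNIV (\<lambda>t. (2 * t * (e + t\<^sup>2) - t\<^sup>2 * (2 * t)) / (e + t\<^sup>2)\<^sup>2)"
      using pos by (intro continuous_intros) (simp add: less_imp_neq[THEN not_sym])
    from partial_deriv_compose_real(2)[OF C1_box_bump deriv this] show ?thesis
      unfolding \<phi>_def e_def .
  qed
  have out: "\<phi> m x = 0" if "x \<notin> box a b" for m x
    using that by (simp add: \<phi>_def g_def box_bump_eq_0_iff[THEN iffD2])
  then have out': "\<phi> m x = 0" if "x \<notin> cbox a b" for m x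
    using that box_subset_cbox[of a b] by blast
  have "\<phi> m \<in> C1_compact \<Omega>" for m
    unfolding C1_compact_iff using C1 out' sub by (auto intro!: exI[of _ "cbox a b"])
  from zero[OF this] have 0: "(LINT x|lebesgue. indicator (cbox a b) x *\<^sub>R \<phi> m x *\<^sub>R w x) = 0" for m
  proof -
    have "(\<lambda>x. indicator (cbox a b) x *\<^sub>R \<phi> m x *\<^sub>R w x) = (\<lambda>x. indicator \<Omega> x *\<^sub>R \<phi> m x *\<^sub>R w x)"
      using sub out'[of _ m] by (auto simp: fun_eq_iff indicator_def)
    with zero[OF \<open>\<phi> m \<in> C1_compact \<Omega>\<close>] show ?thesis by (simp add: set_lebesgue_integral_def)
  qed
  have int: "integrable lebesgue (\<lambda>x. indicator (cbox a b) x *\<^sub>R w x)"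
    using w sub by (simp add: locally_integrable_def set_integrable_def)
  then have int': "integrable lebesgue (\<lambda>x. indicator (box a b) x *\<^sub>R w x)"
    using set_integrable_subset[of lebesgue "cbox a b" w "box a b"] box_subset_cbox[of a b]
    by (simp add: set_integrable_def)
  have bound: "0 \<le> \<phi> m x \<and> \<phi> m x \<le> 1" for m x
    by (simp add: \<phi>_def g_def divide_simps add_pos_nonneg)
  have "(\<lambda>m. LINT x|lebesgue. indicator (cbox a b) x *\<^sub>R \<phi> m x *\<^sub>R w x)
      \<longlonglongrightarrow> (LINT x|lebesgue. indicator (box a b) x *\<^sub>R w x)"
  proof (rule integral_dominated_convergence[where w = "\<lambda>x. norm (indicator (cbox a b) x *\<^sub>R w x)"])
    show "(\<lambda>x. indicator (box a b) x *\<^sub>R w x) \<in> borel_measurable lebesgue"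
      using int' by (rule borel_measurable_integrable)
    show "(\<lambda>x. indicator (cbox a b) x *\<^sub>R \<phi> m x *\<^sub>R w x) \<in> borel_measurable lebesgue" for m
      using borel_measurable_scaleR[OF borel_measurable_lebesgue_continuous[OF C1_continuous[OF C1[of m]]]
          borel_measurable_integrable[OF int]] by (simp add: mult.commute)
    show "integrable lebesgue (\<lambda>x. norm (indicator (cbox a b) x *\<^sub>R w x))"
      by (intro integrable_norm int)
    show "AE x in lebesgue. (\<lambda>m. indicator (cbox a b) x *\<^sub>R \<phi> m x *\<^sub>R w x) \<longlonglongrightarrow> indicator (box a b) x *\<^sub>R w x"
    proof (rule AE_I2)
      fix x
      show "(\<lambda>m. indicator (cbox a b) x *\<^sub>R \<phi> m x *\<^sub>R w x) \<longlonglongrightarrow> indicator (box a b) x *\<^sub>R w x"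
      proof (cases "x \<in> box a b")
        case True
        then have nz: "box_bump a b x \<noteq> 0" by (simp add: box_bump_eq_0_iff)
        have "(\<lambda>m. 1 / real (Suc m)) \<longlonglongrightarrow> 0"
          using LIMSEQ_inverse_real_of_nat by (simp add: inverse_eq_divide)
        then have "(\<lambda>m. (box_bump a b x)\<^sup>2 / (1 / real (Suc m) + (box_bump a b x)\<^sup>2)) \<longlonglongrightarrow>
            (box_bump a b x)\<^sup>2 / (0 + (box_bump a b x)\<^sup>2)"
          using nz by (intro tendsto_intros) auto
        then have "(\<lambda>m. \<phi> m x) \<longlonglongrightarrow> 1"
          using nz by (simp add: \<phi>_def g_def)
        then have "(\<lambda>m. \<phi> m x *\<^sub>R w x) \<longlonglongrightarrow> 1 *\<^sub>R w x"
          by (intro tendsto_intros)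
        with True box_subset_cbox[of a b] show ?thesis by auto
      qed (simp add: out)
    qed
    show "AE x in lebesgue. norm (indicator (cbox a b) x *\<^sub>R \<phi> m x *\<^sub>R w x)
        \<le> norm (indicator (cbox a b) x *\<^sub>R w x)" for m
      using bound[of m] by (intro AE_I2) (auto simp: indicator_def mult_left_le_one_le)
  qed
  with 0 show ?thesis
    by (simp add: LIMSEQ_const_iff set_lebesgue_integral_def)
qed

lemma sigma_finite_measure_lebesgue: "sigma_finite_measure (lebesgue :: 'a::euclidean_space measure)"
proof
  obtain A :: "'a set set" where "countable A" "A \<subseteq> sets lborel" "\<Union>A = space lborel"
    "\<forall>a\<in>A. emeasure lborel a \<noteq> \<infinity>"
    using lborel.sigma_finite_countable by blast
  then show "\<exists>A :: 'a set set. countable A \<and> A \<subseteq> sets lebesgue \<and> \<Union>A = space lebesgue \<and>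
      (\<forall>a\<in>A. emeasure lebesgue a \<noteq> \<infinity>)"
    by (intro exI[of _ A]) (auto simp: subset_iff)
qed

text \<open>
  The Borel sets over which \<open>W\<close> has integral zero form a Dynkin system that contains all boxes; so these
  are all Borel sets.
\<close>

lemma box_integrals_zero_imp_AE_zero:
  fixes W :: "'a::euclidean_space \<Rightarrow> 'b::euclidean_space"
  assumes int: "integrable lebesgue W" and tot: "integral\<^sup>L lebesgue W = 0"
    and box: "\<And>a b. (LINT x:box a b|lebesgue. W x) = 0"
  shows "AE x in lebesgue. W x = 0"
proof -
  let ?G = "range (\<lambda>(a, b). box a b :: 'a set)"
  have set_int: "set_integrable lebesgue A W" if "A \<in> sets lebesgue" for A
    using integrable_mult_indicator[OF that int] by (simp add: set_integrable_def)
  have borel: "(LINT x:A|lebesgue. W x) = 0" if "A \<in> sets borel" for A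
  proof -
    have sub: "sigma_sets UNIV ?G \<subseteq> sets lebesgue"
      using sets_completionI_sets[of _ lborel] by (auto simp: borel_eq_box)
    have stable: "Int_stable ?G"
      by (auto simp: Int_stable_def box_Int_box)
    have closed: "?G \<subseteq> Pow UNIV" by simp
    have "A \<in> sigma_sets UNIV ?G"
      using that by (simp add: borel_eq_box)
    from stable closed this show ?thesis
    proof (induction A rule: sigma_sets_induct_disjoint)
      case (compl A)
      have "(LINT x:UNIV - A|lebesgue. W x) + (LINT x:A|lebesgue. W x) = (LINT x:(UNIV - A) \<union> A|lebesgue. W x)"
        using compl sub by (intro set_integral_Un[symmetric] set_int) auto
      with compl tot show ?case by (simp add: set_lebesgue_integral_def)
    next
      case (union A)
      have "(LINT x:(\<Union>i. A i)|lebesgue. W x) = suminf (\<lambda>i. LINT x:A i|lebesgue. W x)"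
      proof (intro lebesgue_integral_countable_add set_int)
        show A: "A i \<in> sets lebesgue" for i using union(2) sub by blast
        show "(\<Union>i. A i) \<in> sets lebesgue" using A by blast
        show "i \<noteq> j \<Longrightarrow> A i \<inter> A j = {}" for i j
          using union(1) by (auto simp: disjoint_family_on_def)
      qed
      with union show ?case by simp
    next
      case (basic A)
      then show ?case using box by auto
    qed (simp add: set_lebesgue_integral_def)
  qed
  show ?thesis
  proof (rule sigma_finite_measure.density_unique_banach[OF sigma_finite_measure_lebesgue int])
    show "integrable lebesgue (\<lambda>x. 0 :: 'b)" by simp
    fix A :: "'a set" assume A: "A \<in> sets lebesgue"
    then obtain B N where BN: "B \<in> sets borel" "negligible N" "B \<union> N = A"
      by (rule sets_lebesgue_almost_borel)
    have "(LINT x:A|lebesgue. W x) = (LINT x:B|lebesgue. W x)"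
    proof (rule set_integral_cong_set)
      have "AE x in lebesgue. x \<notin> N"
        using BN(2) by (simp add: AE_not_in negligible_iff_null_sets)
      then show "AE x in lebesgue. (x \<in> B) = (x \<in> A)"
        using BN(3) by (elim AE_mp) auto
    next
      show "set_borel_measurable lebesgue A W" "set_borel_measurable lebesgue B W"
        using set_int A BN(1) by (auto simp: set_integrable_def set_borel_measurable_def intro: borel_measurable_integrable)
    qed
    then show "(LINT x:A|lebesgue. W x) = (LINT x:A|lebesgue. 0)"
      using borel[OF BN(1)] by (simp add: set_lebesgue_integral_def)
  qed
qed

text \<open>
  The set \<open>\<Omega>\<close> is a countable union of open boxes whose closures lie in \<open>\<Omega>\<close>, and there \<open>w\<close> is integrable.
\<close>

lemma test_integrals_zero_imp_AE_zero:
  fixes w :: "real^'n \<Rightarrow> 'b::euclidean_space"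
  assumes "open \<Omega>" "locally_integrable lebesgue \<Omega> w"
    and "\<And>\<phi> :: real^'n \<Rightarrow> real. \<phi> \<in> C1_compact \<Omega> \<Longrightarrow> (LINT x:\<Omega>|lebesgue. \<phi> x *\<^sub>R w x) = 0"
  shows "AE x in lebesgue. x \<in> \<Omega> \<longrightarrow> w x = 0"
proof -
  have box: "AE x in lebesgue. x \<in> box c d \<longrightarrow> w x = 0" if sub: "cbox c d \<subseteq> \<Omega>" for c d
  proof -
    note box0 = test_integral_zero_imp_box_integral_zero[OF assms(2) _ assms(3)]
    have "set_integrable lebesgue (cbox c d) w"
      using assms(2) sub by (simp add: locally_integrable_def)
    then have "set_integrable lebesgue (box c d) w"
      by (rule set_integrable_subset) (auto simp: box_subset_cbox)
    then have "integrable lebesgue (\<lambda>x. indicator (box c d) x *\<^sub>R w x)"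
      by (simp add: set_integrable_def)
    then have "AE x in lebesgue. indicator (box c d) x *\<^sub>R w x = 0"
    proof (rule box_integrals_zero_imp_AE_zero)
      show "(LINT x|lebesgue. indicator (box c d) x *\<^sub>R w x) = 0"
        using box0[OF sub] by (simp add: set_lebesgue_integral_def)
      fix a b
      obtain a' b' where ab: "box a b \<inter> box c d = box a' b'"
        by (simp add: box_Int_box)
      have "(LINT x:box a b|lebesgue. indicator (box c d) x *\<^sub>R w x) = (LINT x:box a' b'|lebesgue. w x)"
        unfolding set_lebesgue_integral_def ab[symmetric]
        by (rule Bochner_Integration.integral_cong) (auto simp: indicator_def)
      also have "\<dots> = 0"
      proof (cases "box a' b' = {}")
        case False
        have "box c d \<noteq> {}" using False ab by auto
        then have "cbox a' b' \<subseteq> cbox c d"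
          using closure_mono[of "box a' b'" "box c d"] False ab by auto
        with sub show ?thesis by (intro box0) auto
      qed (simp add: set_lebesgue_integral_def)
      finally show "(LINT x:box a b|lebesgue. indicator (box c d) x *\<^sub>R w x) = 0" .
    qed
    then show ?thesis by (elim AE_mp) (auto simp: indicator_def)
  qed
  define \<F> where "\<F> = {box c d | c d. cbox c d \<subseteq> \<Omega>}"
  have "\<Union>\<F> = \<Omega>"
  proof
    show "\<Union>\<F> \<subseteq> \<Omega>" using box_subset_cbox by (fastforce simp: \<F>_def)
    show "\<Omega> \<subseteq> \<Union>\<F>"
    proof
      fix x assume "x \<in> \<Omega>"
      then obtain c d where "x \<in> box c d" "cbox c d \<subseteq> \<Omega>"
        using assms(1) open_contains_cbox by metis
      then show "x \<in> \<Union>\<F>" by (auto simp: \<F>_def)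
    qed
  qed
  moreover obtain \<F>' where F': "\<F>' \<subseteq> \<F>" "countable \<F>'" "\<Union>\<F>' = \<Union>\<F>"
    by (rule Lindelof[of \<F>]) (auto simp: \<F>_def)
  have "AE x in lebesgue. \<forall>S\<in>\<F>'. x \<in> S \<longrightarrow> w x = 0"
  proof (rule AE_ball_countable'[OF _ F'(2)])
    fix S assume "S \<in> \<F>'"
    then obtain c d where "S = box c d" "cbox c d \<subseteq> \<Omega>"
      using F'(1) by (auto simp: \<F>_def)
    then show "AE x in lebesgue. x \<in> S \<longrightarrow> w x = 0" using box by simp
  qed
  ultimately show ?thesis
    using F'(3) by (elim AE_mp) (intro AE_I2, blast)
qed

subsection \<open>Weak derivatives\<close>

lemma weak_deriv_unique:
  fixes v v' :: "real^'n \<Rightarrow> 'b::euclidean_space"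
  assumes "open \<Omega>" "is_weak_deriv \<Omega> i u v" "is_weak_deriv \<Omega> i u v'"
  shows "AE x in lebesgue. x \<in> \<Omega> \<longrightarrow> v x = v' x"
proof -
  have loc: "locally_integrable lebesgue \<Omega> v" "locally_integrable lebesgue \<Omega> v'"
    using assms by (auto simp: is_weak_deriv_def)
  have "AE x in lebesgue. x \<in> \<Omega> \<longrightarrow> v x - v' x = 0"
  proof (rule test_integrals_zero_imp_AE_zero[OF assms(1)])
    show "locally_integrable lebesgue \<Omega> (\<lambda>x. v x - v' x)"
      using loc by (auto simp: locally_integrable_def)
    fix \<phi> :: "real^'n \<Rightarrow> real" assume \<phi>: "\<phi> \<in> C1_compact \<Omega>"
    then obtain K where K: "C1 \<phi>" "compact K" "K \<subseteq> \<Omega>" "\<And>x. x \<notin> K \<Longrightarrow> \<phi> x = 0"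
      unfolding C1_compact_iff by blast
    note int = locally_integrable_scaleR[OF _ C1_continuous[OF K(1)] K(2-4)]
    have "(LINT x:\<Omega>|lebesgue. \<phi> x *\<^sub>R v x) = (LINT x:\<Omega>|lebesgue. \<phi> x *\<^sub>R v' x)"
    proof -
      have "(LINT x:\<Omega>|lebesgue. partial_deriv i \<phi> x *\<^sub>R u x) = - (LINT x:\<Omega>|lebesgue. \<phi> x *\<^sub>R v x)"
        using assms(2) \<phi> unfolding is_weak_deriv_def by blast
      moreover have "(LINT x:\<Omega>|lebesgue. partial_deriv i \<phi> x *\<^sub>R u x) = - (LINT x:\<Omega>|lebesgue. \<phi> x *\<^sub>R v' x)"
        using assms(3) \<phi> unfolding is_weak_deriv_def by blast
      ultimately show ?thesis by simp
    qed
    then show "(LINT x:\<Omega>|lebesgue. \<phi> x *\<^sub>R (v x - v' x)) = 0"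
      using set_integral_diff(2)[OF int[OF loc(1)] int[OF loc(2)]] by (simp add: scaleR_diff_right)
  qed
  then show ?thesis by (elim AE_mp) auto
qed

text \<open>
  The constant \<open>weak_deriv\<close> denotes an unspecified representative; under an integral, it can be replaced
  by any known weak derivative.
\<close>

lemma weak_deriv_AE_eq:
  fixes v :: "real^'n \<Rightarrow> 'b::euclidean_space"
  assumes "open \<Omega>" "is_weak_deriv \<Omega> i u v"
  shows "AE x in lebesgue. x \<in> \<Omega> \<longrightarrow> weak_deriv \<Omega> i u x = v x"
  using weak_deriv_unique[OF assms(1) _ assms(2)] someI[of "is_weak_deriv \<Omega> i u" v] assms(2)
  by (simp add: weak_deriv_def)

section \<open>Mollification\<close>

definition convolution :: "(real^'n \<Rightarrow> real) \<Rightarrow> (real^'n \<Rightarrow> real) \<Rightarrow> real^'n \<Rightarrow> real" where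
  "convolution K g x = (LINT y|lebesgue. K (x - y) * g y)"

text \<open>
  Derivatives can thus be moved to either factor: to the kernel for regularity, and to the function for
  convergence.
\<close>

lemma convolution_commute:
  fixes K g :: "real^'n \<Rightarrow> real"
  assumes "continuous_on UNIV K" "continuous_on UNIV g"
  shows "convolution K g = convolution g K"
proof (rule ext)
  fix x :: "real^'n"
  have meas: "(\<lambda>y. K (x - y) * g y) \<in> borel_measurable borel" "(\<lambda>y. g (x - y) * K y) \<in> borel_measurable borel"
    by (intro borel_measurable_continuous_onI continuous_intros continuous_on_compose2[OF assms(1)]
        continuous_on_compose2[OF assms(2)]; auto)+
  have "distr lborel borel (\<lambda>y. x + (- 1) *\<^sub>R y) = lborel"
    using lborel_affine[of "- 1" x] by (simp add: density_1)
  then have "(LINT y|lborel. K (x - y) * g y) = (LINT y|distr lborel borel (\<lambda>y. x + (- 1) *\<^sub>R y). K (x - y) * g y)"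
    by simp
  also have "\<dots> = (LINT y|lborel. g (x - y) * K y)"
    by (subst integral_distr) (use meas in \<open>auto simp: mult.commute\<close>)
  finally show "convolution K g x = convolution g K x"
    using meas by (simp add: convolution_def integral_completion)
qed

text \<open>
  Differentiation under the integral sign over a box that contains the support of \<open>g\<close>.
\<close>

lemma convolution_C1:
  fixes K g :: "real^'n \<Rightarrow> real"
  assumes K: "C1 K" and g: "continuous_on UNIV g" and C: "compact C" "\<And>x. x \<notin> C \<Longrightarrow> g x = 0"
  shows "C1 (convolution K g)" and "partial_deriv i (convolution K g) = convolution (partial_deriv i K) g"
proof -
  obtain a where a: "C \<subseteq> cbox (- a) a"
    using bounded_subset_cbox_symmetric[OF compact_imp_bounded[OF C(1)]] by blast
  have cont2: "continuous_on S (\<lambda>(x, y). K' (x - y) * g y)" if "continuous_on UNIV K'" for K' S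
    unfolding split_beta
    by (intro continuous_intros continuous_on_compose2[OF that] continuous_on_compose2[OF g]) auto
  have cont1: "continuous_on S (\<lambda>y. K' (x - y) * g y)" if "continuous_on UNIV K'" for K' S x
    by (intro continuous_intros continuous_on_compose2[OF that] continuous_on_subset[OF g]) auto
  have conv_eq: "convolution K' g x = integral (cbox (- a) a) (\<lambda>y. K' (x - y) * g y)"
    if "continuous_on UNIV K'" for K' x
  proof -
    have eq: "(\<lambda>y. indicator (cbox (- a) a) y *\<^sub>R (K' (x - y) * g y)) = (\<lambda>y. K' (x - y) * g y)"
      using a C(2) by (auto simp: fun_eq_iff indicator_def)
    have "integrable lebesgue (\<lambda>y. K' (x - y) * g y)"
      by (rule compact_support_integrable(1)[OF cont1[OF that] C(1)]) (simp add: C(2))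
    then have "set_integrable lebesgue (cbox (- a) a) (\<lambda>y. K' (x - y) * g y)"
      unfolding set_integrable_def eq .
    from set_lebesgue_integral_eq_integral(2)[OF this] show ?thesis
      unfolding set_lebesgue_integral_def eq convolution_def .
  qed
  define D where "D x y = (\<Sum>i\<in>UNIV. (partial_deriv i K (x - y) * g y) *\<^sub>R blinfun_inner_right (axis i 1 :: real^'n))" for x y
  have D_apply: "blinfun_apply (D x y) h = (\<Sum>i\<in>UNIV. partial_deriv i K (x - y) * g y * h $ i)" for x y h
    by (simp add: D_def blinfun.sum_left blinfun.scaleR_left inner_axis')
  have D_cont: "continuous_on S (\<lambda>(x, y). D x y)" for S
    unfolding D_def split_beta
    by (intro continuous_intros continuous_on_compose2[OF C1_continuous_partial[OF K]]
        continuous_on_compose2[OF g]) auto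
  have deriv: "((\<lambda>x. K (x - y) * g y) has_derivative blinfun_apply (D x y)) (at x)" for x y
  proof -
    have "((\<lambda>x. K (x - y) * g y) has_derivative (\<lambda>h. frechet_derivative K (at (x - y)) h * g y)) (at x)"
      by (intro has_derivative_mult_left has_derivative_compose[OF _ C1_has_derivative[OF K], of "\<lambda>x. x - y"])
         (auto intro!: derivative_eq_intros)
    moreover have "frechet_derivative K (at (x - y)) h * g y = blinfun_apply (D x y) h" for h
      by (simp add: D_apply frechet_derivative_expansion[OF K] sum_distrib_left mult_ac)
    ultimately show ?thesis by simp
  qed
  have conv_deriv: "(convolution K g has_derivative blinfun_apply (integral (cbox (- a) a) (D x))) (at x)" for x
    unfolding conv_eq[OF C1_continuous[OF K], abs_def]
    by (rule leibniz_rule[of UNIV, where fx = D])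
       (auto intro!: deriv D_cont integrable_continuous cont1 C1_continuous[OF K])
  have conv_partial: "blinfun_apply (integral (cbox (- a) a) (D x)) (axis i 1) = convolution (partial_deriv i K) g x" for x i
  proof -
    have "continuous_on (cbox (- a) a) (D x)"
      using continuous_on_compose2[OF D_cont[of UNIV], of _ "\<lambda>y. (x, y)"]
      by (simp add: continuous_on_Pair)
    then have "blinfun_apply (integral (cbox (- a) a) (D x)) (axis i 1)
        = integral (cbox (- a) a) (\<lambda>y. blinfun_apply (D x y) (axis i 1))"
      by (intro blinfun_apply_integral integrable_continuous)
    also have "(\<lambda>y. blinfun_apply (D x y) (axis i 1)) = (\<lambda>y. partial_deriv i K (x - y) * g y)"
      by (simp add: D_apply axis_def if_distrib cong: if_cong)
    finally show ?thesis
      by (simp add: conv_eq[OF C1_continuous_partial[OF K]])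
  qed
  show "C1 (convolution K g)"
  proof (rule C1_I[OF conv_deriv])
    fix i
    show "continuous_on UNIV (\<lambda>x. blinfun_apply (integral (cbox (- a) a) (D x)) (axis i 1))"
      unfolding conv_partial conv_eq[OF C1_continuous_partial[OF K]]
      by (rule integral_continuous_on_param) (rule cont2[OF C1_continuous_partial[OF K]])
  qed
  show "partial_deriv i (convolution K g) = convolution (partial_deriv i K) g"
    using partial_deriv_eqI[OF conv_deriv] by (simp add: fun_eq_iff conv_partial)
qed

subsection \<open>A twice continuously differentiable kernel\<close>

lemma has_real_derivative_cube_pos:
  "((\<lambda>t. (max 0 t) ^ 3) has_real_derivative 3 * (max 0 t)\<^sup>2) (at t)"
  using has_real_derivative_power_pos[of 1 t] by (simp add: numeral_3_eq_3 numeral_2_eq_2)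

text \<open>The third power makes the kernel twice continuously differentiable.\<close>

definition bump_kernel :: "real \<Rightarrow> real^'n \<Rightarrow> real" where
  "bump_kernel h z = (max 0 (h\<^sup>2 - z \<bullet> z)) ^ 3"

lemma C1_radius: "C1 (\<lambda>z :: real^'n. h\<^sup>2 - z \<bullet> z)"
  and partial_deriv_radius: "partial_deriv i (\<lambda>z :: real^'n. h\<^sup>2 - z \<bullet> z) z = - 2 * z $ i"
proof -
  have deriv: "((\<lambda>z :: real^'n. h\<^sup>2 - z \<bullet> z) has_derivative (\<lambda>e. - 2 * (z \<bullet> e))) (at z)" for z
    by (auto intro!: derivative_eq_intros simp: inner_commute)
  show "C1 (\<lambda>z :: real^'n. h\<^sup>2 - z \<bullet> z)"
    by (rule C1_I[OF deriv]) (intro continuous_intros)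
  show "partial_deriv i (\<lambda>z :: real^'n. h\<^sup>2 - z \<bullet> z) z = - 2 * z $ i"
    using partial_deriv_eqI[OF deriv, of i z] by (simp add: inner_axis)
qed

lemma C1_component: "C1 (\<lambda>z :: real^'n. z $ i)"
  and partial_deriv_component: "partial_deriv j (\<lambda>z :: real^'n. z $ i) z = (if i = j then 1 else 0)"
proof -
  have deriv: "((\<lambda>z :: real^'n. z $ i) has_derivative (\<lambda>e. e $ i)) (at z)" for z
    by (rule bounded_linear_imp_has_derivative) (rule bounded_linear_vec_nth)
  show "C1 (\<lambda>z :: real^'n. z $ i)"
    by (rule C1_I[OF deriv]) (intro continuous_intros)
  show "partial_deriv j (\<lambda>z :: real^'n. z $ i) z = (if i = j then 1 else 0)"
    using partial_deriv_eqI[OF deriv, of j z] by (simp add: axis_def)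
qed

lemma C1_bump_kernel: "C1 (bump_kernel h :: real^'n \<Rightarrow> real)"
  and partial_deriv_bump_kernel:
    "partial_deriv i (bump_kernel h :: real^'n \<Rightarrow> real) = (\<lambda>z. z $ i * (- 6 * (max 0 (h\<^sup>2 - z \<bullet> z))\<^sup>2))"
proof -
  have cont: "continuous_on UNIV (\<lambda>t::real. 3 * (max 0 t)\<^sup>2)" by (intro continuous_intros)
  note P = partial_deriv_compose_real[OF C1_radius has_real_derivative_cube_pos cont]
  show "C1 (bump_kernel h :: real^'n \<Rightarrow> real)"
    unfolding bump_kernel_def[abs_def] by (rule P(2))
  show "partial_deriv i (bump_kernel h :: real^'n \<Rightarrow> real) = (\<lambda>z. z $ i * (- 6 * (max 0 (h\<^sup>2 - z \<bullet> z))\<^sup>2))"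
    unfolding bump_kernel_def[abs_def] by (rule ext) (simp add: P(1) partial_deriv_radius)
qed

lemma C1_partial_bump_kernel: "C1 (partial_deriv i (bump_kernel h :: real^'n \<Rightarrow> real))"
  and partial_deriv2_bump_kernel_symmetric:
    "partial_deriv j (partial_deriv i (bump_kernel h :: real^'n \<Rightarrow> real))
      = partial_deriv i (partial_deriv j (bump_kernel h))"
proof -
  have cont: "continuous_on UNIV (\<lambda>t::real. 2 * max 0 t)" by (intro continuous_intros)
  note P = partial_deriv_compose_real[OF C1_radius has_real_derivative_square_pos cont]
  define q where "q = (\<lambda>z :: real^'n. - 6 * (max 0 (h\<^sup>2 - z \<bullet> z))\<^sup>2)"
  note T = bounded_linear_partial_deriv[OF bounded_linear_mult_right[of "- 6"] P(2)]
  have q: "C1 q" "partial_deriv i q z = 24 * max 0 (h\<^sup>2 - z \<bullet> z) * z $ i" for i z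
    unfolding q_def T(1) P(1) partial_deriv_radius by (rule T(2)) simp
  have eq: "partial_deriv i (bump_kernel h) = (\<lambda>z. z $ i *\<^sub>R q z)" for i
    by (simp add: partial_deriv_bump_kernel q_def)
  note R = partial_deriv_mult[OF C1_component q(1)]
  show "C1 (partial_deriv i (bump_kernel h :: real^'n \<Rightarrow> real))" for i
    unfolding eq by (rule R(2))
  show "partial_deriv j (partial_deriv i (bump_kernel h :: real^'n \<Rightarrow> real))
      = partial_deriv i (partial_deriv j (bump_kernel h))"
    unfolding eq by (rule ext) (simp only: R(1) partial_deriv_component q(2), auto)
qed

lemma bump_kernel_nonneg: "0 \<le> bump_kernel h z"
  by (simp add: bump_kernel_def)

lemma bump_kernel_outside:
  assumes "z \<notin> cball 0 h" "0 < h"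
  shows "bump_kernel h z = 0"
proof -
  have "h < norm z" using assms(1) by simp
  then have "h\<^sup>2 < z \<bullet> z"
    using assms(2) by (simp add: power2_norm_eq_inner[symmetric] power_strict_mono)
  then show ?thesis by (simp add: bump_kernel_def)
qed

lemma integral_bump_kernel_pos:
  assumes "0 < h"
  shows "0 < integral\<^sup>L lebesgue (bump_kernel h :: real^'n \<Rightarrow> real)"
proof -
  note cont = C1_continuous[OF C1_bump_kernel[of h]]
  have int: "integrable lebesgue (bump_kernel h :: real^'n \<Rightarrow> real)"
    by (rule compact_support_integrable(1)[OF cont compact_cball]) (rule bump_kernel_outside[OF _ assms])
  have "integral\<^sup>L lebesgue (bump_kernel h :: real^'n \<Rightarrow> real) \<noteq> 0"
  proof
    assume "integral\<^sup>L lebesgue (bump_kernel h :: real^'n \<Rightarrow> real) = 0"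
    then have "AE z in lebesgue. bump_kernel h (z :: real^'n) = 0"
      using integral_nonneg_eq_0_iff_AE[OF int] by (simp add: bump_kernel_nonneg)
    then have "AE z in lebesgue. z \<notin> ball (0 :: real^'n) h"
    proof (elim AE_mp, intro AE_I2 impI notI)
      fix z :: "real^'n" assume "bump_kernel h z = 0" "z \<in> ball 0 h"
      then have "norm z < h" by simp
      then have "z \<bullet> z < h\<^sup>2"
        by (simp add: power2_norm_eq_inner[symmetric] power_strict_mono)
      with \<open>bump_kernel h z = 0\<close> show False by (simp add: bump_kernel_def)
    qed
    then have "negligible (ball (0 :: real^'n) h)"
      by (simp add: negligible_iff_null_sets AE_iff_null_sets)
    then show False
      using assms open_not_negligible[of "ball (0 :: real^'n) h"] by simp
  qed
  moreover have "0 \<le> integral\<^sup>L lebesgue (bump_kernel h :: real^'n \<Rightarrow> real)"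
    by (simp add: bump_kernel_nonneg)
  ultimately show ?thesis by simp
qed

text \<open>
  The symmetry of the second derivatives is what makes \<open>d \<circ> d\<close> vanish on mollified functions; for the
  explicit kernel it is seen directly.
\<close>

definition mollifier :: "real \<Rightarrow> (real^'n \<Rightarrow> real) \<Rightarrow> bool" where
  "mollifier h \<rho> \<longleftrightarrow> C1 \<rho> \<and> (\<forall>i. C1 (partial_deriv i \<rho>)) \<and>
     (\<forall>i j. partial_deriv j (partial_deriv i \<rho>) = partial_deriv i (partial_deriv j \<rho>)) \<and>
     (\<forall>z. 0 \<le> \<rho> z) \<and> (\<forall>z. z \<notin> cball 0 h \<longrightarrow> \<rho> z = 0) \<and> integral\<^sup>L lebesgue \<rho> = 1"

lemma mollifier_exists:
  assumes "0 < h"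
  shows "\<exists>\<rho> :: real^'n \<Rightarrow> real. mollifier h \<rho>"
proof -
  define c where "c = 1 / integral\<^sup>L lebesgue (bump_kernel h :: real^'n \<Rightarrow> real)"
  define \<rho> where "\<rho> = (\<lambda>z :: real^'n. c * bump_kernel h z)"
  note S = bounded_linear_partial_deriv[OF bounded_linear_mult_right[of c]]
  have partial: "partial_deriv i \<rho> = (\<lambda>z. c * partial_deriv i (bump_kernel h) z)" for i
    unfolding \<rho>_def by (rule ext) (rule S(1)[OF C1_bump_kernel])
  have partial2: "partial_deriv j (partial_deriv i \<rho>) = (\<lambda>z. c * partial_deriv j (partial_deriv i (bump_kernel h)) z)" for i j
    unfolding partial by (rule ext) (rule S(1)[OF C1_partial_bump_kernel])
  have "mollifier h \<rho>"
    unfolding mollifier_def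
  proof (intro conjI allI impI)
    show "C1 \<rho>" unfolding \<rho>_def by (rule S(2)[OF C1_bump_kernel])
    show "C1 (partial_deriv i \<rho>)" for i unfolding partial by (rule S(2)[OF C1_partial_bump_kernel])
    show "partial_deriv j (partial_deriv i \<rho>) = partial_deriv i (partial_deriv j \<rho>)" for i j
      unfolding partial2 by (simp only: partial_deriv2_bump_kernel_symmetric)
    show "0 \<le> \<rho> z" for z
      using integral_bump_kernel_pos[OF assms, where 'n = 'n] by (simp add: \<rho>_def c_def bump_kernel_nonneg)
    show "\<rho> z = 0" if "z \<notin> cball 0 h" for z
      using bump_kernel_outside[OF that assms] by (simp add: \<rho>_def)
    show "integral\<^sup>L lebesgue \<rho> = 1"
      using integral_bump_kernel_pos[OF assms, where 'n = 'n] by (simp add: \<rho>_def c_def)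
  qed
  then show ?thesis by blast
qed

lemma mollifier_integrable:
  fixes \<rho> :: "real^'n \<Rightarrow> real"
  assumes "mollifier h \<rho>"
  shows "integrable lebesgue \<rho>"
  by (rule compact_support_integrable(1)[of _ "cball 0 h"])
     (use assms in \<open>auto simp: mollifier_def intro: C1_continuous\<close>)

lemma convolution_outside:
  assumes "\<And>z. z \<notin> A \<Longrightarrow> K z = 0" "\<And>y. y \<notin> C \<Longrightarrow> g y = 0" "x \<notin> {a + b | a b. a \<in> A \<and> b \<in> C}"
  shows "convolution K g x = 0"
proof -
  have "K (x - y) * g y = 0" for y
  proof (rule ccontr)
    assume "K (x - y) * g y \<noteq> 0"
    then have "x - y \<in> A" "y \<in> C" using assms(1,2) by fastforce+
    moreover have "x = (x - y) + y" by simp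
    ultimately show False using assms(3) by blast
  qed
  then have "(\<lambda>y. K (x - y) * g y) = (\<lambda>y. 0)" by (rule ext)
  then show ?thesis unfolding convolution_def by simp
qed

lemma convolution_mollifier_close:
  fixes v \<rho> :: "real^'n \<Rightarrow> real"
  assumes v: "continuous_on UNIV v" and \<rho>: "mollifier h \<rho>"
    and close: "\<And>y. y \<in> cball 0 h \<Longrightarrow> \<bar>v (x - y) - a\<bar> \<le> e"
  shows "\<bar>convolution v \<rho> x - a\<bar> \<le> e"
proof -
  have \<rho>c: "continuous_on UNIV \<rho>"
    using \<rho> by (auto simp: mollifier_def intro: C1_continuous)
  have int: "integrable lebesgue (\<lambda>y. v (x - y) * \<rho> y)"
    by (rule compact_support_integrable(1)[of _ "cball 0 h"])
       (use \<rho> \<rho>c in \<open>auto simp: mollifier_def intro!: continuous_intros continuous_on_compose2[OF v]\<close>)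
  note int\<rho> = mollifier_integrable[OF \<rho>]
  have "convolution v \<rho> x - a = (LINT y|lebesgue. v (x - y) * \<rho> y) - (LINT y|lebesgue. a * \<rho> y)"
    using \<rho> by (simp add: convolution_def mollifier_def)
  also have "\<dots> = (LINT y|lebesgue. (v (x - y) - a) * \<rho> y)"
    using int int\<rho> by (simp add: left_diff_distrib)
  also have "\<bar>\<dots>\<bar> \<le> (LINT y|lebesgue. e * \<rho> y)"
  proof (rule integral_abs_bound_integral)
    show "integrable lebesgue (\<lambda>y. (v (x - y) - a) * \<rho> y)"
      using int int\<rho> by (simp add: left_diff_distrib)
    show "integrable lebesgue (\<lambda>y. e * \<rho> y)" using int\<rho> by simp
    show "\<bar>(v (x - y) - a) * \<rho> y\<bar> \<le> e * \<rho> y" for y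
    proof (cases "y \<in> cball 0 h")
      case True
      have "0 \<le> \<rho> y" using \<rho> by (simp add: mollifier_def)
      then show ?thesis
        using close[OF True] by (simp add: abs_mult mult_right_mono)
    next
      case False
      then have "\<rho> y = 0" using \<rho> unfolding mollifier_def by blast
      then show ?thesis by simp
    qed
  qed
  finally show ?thesis
    using \<rho> by (simp add: mollifier_def)
qed

text \<open>
  The approximations are convolutions with mollifiers of radius \<open>1 / (m + 1)\<close>. Their derivatives are
  dominated by a multiple of the indicator function of one compact set.
\<close>

lemma C2_approximation:
  fixes u :: "real^'n \<Rightarrow> real"
  assumes "u \<in> C1_compact UNIV"
  obtains U B K where
    "\<And>m. U m \<in> C1_compact UNIV"
    "\<And>m i. partial_deriv i (U m) \<in> C1_compact UNIV"
    "\<And>m i j. partial_deriv j (partial_deriv i (U m)) = partial_deriv i (partial_deriv j (U m))"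
    "\<And>i x. (\<lambda>m. partial_deriv i (U m) x) \<longlonglongrightarrow> partial_deriv i u x"
    "compact K" "\<And>m i x. \<bar>partial_deriv i (U m) x\<bar> \<le> indicator K x * B"
proof -
  obtain C where u: "C1 u" "compact C" "\<And>x. x \<notin> C \<Longrightarrow> u x = 0"
    using assms unfolding C1_compact_iff by blast
  define h where "h m = 1 / real (Suc m)" for m
  have h: "0 < h m" "h m \<le> 1" for m by (simp_all add: h_def)
  obtain \<rho> :: "nat \<Rightarrow> real^'n \<Rightarrow> real" where \<rho>: "\<And>m. mollifier (h m) (\<rho> m)"
    using mollifier_exists[OF h(1)] by metis
  have \<rho>C1: "C1 (\<rho> m)" "C1 (partial_deriv i (\<rho> m))" for m i
    using \<rho>[of m] by (auto simp: mollifier_def)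
  have \<rho>out: "\<rho> m z = 0" if "z \<notin> cball 0 1" for m z
  proof -
    have "z \<notin> cball 0 (h m)" using that h(2)[of m] by auto
    then show ?thesis using \<rho>[of m] unfolding mollifier_def by blast
  qed
  define U where "U m = convolution (\<rho> m) u" for m
  note uc = C1_continuous[OF u(1)]
  have partial: "partial_deriv i (U m) = convolution (partial_deriv i (\<rho> m)) u" for m i
    unfolding U_def by (rule convolution_C1(2)[OF \<rho>C1(1) uc u(2,3)])
  have partial2: "partial_deriv j (partial_deriv i (U m)) = convolution (partial_deriv j (partial_deriv i (\<rho> m))) u" for m i j
    unfolding partial by (rule convolution_C1(2)[OF \<rho>C1(2) uc u(2,3)])
  have partial': "partial_deriv i (U m) = convolution (partial_deriv i u) (\<rho> m)" for m i
    unfolding U_def convolution_commute[OF C1_continuous[OF \<rho>C1(1)] uc]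
    by (rule convolution_C1(2)[OF u(1) C1_continuous[OF \<rho>C1(1)] compact_cball \<rho>out])
  define K where "K = {a + b | a b. a \<in> cball (0 :: real^'n) 1 \<and> b \<in> C}"
  have K: "compact K"
    unfolding K_def by (rule compact_sums[OF compact_cball u(2)])
  have out: "U m x = 0" if "x \<notin> K" for m x
  proof -
    have "x \<notin> {a + b | a b. a \<in> cball 0 1 \<and> b \<in> C}" using that unfolding K_def .
    from convolution_outside[OF \<rho>out u(3) this] show ?thesis unfolding U_def .
  qed
  have out': "partial_deriv i (U m) x = 0" if "x \<notin> K" for m i x
    by (rule partial_deriv_outside[OF K out that])
  have C1U: "C1 (U m)" "C1 (partial_deriv i (U m))" for m i
  proof -
    show "C1 (U m)" unfolding U_def by (rule convolution_C1(1)[OF \<rho>C1(1) uc u(2,3)])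
    show "C1 (partial_deriv i (U m))" unfolding partial by (rule convolution_C1(1)[OF \<rho>C1(2) uc u(2,3)])
  qed
  obtain B where B: "\<And>i x. \<bar>partial_deriv i u x\<bar> \<le> B"
  proof -
    have "\<forall>i. \<exists>B. \<forall>x. \<bar>partial_deriv i u x\<bar> \<le> B"
      using C1_compact_partial(3)[OF assms] by simp
    then obtain b where b: "\<And>i x. \<bar>partial_deriv i u x\<bar> \<le> b i" by metis
    have "\<bar>partial_deriv i u x\<bar> \<le> (\<Sum>i\<in>UNIV. \<bar>b i\<bar>)" for i x
      using b[of i x] member_le_sum[of i UNIV "\<lambda>i. \<bar>b i\<bar>"] by auto
    then show ?thesis by (rule that)
  qed
  show thesis
  proof (rule that[of U K B])
    show "U m \<in> C1_compact UNIV" for m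
      unfolding C1_compact_iff using C1U(1) K out by blast
    show "partial_deriv i (U m) \<in> C1_compact UNIV" for m i
      unfolding C1_compact_iff using C1U(2) K out' by blast
    show "partial_deriv j (partial_deriv i (U m)) = partial_deriv i (partial_deriv j (U m))" for m i j
      unfolding partial2 using \<rho>[of m] by (simp add: mollifier_def)
    show "compact K" by (rule K)
    show "\<bar>partial_deriv i (U m) x\<bar> \<le> indicator K x * B" for m i x
    proof (cases "x \<in> K")
      case True
      have "\<bar>convolution (partial_deriv i u) (\<rho> m) x - 0\<bar> \<le> B"
        by (rule convolution_mollifier_close[OF C1_continuous_partial[OF u(1)] \<rho>]) (use B in simp)
      with True show ?thesis by (simp add: partial')
    qed (simp add: out')
    show "(\<lambda>m. partial_deriv i (U m) x) \<longlonglongrightarrow> partial_deriv i u x" for i x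
    proof (rule LIMSEQ_I)
      fix r :: real assume "0 < r"
      have "isCont (partial_deriv i u) x"
        using C1_continuous_partial[OF u(1)] by (simp add: continuous_on_eq_continuous_at)
      then obtain d where d: "0 < d" "\<And>y. dist y x < d \<Longrightarrow> dist (partial_deriv i u y) (partial_deriv i u x) < r / 2"
        using \<open>0 < r\<close> unfolding continuous_at_eps_delta by (meson half_gt_zero)
      obtain N where N: "1 / real (Suc N) < d"
        using d(1) nat_approx_posE by blast
      have "norm (partial_deriv i (U m) x - partial_deriv i u x) < r" if "N \<le> m" for m
      proof -
        have "h m \<le> 1 / real (Suc N)"
          using that by (simp add: h_def frac_le)
        then have "h m < d" using N by simp
        have "\<bar>convolution (partial_deriv i u) (\<rho> m) x - partial_deriv i u x\<bar> \<le> r / 2"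
        proof (rule convolution_mollifier_close[OF C1_continuous_partial[OF u(1)] \<rho>])
          fix y :: "real^'n" assume "y \<in> cball 0 (h m)"
          then have "dist (x - y) x < d" using \<open>h m < d\<close> by (simp add: dist_norm)
          from d(2)[OF this] show "\<bar>partial_deriv i u (x - y) - partial_deriv i u x\<bar> \<le> r / 2"
            by (simp add: dist_real_def)
        qed
        then show ?thesis using \<open>0 < r\<close> by (simp add: partial')
      qed
      then show "\<exists>N. \<forall>m\<ge>N. norm (partial_deriv i (U m) x - partial_deriv i u x) < r" by blast
    qed
  qed
qed

section \<open>Weakly closed form fields\<close>

definition bounded_measurable :: "(real^'n \<Rightarrow> 'b::euclidean_space) \<Rightarrow> bool" where
  "bounded_measurable \<Psi> \<longleftrightarrow> \<Psi> \<in> borel_measurable lebesgue \<and> (\<exists>B. \<forall>x. norm (\<Psi> x) \<le> B)"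

lemma bounded_measurable_const: "bounded_measurable (\<lambda>x. c)"
  by (auto simp: bounded_measurable_def)

lemma bounded_measurable_continuous:
  fixes f :: "real^'n \<Rightarrow> 'b::euclidean_space"
  assumes "continuous_on UNIV f" "\<exists>B. \<forall>x. norm (f x) \<le> B"
  shows "bounded_measurable f"
  using assms borel_measurable_lebesgue_continuous by (auto simp: bounded_measurable_def)

lemma bounded_measurable_add:
  assumes "bounded_measurable \<Phi>" "bounded_measurable \<Psi>"
  shows "bounded_measurable (\<lambda>x. \<Phi> x + \<Psi> x)"
proof -
  obtain B C where "\<And>x. norm (\<Phi> x) \<le> B" "\<And>x. norm (\<Psi> x) \<le> C"
    using assms unfolding bounded_measurable_def by blast
  then have "norm (\<Phi> x + \<Psi> x) \<le> B + C" for x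
    by (meson norm_triangle_mono)
  then show ?thesis
    using assms unfolding bounded_measurable_def by (auto intro!: borel_measurable_add)
qed

lemma bounded_measurable_sum:
  assumes "\<And>i. i \<in> I \<Longrightarrow> bounded_measurable (\<Phi> i)"
  shows "bounded_measurable (\<lambda>x. \<Sum>i\<in>I. \<Phi> i x)"
  using assms
  by (induction I rule: infinite_finite_induct) (auto intro: bounded_measurable_const bounded_measurable_add)

lemma bounded_bilinear_wedge:
  "bounded_bilinear ((\<and>\<^sub>\<Lambda>) :: 'n::{finite,linorder} form \<Rightarrow> 'n form \<Rightarrow> 'n form)"
  using bilinear_wedge by (rule bilinear_conv_bounded_bilinear[THEN iffD1])

lemma wedge_norm_bound:
  obtains C where "0 < C" "\<And>\<alpha> \<beta> :: 'n::{finite,linorder} form. norm (\<alpha> \<and>\<^sub>\<Lambda> \<beta>) \<le> C * norm \<alpha> * norm \<beta>"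
proof -
  obtain C where "0 < C" "\<And>\<alpha> \<beta> :: 'n form. norm (\<alpha> \<and>\<^sub>\<Lambda> \<beta>) \<le> norm \<alpha> * norm \<beta> * C"
    using bounded_bilinear.pos_bounded[OF bounded_bilinear_wedge] by blast
  then show ?thesis
    by (intro that[of C]) (simp_all add: mult_ac)
qed

lemma borel_measurable_wedge:
  fixes f g :: "'a \<Rightarrow> 'n::{finite,linorder} form"
  assumes "f \<in> borel_measurable M" "g \<in> borel_measurable M"
  shows "(\<lambda>x. f x \<and>\<^sub>\<Lambda> g x) \<in> borel_measurable M"
proof (rule borel_measurable_continuous_Pair[OF assms])
  show "continuous_on UNIV (\<lambda>z :: 'n form \<times> 'n form. fst z \<and>\<^sub>\<Lambda> snd z)"
    by (intro bounded_bilinear.continuous_on[OF bounded_bilinear_wedge] continuous_intros)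
qed

lemma bounded_measurable_wedge:
  fixes \<Phi> \<Psi> :: "(real, 'm::finite) vec \<Rightarrow> 'n::{finite,linorder} form"
  assumes "bounded_measurable \<Phi>" "bounded_measurable \<Psi>"
  shows "bounded_measurable (\<lambda>x. \<Phi> x \<and>\<^sub>\<Lambda> \<Psi> x)"
proof -
  obtain B1 B2 where B: "\<And>x. norm (\<Phi> x) \<le> B1" "\<And>x. norm (\<Psi> x) \<le> B2"
    using assms unfolding bounded_measurable_def by blast
  obtain C where C: "0 < C" "\<And>\<alpha> \<beta> :: 'n form. norm (\<alpha> \<and>\<^sub>\<Lambda> \<beta>) \<le> C * norm \<alpha> * norm \<beta>"
    by (rule wedge_norm_bound) blast
  have "0 \<le> B1" by (meson B(1) norm_ge_zero order_trans)
  then have "norm (\<Phi> x \<and>\<^sub>\<Lambda> \<Psi> x) \<le> C * B1 * B2" for x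
    using C(1) B by (intro order_trans[OF C(2)] mult_mono) auto
  then show ?thesis
    using assms borel_measurable_wedge unfolding bounded_measurable_def by blast
qed

lemma integrable_wedge_bounded:
  fixes f \<Psi> :: "(real, 'm::finite) vec \<Rightarrow> 'n::{finite,linorder} form"
  assumes "integrable lebesgue f" "bounded_measurable \<Psi>"
  shows "integrable lebesgue (\<lambda>x. f x \<and>\<^sub>\<Lambda> \<Psi> x)" and "integrable lebesgue (\<lambda>x. \<Psi> x \<and>\<^sub>\<Lambda> f x)"
proof -
  obtain B where B: "\<And>x. norm (\<Psi> x) \<le> B"
    using assms unfolding bounded_measurable_def by blast
  obtain C where C: "0 < C" "\<And>\<alpha> \<beta> :: 'n form. norm (\<alpha> \<and>\<^sub>\<Lambda> \<beta>) \<le> C * norm \<alpha> * norm \<beta>"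
    by (rule wedge_norm_bound) blast
  have int: "integrable lebesgue (\<lambda>x. C * B * norm (f x))"
    by (intro integrable_mult_right integrable_norm assms)
  have meas: "f \<in> borel_measurable lebesgue" "\<Psi> \<in> borel_measurable lebesgue"
    using assms by (auto simp: bounded_measurable_def)
  have "norm (f x \<and>\<^sub>\<Lambda> \<Psi> x) \<le> norm (C * B * norm (f x))" for x
  proof -
    have "norm (f x \<and>\<^sub>\<Lambda> \<Psi> x) \<le> C * norm (f x) * norm (\<Psi> x)" by (rule C(2))
    also have "\<dots> \<le> C * norm (f x) * B" using B C(1) by (intro mult_left_mono) auto
    finally show ?thesis by (simp add: mult_ac)
  qed
  then show "integrable lebesgue (\<lambda>x. f x \<and>\<^sub>\<Lambda> \<Psi> x)"
    by (intro Bochner_Integration.integrable_bound[OF int] borel_measurable_wedge meas AE_I2)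
  have "norm (\<Psi> x \<and>\<^sub>\<Lambda> f x) \<le> norm (C * B * norm (f x))" for x
  proof -
    have "norm (\<Psi> x \<and>\<^sub>\<Lambda> f x) \<le> C * norm (\<Psi> x) * norm (f x)" by (rule C(2))
    also have "\<dots> \<le> C * B * norm (f x)" using B C(1) by (intro mult_right_mono mult_left_mono) auto
    finally show ?thesis by simp
  qed
  then show "integrable lebesgue (\<lambda>x. \<Psi> x \<and>\<^sub>\<Lambda> f x)"
    by (intro Bochner_Integration.integrable_bound[OF int] borel_measurable_wedge meas AE_I2)
qed

lemma integral_wedge_const:
  fixes f :: "(real, 'm::finite) vec \<Rightarrow> 'n::{finite,linorder} form"
  assumes "integrable lebesgue f"
  shows "(LINT x|lebesgue. c \<and>\<^sub>\<Lambda> f x) = c \<and>\<^sub>\<Lambda> integral\<^sup>L lebesgue f"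
    and "(LINT x|lebesgue. f x \<and>\<^sub>\<Lambda> c) = integral\<^sup>L lebesgue f \<and>\<^sub>\<Lambda> c"
  using integral_bounded_linear[OF bounded_bilinear.bounded_linear_right[OF bounded_bilinear_wedge] assms]
    integral_bounded_linear[OF bounded_bilinear.bounded_linear_left[OF bounded_bilinear_wedge] assms] by auto

definition differential :: "(real^'n \<Rightarrow> real) \<Rightarrow> real^'n \<Rightarrow> 'n::finite form" where
  "differential u x = (\<Sum>i\<in>UNIV. partial_deriv i u x *\<^sub>R one_form (axis i 1))"

lemma differential_eq_one_form: "differential u x = one_form (\<chi> i. partial_deriv i u x)"
proof -
  have "(\<chi> i. partial_deriv i u x) = (\<Sum>i\<in>UNIV. partial_deriv i u x *\<^sub>R axis i 1)"
    using basis_expansion[of "\<chi> i. partial_deriv i u x"] by (simp add: scalar_mult_eq_scaleR)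
  then show ?thesis
    by (simp add: differential_def linear_sum[OF linear_one_form] linear_scale[OF linear_one_form])
qed

text \<open>
  For a field of class \<open>C\<^sup>1\<close> this means \<open>d\<Psi> = 0\<close>, by integration by parts.
\<close>

definition weakly_closed :: "('n::{finite,linorder}) form_field \<Rightarrow> bool" where
  "weakly_closed \<Psi> \<longleftrightarrow> bounded_measurable \<Psi> \<and>
     (\<forall>u\<in>C1_compact UNIV. (LINT x|lebesgue. differential u x \<and>\<^sub>\<Lambda> \<Psi> x) = 0)"

lemma differential_integrable:
  fixes u :: "(real, 'n::{finite,linorder}) vec \<Rightarrow> real"
  assumes "u \<in> C1_compact UNIV"
  shows "integrable lebesgue (differential u :: _ \<Rightarrow> 'n form)" "bounded_measurable (differential u :: _ \<Rightarrow> 'n form)"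
    "integral\<^sup>L lebesgue (differential u :: _ \<Rightarrow> 'n form) = 0"
proof -
  note int = C1_compact_partial(2)[OF assms]
  show "integrable lebesgue (differential u :: _ \<Rightarrow> 'n form)"
    unfolding differential_def[abs_def] by (intro Bochner_Integration.integrable_sum integrable_scaleR_left int)
  show "integral\<^sup>L lebesgue (differential u :: _ \<Rightarrow> 'n form) = 0"
    unfolding differential_def[abs_def]
    by (subst Bochner_Integration.integral_sum) (auto simp: int integral_partial_deriv_eq_0[OF assms])
  have "bounded_measurable (\<lambda>x. partial_deriv i u x *\<^sub>R (one_form (axis i 1) :: 'n form))" for i
  proof (rule bounded_measurable_continuous)
    show "continuous_on UNIV (\<lambda>x. partial_deriv i u x *\<^sub>R (one_form (axis i 1) :: 'n form))"
      by (intro continuous_intros C1_compact_partial(1)[OF assms])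
    obtain B where "\<And>x. norm (partial_deriv i u x) \<le> B"
      using C1_compact_partial(3)[OF assms] by blast
    then have "norm (partial_deriv i u x *\<^sub>R (one_form (axis i 1) :: 'n form)) \<le> B * norm (one_form (axis i 1) :: 'n form)" for x
      by (simp add: mult_right_mono)
    then show "\<exists>B. \<forall>x. norm (partial_deriv i u x *\<^sub>R (one_form (axis i 1) :: 'n form)) \<le> B" by blast
  qed
  then show "bounded_measurable (differential u :: _ \<Rightarrow> 'n form)"
    unfolding differential_def[abs_def] by (intro bounded_measurable_sum)
qed

lemma weakly_closed_const: "weakly_closed (\<lambda>x. c)"
  unfolding weakly_closed_def
  by (auto simp: bounded_measurable_const integral_wedge_const differential_integrable)

lemma weakly_closed_add:
  assumes "weakly_closed \<Phi>" "weakly_closed \<Psi>"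
  shows "weakly_closed (\<lambda>x. \<Phi> x + \<Psi> x)"
  using assms unfolding weakly_closed_def
  by (auto simp: wedge_add_right integrable_wedge_bounded(1) differential_integrable intro!: bounded_measurable_add)

lemma weakly_closed_sum:
  assumes "\<And>i. i \<in> I \<Longrightarrow> weakly_closed (\<Phi> i)"
  shows "weakly_closed (\<lambda>x. \<Sum>i\<in>I. \<Phi> i x)"
  using assms
  by (induction I rule: infinite_finite_induct) (auto intro: weakly_closed_const weakly_closed_add)

lemma weakly_closed_wedge_const:
  assumes "weakly_closed \<Psi>"
  shows "weakly_closed (\<lambda>x. c \<and>\<^sub>\<Lambda> \<Psi> x)"
  unfolding weakly_closed_def
proof (intro conjI ballI)
  have \<Psi>: "bounded_measurable \<Psi>" using assms by (simp add: weakly_closed_def)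
  show "bounded_measurable (\<lambda>x. c \<and>\<^sub>\<Lambda> \<Psi> x)"
    by (intro bounded_measurable_wedge bounded_measurable_const \<Psi>)
  fix u :: "(real, 'a) vec \<Rightarrow> real" assume u: "u \<in> C1_compact UNIV"
  have "differential u x \<and>\<^sub>\<Lambda> c \<and>\<^sub>\<Lambda> \<Psi> x = grade_inv c \<and>\<^sub>\<Lambda> differential u x \<and>\<^sub>\<Lambda> \<Psi> x" for x
    by (simp add: differential_eq_one_form one_form_commute[of _ c] flip: wedge_assoc)
  moreover have "integrable lebesgue (\<lambda>x. differential u x \<and>\<^sub>\<Lambda> \<Psi> x)"
    by (intro integrable_wedge_bounded(1) differential_integrable u \<Psi>)
  ultimately show "(LINT x|lebesgue. differential u x \<and>\<^sub>\<Lambda> c \<and>\<^sub>\<Lambda> \<Psi> x) = 0"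
    using assms u by (simp add: integral_wedge_const weakly_closed_def)
qed

lemma differential_mult:
  assumes "C1 u" "C1 v"
  shows "differential (\<lambda>x. u x * v x) x = v x *\<^sub>R differential u x + u x *\<^sub>R differential v x"
  using partial_deriv_mult(1)[OF assms]
  by (simp add: differential_def scaleR_add_left sum.distrib scaleR_sum_right mult_ac)

lemma antisymmetric_sum_zero:
  fixes a :: "'n::{finite,linorder} \<Rightarrow> 'n \<Rightarrow> real" and \<psi> :: "'n form"
  assumes "\<And>i j. a i j = a j i"
  shows "(\<Sum>i\<in>UNIV. \<Sum>j\<in>UNIV. a i j *\<^sub>R (one_form (axis i 1) \<and>\<^sub>\<Lambda> one_form (axis j 1) \<and>\<^sub>\<Lambda> \<psi>)) = 0" (is "?S = 0")
proof -
  let ?e = "\<lambda>i j. one_form (axis i 1) \<and>\<^sub>\<Lambda> one_form (axis j 1) \<and>\<^sub>\<Lambda> \<psi>"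
  have "?S = (\<Sum>j\<in>UNIV. \<Sum>i\<in>UNIV. a i j *\<^sub>R ?e i j)"
    by (rule sum.swap)
  also have "\<dots> = (\<Sum>j\<in>UNIV. \<Sum>i\<in>UNIV. - (a j i *\<^sub>R ?e j i))"
    by (intro sum.cong refl) (metis assms one_wedge_anticommute scaleR_minus_right)
  also have "\<dots> = - ?S" by (simp add: sum_negf)
  finally have eq: "?S = - ?S" .
  have "2 *\<^sub>R ?S = ?S - - ?S" by (simp only: scaleR_2 minus_minus diff_minus_eq_add)
  also have "\<dots> = 0" using eq by (simp only: right_minus_eq)
  finally show ?thesis by (simp only: scaleR_eq_0_iff zero_neq_numeral[symmetric] simp_thms)
qed

text \<open>
  The functions \<open>u \<partial>\<^sub>j v\<close> are of class \<open>C\<^sup>1\<close>, so \<open>\<Psi>\<close> can be tested with them. In the sum of the resulting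
  identities, multiplied by \<open>e\<^sup>j\<close>, the second derivatives of \<open>v\<close> cancel.
\<close>

lemma weakly_closed_differential_C2:
  fixes \<Psi> :: "('n::{finite,linorder}) form_field"
  assumes "weakly_closed \<Psi>" "u \<in> C1_compact UNIV"
    and v: "C1 v" "\<And>i. C1 (partial_deriv i v)"
      "\<And>i j. partial_deriv j (partial_deriv i v) = partial_deriv i (partial_deriv j v)"
  shows "(LINT x|lebesgue. differential u x \<and>\<^sub>\<Lambda> differential v x \<and>\<^sub>\<Lambda> \<Psi> x) = 0"
proof -
  let ?e = "\<lambda>j. one_form (axis j 1) :: 'n form"
  have u: "C1 u" using assms(2) by (simp add: C1_compact_iff)
  define \<tau> where "\<tau> j x = u x * partial_deriv j v x" for j x
  have \<tau>: "\<tau> j \<in> C1_compact UNIV" for j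
    using C1_compact_mult[OF assms(2) v(2)[of j]] by (simp add: \<tau>_def[abs_def])
  have int: "integrable lebesgue (\<lambda>x. differential (\<tau> j) x \<and>\<^sub>\<Lambda> \<Psi> x)" for j
    using assms(1) by (intro integrable_wedge_bounded(1) differential_integrable \<tau>) (simp add: weakly_closed_def)
  have "(\<Sum>j\<in>UNIV. ?e j \<and>\<^sub>\<Lambda> differential (\<tau> j) x \<and>\<^sub>\<Lambda> \<Psi> x) = - (differential u x \<and>\<^sub>\<Lambda> differential v x \<and>\<^sub>\<Lambda> \<Psi> x)" for x
  proof -
    have "(\<Sum>j\<in>UNIV. ?e j \<and>\<^sub>\<Lambda> differential (\<tau> j) x \<and>\<^sub>\<Lambda> \<Psi> x)
        = (\<Sum>j\<in>UNIV. partial_deriv j v x *\<^sub>R (?e j \<and>\<^sub>\<Lambda> differential u x \<and>\<^sub>\<Lambda> \<Psi> x))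
          + u x *\<^sub>R (\<Sum>j\<in>UNIV. ?e j \<and>\<^sub>\<Lambda> differential (partial_deriv j v) x \<and>\<^sub>\<Lambda> \<Psi> x)"
      by (simp add: \<tau>_def[abs_def] differential_mult[OF u v(2)] wedge_add_left wedge_add_right
          wedge_scaleR_left wedge_scaleR_right sum.distrib scaleR_sum_right)
    also have "(\<Sum>j\<in>UNIV. ?e j \<and>\<^sub>\<Lambda> differential (partial_deriv j v) x \<and>\<^sub>\<Lambda> \<Psi> x)
        = (\<Sum>j\<in>UNIV. \<Sum>i\<in>UNIV. partial_deriv i (partial_deriv j v) x *\<^sub>R (?e j \<and>\<^sub>\<Lambda> ?e i \<and>\<^sub>\<Lambda> \<Psi> x))"
      by (simp add: differential_def linear_sum[OF linear_wedge_left] linear_sum[OF linear_wedge_right]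
          wedge_scaleR_left wedge_scaleR_right)
    also have "\<dots> = 0"
      by (rule antisymmetric_sum_zero) (simp only: v(3))
    also have "(\<Sum>j\<in>UNIV. partial_deriv j v x *\<^sub>R (?e j \<and>\<^sub>\<Lambda> differential u x \<and>\<^sub>\<Lambda> \<Psi> x))
        = differential v x \<and>\<^sub>\<Lambda> differential u x \<and>\<^sub>\<Lambda> \<Psi> x"
      by (simp add: differential_def[of v] linear_sum[OF linear_wedge_left] wedge_scaleR_left)
    also have "\<dots> = - (differential u x \<and>\<^sub>\<Lambda> differential v x \<and>\<^sub>\<Lambda> \<Psi> x)"
      unfolding differential_eq_one_form by (rule one_wedge_anticommute)
    finally show ?thesis by simp
  qed
  then have "- (LINT x|lebesgue. differential u x \<and>\<^sub>\<Lambda> differential v x \<and>\<^sub>\<Lambda> \<Psi> x)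
      = (LINT x|lebesgue. (\<Sum>j\<in>UNIV. ?e j \<and>\<^sub>\<Lambda> differential (\<tau> j) x \<and>\<^sub>\<Lambda> \<Psi> x))"
    by simp
  also have "\<dots> = (\<Sum>j\<in>UNIV. (LINT x|lebesgue. ?e j \<and>\<^sub>\<Lambda> differential (\<tau> j) x \<and>\<^sub>\<Lambda> \<Psi> x))"
    by (intro Bochner_Integration.integral_sum integrable_bounded_linear[OF
          bounded_bilinear.bounded_linear_right[OF bounded_bilinear_wedge]] int)
  also have "\<dots> = 0"
    using assms(1) \<tau> by (simp add: integral_wedge_const int weakly_closed_def)
  finally show ?thesis by simp
qed

text \<open>
  Mollification of \<open>v\<close> reduces this to the case of class \<open>C\<^sup>2\<close>; the other factors are bounded and stay fixed.
\<close>

lemma weakly_closed_differential: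
  fixes \<Psi> :: "('n::{finite,linorder}) form_field"
  assumes "weakly_closed \<Psi>" "v \<in> C1_compact UNIV"
  shows "weakly_closed (\<lambda>x. differential v x \<and>\<^sub>\<Lambda> \<Psi> x)"
  unfolding weakly_closed_def
proof (intro conjI ballI)
  have \<Psi>: "bounded_measurable \<Psi>" using assms(1) by (simp add: weakly_closed_def)
  show "bounded_measurable (\<lambda>x. differential v x \<and>\<^sub>\<Lambda> \<Psi> x)"
    by (intro bounded_measurable_wedge \<Psi> differential_integrable assms(2))
  fix u :: "(real, 'n) vec \<Rightarrow> real" assume u: "u \<in> C1_compact UNIV"
  obtain V B K where V: "\<And>m. V m \<in> C1_compact UNIV"
    "\<And>m i. partial_deriv i (V m) \<in> C1_compact UNIV"
    "\<And>m i j. partial_deriv j (partial_deriv i (V m)) = partial_deriv i (partial_deriv j (V m))"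
    "\<And>i x. (\<lambda>m. partial_deriv i (V m) x) \<longlonglongrightarrow> partial_deriv i v x"
    "compact K" "\<And>m i x. \<bar>partial_deriv i (V m) x\<bar> \<le> indicator K x * B"
    by (rule C2_approximation[OF assms(2)], rule that, assumption+)
  let ?F = "\<lambda>w x. differential u x \<and>\<^sub>\<Lambda> differential w x \<and>\<^sub>\<Lambda> \<Psi> x"
  have F_meas: "?F w \<in> borel_measurable lebesgue" if "w \<in> C1_compact UNIV" for w
    using differential_integrable(2)[OF u] differential_integrable(2)[OF that] \<Psi>
    unfolding bounded_measurable_def by (intro borel_measurable_wedge) auto
  obtain C where C: "0 < C" "\<And>\<alpha> \<beta> :: 'n form. norm (\<alpha> \<and>\<^sub>\<Lambda> \<beta>) \<le> C * norm \<alpha> * norm \<beta>"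
    by (rule wedge_norm_bound) blast
  obtain Bu where Bu: "\<And>x. norm (differential u x :: 'n form) \<le> Bu"
    using differential_integrable(2)[OF u] unfolding bounded_measurable_def by blast
  obtain B\<Psi> where B\<Psi>: "\<And>x. norm (\<Psi> x) \<le> B\<Psi>"
    using \<Psi> unfolding bounded_measurable_def by blast
  define M where "M = (\<Sum>i\<in>UNIV. norm (one_form (axis i 1) :: 'n form))"
  have dV: "norm (differential (V m) x :: 'n form) \<le> indicator K x * B * M" for m x
  proof -
    have "norm (differential (V m) x :: 'n form) \<le> (\<Sum>i\<in>UNIV. norm (partial_deriv i (V m) x *\<^sub>R (one_form (axis i 1) :: 'n form)))"
      unfolding differential_def by (rule norm_sum)
    also have "\<dots> \<le> (\<Sum>i\<in>UNIV. (indicator K x * B) * norm (one_form (axis i 1) :: 'n form))"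
      using V(6) by (intro sum_mono) (simp add: mult_right_mono)
    finally show ?thesis by (simp add: M_def sum_distrib_left)
  qed
  have nn: "0 \<le> Bu" "0 \<le> B\<Psi>" by (meson Bu B\<Psi> norm_ge_zero order_trans)+
  have F_bound: "norm (?F (V m) x) \<le> indicator K x * (C * Bu * (C * (B * M) * B\<Psi>))" for m x
  proof -
    have "norm (differential (V m) x \<and>\<^sub>\<Lambda> \<Psi> x) \<le> C * norm (differential (V m) x :: 'n form) * norm (\<Psi> x)"
      by (rule C(2))
    also have "\<dots> \<le> C * (indicator K x * B * M) * B\<Psi>"
    proof (rule mult_mono)
      show "C * norm (differential (V m) x :: 'n form) \<le> C * (indicator K x * B * M)"
        using dV[of m x] C(1) by (intro mult_left_mono) auto
      then show "0 \<le> C * (indicator K x * B * M)"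
        using C(1) by (meson less_imp_le mult_nonneg_nonneg norm_ge_zero order_trans)
    qed (use B\<Psi> in auto)
    finally have 1: "norm (differential (V m) x \<and>\<^sub>\<Lambda> \<Psi> x) \<le> C * (indicator K x * B * M) * B\<Psi>" .
    have "norm (?F (V m) x) \<le> C * norm (differential u x :: 'n form) * norm (differential (V m) x \<and>\<^sub>\<Lambda> \<Psi> x)"
      by (rule C(2))
    also have "\<dots> \<le> C * Bu * (C * (indicator K x * B * M) * B\<Psi>)"
      using 1 Bu C(1) nn by (intro mult_mono[OF mult_left_mono 1]) auto
    finally show ?thesis by (simp add: mult_ac)
  qed
  have "(\<lambda>m. LINT x|lebesgue. ?F (V m) x) \<longlonglongrightarrow> (LINT x|lebesgue. ?F v x)"
  proof (rule integral_dominated_convergence[where w = "\<lambda>x. indicator K x * (C * Bu * (C * (B * M) * B\<Psi>))"])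
    show "integrable lebesgue (\<lambda>x. indicator K x * (C * Bu * (C * (B * M) * B\<Psi>)))"
      using lmeasurable_compact[OF V(5)] by (intro integrable_mult_left) (simp add: lmeasurable_iff_integrable)
    show "AE x in lebesgue. (\<lambda>m. ?F (V m) x) \<longlonglongrightarrow> ?F v x"
    proof (rule AE_I2)
      fix x
      have "(\<lambda>m. differential (V m) x :: 'n form) \<longlonglongrightarrow> differential v x"
        unfolding differential_def by (intro tendsto_intros V(4))
      then show "(\<lambda>m. ?F (V m) x) \<longlonglongrightarrow> ?F v x"
        by (intro bounded_bilinear.tendsto[OF bounded_bilinear_wedge] tendsto_const)
    qed
  qed (use F_bound F_meas V(1) assms(2) in auto)
  moreover have "(LINT x|lebesgue. ?F (V m) x) = 0" for m
    using V(1)[of m] V(2)[of _ m] V(3)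
    by (intro weakly_closed_differential_C2[OF assms(1) u]) (auto simp: C1_compact_iff)
  ultimately show "(LINT x|lebesgue. ?F v x) = 0"
    by (simp add: LIMSEQ_const_iff)
qed

section \<open>Powers of exterior derivatives have null integral\<close>

text \<open>
  If \<open>v i\<close> is the \<open>i\<close>-th partial derivative of \<open>\<omega>\<close>, this is the exterior derivative of \<open>\<omega>\<close>.
\<close>

definition exterior_field :: "('n::{finite,linorder} \<Rightarrow> 'n form_field) \<Rightarrow> 'n form_field" where
  "exterior_field v x = (\<Sum>i\<in>UNIV. one_form (axis i 1) \<and>\<^sub>\<Lambda> v i x)"

text \<open>
  Such families are the bounded gradients of fields in \<open>W\<^sub>0\<^sup>1\<^sup>,\<^sup>1\<close>, extended by zero. Only the convergence of the
  gradients matters for integrals of exterior derivatives.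
\<close>

definition approximable_gradient :: "('n::{finite,linorder} \<Rightarrow> 'n form_field) \<Rightarrow> bool" where
  "approximable_gradient v \<longleftrightarrow>
     (\<forall>i. integrable lebesgue (v i) \<and> bounded_measurable (v i)) \<and>
     (\<exists>\<phi>. (\<forall>m. \<phi> m \<in> C1_compact UNIV) \<and>
       (\<forall>i. (\<lambda>m. LINT x|lebesgue. norm (partial_deriv i (\<phi> m) x - v i x)) \<longlonglongrightarrow> 0))"

lemma tendsto_integral_wedge:
  fixes f :: "nat \<Rightarrow> ('n::{finite,linorder}) form_field"
  assumes int: "\<And>m. integrable lebesgue (f m)" "integrable lebesgue f'"
    and bm: "bounded_measurable h" "bounded_measurable g"
    and conv: "(\<lambda>m. LINT x|lebesgue. norm (f m x - f' x)) \<longlonglongrightarrow> 0"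
  shows "(\<lambda>m. LINT x|lebesgue. h x \<and>\<^sub>\<Lambda> f m x \<and>\<^sub>\<Lambda> g x) \<longlonglongrightarrow> (LINT x|lebesgue. h x \<and>\<^sub>\<Lambda> f' x \<and>\<^sub>\<Lambda> g x)"
proof -
  obtain Bh Bg where B: "\<And>x. norm (h x) \<le> Bh" "\<And>x. norm (g x) \<le> Bg"
    using bm unfolding bounded_measurable_def by blast
  then have nn: "0 \<le> Bh" "0 \<le> Bg" by (meson norm_ge_zero order_trans)+
  obtain C where C: "0 < C" "\<And>\<alpha> \<beta> :: 'n form. norm (\<alpha> \<and>\<^sub>\<Lambda> \<beta>) \<le> C * norm \<alpha> * norm \<beta>"
    by (rule wedge_norm_bound) blast
  have bound: "norm (h x \<and>\<^sub>\<Lambda> w \<and>\<^sub>\<Lambda> g x) \<le> (C * Bh * C * Bg) * norm w" for x w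
  proof -
    have "norm (w \<and>\<^sub>\<Lambda> g x) \<le> C * norm w * norm (g x)" by (rule C(2))
    also have "\<dots> \<le> C * norm w * Bg" using B(2) C(1) by (intro mult_left_mono) auto
    finally have 1: "norm (w \<and>\<^sub>\<Lambda> g x) \<le> C * norm w * Bg" .
    have "norm (h x \<and>\<^sub>\<Lambda> w \<and>\<^sub>\<Lambda> g x) \<le> C * norm (h x) * norm (w \<and>\<^sub>\<Lambda> g x)" by (rule C(2))
    also have "\<dots> \<le> C * Bh * (C * norm w * Bg)"
      using B(1) C(1) nn by (intro mult_mono[OF mult_left_mono 1]) auto
    finally show ?thesis by (simp add: mult_ac)
  qed
  have int_w: "integrable lebesgue (\<lambda>x. h x \<and>\<^sub>\<Lambda> w x \<and>\<^sub>\<Lambda> g x)" if "integrable lebesgue w" for w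
    using that bm by (intro integrable_wedge_bounded)
  have diff: "norm ((LINT x|lebesgue. h x \<and>\<^sub>\<Lambda> f m x \<and>\<^sub>\<Lambda> g x) - (LINT x|lebesgue. h x \<and>\<^sub>\<Lambda> f' x \<and>\<^sub>\<Lambda> g x))
      \<le> (C * Bh * C * Bg) * (LINT x|lebesgue. norm (f m x - f' x))" for m
  proof -
    have int_d: "integrable lebesgue (\<lambda>x. f m x - f' x)" using int by simp
    have "(LINT x|lebesgue. h x \<and>\<^sub>\<Lambda> f m x \<and>\<^sub>\<Lambda> g x) - (LINT x|lebesgue. h x \<and>\<^sub>\<Lambda> f' x \<and>\<^sub>\<Lambda> g x)
        = (LINT x|lebesgue. h x \<and>\<^sub>\<Lambda> (f m x - f' x) \<and>\<^sub>\<Lambda> g x)"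
      using int_w[OF int(1)[of m]] int_w[OF int(2)]
      by (simp add: wedge_diff_right linear_diff[OF linear_wedge_left])
    also have "norm \<dots> \<le> (LINT x|lebesgue. (C * Bh * C * Bg) * norm (f m x - f' x))"
      by (rule Bochner_Integration.integral_norm_bound_integral[OF int_w[OF int_d]
            integrable_mult_right[OF integrable_norm[OF int_d]] bound])
    finally show ?thesis by simp
  qed
  have "(\<lambda>m. (C * Bh * C * Bg) * (LINT x|lebesgue. norm (f m x - f' x))) \<longlonglongrightarrow> 0"
    by (rule tendsto_mult_right_zero[OF conv])
  then have "(\<lambda>m. (LINT x|lebesgue. h x \<and>\<^sub>\<Lambda> f m x \<and>\<^sub>\<Lambda> g x) - (LINT x|lebesgue. h x \<and>\<^sub>\<Lambda> f' x \<and>\<^sub>\<Lambda> g x)) \<longlonglongrightarrow> 0"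
    by (rule Lim_null_comparison[OF always_eventually[OF allI[OF diff]]])
  then show ?thesis by (rule LIM_zero_cancel)
qed

text \<open>
  The components of \<open>\<phi>\<close> reduce statements on form-valued \<open>\<phi>\<close> to scalar functions, with which weak
  closedness is tested.
\<close>

lemma exterior_field_C1:
  fixes \<phi> :: "('n::{finite,linorder}) form_field"
  assumes "C1 \<phi>"
  shows "exterior_field (\<lambda>i. partial_deriv i \<phi>) x = (\<Sum>b\<in>Basis. differential (\<lambda>x. \<phi> x \<bullet> b) x \<and>\<^sub>\<Lambda> b)"
proof -
  have partial: "partial_deriv i (\<lambda>x. \<phi> x \<bullet> b) x = partial_deriv i \<phi> x \<bullet> b" for i b
    by (rule bounded_linear_partial_deriv(1)[OF bounded_linear_inner_left assms])
  have "exterior_field (\<lambda>i. partial_deriv i \<phi>) x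
      = (\<Sum>i\<in>UNIV. one_form (axis i 1) \<and>\<^sub>\<Lambda> (\<Sum>b\<in>Basis. (partial_deriv i \<phi> x \<bullet> b) *\<^sub>R b))"
    by (simp add: exterior_field_def euclidean_representation)
  also have "\<dots> = (\<Sum>i\<in>UNIV. \<Sum>b\<in>Basis. (partial_deriv i \<phi> x \<bullet> b) *\<^sub>R (one_form (axis i 1) \<and>\<^sub>\<Lambda> b))"
    by (simp add: linear_sum[OF linear_wedge_right] wedge_scaleR_right)
  also have "\<dots> = (\<Sum>b\<in>Basis. \<Sum>i\<in>UNIV. (partial_deriv i \<phi> x \<bullet> b) *\<^sub>R (one_form (axis i 1) \<and>\<^sub>\<Lambda> b))"
    by (rule sum.swap)
  finally show ?thesis
    by (simp add: differential_def partial linear_sum[OF linear_wedge_left] wedge_scaleR_left)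
qed

lemma weakly_closed_exterior_field_C1:
  fixes \<Psi> :: "('n::{finite,linorder}) form_field"
  assumes "weakly_closed \<Psi>" "\<phi> \<in> C1_compact UNIV"
  shows "weakly_closed (\<lambda>x. exterior_field (\<lambda>i. partial_deriv i \<phi>) x \<and>\<^sub>\<Lambda> \<Psi> x)"
    and "(LINT x|lebesgue. exterior_field (\<lambda>i. partial_deriv i \<phi>) x \<and>\<^sub>\<Lambda> \<Psi> x) = 0"
proof -
  have C1: "C1 \<phi>" using assms(2) by (simp add: C1_compact_iff)
  have comp: "(\<lambda>x. \<phi> x \<bullet> b) \<in> C1_compact UNIV" for b
    by (rule bounded_linear_C1_compact[OF bounded_linear_inner_left assms(2)])
  have eq: "exterior_field (\<lambda>i. partial_deriv i \<phi>) x \<and>\<^sub>\<Lambda> \<Psi> x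
      = (\<Sum>b\<in>Basis. differential (\<lambda>x. \<phi> x \<bullet> b) x \<and>\<^sub>\<Lambda> b \<and>\<^sub>\<Lambda> \<Psi> x)" for x
    by (simp add: exterior_field_C1[OF C1] linear_sum[OF linear_wedge_left] wedge_assoc)
  have wc: "weakly_closed (\<lambda>x. b \<and>\<^sub>\<Lambda> \<Psi> x)" for b
    by (rule weakly_closed_wedge_const[OF assms(1)])
  show "weakly_closed (\<lambda>x. exterior_field (\<lambda>i. partial_deriv i \<phi>) x \<and>\<^sub>\<Lambda> \<Psi> x)"
    unfolding eq by (intro weakly_closed_sum weakly_closed_differential wc comp)
  have "integrable lebesgue (\<lambda>x. differential (\<lambda>x. \<phi> x \<bullet> b) x \<and>\<^sub>\<Lambda> b \<and>\<^sub>\<Lambda> \<Psi> x)" for b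
    using wc[of b] by (intro integrable_wedge_bounded(1) differential_integrable comp) (simp add: weakly_closed_def)
  then have "(LINT x|lebesgue. exterior_field (\<lambda>i. partial_deriv i \<phi>) x \<and>\<^sub>\<Lambda> \<Psi> x)
      = (\<Sum>b\<in>Basis. (LINT x|lebesgue. differential (\<lambda>x. \<phi> x \<bullet> b) x \<and>\<^sub>\<Lambda> b \<and>\<^sub>\<Lambda> \<Psi> x))"
    unfolding eq by (intro Bochner_Integration.integral_sum)
  also have "\<dots> = 0"
    using wc comp by (simp add: weakly_closed_def)
  finally show "(LINT x|lebesgue. exterior_field (\<lambda>i. partial_deriv i \<phi>) x \<and>\<^sub>\<Lambda> \<Psi> x) = 0" .
qed

lemma exterior_field_integrable:
  assumes "approximable_gradient v"
  shows "integrable lebesgue (exterior_field v)" "bounded_measurable (exterior_field v)"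
  using assms unfolding exterior_field_def[abs_def] approximable_gradient_def
  by (auto intro!: bounded_measurable_sum bounded_measurable_wedge bounded_measurable_const
      Bochner_Integration.integrable_sum integrable_wedge_bounded(2))

lemma tendsto_integral_exterior_field:
  fixes v :: "'n::{finite,linorder} \<Rightarrow> 'n form_field"
  assumes "approximable_gradient v" "bounded_measurable h" "bounded_measurable g"
  obtains \<phi> where "\<And>m. \<phi> m \<in> C1_compact UNIV"
    "(\<lambda>m. LINT x|lebesgue. h x \<and>\<^sub>\<Lambda> exterior_field (\<lambda>i. partial_deriv i (\<phi> m)) x \<and>\<^sub>\<Lambda> g x)
      \<longlonglongrightarrow> (LINT x|lebesgue. h x \<and>\<^sub>\<Lambda> exterior_field v x \<and>\<^sub>\<Lambda> g x)"
proof -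
  obtain \<phi> where \<phi>: "\<And>m. \<phi> m \<in> C1_compact UNIV"
    "\<And>i. (\<lambda>m. LINT x|lebesgue. norm (partial_deriv i (\<phi> m) x - v i x)) \<longlonglongrightarrow> 0"
    using assms(1) unfolding approximable_gradient_def by blast
  let ?h = "\<lambda>i x. h x \<and>\<^sub>\<Lambda> one_form (axis i 1)"
  have h: "bounded_measurable (?h i)" for i
    by (intro bounded_measurable_wedge bounded_measurable_const assms)
  have int_v: "integrable lebesgue (v i)" for i
    using assms(1) by (simp add: approximable_gradient_def)
  have int_\<phi>: "integrable lebesgue (partial_deriv i (\<phi> m))" for i m
    by (rule C1_compact_partial(2)[OF \<phi>(1)])
  have eq: "(LINT x|lebesgue. h x \<and>\<^sub>\<Lambda> exterior_field w x \<and>\<^sub>\<Lambda> g x)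
      = (\<Sum>i\<in>UNIV. (LINT x|lebesgue. ?h i x \<and>\<^sub>\<Lambda> w i x \<and>\<^sub>\<Lambda> g x))" if "\<And>i. integrable lebesgue (w i)" for w
  proof -
    have "h x \<and>\<^sub>\<Lambda> exterior_field w x \<and>\<^sub>\<Lambda> g x = (\<Sum>i\<in>UNIV. ?h i x \<and>\<^sub>\<Lambda> w i x \<and>\<^sub>\<Lambda> g x)" for x
      by (simp add: exterior_field_def linear_sum[OF linear_wedge_left] linear_sum[OF linear_wedge_right] wedge_assoc)
    then show ?thesis
      using that assms(3) h by (simp add: Bochner_Integration.integral_sum integrable_wedge_bounded)
  qed
  show thesis
  proof (rule that[OF \<phi>(1)])
    show "(\<lambda>m. LINT x|lebesgue. h x \<and>\<^sub>\<Lambda> exterior_field (\<lambda>i. partial_deriv i (\<phi> m)) x \<and>\<^sub>\<Lambda> g x)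
      \<longlonglongrightarrow> (LINT x|lebesgue. h x \<and>\<^sub>\<Lambda> exterior_field v x \<and>\<^sub>\<Lambda> g x)"
      unfolding eq[OF int_v] eq[OF int_\<phi>]
      by (intro tendsto_sum tendsto_integral_wedge int_v int_\<phi> h assms(3) \<phi>(2))
  qed
qed

lemma weakly_closed_exterior_field:
  fixes \<Psi> :: "('n::{finite,linorder}) form_field"
  assumes "weakly_closed \<Psi>" "approximable_gradient v"
  shows "weakly_closed (\<lambda>x. exterior_field v x \<and>\<^sub>\<Lambda> \<Psi> x)"
    and "(LINT x|lebesgue. exterior_field v x \<and>\<^sub>\<Lambda> \<Psi> x) = 0"
proof -
  have \<Psi>: "bounded_measurable \<Psi>" using assms(1) by (simp add: weakly_closed_def)
  show "weakly_closed (\<lambda>x. exterior_field v x \<and>\<^sub>\<Lambda> \<Psi> x)"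
    unfolding weakly_closed_def
  proof (intro conjI ballI)
    show "bounded_measurable (\<lambda>x. exterior_field v x \<and>\<^sub>\<Lambda> \<Psi> x)"
      by (intro bounded_measurable_wedge exterior_field_integrable assms(2) \<Psi>)
    fix u :: "(real, 'n) vec \<Rightarrow> real" assume u: "u \<in> C1_compact UNIV"
    obtain \<phi> where \<phi>: "\<And>m. \<phi> m \<in> C1_compact UNIV"
      "(\<lambda>m. LINT x|lebesgue. differential u x \<and>\<^sub>\<Lambda> exterior_field (\<lambda>i. partial_deriv i (\<phi> m)) x \<and>\<^sub>\<Lambda> \<Psi> x)
        \<longlonglongrightarrow> (LINT x|lebesgue. differential u x \<and>\<^sub>\<Lambda> exterior_field v x \<and>\<^sub>\<Lambda> \<Psi> x)"
      by (rule tendsto_integral_exterior_field[OF assms(2) differential_integrable(2)[OF u] \<Psi>],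
          rule that, assumption+)
    moreover have "(LINT x|lebesgue. differential u x \<and>\<^sub>\<Lambda> exterior_field (\<lambda>i. partial_deriv i (\<phi> m)) x \<and>\<^sub>\<Lambda> \<Psi> x) = 0" for m
      using weakly_closed_exterior_field_C1(1)[OF assms(1) \<phi>(1)] u by (simp add: weakly_closed_def)
    ultimately show "(LINT x|lebesgue. differential u x \<and>\<^sub>\<Lambda> exterior_field v x \<and>\<^sub>\<Lambda> \<Psi> x) = 0"
      by (simp add: LIMSEQ_const_iff)
  qed
  obtain \<phi> where \<phi>: "\<And>m. \<phi> m \<in> C1_compact UNIV"
    "(\<lambda>m. LINT x|lebesgue. unit_form \<and>\<^sub>\<Lambda> exterior_field (\<lambda>i. partial_deriv i (\<phi> m)) x \<and>\<^sub>\<Lambda> \<Psi> x)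
      \<longlonglongrightarrow> (LINT x|lebesgue. unit_form \<and>\<^sub>\<Lambda> exterior_field v x \<and>\<^sub>\<Lambda> \<Psi> x)"
    by (rule tendsto_integral_exterior_field[OF assms(2) bounded_measurable_const[of unit_form] \<Psi>],
        rule that, assumption+)
  then show "(LINT x|lebesgue. exterior_field v x \<and>\<^sub>\<Lambda> \<Psi> x) = 0"
    by (simp add: weakly_closed_exterior_field_C1(2)[OF assms(1) \<phi>(1)] LIMSEQ_const_iff)
qed

lemma weakly_closed_power:
  fixes \<zeta> :: "'n::{finite,linorder} form"
  assumes "approximable_gradient v"
  shows "weakly_closed (\<lambda>x. wedge_power (\<zeta> + exterior_field v x) s)"
proof (induction s)
  case 0
  show ?case by (simp add: weakly_closed_const)
next
  case (Suc s)
  show ?case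
    by (simp add: wedge_add_left)
       (intro weakly_closed_add weakly_closed_wedge_const weakly_closed_exterior_field Suc assms)
qed

text \<open>
  The telescoping identity \<open>(\<zeta> + U)\<^sup>s\<^sup>+\<^sup>1 - \<zeta>\<^sup>s\<^sup>+\<^sup>1 = U \<and> (\<zeta> + U)\<^sup>s + \<zeta> \<and> ((\<zeta> + U)\<^sup>s - \<zeta>\<^sup>s)\<close> keeps all integrands
  integrable, although the powers themselves are merely bounded on the whole space.
\<close>

lemma integral_power_exterior_field:
  fixes \<zeta> :: "'n::{finite,linorder} form"
  assumes "approximable_gradient v"
  shows "integrable lebesgue (\<lambda>x. wedge_power (\<zeta> + exterior_field v x) s - wedge_power \<zeta> s)"
    and "(LINT x|lebesgue. wedge_power (\<zeta> + exterior_field v x) s - wedge_power \<zeta> s) = 0"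
proof (induction s)
  case (Suc s)
  let ?P = "\<lambda>x. wedge_power (\<zeta> + exterior_field v x) s"
  case 1
  have eq: "wedge_power (\<zeta> + exterior_field v x) (Suc s) - wedge_power \<zeta> (Suc s)
      = exterior_field v x \<and>\<^sub>\<Lambda> ?P x + \<zeta> \<and>\<^sub>\<Lambda> (?P x - wedge_power \<zeta> s)" for x
    by (simp add: wedge_add_left wedge_diff_right)
  note wc = weakly_closed_power[OF assms, of \<zeta> s]
  have int1: "integrable lebesgue (\<lambda>x. exterior_field v x \<and>\<^sub>\<Lambda> ?P x)"
    using wc by (intro integrable_wedge_bounded(1) exterior_field_integrable assms) (simp add: weakly_closed_def)
  have int2: "integrable lebesgue (\<lambda>x. \<zeta> \<and>\<^sub>\<Lambda> (?P x - wedge_power \<zeta> s))"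
    by (intro integrable_wedge_bounded(2) Suc(1) bounded_measurable_const)
  show ?case
    unfolding eq by (intro Bochner_Integration.integrable_add int1 int2)
  case 2
  show ?case
    unfolding eq using weakly_closed_exterior_field(2)[OF wc assms] int1 int2
    by (simp add: integral_wedge_const(1)[OF Suc(1)] Suc(2))
qed simp_all

lemma approximable_gradient_bounded_linear:
  fixes v :: "'n::{finite,linorder} \<Rightarrow> 'n form_field"
  assumes "approximable_gradient v" "bounded_linear T"
  shows "approximable_gradient (\<lambda>i x. T (v i x))"
  unfolding approximable_gradient_def
proof (intro conjI allI)
  obtain K where K: "0 < K" "\<And>x. norm (T x) \<le> norm x * K"
    using bounded_linear.pos_bounded[OF assms(2)] by blast
  have v: "integrable lebesgue (v i)" "bounded_measurable (v i)" for i
    using assms(1) by (auto simp: approximable_gradient_def)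
  show "integrable lebesgue (\<lambda>x. T (v i x))" for i
    by (rule integrable_bounded_linear[OF assms(2) v(1)])
  show "bounded_measurable (\<lambda>x. T (v i x))" for i
  proof -
    obtain B where "\<And>x. norm (v i x) \<le> B" using v(2) unfolding bounded_measurable_def by blast
    then have "norm (T (v i x)) \<le> B * K" for x
      using K(1) by (intro order_trans[OF K(2)] mult_right_mono) auto
    moreover have "T \<in> borel_measurable borel"
      using linear_continuous_on[OF assms(2)] by (rule borel_measurable_continuous_onI)
    then have "(\<lambda>x. T (v i x)) \<in> borel_measurable lebesgue"
      using v(2) unfolding bounded_measurable_def by (auto intro: measurable_compose)
    ultimately show ?thesis unfolding bounded_measurable_def by blast
  qed
  obtain \<phi> where \<phi>: "\<And>m. \<phi> m \<in> C1_compact UNIV"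
    "\<And>i. (\<lambda>m. LINT x|lebesgue. norm (partial_deriv i (\<phi> m) x - v i x)) \<longlonglongrightarrow> 0"
    using assms(1) unfolding approximable_gradient_def by blast
  show "\<exists>\<phi>. (\<forall>m. \<phi> m \<in> C1_compact UNIV) \<and>
      (\<forall>i. (\<lambda>m. LINT x|lebesgue. norm (partial_deriv i (\<phi> m) x - T (v i x))) \<longlonglongrightarrow> 0)"
  proof (intro exI conjI allI)
    show "(\<lambda>x. T (\<phi> m x)) \<in> C1_compact UNIV" for m
      by (rule bounded_linear_C1_compact[OF assms(2) \<phi>(1)])
    fix i
    have int: "integrable lebesgue (\<lambda>x. partial_deriv i (\<phi> m) x - v i x)" for m
      by (intro Bochner_Integration.integrable_diff v C1_compact_partial(2)[OF \<phi>(1)])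
    have "C1 (\<phi> m)" for m using \<phi>(1) by (simp add: C1_compact_iff)
    then have eq: "partial_deriv i (\<lambda>x. T (\<phi> m x)) x - T (v i x) = T (partial_deriv i (\<phi> m) x - v i x)" for m x
      by (simp add: bounded_linear_partial_deriv(1)[OF assms(2)] linear_diff[OF bounded_linear.linear[OF assms(2)]])
    have bound: "norm (LINT x|lebesgue. norm (partial_deriv i (\<lambda>x. T (\<phi> m x)) x - T (v i x)))
        \<le> (LINT x|lebesgue. norm (partial_deriv i (\<phi> m) x - v i x)) * K" for m
    proof -
      have "(LINT x|lebesgue. norm (T (partial_deriv i (\<phi> m) x - v i x)))
          \<le> (LINT x|lebesgue. norm (partial_deriv i (\<phi> m) x - v i x) * K)"
        using K(2) by (intro integral_mono integrable_norm integrable_bounded_linear[OF assms(2)] int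
            integrable_mult_left)
      then show ?thesis by (simp add: eq)
    qed
    have "(\<lambda>m. (LINT x|lebesgue. norm (partial_deriv i (\<phi> m) x - v i x)) * K) \<longlonglongrightarrow> 0"
      by (rule tendsto_mult_left_zero[OF \<phi>(2)])
    then show "(\<lambda>m. LINT x|lebesgue. norm (partial_deriv i (\<lambda>x. T (\<phi> m x)) x - T (v i x))) \<longlonglongrightarrow> 0"
      by (rule Lim_null_comparison[OF always_eventually[OF allI[OF bound]]])
  qed
qed

section \<open>Linear combinations of exterior powers are quasiaffine\<close>

lemma borel_measurable_lebesgue_AE_eq:
  fixes f g :: "'a::euclidean_space \<Rightarrow> 'b::euclidean_space"
  assumes "f \<in> borel_measurable lebesgue" "AE x in lebesgue. f x = g x"
  shows "g \<in> borel_measurable lebesgue"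
proof (rule measurableI)
  fix A :: "'b set" assume A: "A \<in> sets borel"
  have N: "negligible {x. f x \<noteq> g x}"
    using assms(2) by (simp add: negligible_iff_null_sets completion.AE_iff_null_sets)
  have 1: "f -` A \<inter> space lebesgue \<in> sets lebesgue"
    using assms(1) A by (rule measurable_sets)
  have eq: "g -` A \<inter> space lebesgue = (f -` A \<inter> space lebesgue - {x. f x \<noteq> g x}) \<union> (g -` A \<inter> {x. f x \<noteq> g x})"
    by auto
  have 2: "{x. f x \<noteq> g x} \<in> sets lebesgue" "g -` A \<inter> {x. f x \<noteq> g x} \<in> sets lebesgue"
    using N negligible_subset[OF N] by (auto intro!: negligible_imp_sets)
  show "g -` A \<inter> space lebesgue \<in> sets lebesgue"
    unfolding eq by (intro sets.Un sets.Diff 1 2)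
qed auto

lemma is_weak_deriv_bounded_linear:
  fixes u v :: "real^'n \<Rightarrow> 'b::euclidean_space" and T :: "'b \<Rightarrow> 'c::euclidean_space"
  assumes "is_weak_deriv \<Omega> i u v" "bounded_linear T"
  shows "is_weak_deriv \<Omega> i (\<lambda>x. T (u x)) (\<lambda>x. T (v x))"
proof -
  note lin = bounded_linear.linear[OF assms(2)]
  have loc: "locally_integrable lebesgue \<Omega> u" "locally_integrable lebesgue \<Omega> v"
    using assms(1) by (auto simp: is_weak_deriv_def)
  have loc_T: "locally_integrable lebesgue \<Omega> (\<lambda>x. T (w x))" if "locally_integrable lebesgue \<Omega> w" for w
    unfolding locally_integrable_def
  proof (intro allI impI)
    fix K assume "compact K \<and> K \<subseteq> \<Omega>"
    with that have "integrable lebesgue (\<lambda>x. indicator K x *\<^sub>R w x)"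
      by (simp add: locally_integrable_def set_integrable_def)
    from integrable_bounded_linear[OF assms(2) this] show "set_integrable lebesgue K (\<lambda>x. T (w x))"
      by (simp add: set_integrable_def linear_scale[OF lin])
  qed
  have int_T: "(LINT x:\<Omega>|lebesgue. \<phi> x *\<^sub>R T (w x)) = T (LINT x:\<Omega>|lebesgue. \<phi> x *\<^sub>R w x)"
    if "locally_integrable lebesgue \<Omega> w" "continuous_on UNIV \<phi>" "compact K" "K \<subseteq> \<Omega>" "\<And>x. x \<notin> K \<Longrightarrow> \<phi> x = 0"
    for w \<phi> K
    using integral_bounded_linear[OF assms(2)
        locally_integrable_scaleR[OF that, unfolded set_integrable_def]]
    by (simp add: set_lebesgue_integral_def linear_scale[OF lin])
  show ?thesis
    unfolding is_weak_deriv_def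
  proof (intro conjI allI impI loc_T loc)
    fix \<phi> :: "real^'n \<Rightarrow> real" assume \<phi>: "\<phi> \<in> C1_compact \<Omega>"
    then obtain K where K: "C1 \<phi>" "compact K" "K \<subseteq> \<Omega>" "\<And>x. x \<notin> K \<Longrightarrow> \<phi> x = 0"
      unfolding C1_compact_iff by blast
    have "(LINT x:\<Omega>|lebesgue. partial_deriv i \<phi> x *\<^sub>R u x) = - (LINT x:\<Omega>|lebesgue. \<phi> x *\<^sub>R v x)"
      using assms(1) \<phi> unfolding is_weak_deriv_def by blast
    moreover have "(LINT x:\<Omega>|lebesgue. \<phi> x *\<^sub>R T (v x)) = T (LINT x:\<Omega>|lebesgue. \<phi> x *\<^sub>R v x)"
      by (rule int_T[OF loc(2) C1_continuous[OF K(1)] K(2-4)])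
    moreover have "(LINT x:\<Omega>|lebesgue. partial_deriv i \<phi> x *\<^sub>R T (u x)) = T (LINT x:\<Omega>|lebesgue. partial_deriv i \<phi> x *\<^sub>R u x)"
      by (rule int_T[OF loc(1) C1_continuous_partial[OF K(1)] K(2,3)]) (rule partial_deriv_outside[OF K(2,4)])
    ultimately show "(LINT x:\<Omega>|lebesgue. partial_deriv i \<phi> x *\<^sub>R T (u x)) = - (LINT x:\<Omega>|lebesgue. \<phi> x *\<^sub>R T (v x))"
      by (simp add: linear_neg[OF lin])
  qed
qed

lemma is_weak_deriv_cong:
  fixes u u' v :: "real^'n \<Rightarrow> 'b::euclidean_space"
  assumes "is_weak_deriv \<Omega> i u v" "\<And>x. x \<in> \<Omega> \<Longrightarrow> u x = u' x"
  shows "is_weak_deriv \<Omega> i u' v"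
proof -
  have "locally_integrable lebesgue \<Omega> u' = locally_integrable lebesgue \<Omega> u"
    using assms(2) unfolding locally_integrable_def
    by (intro all_cong1 imp_cong refl set_integrable_cong) (auto simp: subset_iff)
  moreover have "(LINT x:\<Omega>|lebesgue. \<phi> x *\<^sub>R u' x) = (LINT x:\<Omega>|lebesgue. \<phi> x *\<^sub>R u x)" for \<phi> :: "real^'n \<Rightarrow> real"
    using assms(2) unfolding set_lebesgue_integral_def
    by (intro Bochner_Integration.integral_cong) (auto simp: indicator_def)
  ultimately show ?thesis
    using assms(1) by (simp add: is_weak_deriv_def)
qed

text \<open>
  Truncation of a weak derivative that is essentially bounded gives a representative that is bounded
  everywhere. It takes its values in \<open>\<Lambda> k\<close> almost everywhere, because the component of degree \<open>k\<close> of a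
  weak derivative of \<open>\<omega>\<close> is again a weak derivative of \<open>\<omega>\<close>.
\<close>

lemma W_1_infinity_0_gradient:
  fixes \<omega> :: "'n::{finite,linorder} form_field"
  assumes \<omega>: "\<omega> \<in> W_1_infinity_0 \<Omega> k" and \<Omega>: "open \<Omega>" "bounded \<Omega>"
  obtains v where "approximable_gradient v" "\<And>i x. x \<notin> \<Omega> \<Longrightarrow> v i x = 0"
    "AE x in lebesgue. x \<in> \<Omega> \<longrightarrow> (\<forall>i. weak_deriv \<Omega> i \<omega> x = v i x \<and> v i x \<in> \<Lambda> k)"
proof -
  have lm: "\<Omega> \<in> lmeasurable" using \<Omega> by (intro lmeasurable_open)
  define P where "P i v C \<longleftrightarrow> is_weak_deriv \<Omega> i \<omega> v \<and> set_borel_measurable lebesgue \<Omega> v \<and>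
      (AE x in lebesgue. x \<in> \<Omega> \<longrightarrow> norm (v x) \<le> C)" for i v C
  have "\<exists>v C. P i v C" for i
    using \<omega> unfolding W_1_infinity_0_def W_1_infinity_def L_infinity_def P_def by blast
  then obtain v0 C where "\<And>i. P i (v0 i) (C i)" by metis
  then have v0: "\<And>i. is_weak_deriv \<Omega> i \<omega> (v0 i)" "\<And>i. set_borel_measurable lebesgue \<Omega> (v0 i)"
    "\<And>i. AE x in lebesgue. x \<in> \<Omega> \<longrightarrow> norm (v0 i x) \<le> C i"
    by (simp_all add: P_def)
  define w where "w i x = indicator \<Omega> x *\<^sub>R v0 i x" for i x
  define v where "v i x = (if norm (w i x) \<le> C i then w i x else 0)" for i x
  have w_meas: "w i \<in> borel_measurable lebesgue" for i
    using v0(2)[of i] by (simp add: w_def[abs_def] set_borel_measurable_def)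
  have v_meas: "v i \<in> borel_measurable lebesgue" for i
    unfolding v_def[abs_def] using w_meas[of i] by measurable
  have v_bound: "norm (v i x) \<le> \<bar>C i\<bar>" for i x by (auto simp: v_def)
  have v_out: "v i x = 0" if "x \<notin> \<Omega>" for i x using that by (simp add: v_def w_def)
  have v_int: "integrable lebesgue (v i)" for i
  proof (rule Bochner_Integration.integrable_bound[OF _ v_meas])
    show "integrable lebesgue (\<lambda>x. indicator \<Omega> x * \<bar>C i\<bar>)"
      using lm by (intro integrable_mult_left) (simp add: lmeasurable_iff_integrable)
    show "AE x in lebesgue. norm (v i x) \<le> norm (indicator \<Omega> x * \<bar>C i\<bar>)"
      using v_bound v_out by (intro AE_I2) (auto simp: indicator_def)
  qed
  have bl: "bounded_linear (deg_part k :: 'n form \<Rightarrow> 'n form)"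
    by (rule linear_conv_bounded_linear[THEN iffD1, OF linear_deg_part])
  have Lam: "AE x in lebesgue. x \<in> \<Omega> \<longrightarrow> v0 i x \<in> \<Lambda> k" for i
  proof -
    have "is_weak_deriv \<Omega> i \<omega> (\<lambda>x. deg_part k (v0 i x))"
    proof (rule is_weak_deriv_cong[OF is_weak_deriv_bounded_linear[OF v0(1) bl]])
      fix x assume "x \<in> \<Omega>"
      then have "\<omega> x \<in> \<Lambda> k" using \<omega> by (simp add: W_1_infinity_0_def W_1_infinity_def)
      then show "deg_part k (\<omega> x) = \<omega> x" by (rule deg_part_Lam)
    qed
    from weak_deriv_unique[OF \<Omega>(1) v0(1) this] show ?thesis
      by (elim AE_mp) (intro AE_I2 impI, metis deg_part_in_Lam)
  qed
  have AE_v: "AE x in lebesgue. x \<in> \<Omega> \<longrightarrow> weak_deriv \<Omega> i \<omega> x = v i x \<and> v i x \<in> \<Lambda> k" for i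
    using weak_deriv_AE_eq[OF \<Omega>(1) v0(1)] v0(3)[of i] Lam[of i]
    by eventually_elim (simp add: v_def w_def)
  obtain \<phi> where \<phi>: "\<And>m. \<phi> m \<in> C1_compact \<Omega>"
    "\<And>i. (\<lambda>m. LINT x:\<Omega>|lebesgue. norm (partial_deriv i (\<phi> m) x - weak_deriv \<Omega> i \<omega> x)) \<longlonglongrightarrow> 0"
    using \<omega> unfolding W_1_infinity_0_def W_1_1_0_def by blast
  have \<phi>_eq: "(LINT x:\<Omega>|lebesgue. norm (partial_deriv i (\<phi> m) x - weak_deriv \<Omega> i \<omega> x))
      = (LINT x|lebesgue. norm (partial_deriv i (\<phi> m) x - v i x))" for i m
  proof -
    have AE: "AE x in lebesgue. norm (partial_deriv i (\<phi> m) x - v i x)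
        = indicator \<Omega> x *\<^sub>R norm (partial_deriv i (\<phi> m) x - weak_deriv \<Omega> i \<omega> x)"
      using AE_v[of i] by eventually_elim
        (auto simp: indicator_def v_out C1_compact_partial(4)[OF \<phi>(1)])
    have meas: "(\<lambda>x. norm (partial_deriv i (\<phi> m) x - v i x)) \<in> borel_measurable lebesgue"
      using borel_measurable_integrable[OF C1_compact_partial(2)[OF \<phi>(1)[of m]]] v_meas[of i] by measurable
    show ?thesis
      unfolding set_lebesgue_integral_def
      using meas borel_measurable_lebesgue_AE_eq[OF meas AE] AE
      by (intro integral_cong_AE) auto
  qed
  show thesis
  proof (rule that[of v])
    show "approximable_gradient v"
      unfolding approximable_gradient_def
    proof (intro conjI allI exI[of _ \<phi>])
      show "integrable lebesgue (v i)" for i by (rule v_int)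
      show "bounded_measurable (v i)" for i
        using v_meas v_bound unfolding bounded_measurable_def by blast
      show "\<phi> m \<in> C1_compact UNIV" for m by (rule C1_compact_mono[OF \<phi>(1)]) simp
      show "(\<lambda>m. LINT x|lebesgue. norm (partial_deriv i (\<phi> m) x - v i x)) \<longlonglongrightarrow> 0" for i
        using \<phi>(2)[of i] unfolding \<phi>_eq .
    qed
    show "v i x = 0" if "x \<notin> \<Omega>" for i x using that by (rule v_out)
    show "AE x in lebesgue. x \<in> \<Omega> \<longrightarrow> (\<forall>i. weak_deriv \<Omega> i \<omega> x = v i x \<and> v i x \<in> \<Lambda> k)"
    proof -
      have "AE x in lebesgue. \<forall>i\<in>UNIV. x \<in> \<Omega> \<longrightarrow> weak_deriv \<Omega> i \<omega> x = v i x \<and> v i x \<in> \<Lambda> k"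
        by (rule AE_ball_countable'[OF AE_v]) (rule countable_finite, simp)
      then show ?thesis by eventually_elim blast
    qed
  qed
qed

lemma set_integral_power_exterior_field:
  fixes c \<zeta> :: "'n::{finite,linorder} form"
  assumes "approximable_gradient v" "\<And>i x. x \<notin> \<Omega> \<Longrightarrow> v i x = 0" "\<Omega> \<in> lmeasurable"
  shows "set_integrable lebesgue \<Omega> (\<lambda>x. c \<bullet> wedge_power (\<zeta> + exterior_field v x) s)"
    and "(LINT x:\<Omega>|lebesgue. c \<bullet> wedge_power (\<zeta> + exterior_field v x) s) = (c \<bullet> wedge_power \<zeta> s) * measure lebesgue \<Omega>"
proof -
  let ?D = "\<lambda>x. wedge_power (\<zeta> + exterior_field v x) s - wedge_power \<zeta> s"
  have eq: "indicator \<Omega> x *\<^sub>R (c \<bullet> wedge_power (\<zeta> + exterior_field v x) s)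
      = c \<bullet> ?D x + indicator \<Omega> x * (c \<bullet> wedge_power \<zeta> s)" for x
    using assms(2)[of x] by (auto simp: indicator_def inner_diff_right exterior_field_def)
  have int1: "integrable lebesgue (\<lambda>x. c \<bullet> ?D x)"
    by (intro integrable_inner_right integral_power_exterior_field assms)
  have int2: "integrable lebesgue (\<lambda>x. indicator \<Omega> x * (c \<bullet> wedge_power \<zeta> s))"
    using assms(3) by (intro integrable_mult_left) (simp add: lmeasurable_iff_integrable)
  show "set_integrable lebesgue \<Omega> (\<lambda>x. c \<bullet> wedge_power (\<zeta> + exterior_field v x) s)"
    unfolding set_integrable_def eq by (intro Bochner_Integration.integrable_add int1 int2)
  have "(LINT x|lebesgue. c \<bullet> ?D x) = c \<bullet> (LINT x|lebesgue. ?D x)"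
    by (rule integral_inner_right) (rule integral_power_exterior_field(1)[OF assms(1)])
  then have "(LINT x|lebesgue. c \<bullet> ?D x) = 0"
    by (simp add: integral_power_exterior_field(2)[OF assms(1)])
  then show "(LINT x:\<Omega>|lebesgue. c \<bullet> wedge_power (\<zeta> + exterior_field v x) s) = (c \<bullet> wedge_power \<zeta> s) * measure lebesgue \<Omega>"
    unfolding set_lebesgue_integral_def eq Bochner_Integration.integral_add[OF int1 int2]
    using assms(3) by (simp add: mult.commute)
qed

lemma power_sum_integral:
  fixes f :: "'n::{finite,linorder} form \<times> 'n form \<Rightarrow> real" and c d :: "nat \<Rightarrow> 'n form"
  assumes f: "\<And>\<xi> \<eta>. \<xi> \<in> \<Lambda> (k + 1) \<Longrightarrow> \<eta> \<in> \<Lambda> (k - 1) \<Longrightarrow>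
      f (\<xi>, \<eta>) = (\<Sum>s\<in>S. c s \<bullet> wedge_power \<xi> s) + (\<Sum>r\<in>R. d r \<bullet> wedge_power (\<star> \<eta>) r)"
    and k: "1 \<le> k" and \<Omega>: "open \<Omega>" "bounded \<Omega>" and \<omega>: "\<omega> \<in> W_1_infinity_0 \<Omega> k"
    and \<xi>: "\<xi> \<in> \<Lambda> (k + 1)" and \<eta>: "\<eta> \<in> \<Lambda> (k - 1)"
  shows "set_integrable lebesgue \<Omega> (\<lambda>x. f (\<xi> + ext_deriv \<Omega> \<omega> x, \<eta> + codifferential \<Omega> \<omega> x))"
    and "(LINT x:\<Omega>|lebesgue. f (\<xi> + ext_deriv \<Omega> \<omega> x, \<eta> + codifferential \<Omega> \<omega> x))
      = f (\<xi>, \<eta>) * measure lebesgue \<Omega>"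
proof -
  have lm: "\<Omega> \<in> lmeasurable" using \<Omega> by (intro lmeasurable_open)
  obtain v where v: "approximable_gradient v" "\<And>i x. x \<notin> \<Omega> \<Longrightarrow> v i x = 0"
    "AE x in lebesgue. x \<in> \<Omega> \<longrightarrow> (\<forall>i. weak_deriv \<Omega> i \<omega> x = v i x \<and> v i x \<in> \<Lambda> k)"
    by (rule W_1_infinity_0_gradient[OF \<omega> \<Omega>], rule that, assumption+)
  \<comment> \<open>Up to a sign, the Hodge star turns the codifferential of \<open>\<omega>\<close> into the exterior derivative of \<open>\<star> \<omega>\<close>.\<close>
  define T where "T \<beta> = (- 1) ^ (k + 1) *\<^sub>R \<star> \<beta>" for \<beta> :: "'n form"
  define v' where "v' i x = T (v i x)" for i x
  have T: "linear T"
    unfolding T_def by (intro linear_compose_scale_right linear_hodge)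
  then have "bounded_linear T" by (simp add: linear_conv_bounded_linear)
  then have v': "approximable_gradient v'"
    unfolding v'_def[abs_def] by (rule approximable_gradient_bounded_linear[OF v(1)])
  have v'_out: "v' i x = 0" if "x \<notin> \<Omega>" for i x
    using that by (simp add: v'_def v(2) linear_0[OF T])
  define G where "G x = (\<Sum>s\<in>S. c s \<bullet> wedge_power (\<xi> + exterior_field v x) s)
      + (\<Sum>r\<in>R. d r \<bullet> wedge_power (\<star> \<eta> + exterior_field v' x) r)" for x
  note I = set_integral_power_exterior_field[OF v(1) v(2) lm] set_integral_power_exterior_field[OF v' v'_out lm]
  have G_sum: "indicator \<Omega> x *\<^sub>R G x
      = (\<Sum>s\<in>S. indicator \<Omega> x *\<^sub>R (c s \<bullet> wedge_power (\<xi> + exterior_field v x) s))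
      + (\<Sum>r\<in>R. indicator \<Omega> x *\<^sub>R (d r \<bullet> wedge_power (\<star> \<eta> + exterior_field v' x) r))" for x
    by (simp add: G_def sum_distrib_left distrib_left)
  have G_int: "integrable lebesgue (\<lambda>x. indicator \<Omega> x *\<^sub>R G x)"
    unfolding G_sum using I(1,3)
    by (intro Bochner_Integration.integrable_add Bochner_Integration.integrable_sum) (simp_all add: set_integrable_def)
  have G_val: "(LINT x|lebesgue. indicator \<Omega> x *\<^sub>R G x) = f (\<xi>, \<eta>) * measure lebesgue \<Omega>"
    unfolding G_sum f[OF \<xi> \<eta>] using I
    by (simp add: Bochner_Integration.integral_add Bochner_Integration.integral_sum Bochner_Integration.integrable_sum
        set_integrable_def set_lebesgue_integral_def sum_distrib_right distrib_right)
  let ?f = "\<lambda>x. indicator \<Omega> x *\<^sub>R f (\<xi> + ext_deriv \<Omega> \<omega> x, \<eta> + codifferential \<Omega> \<omega> x)"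
  have AE: "AE x in lebesgue. indicator \<Omega> x *\<^sub>R G x = ?f x"
    using v(3)
  proof eventually_elim
    fix x assume v_x: "x \<in> \<Omega> \<longrightarrow> (\<forall>i. weak_deriv \<Omega> i \<omega> x = v i x \<and> v i x \<in> \<Lambda> k)"
    show "indicator \<Omega> x *\<^sub>R G x = ?f x"
    proof (cases "x \<in> \<Omega>")
      case True
      with v_x have vx: "weak_deriv \<Omega> i \<omega> x = v i x" "v i x \<in> \<Lambda> k" for i by auto
      have ext: "ext_deriv \<Omega> \<omega> x = exterior_field v x"
        by (simp add: ext_deriv_def exterior_field_def vx)
      have codiff: "\<star> (codifferential \<Omega> \<omega> x) = exterior_field v' x"
        by (simp add: codifferential_def exterior_field_def vx linear_sum[OF linear_hodge]
            hodge_int_prod[OF vx(2)] v'_def T_def wedge_scaleR_right wedge_minus_right)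
      have "\<xi> + ext_deriv \<Omega> \<omega> x \<in> \<Lambda> (k + 1)"
        unfolding ext_deriv_def vx using \<xi> one_form_wedge_Lam[OF vx(2)]
        by (intro subspace_add[OF subspace_Lam] subspace_sum[OF subspace_Lam]) auto
      moreover have "\<eta> + codifferential \<Omega> \<omega> x \<in> \<Lambda> (k - 1)"
        unfolding codifferential_def vx using \<eta> int_prod_Lam[OF vx(2) k]
        by (intro subspace_add[OF subspace_Lam] subspace_sum[OF subspace_Lam]) auto
      ultimately show ?thesis
        by (simp add: f G_def linear_add[OF linear_hodge] codiff ext)
    qed simp
  qed
  have AE': "AE x in lebesgue. ?f x = indicator \<Omega> x *\<^sub>R G x"
    using AE by eventually_elim (simp only:)
  have f_meas: "?f \<in> borel_measurable lebesgue"
    by (rule borel_measurable_lebesgue_AE_eq[OF borel_measurable_integrable[OF G_int] AE])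
  show "set_integrable lebesgue \<Omega> (\<lambda>x. f (\<xi> + ext_deriv \<Omega> \<omega> x, \<eta> + codifferential \<Omega> \<omega> x))"
    unfolding set_integrable_def by (rule integrable_cong_AE_imp[OF G_int f_meas AE])
  have "integral\<^sup>L lebesgue ?f = (LINT x|lebesgue. indicator \<Omega> x *\<^sub>R G x)"
    by (rule integral_cong_AE[OF f_meas borel_measurable_integrable[OF G_int] AE'])
  with G_val show "(LINT x:\<Omega>|lebesgue. f (\<xi> + ext_deriv \<Omega> \<omega> x, \<eta> + codifferential \<Omega> \<omega> x))
      = f (\<xi>, \<eta>) * measure lebesgue \<Omega>"
    by (simp add: set_lebesgue_integral_def)
qed

lemma continuous_on_wedge_power:
  fixes h :: "'a::topological_space \<Rightarrow> 'n::{finite,linorder} form"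
  assumes "continuous_on A h"
  shows "continuous_on A (\<lambda>x. wedge_power (h x) s)"
  by (induction s) (auto intro!: continuous_intros bounded_bilinear.continuous_on[OF bounded_bilinear_wedge] assms)

text \<open>In coordinates, a bounded set lies in a cube.\<close>

lemma emeasure_coordinate_lborel_bounded:
  fixes V :: "'a::euclidean_space set"
  assumes "bounded K" "K \<in> sets borel"
  shows "emeasure (coordinate_lborel V) K < \<infinity>"
proof -
  let ?B = "Basis \<inter> V"
  let ?P = "\<Pi>\<^sub>M b\<in>?B. lborel :: real measure"
  let ?\<sigma> = "\<lambda>x. \<Sum>b\<in>?B. x b *\<^sub>R b"
  interpret product_sigma_finite "\<lambda>_::'a. lborel :: real measure" ..
  have fin: "finite ?B" by simp
  obtain R where R: "\<And>z. z \<in> K \<Longrightarrow> norm z \<le> R"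
    using assms(1) by (auto simp: bounded_iff)
  have meas: "?\<sigma> \<in> measurable ?P borel"
    by measurable
  have "emeasure (coordinate_lborel V) K = emeasure ?P (?\<sigma> -` K \<inter> space ?P)"
    unfolding coordinate_lborel_def by (rule emeasure_distr[OF meas assms(2)])
  also have "\<dots> \<le> emeasure ?P (Pi\<^sub>E ?B (\<lambda>_. {- R..R}))"
  proof (rule emeasure_mono)
    show "?\<sigma> -` K \<inter> space ?P \<subseteq> Pi\<^sub>E ?B (\<lambda>_. {- R..R})"
    proof
      fix x assume x: "x \<in> ?\<sigma> -` K \<inter> space ?P"
      have "x b \<in> {- R..R}" if "b \<in> ?B" for b
      proof -
        have "?\<sigma> x \<bullet> b = (\<Sum>b'\<in>?B. if b' = b then x b' else 0)"
          unfolding inner_sum_left using that by (intro sum.cong) (auto simp: inner_Basis)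
        also have "\<dots> = x b" using that by simp
        finally have "\<bar>x b\<bar> \<le> norm (?\<sigma> x)"
          using that Basis_le_norm[of b "?\<sigma> x"] by simp
        also have "\<dots> \<le> R" using x R by simp
        finally show ?thesis by auto
      qed
      with x show "x \<in> Pi\<^sub>E ?B (\<lambda>_. {- R..R})" by (auto simp: space_PiM PiE_iff)
    qed
    show "Pi\<^sub>E ?B (\<lambda>_. {- R..R}) \<in> sets ?P"
      using fin by (intro sets_PiM_I_finite) auto
  qed
  also have "\<dots> = (\<Prod>b\<in>?B. emeasure lborel {- R..R})"
    by (rule emeasure_PiM[OF fin]) simp
  also have "\<dots> < \<infinity>"
    unfolding emeasure_lborel_Icc_eq by (subst prod_ennreal) auto
  finally show ?thesis .
qed

lemma exterior_power_sum_imp_quasiconvex: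
  fixes f :: "'n::{finite,linorder} form \<times> 'n form \<Rightarrow> real"
  assumes "exterior_power_sum k f" "1 \<le> k"
  shows "ext_int_quasiconvex k f"
proof -
  let ?S = "{0..CARD('n) div (k + 1)}" and ?R = "{0..CARD('n) div (CARD('n) - k + 1)}"
  let ?V = "\<Lambda> (k + 1) \<times> \<Lambda> (k - 1) :: ('n form \<times> 'n form) set"
  obtain c d :: "nat \<Rightarrow> 'n form" where f: "\<And>\<xi> \<eta>. \<xi> \<in> \<Lambda> (k + 1) \<Longrightarrow> \<eta> \<in> \<Lambda> (k - 1) \<Longrightarrow>
      f (\<xi>, \<eta>) = (\<Sum>s\<in>?S. c s \<bullet> wedge_power \<xi> s) + (\<Sum>r\<in>?R. d r \<bullet> wedge_power (\<star> \<eta>) r)"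
    using assms(1) unfolding exterior_power_sum_def by blast
  define F where "F z = (\<Sum>s\<in>?S. c s \<bullet> wedge_power (fst z) s) + (\<Sum>r\<in>?R. d r \<bullet> wedge_power (\<star> (snd z)) r)" for z
  have f_F: "f z = F z" if "z \<in> ?V" for z
    using that f by (cases z) (simp add: F_def)
  have "bounded_linear (\<star> :: 'n form \<Rightarrow> 'n form)"
    using linear_hodge by (simp add: linear_conv_bounded_linear)
  then have "continuous_on UNIV (\<lambda>z :: 'n form \<times> 'n form. \<star> (snd z))"
    by (rule bounded_linear.continuous_on) (intro continuous_intros)
  then have F_cont: "continuous_on UNIV F"
    unfolding F_def
    by (intro continuous_on_add continuous_on_sum continuous_on_inner continuous_on_const
        continuous_on_wedge_power continuous_on_fst continuous_on_id)
  then have F_meas: "F \<in> borel_measurable borel"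
    by (rule borel_measurable_continuous_onI)
  have "locally_integrable (coordinate_lborel ?V) ?V f"
    unfolding locally_integrable_def
  proof (intro allI impI)
    fix K assume K: "compact K \<and> K \<subseteq> ?V"
    have eq: "(\<lambda>z. indicator K z *\<^sub>R f z) = (\<lambda>z. indicator K z *\<^sub>R F z)"
      using K f_F by (auto simp: fun_eq_iff indicator_def)
    have "bounded (F ` K)"
      using K F_cont by (intro compact_imp_bounded compact_continuous_image) (auto intro: continuous_on_subset)
    then obtain B where B: "\<And>z. z \<in> K \<Longrightarrow> norm (F z) \<le> B" by (auto simp: bounded_iff)
    have sets: "sets (coordinate_lborel ?V) = sets borel" by (simp add: coordinate_lborel_def)
    show "set_integrable (coordinate_lborel ?V) K f"
      unfolding set_integrable_def eq
    proof (rule integrableI_bounded_set_indicator[where B = B])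
      show "K \<in> sets (coordinate_lborel ?V)" using K sets by (simp add: borel_compact)
      show "F \<in> borel_measurable (coordinate_lborel ?V)" using F_meas measurable_cong_sets[OF sets refl] by blast
      show "emeasure (coordinate_lborel ?V) K < \<infinity>"
        using K by (intro emeasure_coordinate_lborel_bounded) (auto intro: compact_imp_bounded borel_compact)
      show "AE z in coordinate_lborel ?V. z \<in> K \<longrightarrow> norm (F z) \<le> B" using B by simp
    qed
  qed
  moreover have "f \<in> borel_measurable (restrict_space borel ?V)"
    using measurable_restrict_space1[OF F_meas]
    by (rule measurable_cong[THEN iffD1, rotated]) (simp add: space_restrict_space f_F)
  ultimately show ?thesis
    unfolding ext_int_quasiconvex_def
    using power_sum_integral[where f = f, OF f assms(2)] by auto
qed

section \<open>Pyramids: minima of affine functions as Sobolev functions\<close>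

text \<open>
  The log-sum-exp approximation from below of the minimum of the affine functions \<open>1 + g \<bullet> x\<close>; its error
  is at most \<open>ln (card G) / \<mu>\<close>.
\<close>

definition soft_min :: "(real^'n) set \<Rightarrow> real \<Rightarrow> real^'n \<Rightarrow> real" where
  "soft_min G \<mu> x = - ln (\<Sum>g\<in>G. exp (- \<mu> * (1 + g \<bullet> x))) / \<mu>"

text \<open>
  The gradient of the soft minimum is the mean of \<open>G\<close> with these weights, which concentrate on the
  minimiser for \<open>\<mu> \<rightarrow> \<infinity>\<close>.
\<close>

definition soft_weight :: "(real^'n) set \<Rightarrow> real \<Rightarrow> real^'n \<Rightarrow> real^'n \<Rightarrow> real" where
  "soft_weight G \<mu> x g = exp (- \<mu> * (1 + g \<bullet> x)) / (\<Sum>g\<in>G. exp (- \<mu> * (1 + g \<bullet> x)))"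

context
  fixes G :: "(real^'n) set"
  assumes G: "finite G" "G \<noteq> {}"
begin

lemma exp_sum_pos: "0 < (\<Sum>g\<in>G. exp (- \<mu> * (1 + g \<bullet> x)))"
  using G by (intro sum_pos) auto

lemma soft_min_le:
  assumes "0 < \<mu>" "g \<in> G"
  shows "soft_min G \<mu> x \<le> 1 + g \<bullet> x"
proof -
  have "exp (- \<mu> * (1 + g \<bullet> x)) \<le> (\<Sum>g\<in>G. exp (- \<mu> * (1 + g \<bullet> x)))"
    using assms(2) G by (intro member_le_sum) auto
  then have "- \<mu> * (1 + g \<bullet> x) \<le> ln (\<Sum>g\<in>G. exp (- \<mu> * (1 + g \<bullet> x)))"
    using exp_sum_pos by (simp add: ln_ge_iff)
  then show ?thesis
    using assms(1) by (simp add: soft_min_def field_simps)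
qed

lemma soft_min_ge:
  assumes "0 < \<mu>" "\<And>g. g \<in> G \<Longrightarrow> a \<le> 1 + g \<bullet> x"
  shows "a - ln (card G) / \<mu> \<le> soft_min G \<mu> x"
proof -
  have "(\<Sum>g\<in>G. exp (- \<mu> * (1 + g \<bullet> x))) \<le> (\<Sum>g\<in>G. exp (- \<mu> * a))"
    using assms by (intro sum_mono) auto
  then have "ln (\<Sum>g\<in>G. exp (- \<mu> * (1 + g \<bullet> x))) \<le> ln (card G * exp (- \<mu> * a))"
    using exp_sum_pos by (intro ln_mono) auto
  also have "\<dots> = ln (card G) - \<mu> * a"
    using G by (subst ln_mult) (auto simp: card_gt_0_iff)
  finally have "(\<mu> * a - ln (card G)) / \<mu> \<le> (- ln (\<Sum>g\<in>G. exp (- \<mu> * (1 + g \<bullet> x)))) / \<mu>"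
    using assms(1) by (intro divide_right_mono) auto
  then show ?thesis
    using assms(1) by (simp add: soft_min_def diff_divide_distrib)
qed

lemma soft_min_C1:
  assumes "0 < \<mu>"
  shows "C1 (soft_min G \<mu>)" "partial_deriv i (soft_min G \<mu>) x = (\<Sum>g\<in>G. soft_weight G \<mu> x g * g $ i)"
proof -
  have deriv: "(soft_min G \<mu> has_derivative (\<lambda>e. \<Sum>g\<in>G. soft_weight G \<mu> x g * (g \<bullet> e))) (at x)" for x
  proof -
    let ?S = "\<lambda>x. \<Sum>g\<in>G. exp (- \<mu> * (1 + g \<bullet> x))"
    have "(?S has_derivative (\<lambda>e. \<Sum>g\<in>G. exp (- \<mu> * (1 + g \<bullet> x)) * (- \<mu> * (g \<bullet> e)))) (at x)"
      by (auto intro!: derivative_eq_intros simp: fun_eq_iff mult_ac)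
    then have "((\<lambda>x. ln (?S x)) has_derivative
        (\<lambda>e. (\<Sum>g\<in>G. exp (- \<mu> * (1 + g \<bullet> x)) * (- \<mu> * (g \<bullet> e))) * inverse (?S x))) (at x)"
      by (rule has_derivative_ln[where g = ?S, OF exp_sum_pos])
    then have "((\<lambda>x. - ln (?S x) / \<mu>) has_derivative
        (\<lambda>e. - ((\<Sum>g\<in>G. exp (- \<mu> * (1 + g \<bullet> x)) * (- \<mu> * (g \<bullet> e))) * inverse (?S x)) / \<mu>)) (at x)"
      by (intro bounded_linear.has_derivative[OF bounded_linear_divide] has_derivative_minus)
    moreover have "- ((\<Sum>g\<in>G. exp (- \<mu> * (1 + g \<bullet> x)) * (- \<mu> * (g \<bullet> e))) * inverse (?S x)) / \<mu>
        = (\<Sum>g\<in>G. soft_weight G \<mu> x g * (g \<bullet> e))" for e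
    proof -
      have "(\<Sum>g\<in>G. exp (- \<mu> * (1 + g \<bullet> x)) * (- \<mu> * (g \<bullet> e))) = - \<mu> * (\<Sum>g\<in>G. exp (- \<mu> * (1 + g \<bullet> x)) * (g \<bullet> e))"
        by (simp add: sum_distrib_left mult_ac)
      then have "- ((\<Sum>g\<in>G. exp (- \<mu> * (1 + g \<bullet> x)) * (- \<mu> * (g \<bullet> e))) * inverse (?S x)) / \<mu>
          = (\<Sum>g\<in>G. exp (- \<mu> * (1 + g \<bullet> x)) * (g \<bullet> e)) / ?S x"
        using assms by (simp only: divide_inverse) simp
      then show ?thesis by (simp add: soft_weight_def sum_divide_distrib)
    qed
    ultimately show ?thesis by (simp add: soft_min_def[abs_def])
  qed
  have weight_cont: "continuous_on UNIV (\<lambda>x. soft_weight G \<mu> x g)" for g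
    unfolding soft_weight_def using exp_sum_pos by (intro continuous_intros) (metis less_irrefl)
  show "C1 (soft_min G \<mu>)"
    by (rule C1_I[OF deriv]) (intro continuous_intros weight_cont)
  show "partial_deriv i (soft_min G \<mu>) x = (\<Sum>g\<in>G. soft_weight G \<mu> x g * g $ i)"
    using partial_deriv_eqI[OF deriv, of i x] by (simp add: inner_axis)
qed

lemma soft_weight_bounds:
  assumes "g \<in> G"
  shows "0 \<le> soft_weight G \<mu> x g" "soft_weight G \<mu> x g \<le> 1"
proof -
  have "exp (- \<mu> * (1 + g \<bullet> x)) \<le> (\<Sum>g\<in>G. exp (- \<mu> * (1 + g \<bullet> x)))"
    using assms G by (intro member_le_sum) auto
  then show "0 \<le> soft_weight G \<mu> x g" "soft_weight G \<mu> x g \<le> 1"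
    using exp_sum_pos[of \<mu> x] by (auto simp: soft_weight_def divide_simps)
qed

lemma soft_weight_le_exp:
  assumes "g \<in> G" "g' \<in> G"
  shows "soft_weight G \<mu> x g \<le> exp (- \<mu> * (g \<bullet> x - g' \<bullet> x))"
proof -
  have "exp (- \<mu> * (1 + g' \<bullet> x)) \<le> (\<Sum>g\<in>G. exp (- \<mu> * (1 + g \<bullet> x)))"
    using assms G by (intro member_le_sum) auto
  then have "soft_weight G \<mu> x g \<le> exp (- \<mu> * (1 + g \<bullet> x)) / exp (- \<mu> * (1 + g' \<bullet> x))"
    unfolding soft_weight_def by (intro divide_left_mono mult_pos_pos exp_sum_pos) auto
  also have "\<dots> = exp (- \<mu> * (g \<bullet> x - g' \<bullet> x))"
    by (simp add: exp_diff[symmetric] algebra_simps)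
  finally show ?thesis .
qed

lemma soft_weight_sum: "(\<Sum>g\<in>G. soft_weight G \<mu> x g) = 1"
  using exp_sum_pos[of \<mu> x] by (simp add: soft_weight_def flip: sum_divide_distrib)

lemma soft_weight_tendsto:
  assumes "g0 \<in> G" "\<And>g. g \<in> G - {g0} \<Longrightarrow> g0 \<bullet> x < g \<bullet> x"
  shows "g \<in> G - {g0} \<Longrightarrow> (\<lambda>m. soft_weight G (real (Suc m)) x g) \<longlonglongrightarrow> 0"
    and "(\<lambda>m. soft_weight G (real (Suc m)) x g0) \<longlonglongrightarrow> 1"
proof -
  show other: "(\<lambda>m. soft_weight G (real (Suc m)) x g) \<longlonglongrightarrow> 0" if g: "g \<in> G - {g0}" for g
  proof (rule tendsto_sandwich[OF _ _ tendsto_const])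
    define q where "q = exp (- (g \<bullet> x - g0 \<bullet> x))"
    have "exp (- real (Suc m) * (g \<bullet> x - g0 \<bullet> x)) = q ^ Suc m" for m
      by (simp only: q_def exp_of_nat_mult[symmetric]) (simp add: algebra_simps)
    then show "\<forall>\<^sub>F m in sequentially. soft_weight G (real (Suc m)) x g \<le> q ^ Suc m"
      using soft_weight_le_exp[of g g0] g assms(1) by (intro always_eventually allI) (metis DiffD1)
    show "(\<lambda>m. q ^ Suc m) \<longlonglongrightarrow> 0"
      using assms(2)[OF g] by (intro LIMSEQ_Suc LIMSEQ_realpow_zero) (auto simp: q_def)
    show "\<forall>\<^sub>F m in sequentially. 0 \<le> soft_weight G (real (Suc m)) x g"
      using soft_weight_bounds(1) g by auto
  qed
  have "soft_weight G \<mu> x g0 = 1 - (\<Sum>g\<in>G - {g0}. soft_weight G \<mu> x g)" for \<mu>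
    using soft_weight_sum[of \<mu> x] assms(1) G by (simp add: sum.remove)
  moreover have "(\<lambda>m. 1 - (\<Sum>g\<in>G - {g0}. soft_weight G (real (Suc m)) x g)) \<longlonglongrightarrow> 1 - (\<Sum>g\<in>G - {g0}. 0)"
    by (intro tendsto_intros other)
  ultimately show "(\<lambda>m. soft_weight G (real (Suc m)) x g0) \<longlonglongrightarrow> 1"
    by simp
qed

end

text \<open>
  A \<open>C\<^sup>1\<close> approximation of the positive part. It vanishes for \<open>t \<le> \<delta>\<close>, and not only for \<open>t \<le> 0\<close>, so that the
  composition with the soft minimum has compact support in the open base of the pyramid.
\<close>

definition soft_pos :: "real \<Rightarrow> real \<Rightarrow> real" where
  "soft_pos \<delta> t = sqrt (\<delta>\<^sup>2 + (max 0 (t - \<delta>))\<^sup>2) - \<delta>"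

lemma has_real_derivative_soft_pos:
  assumes "0 < \<delta>"
  shows "(soft_pos \<delta> has_real_derivative max 0 (t - \<delta>) / sqrt (\<delta>\<^sup>2 + (max 0 (t - \<delta>))\<^sup>2)) (at t)"
proof -
  have pos: "0 < \<delta>\<^sup>2 + (max 0 (t - \<delta>))\<^sup>2"
    using assms by (simp add: add_pos_nonneg)
  have "((\<lambda>t. (max 0 (t - \<delta>))\<^sup>2) has_real_derivative 2 * max 0 (t - \<delta>) * 1) (at t)"
    by (rule DERIV_chain2[OF has_real_derivative_square_pos]) (auto intro!: derivative_eq_intros)
  then have "((\<lambda>t. \<delta>\<^sup>2 + (max 0 (t - \<delta>))\<^sup>2) has_real_derivative 0 + 2 * max 0 (t - \<delta>) * 1) (at t)"
    by (intro DERIV_add DERIV_const)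
  then have "((\<lambda>t. \<delta>\<^sup>2 + (max 0 (t - \<delta>))\<^sup>2) has_real_derivative 2 * max 0 (t - \<delta>)) (at t)"
    by simp
  from DERIV_chain2[OF DERIV_real_sqrt[OF pos] this]
  have "((\<lambda>t. sqrt (\<delta>\<^sup>2 + (max 0 (t - \<delta>))\<^sup>2) - \<delta>) has_real_derivative
      inverse (sqrt (\<delta>\<^sup>2 + (max 0 (t - \<delta>))\<^sup>2)) / 2 * (2 * max 0 (t - \<delta>)) - 0) (at t)"
    by (intro DERIV_diff DERIV_const)
  moreover have "inverse s / 2 * (2 * r) - 0 = r / s" for r s :: real
    by (simp add: inverse_eq_divide)
  ultimately show ?thesis
    unfolding soft_pos_def[abs_def] by (simp only:)
qed

lemma soft_pos_bounds:
  assumes "0 < \<delta>"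
  shows "t - 2 * \<delta> \<le> soft_pos \<delta> t" "0 \<le> soft_pos \<delta> t" "soft_pos \<delta> t \<le> max 0 t" "t \<le> \<delta> \<Longrightarrow> soft_pos \<delta> t = 0"
proof -
  let ?r = "max 0 (t - \<delta>)"
  have "?r \<le> sqrt (\<delta>\<^sup>2 + ?r\<^sup>2)" "\<delta> \<le> sqrt (\<delta>\<^sup>2 + ?r\<^sup>2)"
    using assms by (auto intro!: real_le_rsqrt)
  moreover have "t - \<delta> \<le> ?r" by simp
  ultimately show "t - 2 * \<delta> \<le> soft_pos \<delta> t" "0 \<le> soft_pos \<delta> t"
    unfolding soft_pos_def by linarith+
  have "sqrt (\<delta>\<^sup>2 + ?r\<^sup>2) \<le> \<delta> + ?r"
    using assms by (intro real_le_lsqrt) (auto simp: power2_sum)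
  then show "soft_pos \<delta> t \<le> max 0 t"
    using assms by (auto simp: soft_pos_def max_def split: if_splits)
  show "soft_pos \<delta> t = 0" if "t \<le> \<delta>"
    using that assms by (simp add: soft_pos_def)
qed

definition pyramid_base :: "(real^'n) set \<Rightarrow> (real^'n) set" where
  "pyramid_base G = {x. \<forall>g\<in>G. 0 < 1 + g \<bullet> x}"

text \<open>
  The part of the base over which the affine function with gradient \<open>g\<close> is strictly the smallest one.
\<close>

definition facet :: "(real^'n) set \<Rightarrow> real^'n \<Rightarrow> (real^'n) set" where
  "facet G g = {x \<in> pyramid_base G. \<forall>g'\<in>G - {g}. g \<bullet> x < g' \<bullet> x}"

definition pyramid_gradient :: "(real^'n) set \<Rightarrow> real^'n \<Rightarrow> real^'n" where
  "pyramid_gradient G x = (\<Sum>g\<in>G. indicator (facet G g) x *\<^sub>R g)"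

definition pyramid :: "(real^'n) set \<Rightarrow> real^'n \<Rightarrow> real" where
  "pyramid G x = Min ((\<lambda>g. 1 + g \<bullet> x) ` G)"

definition smooth_pyramid :: "(real^'n) set \<Rightarrow> nat \<Rightarrow> real^'n \<Rightarrow> real" where
  "smooth_pyramid G m x = soft_pos (1 / real (Suc m)) (soft_min G (real (Suc m)) x)"

locale bounded_pyramid =
  fixes G :: "(real^'n) set"
  assumes finite_G: "finite G" and nonempty_G: "G \<noteq> {}" and bounded_base: "bounded (pyramid_base G)"
begin

lemmas G = finite_G nonempty_G

lemma open_base: "open (pyramid_base G)"
proof -
  have "pyramid_base G = (\<Inter>g\<in>G. {x. 0 < 1 + g \<bullet> x})" by (auto simp: pyramid_base_def)
  then show ?thesis
    using finite_G by (auto intro!: open_INT open_Collect_less continuous_intros)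
qed

lemma open_facet: "open (facet G g)"
proof -
  have "facet G g = pyramid_base G \<inter> (\<Inter>g'\<in>G - {g}. {x. g \<bullet> x < g' \<bullet> x})" by (auto simp: facet_def)
  then show ?thesis
    using finite_G by (auto intro!: open_INT open_Int open_base open_Collect_less continuous_intros)
qed

lemma base_lmeasurable: "pyramid_base G \<in> lmeasurable"
  by (rule lmeasurable_open[OF bounded_base open_base])

lemma facet_lmeasurable: "facet G g \<in> lmeasurable"
  by (rule lmeasurable_open[OF bounded_subset[OF bounded_base] open_facet]) (auto simp: facet_def)

lemma pyramid_gradient_facet:
  assumes "g \<in> G" "x \<in> facet G g"
  shows "pyramid_gradient G x = g"
proof -
  have "indicator (facet G g') x = (if g' = g then 1 else 0 :: real)" if "g' \<in> G" for g'
    using assms that by (auto simp: facet_def indicator_def dest: less_asym)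
  then have "pyramid_gradient G x = (\<Sum>g'\<in>G. if g' = g then g else 0)"
    unfolding pyramid_gradient_def by (intro sum.cong) auto
  with assms(1) finite_G show ?thesis by simp
qed

text \<open>Two affine functions with different gradients coincide only on a hyperplane.\<close>

lemma AE_facet: "AE x in lebesgue. x \<in> pyramid_base G \<longrightarrow> (\<exists>g\<in>G. x \<in> facet G g)"
proof -
  let ?T = "\<Union>(g, g')\<in>{p \<in> G \<times> G. fst p \<noteq> snd p}. {x. (g - g') \<bullet> x = 0}"
  have "negligible ?T"
  proof (rule negligible_Union)
    show "finite ((\<lambda>(g, g'). {x. (g - g') \<bullet> x = 0}) ` {p \<in> G \<times> G. fst p \<noteq> snd p})"
      using finite_G by auto
  qed (auto intro: negligible_hyperplane)
  then have "AE x in lebesgue. x \<notin> ?T"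
    by (simp only: negligible_iff_null_sets AE_not_in)
  then show ?thesis
  proof eventually_elim
    fix x assume x: "x \<notin> ?T"
    have fin: "finite ((\<lambda>g. g \<bullet> x) ` G)" "(\<lambda>g. g \<bullet> x) ` G \<noteq> {}" using G by auto
    obtain g where g: "g \<in> G" "g \<bullet> x = Min ((\<lambda>g. g \<bullet> x) ` G)"
      using Min_in[OF fin] by auto
    have "g \<bullet> x < g' \<bullet> x" if "g' \<in> G - {g}" for g'
    proof -
      have "g \<bullet> x \<le> g' \<bullet> x" using g(2) fin that by simp
      moreover have "g \<bullet> x \<noteq> g' \<bullet> x" using x g(1) that by (auto simp: inner_diff_left)
      ultimately show ?thesis by simp
    qed
    with g(1) show "x \<in> pyramid_base G \<longrightarrow> (\<exists>g\<in>G. x \<in> facet G g)"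
      by (auto simp: facet_def)
  qed
qed

lemma smooth_pyramid_C1:
  shows "C1 (smooth_pyramid G m)"
    and "partial_deriv i (smooth_pyramid G m) x =
      max 0 (soft_min G (real (Suc m)) x - 1 / real (Suc m)) /
        sqrt ((1 / real (Suc m))\<^sup>2 + (max 0 (soft_min G (real (Suc m)) x - 1 / real (Suc m)))\<^sup>2)
      * (\<Sum>g\<in>G. soft_weight G (real (Suc m)) x g * g $ i)"
proof -
  let ?\<delta> = "1 / real (Suc m)"
  have \<delta>: "0 < ?\<delta>" by simp
  have pos: "0 < ?\<delta>\<^sup>2 + (max 0 (t - ?\<delta>))\<^sup>2" for t
    using \<delta> by (intro add_pos_nonneg zero_less_power zero_le_power2)
  have "continuous_on UNIV (\<lambda>t. max 0 (t - ?\<delta>) / sqrt (?\<delta>\<^sup>2 + (max 0 (t - ?\<delta>))\<^sup>2))"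
    by (intro continuous_intros) (metis pos less_irrefl real_sqrt_eq_zero_cancel_iff)
  note P = partial_deriv_compose_real[OF soft_min_C1(1)[OF G, of "real (Suc m)"] has_real_derivative_soft_pos[OF \<delta>] this]
  show "C1 (smooth_pyramid G m)"
    unfolding smooth_pyramid_def[abs_def] by (rule P(2)) simp
  show "partial_deriv i (smooth_pyramid G m) x =
      max 0 (soft_min G (real (Suc m)) x - 1 / real (Suc m)) /
        sqrt ((1 / real (Suc m))\<^sup>2 + (max 0 (soft_min G (real (Suc m)) x - 1 / real (Suc m)))\<^sup>2)
      * (\<Sum>g\<in>G. soft_weight G (real (Suc m)) x g * g $ i)"
    unfolding smooth_pyramid_def[abs_def] by (subst P(1)) (simp_all add: soft_min_C1(2)[OF G])
qed

lemma smooth_pyramid_C1_compact: "smooth_pyramid G m \<in> C1_compact (pyramid_base G)"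
  unfolding C1_compact_iff
proof (intro conjI exI allI impI)
  let ?\<delta> = "1 / real (Suc m)"
  let ?K = "\<Inter>g\<in>G. {x. ?\<delta> \<le> 1 + g \<bullet> x}"
  show "C1 (smooth_pyramid G m)" by (rule smooth_pyramid_C1)
  have \<delta>: "0 < ?\<delta>" by simp
  show sub: "?K \<subseteq> pyramid_base G"
  proof
    fix x assume "x \<in> ?K"
    then have "?\<delta> \<le> 1 + g \<bullet> x" if "g \<in> G" for g using that by blast
    then show "x \<in> pyramid_base G"
      using less_le_trans[OF \<delta>] by (simp add: pyramid_base_def)
  qed
  have "closed ?K"
    by (intro closed_INT ballI closed_Collect_le continuous_intros)
  then show "compact ?K"
    using bounded_subset[OF bounded_base sub] by (simp add: compact_eq_bounded_closed)
  fix x assume "x \<notin> ?K"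
  then obtain g where g: "g \<in> G" "1 + g \<bullet> x < ?\<delta>" by auto
  have "soft_min G (real (Suc m)) x \<le> 1 + g \<bullet> x"
    by (rule soft_min_le[OF G _ g(1)]) simp
  with g(2) show "smooth_pyramid G m x = 0"
    unfolding smooth_pyramid_def by (intro soft_pos_bounds(4)[OF \<delta>]) linarith
qed

lemma smooth_pyramid_partial_bound:
  "\<bar>partial_deriv i (smooth_pyramid G m) x\<bar> \<le> (\<Sum>g\<in>G. \<bar>g $ i\<bar>)"
proof -
  define r where "r = max 0 (soft_min G (real (Suc m)) x - 1 / real (Suc m))"
  define \<delta> where "\<delta> = 1 / real (Suc m)"
  have "r \<le> sqrt (\<delta>\<^sup>2 + r\<^sup>2)" by (simp add: real_le_rsqrt)
  moreover have "0 < \<delta>" by (simp add: \<delta>_def)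
  then have "0 < \<delta>\<^sup>2 + r\<^sup>2" by (simp add: add_pos_nonneg)
  ultimately have 1: "0 \<le> r / sqrt (\<delta>\<^sup>2 + r\<^sup>2)" "r / sqrt (\<delta>\<^sup>2 + r\<^sup>2) \<le> 1"
    by (auto simp: r_def divide_simps)
  have 2: "\<bar>\<Sum>g\<in>G. soft_weight G (real (Suc m)) x g * g $ i\<bar> \<le> (\<Sum>g\<in>G. \<bar>g $ i\<bar>)"
    using soft_weight_bounds[OF G] by (intro order_trans[OF sum_abs] sum_mono) (auto simp: abs_mult intro: mult_left_le_one_le)
  have eq: "partial_deriv i (smooth_pyramid G m) x
      = r / sqrt (\<delta>\<^sup>2 + r\<^sup>2) * (\<Sum>g\<in>G. soft_weight G (real (Suc m)) x g * g $ i)"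
    by (simp only: smooth_pyramid_C1(2) r_def \<delta>_def)
  have "\<bar>partial_deriv i (smooth_pyramid G m) x\<bar>
      = r / sqrt (\<delta>\<^sup>2 + r\<^sup>2) * \<bar>\<Sum>g\<in>G. soft_weight G (real (Suc m)) x g * g $ i\<bar>"
    unfolding eq abs_mult abs_of_nonneg[OF 1(1)] ..
  also have "\<dots> \<le> 1 * (\<Sum>g\<in>G. \<bar>g $ i\<bar>)"
    using 1 2 by (intro mult_mono) auto
  finally show ?thesis by simp
qed

lemma soft_min_tendsto: "(\<lambda>m. soft_min G (real (Suc m)) x) \<longlonglongrightarrow> pyramid G x"
proof (rule tendsto_sandwich)
  have fin: "finite ((\<lambda>g. 1 + g \<bullet> x) ` G)" "(\<lambda>g. 1 + g \<bullet> x) ` G \<noteq> {}" using G by auto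
  obtain g where g: "g \<in> G" "pyramid G x = 1 + g \<bullet> x"
    unfolding pyramid_def using Min_in[OF fin] by auto
  have "soft_min G (real (Suc m)) x \<le> 1 + g \<bullet> x" for m
    by (rule soft_min_le[OF G _ g(1)]) simp
  then show "\<forall>\<^sub>F m in sequentially. soft_min G (real (Suc m)) x \<le> pyramid G x"
    using g(2) by simp
  have "pyramid G x - ln (card G) / real (Suc m) \<le> soft_min G (real (Suc m)) x" for m
    using fin by (intro soft_min_ge[OF G]) (auto simp: pyramid_def)
  then show "\<forall>\<^sub>F m in sequentially. pyramid G x - ln (card G) / real (Suc m) \<le> soft_min G (real (Suc m)) x"
    by simp
  have "(\<lambda>m. pyramid G x - ln (card G) * inverse (real (Suc m))) \<longlonglongrightarrow> pyramid G x - ln (card G) * 0"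
    by (intro tendsto_intros LIMSEQ_inverse_real_of_nat)
  then show "(\<lambda>m. pyramid G x - ln (card G) / real (Suc m)) \<longlonglongrightarrow> pyramid G x"
    by (simp add: divide_inverse)
qed auto

lemma pyramid_pos:
  assumes "x \<in> pyramid_base G"
  shows "0 < pyramid G x"
  unfolding pyramid_def using assms G by (subst Min_gr_iff) (auto simp: pyramid_base_def)

lemma inverse_Suc_tendsto: "(\<lambda>m. 1 / real (Suc m)) \<longlonglongrightarrow> 0"
  using LIMSEQ_inverse_real_of_nat by (simp add: inverse_eq_divide)

lemma smooth_pyramid_tendsto:
  assumes "x \<in> pyramid_base G"
  shows "(\<lambda>m. smooth_pyramid G m x) \<longlonglongrightarrow> pyramid G x"
proof (rule tendsto_sandwich)
  show "\<forall>\<^sub>F m in sequentially. soft_min G (real (Suc m)) x - 2 * (1 / real (Suc m)) \<le> smooth_pyramid G m x"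
    unfolding smooth_pyramid_def by (intro always_eventually allI soft_pos_bounds(1)) simp
  show "\<forall>\<^sub>F m in sequentially. smooth_pyramid G m x \<le> max 0 (soft_min G (real (Suc m)) x)"
    unfolding smooth_pyramid_def by (intro always_eventually allI soft_pos_bounds(3)) simp
  have "(\<lambda>m. soft_min G (real (Suc m)) x - 2 * (1 / real (Suc m))) \<longlonglongrightarrow> pyramid G x - 2 * 0"
    by (intro tendsto_intros soft_min_tendsto inverse_Suc_tendsto)
  then show "(\<lambda>m. soft_min G (real (Suc m)) x - 2 * (1 / real (Suc m))) \<longlonglongrightarrow> pyramid G x" by simp
  have "(\<lambda>m. max 0 (soft_min G (real (Suc m)) x)) \<longlonglongrightarrow> max 0 (pyramid G x)"
    by (intro tendsto_intros soft_min_tendsto)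
  then show "(\<lambda>m. max 0 (soft_min G (real (Suc m)) x)) \<longlonglongrightarrow> pyramid G x"
    using pyramid_pos[OF assms] by simp
qed

text \<open>
  Over a facet, both the derivative of the soft positive part and the weight of \<open>g\<close> tend to \<open>1\<close>.
\<close>

lemma smooth_pyramid_partial_tendsto:
  assumes "g \<in> G" "x \<in> facet G g"
  shows "(\<lambda>m. partial_deriv i (smooth_pyramid G m) x) \<longlonglongrightarrow> g $ i"
proof -
  have base: "x \<in> pyramid_base G" and less: "\<And>g'. g' \<in> G - {g} \<Longrightarrow> g \<bullet> x < g' \<bullet> x"
    using assms(2) by (auto simp: facet_def)
  let ?r = "\<lambda>m. max 0 (soft_min G (real (Suc m)) x - 1 / real (Suc m))"
  have p: "0 < pyramid G x" by (rule pyramid_pos[OF base])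
  have "?r \<longlonglongrightarrow> max 0 (pyramid G x - 0)"
    by (intro tendsto_intros soft_min_tendsto inverse_Suc_tendsto)
  then have r: "?r \<longlonglongrightarrow> pyramid G x" using p by simp
  have "(\<lambda>m. ?r m / sqrt ((1 / real (Suc m))\<^sup>2 + (?r m)\<^sup>2)) \<longlonglongrightarrow> pyramid G x / sqrt (0\<^sup>2 + (pyramid G x)\<^sup>2)"
    using p by (intro tendsto_intros r inverse_Suc_tendsto) auto
  then have 1: "(\<lambda>m. ?r m / sqrt ((1 / real (Suc m))\<^sup>2 + (?r m)\<^sup>2)) \<longlonglongrightarrow> 1"
    using p by simp
  have "(\<lambda>m. soft_weight G (real (Suc m)) x g * g $ i + (\<Sum>g'\<in>G - {g}. soft_weight G (real (Suc m)) x g' * g' $ i))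
      \<longlonglongrightarrow> 1 * g $ i + (\<Sum>g'\<in>G - {g}. 0 * g' $ i)"
    by (intro tendsto_intros soft_weight_tendsto[OF G assms(1) less])
  then have 2: "(\<lambda>m. \<Sum>g'\<in>G. soft_weight G (real (Suc m)) x g' * g' $ i) \<longlonglongrightarrow> g $ i"
    using assms(1) finite_G by (simp add: sum.remove)
  show ?thesis
    unfolding smooth_pyramid_C1(2) using tendsto_mult[OF 1 2] by simp
qed

end

text \<open>A bounded factor does not destroy convergence in \<open>L\<^sup>1\<close>.\<close>

lemma tendsto_set_integral_scaleR:
  fixes f :: "nat \<Rightarrow> real^'n \<Rightarrow> 'b::euclidean_space" and \<beta> :: "real^'n \<Rightarrow> real"
  assumes int: "\<And>m. set_integrable lebesgue \<Omega> (f m)" "set_integrable lebesgue \<Omega> f'"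
    and \<beta>: "continuous_on UNIV \<beta>" "\<And>x. \<bar>\<beta> x\<bar> \<le> B"
    and conv: "(\<lambda>m. LINT x:\<Omega>|lebesgue. norm (f m x - f' x)) \<longlonglongrightarrow> 0"
  shows "(\<lambda>m. LINT x:\<Omega>|lebesgue. \<beta> x *\<^sub>R f m x) \<longlonglongrightarrow> (LINT x:\<Omega>|lebesgue. \<beta> x *\<^sub>R f' x)"
proof -
  have int_\<beta>: "integrable lebesgue (\<lambda>x. indicator \<Omega> x *\<^sub>R \<beta> x *\<^sub>R w x)"
    if "set_integrable lebesgue \<Omega> w" for w :: "real^'n \<Rightarrow> 'b"
  proof (rule Bochner_Integration.integrable_bound)
    have w: "integrable lebesgue (\<lambda>x. indicator \<Omega> x *\<^sub>R w x)" using that by (simp add: set_integrable_def)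
    show "integrable lebesgue (\<lambda>x. B * norm (indicator \<Omega> x *\<^sub>R w x))"
      by (intro integrable_mult_right integrable_norm w)
    show "(\<lambda>x. indicator \<Omega> x *\<^sub>R \<beta> x *\<^sub>R w x) \<in> borel_measurable lebesgue"
      using borel_measurable_scaleR[OF borel_measurable_lebesgue_continuous[OF \<beta>(1)] borel_measurable_integrable[OF w]]
      by (simp add: mult.commute)
    have "norm (indicator \<Omega> x *\<^sub>R \<beta> x *\<^sub>R w x) \<le> norm (B * norm (indicator \<Omega> x *\<^sub>R w x))" for x
      using \<beta>(2)[of x] by (auto simp: indicator_def abs_mult intro!: mult_right_mono)
    then show "AE x in lebesgue. norm (indicator \<Omega> x *\<^sub>R \<beta> x *\<^sub>R w x) \<le> norm (B * norm (indicator \<Omega> x *\<^sub>R w x))"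
      by simp
  qed
  have diff: "norm ((LINT x:\<Omega>|lebesgue. \<beta> x *\<^sub>R f m x) - (LINT x:\<Omega>|lebesgue. \<beta> x *\<^sub>R f' x))
      \<le> B * (LINT x:\<Omega>|lebesgue. norm (f m x - f' x))" for m
  proof -
    have d: "set_integrable lebesgue \<Omega> (\<lambda>x. f m x - f' x)" using int by auto
    have "(LINT x:\<Omega>|lebesgue. \<beta> x *\<^sub>R f m x) - (LINT x:\<Omega>|lebesgue. \<beta> x *\<^sub>R f' x)
        = (LINT x|lebesgue. indicator \<Omega> x *\<^sub>R \<beta> x *\<^sub>R (f m x - f' x))"
      unfolding set_lebesgue_integral_def using int_\<beta>[OF int(1)[of m]] int_\<beta>[OF int(2)]
      by (simp add: scaleR_diff_right)
    also have "norm \<dots> \<le> (LINT x|lebesgue. B * (indicator \<Omega> x *\<^sub>R norm (f m x - f' x)))"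
    proof (rule Bochner_Integration.integral_norm_bound_integral[OF int_\<beta>[OF d]])
      have "integrable lebesgue (\<lambda>x. norm (indicator \<Omega> x *\<^sub>R (f m x - f' x)))"
        using d by (intro integrable_norm) (simp add: set_integrable_def)
      then show "integrable lebesgue (\<lambda>x. B * (indicator \<Omega> x *\<^sub>R norm (f m x - f' x)))"
        by (intro integrable_mult_right) simp
      show "norm (indicator \<Omega> x *\<^sub>R \<beta> x *\<^sub>R (f m x - f' x)) \<le> B * (indicator \<Omega> x *\<^sub>R norm (f m x - f' x))" for x
        using \<beta>(2)[of x] by (auto simp: indicator_def intro!: mult_right_mono)
    qed
    finally show ?thesis by (simp add: set_lebesgue_integral_def)
  qed
  have "(\<lambda>m. B * (LINT x:\<Omega>|lebesgue. norm (f m x - f' x))) \<longlonglongrightarrow> 0"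
    by (rule tendsto_mult_right_zero[OF conv])
  then have "(\<lambda>m. (LINT x:\<Omega>|lebesgue. \<beta> x *\<^sub>R f m x) - (LINT x:\<Omega>|lebesgue. \<beta> x *\<^sub>R f' x)) \<longlonglongrightarrow> 0"
    by (rule Lim_null_comparison[OF always_eventually[OF allI[OF diff]]])
  then show ?thesis by (rule LIM_zero_cancel)
qed

lemma is_weak_deriv_of_approximation:
  fixes \<phi> :: "nat \<Rightarrow> real^'n \<Rightarrow> 'b::euclidean_space"
  assumes \<Omega>: "\<Omega> \<in> sets lebesgue"
    and \<phi>: "\<And>m. \<phi> m \<in> C1_compact \<Omega>"
    and int: "set_integrable lebesgue \<Omega> \<omega>" "set_integrable lebesgue \<Omega> v"
    and conv: "(\<lambda>m. LINT x:\<Omega>|lebesgue. norm (\<phi> m x - \<omega> x)) \<longlonglongrightarrow> 0"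
      "(\<lambda>m. LINT x:\<Omega>|lebesgue. norm (partial_deriv i (\<phi> m) x - v x)) \<longlonglongrightarrow> 0"
  shows "is_weak_deriv \<Omega> i \<omega> v"
  unfolding is_weak_deriv_def
proof (intro conjI allI impI)
  have "locally_integrable lebesgue \<Omega> w" if "set_integrable lebesgue \<Omega> w" for w :: "real^'n \<Rightarrow> 'b"
    using that unfolding locally_integrable_def
    by (auto intro!: set_integrable_subset[OF that] intro: lmeasurable_compact fmeasurableD)
  then show "locally_integrable lebesgue \<Omega> \<omega>" "locally_integrable lebesgue \<Omega> v" using int by auto
  fix \<psi> :: "real^'n \<Rightarrow> real" assume \<psi>: "\<psi> \<in> C1_compact \<Omega>"
  then have \<psi>C1: "C1 \<psi>" by (simp add: C1_compact_iff)
  have \<phi>C1: "C1 (\<phi> m)" for m using \<phi> by (simp add: C1_compact_iff)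
  obtain B where B: "\<And>x. \<bar>\<psi> x\<bar> \<le> B" using C1_compact_function(3)[OF \<psi>] by auto
  obtain B' where B': "\<And>x. \<bar>partial_deriv i \<psi> x\<bar> \<le> B'" using C1_compact_partial(3)[OF \<psi>] by auto
  have int_\<phi>: "set_integrable lebesgue \<Omega> (\<phi> m)" "set_integrable lebesgue \<Omega> (partial_deriv i (\<phi> m))" for m
    unfolding set_integrable_def
    by (intro integrable_mult_indicator[OF \<Omega>] C1_compact_function(2)[OF \<phi>] C1_compact_partial(2)[OF \<phi>])+
  have parts: "(LINT x:\<Omega>|lebesgue. partial_deriv i \<psi> x *\<^sub>R \<phi> m x) = - (LINT x:\<Omega>|lebesgue. \<psi> x *\<^sub>R partial_deriv i (\<phi> m) x)" for m
  proof -
    have \<phi>0: "\<phi> m x = 0" and \<psi>0: "\<psi> x = 0" if "x \<notin> \<Omega>" for x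
      using C1_compact_function(4)[OF \<phi> that] C1_compact_function(4)[OF \<psi> that] by auto
    obtain K where K: "compact K" "\<And>x. x \<notin> K \<Longrightarrow> \<phi> m x = 0" using \<phi>[of m] unfolding C1_compact_iff by blast
    note out = K(2) partial_deriv_outside[OF K(1,2)]
    have a: "(LINT x:\<Omega>|lebesgue. partial_deriv i \<psi> x *\<^sub>R \<phi> m x) = (LINT x|lebesgue. partial_deriv i \<psi> x *\<^sub>R \<phi> m x)"
      unfolding set_lebesgue_integral_def
      by (rule Bochner_Integration.integral_cong) (use \<phi>0 in \<open>auto simp: indicator_def\<close>)
    have b: "(LINT x:\<Omega>|lebesgue. \<psi> x *\<^sub>R partial_deriv i (\<phi> m) x) = (LINT x|lebesgue. \<psi> x *\<^sub>R partial_deriv i (\<phi> m) x)"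
      unfolding set_lebesgue_integral_def
      by (rule Bochner_Integration.integral_cong) (use \<psi>0 in \<open>auto simp: indicator_def\<close>)
    have i1: "integrable lebesgue (\<lambda>x. partial_deriv i \<psi> x *\<^sub>R \<phi> m x)"
      by (rule compact_support_integrable(1)[OF _ K(1)])
         (auto intro!: continuous_on_scaleR C1_continuous_partial[OF \<psi>C1] C1_continuous_partial[OF \<phi>C1] C1_continuous[OF \<psi>C1] C1_continuous[OF \<phi>C1] simp: out)
    have i2: "integrable lebesgue (\<lambda>x. \<psi> x *\<^sub>R partial_deriv i (\<phi> m) x)"
      by (rule compact_support_integrable(1)[OF _ K(1)])
         (auto intro!: continuous_on_scaleR C1_continuous_partial[OF \<psi>C1] C1_continuous_partial[OF \<phi>C1] C1_continuous[OF \<psi>C1] C1_continuous[OF \<phi>C1] simp: out)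
    have "(\<lambda>x. \<psi> x *\<^sub>R \<phi> m x) \<in> C1_compact UNIV"
      by (rule C1_compact_mono[OF C1_compact_mult[OF \<psi> \<phi>C1]]) simp
    from integral_partial_deriv_eq_0[OF this, of i]
    have "(LINT x|lebesgue. partial_deriv i \<psi> x *\<^sub>R \<phi> m x + \<psi> x *\<^sub>R partial_deriv i (\<phi> m) x) = 0"
      by (simp add: partial_deriv_mult(1)[OF \<psi>C1 \<phi>C1] cong: Bochner_Integration.integral_cong)
    then show ?thesis
      unfolding a b Bochner_Integration.integral_add[OF i1 i2] by (simp add: eq_neg_iff_add_eq_0)
  qed
  have "(\<lambda>m. LINT x:\<Omega>|lebesgue. partial_deriv i \<psi> x *\<^sub>R \<phi> m x) \<longlonglongrightarrow> (LINT x:\<Omega>|lebesgue. partial_deriv i \<psi> x *\<^sub>R \<omega> x)"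
    by (rule tendsto_set_integral_scaleR[OF int_\<phi>(1) int(1) C1_continuous_partial[OF \<psi>C1] B' conv(1)])
  moreover have "(\<lambda>m. LINT x:\<Omega>|lebesgue. \<psi> x *\<^sub>R partial_deriv i (\<phi> m) x) \<longlonglongrightarrow> (LINT x:\<Omega>|lebesgue. \<psi> x *\<^sub>R v x)"
    by (rule tendsto_set_integral_scaleR[OF int_\<phi>(2) int(2) C1_continuous[OF \<psi>C1] B conv(2)])
  then have "(\<lambda>m. - (LINT x:\<Omega>|lebesgue. \<psi> x *\<^sub>R partial_deriv i (\<phi> m) x)) \<longlonglongrightarrow> - (LINT x:\<Omega>|lebesgue. \<psi> x *\<^sub>R v x)"
    by (rule tendsto_minus)
  ultimately show "(LINT x:\<Omega>|lebesgue. partial_deriv i \<psi> x *\<^sub>R \<omega> x) = - (LINT x:\<Omega>|lebesgue. \<psi> x *\<^sub>R v x)"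
    unfolding parts by (rule LIMSEQ_unique)
qed

context bounded_pyramid
begin

lemma pyramid_measurable: "pyramid G \<in> borel_measurable lebesgue"
  by (rule borel_measurable_LIMSEQ_real[OF soft_min_tendsto])
     (intro borel_measurable_lebesgue_continuous C1_continuous soft_min_C1[OF G], simp)

lemma pyramid_gradient_measurable: "(\<lambda>x. pyramid_gradient G x $ i) \<in> borel_measurable lebesgue"
proof -
  have "pyramid_gradient G x $ i = (\<Sum>g\<in>G. indicator (facet G g) x * g $ i)" for x
    by (simp add: pyramid_gradient_def)
  then show ?thesis
    using fmeasurableD[OF facet_lmeasurable] by simp
qed

lemma pyramid_gradient_bound: "\<bar>pyramid_gradient G x $ i\<bar> \<le> (\<Sum>g\<in>G. \<bar>g $ i\<bar>)"
  unfolding pyramid_gradient_def sum_component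
  by (rule order_trans[OF sum_abs]) (auto intro!: sum_mono simp: indicator_def)

lemma pyramid_bound: "\<exists>M. \<forall>x\<in>pyramid_base G. \<bar>pyramid G x\<bar> \<le> M \<and> (\<forall>m. \<bar>smooth_pyramid G m x\<bar> \<le> M)"
proof -
  obtain g where g: "g \<in> G" using nonempty_G by blast
  obtain R where R: "\<And>x. x \<in> pyramid_base G \<Longrightarrow> norm x \<le> R"
    using bounded_base by (auto simp: bounded_iff)
  have "\<bar>pyramid G x\<bar> \<le> 1 + norm g * R \<and> (\<forall>m. \<bar>smooth_pyramid G m x\<bar> \<le> 1 + norm g * R)"
    if x: "x \<in> pyramid_base G" for x
  proof -
    have "g \<bullet> x \<le> norm g * norm x" by (rule norm_cauchy_schwarz)
    also have "\<dots> \<le> norm g * R" using R[OF x] by (intro mult_left_mono) auto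
    finally have gx: "1 + g \<bullet> x \<le> 1 + norm g * R" by simp
    have "0 < 1 + g \<bullet> x" using x g by (simp add: pyramid_base_def)
    have "pyramid G x \<le> 1 + g \<bullet> x"
      unfolding pyramid_def using finite_G g by (intro Min_le) auto
    then have 1: "\<bar>pyramid G x\<bar> \<le> 1 + norm g * R"
      using pyramid_pos[OF x] gx by simp
    have "\<bar>smooth_pyramid G m x\<bar> \<le> 1 + norm g * R" for m
    proof -
      have \<delta>: "0 < 1 / real (Suc m)" by simp
      have "soft_min G (real (Suc m)) x \<le> 1 + g \<bullet> x"
        by (rule soft_min_le[OF G _ g]) simp
      then have "smooth_pyramid G m x \<le> 1 + g \<bullet> x"
        using soft_pos_bounds(3)[OF \<delta>, of "soft_min G (real (Suc m)) x"] \<open>0 < 1 + g \<bullet> x\<close>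
        unfolding smooth_pyramid_def by linarith
      moreover have "0 \<le> smooth_pyramid G m x"
        unfolding smooth_pyramid_def by (rule soft_pos_bounds(2)[OF \<delta>])
      ultimately show ?thesis using gx by simp
    qed
    with 1 show ?thesis by blast
  qed
  then show ?thesis by blast
qed

lemma integrable_on_base:
  fixes w :: "real^'n \<Rightarrow> 'b::euclidean_space"
  assumes "w \<in> borel_measurable lebesgue" "\<And>x. x \<in> pyramid_base G \<Longrightarrow> norm (w x) \<le> M"
  shows "set_integrable lebesgue (pyramid_base G) w"
  unfolding set_integrable_def
  using base_lmeasurable assms
  by (intro integrableI_bounded_set_indicator[where B = M]) (auto simp: fmeasurable_def)

lemma smooth_pyramid_L1:
  "(\<lambda>m. LINT x:pyramid_base G|lebesgue. \<bar>smooth_pyramid G m x - pyramid G x\<bar>) \<longlonglongrightarrow> 0"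
proof -
  obtain M where M: "\<And>x. x \<in> pyramid_base G \<Longrightarrow> \<bar>pyramid G x\<bar> \<le> M"
    "\<And>x m. x \<in> pyramid_base G \<Longrightarrow> \<bar>smooth_pyramid G m x\<bar> \<le> M"
    using pyramid_bound by blast
  note meas [measurable] = borel_measurable_lebesgue_continuous[OF C1_continuous[OF smooth_pyramid_C1(1)]]
    pyramid_measurable fmeasurableD[OF base_lmeasurable]
  have "(\<lambda>m. LINT x|lebesgue. indicator (pyramid_base G) x *\<^sub>R \<bar>smooth_pyramid G m x - pyramid G x\<bar>)
      \<longlonglongrightarrow> (LINT x::real^'n|lebesgue. 0)"
  proof (rule integral_dominated_convergence[where w = "\<lambda>x. indicator (pyramid_base G) x * (2 * M)"])
    show "integrable lebesgue (\<lambda>x. indicator (pyramid_base G) x * (2 * M))"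
      using base_lmeasurable by (intro integrable_mult_left) (simp add: lmeasurable_iff_integrable)
    show "AE x in lebesgue. (\<lambda>m. indicator (pyramid_base G) x *\<^sub>R \<bar>smooth_pyramid G m x - pyramid G x\<bar>) \<longlonglongrightarrow> 0"
    proof (rule AE_I2)
      fix x
      show "(\<lambda>m. indicator (pyramid_base G) x *\<^sub>R \<bar>smooth_pyramid G m x - pyramid G x\<bar>) \<longlonglongrightarrow> 0"
      proof (cases "x \<in> pyramid_base G")
        case True
        have "(\<lambda>m. \<bar>smooth_pyramid G m x - pyramid G x\<bar>) \<longlonglongrightarrow> \<bar>pyramid G x - pyramid G x\<bar>"
          by (intro tendsto_intros smooth_pyramid_tendsto True)
        with True show ?thesis by simp
      qed simp
    qed
    have "\<bar>smooth_pyramid G m x - pyramid G x\<bar> \<le> 2 * M" if "x \<in> pyramid_base G" for m x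
      using M(1)[OF that] M(2)[OF that, of m] by linarith
    then show "AE x in lebesgue. norm (indicator (pyramid_base G) x *\<^sub>R \<bar>smooth_pyramid G m x - pyramid G x\<bar>)
        \<le> indicator (pyramid_base G) x * (2 * M)" for m
      by (intro AE_I2) (auto simp: indicator_def)
  qed measurable
  then show ?thesis by (simp add: set_lebesgue_integral_def)
qed

lemma smooth_pyramid_partial_L1:
  "(\<lambda>m. LINT x:pyramid_base G|lebesgue. \<bar>partial_deriv i (smooth_pyramid G m) x - pyramid_gradient G x $ i\<bar>) \<longlonglongrightarrow> 0"
proof -
  define M where "M = (\<Sum>g\<in>G. \<bar>g $ i\<bar>)"
  note meas [measurable] = borel_measurable_lebesgue_continuous[OF C1_continuous_partial[OF smooth_pyramid_C1(1)]]
    pyramid_gradient_measurable fmeasurableD[OF base_lmeasurable]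
  have "(\<lambda>m. LINT x|lebesgue. indicator (pyramid_base G) x *\<^sub>R \<bar>partial_deriv i (smooth_pyramid G m) x - pyramid_gradient G x $ i\<bar>)
      \<longlonglongrightarrow> (LINT x::real^'n|lebesgue. 0)"
  proof (rule integral_dominated_convergence[where w = "\<lambda>x. indicator (pyramid_base G) x * (2 * M)"])
    show "integrable lebesgue (\<lambda>x. indicator (pyramid_base G) x * (2 * M))"
      using base_lmeasurable by (intro integrable_mult_left) (simp add: lmeasurable_iff_integrable)
    show "AE x in lebesgue. (\<lambda>m. indicator (pyramid_base G) x *\<^sub>R
        \<bar>partial_deriv i (smooth_pyramid G m) x - pyramid_gradient G x $ i\<bar>) \<longlonglongrightarrow> 0"
      using AE_facet
    proof eventually_elim
      fix x assume x: "x \<in> pyramid_base G \<longrightarrow> (\<exists>g\<in>G. x \<in> facet G g)"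
      show "(\<lambda>m. indicator (pyramid_base G) x *\<^sub>R \<bar>partial_deriv i (smooth_pyramid G m) x - pyramid_gradient G x $ i\<bar>) \<longlonglongrightarrow> 0"
      proof (cases "x \<in> pyramid_base G")
        case True
        with x obtain g where g: "g \<in> G" "x \<in> facet G g" by blast
        have "(\<lambda>m. \<bar>partial_deriv i (smooth_pyramid G m) x - g $ i\<bar>) \<longlonglongrightarrow> \<bar>g $ i - g $ i\<bar>"
          by (intro tendsto_intros smooth_pyramid_partial_tendsto g)
        with True show ?thesis by (simp add: pyramid_gradient_facet[OF g])
      qed simp
    qed
    have "\<bar>partial_deriv i (smooth_pyramid G m) x - pyramid_gradient G x $ i\<bar> \<le> 2 * M" for m x
      using smooth_pyramid_partial_bound[of i m x] pyramid_gradient_bound[of x i] unfolding M_def by linarith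
    then show "AE x in lebesgue. norm (indicator (pyramid_base G) x *\<^sub>R
        \<bar>partial_deriv i (smooth_pyramid G m) x - pyramid_gradient G x $ i\<bar>)
        \<le> indicator (pyramid_base G) x * (2 * M)" for m
      by (intro AE_I2) (auto simp: indicator_def)
  qed measurable
  then show ?thesis by (simp add: set_lebesgue_integral_def)
qed

lemma facet_measure_sum:
  "(\<Sum>g\<in>G. measure lebesgue (facet G g) * a g) = (LINT x|lebesgue. (\<Sum>g\<in>G. indicator (facet G g) x * a g))"
proof -
  have "integrable lebesgue (\<lambda>x. indicator (facet G g) x * a g)" for g
    using facet_lmeasurable by (intro integrable_mult_left) (simp add: lmeasurable_iff_integrable)
  then show ?thesis
    using facet_lmeasurable by (simp add: Bochner_Integration.integral_sum)
qed

lemma sum_facet_measures: "(\<Sum>g\<in>G. measure lebesgue (facet G g)) = measure lebesgue (pyramid_base G)"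
proof -
  have "AE x in lebesgue. (\<Sum>g\<in>G. indicator (facet G g) x * 1) = (indicator (pyramid_base G) x :: real)"
    using AE_facet
  proof eventually_elim
    fix x assume x: "x \<in> pyramid_base G \<longrightarrow> (\<exists>g\<in>G. x \<in> facet G g)"
    show "(\<Sum>g\<in>G. indicator (facet G g) x * 1) = (indicator (pyramid_base G) x :: real)"
    proof (cases "x \<in> pyramid_base G")
      case True
      with x obtain g where g: "g \<in> G" "x \<in> facet G g" by blast
      then have "indicator (facet G g') x = (if g' = g then 1 else 0 :: real)" if "g' \<in> G" for g'
        using that by (auto simp: facet_def indicator_def dest: less_asym)
      then have "(\<Sum>g\<in>G. indicator (facet G g) x * 1) = (\<Sum>g'\<in>G. if g' = g then 1 else 0 :: real)"
        by (intro sum.cong) auto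
      with True g(1) finite_G show ?thesis by simp
    qed (auto simp: facet_def)
  qed
  then have "(LINT x|lebesgue. (\<Sum>g\<in>G. indicator (facet G g) x * 1)) = (LINT x|lebesgue. (indicator (pyramid_base G) x :: real))"
    using fmeasurableD[OF facet_lmeasurable] fmeasurableD[OF base_lmeasurable]
    by (intro integral_cong_AE) auto
  then show ?thesis
    using base_lmeasurable facet_measure_sum[of "\<lambda>_. 1"] by simp
qed

text \<open>
  The left-hand side is the integral of a partial derivative of the pyramid, hence a limit of integrals
  of partial derivatives of compactly supported functions.
\<close>

lemma sum_facet_gradients: "(\<Sum>g\<in>G. measure lebesgue (facet G g) * g $ i) = 0"
proof -
  have base: "pyramid_base G \<in> sets lebesgue" by (rule fmeasurableD[OF base_lmeasurable])
  have int: "set_integrable lebesgue (pyramid_base G) (partial_deriv i (smooth_pyramid G m))" for m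
    unfolding set_integrable_def
    by (intro integrable_mult_indicator[OF base] C1_compact_partial(2)[OF smooth_pyramid_C1_compact])
  have int': "set_integrable lebesgue (pyramid_base G) (\<lambda>x. pyramid_gradient G x $ i)"
    by (rule integrable_on_base[OF pyramid_gradient_measurable]) (use pyramid_gradient_bound in simp)
  have "(\<lambda>m. LINT x:pyramid_base G|lebesgue. 1 *\<^sub>R partial_deriv i (smooth_pyramid G m) x)
      \<longlonglongrightarrow> (LINT x:pyramid_base G|lebesgue. 1 *\<^sub>R pyramid_gradient G x $ i)"
    by (rule tendsto_set_integral_scaleR[OF int int', where B = 1]) (use smooth_pyramid_partial_L1 in auto)
  moreover have "(LINT x:pyramid_base G|lebesgue. 1 *\<^sub>R partial_deriv i (smooth_pyramid G m) x) = 0" for m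
  proof -
    have "(LINT x:pyramid_base G|lebesgue. 1 *\<^sub>R partial_deriv i (smooth_pyramid G m) x)
        = integral\<^sup>L lebesgue (partial_deriv i (smooth_pyramid G m))"
      unfolding set_lebesgue_integral_def
      by (rule Bochner_Integration.integral_cong)
         (auto simp: indicator_def C1_compact_partial(4)[OF smooth_pyramid_C1_compact])
    also have "\<dots> = 0"
      by (rule integral_partial_deriv_eq_0[OF C1_compact_mono[OF smooth_pyramid_C1_compact]]) simp
    finally show ?thesis .
  qed
  ultimately have "(LINT x:pyramid_base G|lebesgue. pyramid_gradient G x $ i) = 0"
    by (simp add: LIMSEQ_const_iff)
  moreover have "(LINT x:pyramid_base G|lebesgue. pyramid_gradient G x $ i)
      = (LINT x|lebesgue. (\<Sum>g\<in>G. indicator (facet G g) x * g $ i))"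
    unfolding set_lebesgue_integral_def
    by (rule Bochner_Integration.integral_cong)
       (auto simp: pyramid_gradient_def indicator_def facet_def intro!: sum.neutral)
  ultimately show ?thesis
    using facet_measure_sum[of "\<lambda>g. g $ i"] by simp
qed

end

section \<open>Quasiaffine functions are ext-int. one affine\<close>

text \<open>
  The smooth pyramids provide both the weak derivative and the approximation that \<open>W\<^sub>0\<^sup>1\<^sup>,\<^sup>1\<close> requires.
\<close>

lemma pyramid_field:
  fixes G :: "(real^('n::{finite,linorder})) set" and b :: "'n form"
  assumes "bounded_pyramid G" and b: "b \<in> \<Lambda> k"
  shows "(\<lambda>x. pyramid G x *\<^sub>R b) \<in> W_1_infinity_0 (pyramid_base G) k"
    and "AE x in lebesgue. x \<in> pyramid_base G \<longrightarrow>
      (\<forall>i. weak_deriv (pyramid_base G) i (\<lambda>x. pyramid G x *\<^sub>R b) x = (pyramid_gradient G x $ i) *\<^sub>R b)"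
proof -
  interpret bounded_pyramid G by (rule assms(1))
  let ?\<Omega> = "pyramid_base G" and ?\<omega> = "\<lambda>x. pyramid G x *\<^sub>R b"
  define \<phi> where "\<phi> m x = smooth_pyramid G m x *\<^sub>R b" for m x
  define v where "v i x = (pyramid_gradient G x $ i) *\<^sub>R b" for i x
  have base: "?\<Omega> \<in> sets lebesgue" by (rule fmeasurableD[OF base_lmeasurable])
  note bl = bounded_linear_scaleR_left[of b]
  have \<phi>: "\<phi> m \<in> C1_compact ?\<Omega>" for m
    unfolding \<phi>_def[abs_def] by (rule bounded_linear_C1_compact[OF bl smooth_pyramid_C1_compact])
  have \<phi>_partial: "partial_deriv i (\<phi> m) x = partial_deriv i (smooth_pyramid G m) x *\<^sub>R b" for i m x
    unfolding \<phi>_def[abs_def] by (rule bounded_linear_partial_deriv(1)[OF bl smooth_pyramid_C1(1)])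
  obtain M where M: "\<And>x. x \<in> ?\<Omega> \<Longrightarrow> \<bar>pyramid G x\<bar> \<le> M" using pyramid_bound by blast
  have \<omega>_meas: "?\<omega> \<in> borel_measurable lebesgue"
    by (intro borel_measurable_scaleR pyramid_measurable borel_measurable_const)
  have \<omega>_bound: "norm (?\<omega> x) \<le> M * norm b" if "x \<in> ?\<Omega>" for x
    using M[OF that] by (simp add: mult_right_mono)
  have v_meas: "v i \<in> borel_measurable lebesgue" for i
    unfolding v_def[abs_def] by (intro borel_measurable_scaleR pyramid_gradient_measurable borel_measurable_const)
  have v_bound: "norm (v i x) \<le> (\<Sum>g\<in>G. \<bar>g $ i\<bar>) * norm b" for i x
    using pyramid_gradient_bound[of x i] by (simp add: v_def mult_right_mono)
  have int: "set_integrable lebesgue ?\<Omega> ?\<omega>" "set_integrable lebesgue ?\<Omega> (v i)" for i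
    using integrable_on_base[OF \<omega>_meas \<omega>_bound] integrable_on_base[OF v_meas v_bound] by auto
  have conv1: "(\<lambda>m. LINT x:?\<Omega>|lebesgue. norm (\<phi> m x - ?\<omega> x)) \<longlonglongrightarrow> 0"
    using tendsto_mult_left_zero[OF smooth_pyramid_L1, of "norm b"]
    by (simp add: \<phi>_def set_lebesgue_integral_def flip: scaleR_diff_left integral_mult_left_zero mult.assoc)
  have conv2: "(\<lambda>m. LINT x:?\<Omega>|lebesgue. norm (partial_deriv i (\<phi> m) x - v i x)) \<longlonglongrightarrow> 0" for i
    using tendsto_mult_left_zero[OF smooth_pyramid_partial_L1[of i], of "norm b"]
    by (simp add: \<phi>_partial v_def set_lebesgue_integral_def flip: scaleR_diff_left integral_mult_left_zero mult.assoc)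
  have weak: "is_weak_deriv ?\<Omega> i ?\<omega> (v i)" for i
    by (rule is_weak_deriv_of_approximation[OF base \<phi> int conv1 conv2])
  have AE_weak: "AE x in lebesgue. x \<in> ?\<Omega> \<longrightarrow> weak_deriv ?\<Omega> i ?\<omega> x = v i x" for i
    by (rule weak_deriv_AE_eq[OF open_base weak])
  have L_inf: "?\<omega> \<in> L_infinity ?\<Omega>" "v i \<in> L_infinity ?\<Omega>" for i
    unfolding L_infinity_def set_borel_measurable_def
    using borel_measurable_integrable[OF int(1)[unfolded set_integrable_def]]
      borel_measurable_integrable[OF int(2)[of i, unfolded set_integrable_def]] \<omega>_bound v_bound[of i] by auto
  have conv3: "(\<lambda>m. LINT x:?\<Omega>|lebesgue. norm (partial_deriv i (\<phi> m) x - weak_deriv ?\<Omega> i ?\<omega> x)) \<longlonglongrightarrow> 0" for i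
  proof -
    have "(LINT x:?\<Omega>|lebesgue. norm (partial_deriv i (\<phi> m) x - weak_deriv ?\<Omega> i ?\<omega> x))
        = (LINT x:?\<Omega>|lebesgue. norm (partial_deriv i (\<phi> m) x - v i x))" for m
    proof -
      have meas: "(\<lambda>x. indicator ?\<Omega> x *\<^sub>R norm (partial_deriv i (\<phi> m) x - v i x)) \<in> borel_measurable lebesgue"
        using borel_measurable_integrable[OF C1_compact_partial(2)[OF \<phi>[of m]]] v_meas[of i] base
        by measurable
      have AE: "AE x in lebesgue. indicator ?\<Omega> x *\<^sub>R norm (partial_deriv i (\<phi> m) x - v i x)
          = indicator ?\<Omega> x *\<^sub>R norm (partial_deriv i (\<phi> m) x - weak_deriv ?\<Omega> i ?\<omega> x)"
        using AE_weak[of i] by eventually_elim (auto simp: indicator_def)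
      show ?thesis
        unfolding set_lebesgue_integral_def
        by (rule integral_cong_AE[OF meas borel_measurable_lebesgue_AE_eq[OF meas AE] AE, symmetric])
    qed
    with conv2 show ?thesis by simp
  qed
  have Lam: "\<forall>x\<in>?\<Omega>. ?\<omega> x \<in> \<Lambda> k" "\<phi> m x \<in> \<Lambda> k" for m x
    using b by (auto simp: \<phi>_def intro: subspace_scale[OF subspace_Lam])
  show "?\<omega> \<in> W_1_infinity_0 ?\<Omega> k"
    unfolding W_1_infinity_0_def
  proof
    show "?\<omega> \<in> W_1_infinity ?\<Omega> k"
      unfolding W_1_infinity_def mem_Collect_eq
      by (intro conjI Lam(1) L_inf(1) allI, rule bexI, rule weak, rule L_inf(2))
    have "?\<omega> \<in> W_1_1 ?\<Omega> k"
      unfolding W_1_1_def mem_Collect_eq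
      by (intro conjI Lam(1) int(1) allI, rule exI, rule conjI, rule int(2), rule weak)
    then show "?\<omega> \<in> W_1_1_0 ?\<Omega> k"
      unfolding W_1_1_0_def mem_Collect_eq
      by (intro conjI exI[of _ \<phi>] allI \<phi> Lam(2) conv1 conv3)
  qed
  have "AE x in lebesgue. \<forall>i\<in>UNIV. x \<in> ?\<Omega> \<longrightarrow> weak_deriv ?\<Omega> i ?\<omega> x = v i x"
    by (rule AE_ball_countable'[OF AE_weak]) (rule countable_finite, simp)
  then show "AE x in lebesgue. x \<in> ?\<Omega> \<longrightarrow> (\<forall>i. weak_deriv ?\<Omega> i ?\<omega> x = (pyramid_gradient G x $ i) *\<^sub>R b)"
    by eventually_elim (simp add: v_def)
qed

text \<open>
  On each facet, the integrand of the quasiaffinity identity for the field \<open>pyramid G x *\<^sub>R b\<close> is constant.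
\<close>

lemma quasiaffine_pyramid_average:
  fixes f :: "'n::{finite,linorder} form \<times> 'n form \<Rightarrow> real"
  assumes f: "ext_int_quasiaffine k f" and pyr: "bounded_pyramid G"
    and \<xi>: "\<xi> \<in> \<Lambda> (k + 1)" and \<eta>: "\<eta> \<in> \<Lambda> (k - 1)" and b: "b \<in> \<Lambda> k"
  shows "f (\<xi>, \<eta>) * measure lebesgue (pyramid_base G)
    = (\<Sum>g\<in>G. measure lebesgue (facet G g) * f (\<xi> + one_form g \<and>\<^sub>\<Lambda> b, \<eta> + g \<lrcorner> b))"
proof -
  interpret bounded_pyramid G by (rule pyr)
  let ?\<Omega> = "pyramid_base G" and ?\<omega> = "\<lambda>x. pyramid G x *\<^sub>R b"
  let ?f = "\<lambda>x. f (\<xi> + ext_deriv ?\<Omega> ?\<omega> x, \<eta> + codifferential ?\<Omega> ?\<omega> x)"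
  let ?a = "\<lambda>g. f (\<xi> + one_form g \<and>\<^sub>\<Lambda> b, \<eta> + g \<lrcorner> b)"
  note \<omega> = pyramid_field[OF pyr b]
  have "set_integrable lebesgue ?\<Omega> ?f \<and> f (\<xi>, \<eta>) * measure lebesgue ?\<Omega> \<le> (LINT x:?\<Omega>|lebesgue. ?f x)"
    using f open_base bounded_base \<xi> \<eta> \<omega>(1) unfolding ext_int_quasiaffine_def ext_int_quasiconvex_def by blast
  moreover have "set_integrable lebesgue ?\<Omega> (\<lambda>x. - ?f x) \<and>
      - f (\<xi>, \<eta>) * measure lebesgue ?\<Omega> \<le> (LINT x:?\<Omega>|lebesgue. - ?f x)"
    using f open_base bounded_base \<xi> \<eta> \<omega>(1) unfolding ext_int_quasiaffine_def ext_int_quasiconvex_def by blast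
  moreover have "(LINT x:?\<Omega>|lebesgue. - ?f x) = - (LINT x:?\<Omega>|lebesgue. ?f x)"
    by (simp add: set_lebesgue_integral_def)
  ultimately have int: "set_integrable lebesgue ?\<Omega> ?f"
    and eq: "f (\<xi>, \<eta>) * measure lebesgue ?\<Omega> = (LINT x:?\<Omega>|lebesgue. ?f x)"
    by auto
  have AE: "AE x in lebesgue. indicator ?\<Omega> x *\<^sub>R ?f x = (\<Sum>g\<in>G. indicator (facet G g) x * ?a g)"
    using \<omega>(2) AE_facet
  proof eventually_elim
    fix x
    assume wd: "x \<in> ?\<Omega> \<longrightarrow> (\<forall>i. weak_deriv ?\<Omega> i ?\<omega> x = (pyramid_gradient G x $ i) *\<^sub>R b)"
      and x: "x \<in> ?\<Omega> \<longrightarrow> (\<exists>g\<in>G. x \<in> facet G g)"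
    show "indicator ?\<Omega> x *\<^sub>R ?f x = (\<Sum>g\<in>G. indicator (facet G g) x * ?a g)"
    proof (cases "x \<in> ?\<Omega>")
      case True
      with x obtain g where g: "g \<in> G" "x \<in> facet G g" by blast
      have g_sum: "g = (\<Sum>i\<in>UNIV. (g $ i) *\<^sub>R axis i 1)"
        using basis_expansion[of g] by (simp add: scalar_mult_eq_scaleR)
      have "one_form g \<and>\<^sub>\<Lambda> b = (\<Sum>i\<in>UNIV. (g $ i) *\<^sub>R (one_form (axis i 1) \<and>\<^sub>\<Lambda> b))"
        by (subst g_sum) (simp add: linear_sum[OF linear_one_form] linear_scale[OF linear_one_form]
            linear_sum[OF linear_wedge_left] wedge_scaleR_left)
      then have d: "ext_deriv ?\<Omega> ?\<omega> x = one_form g \<and>\<^sub>\<Lambda> b"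
        using wd True by (simp add: ext_deriv_def pyramid_gradient_facet[OF g] wedge_scaleR_right)
      have "g \<lrcorner> b = (\<Sum>i\<in>UNIV. (g $ i) *\<^sub>R (axis i 1 \<lrcorner> b))"
        by (subst g_sum) (simp add: linear_sum[OF linear_int_prod_left] linear_scale[OF linear_int_prod_left])
      then have c: "codifferential ?\<Omega> ?\<omega> x = g \<lrcorner> b"
        using wd True by (simp add: codifferential_def pyramid_gradient_facet[OF g] linear_scale[OF linear_int_prod_right])
      have "indicator (facet G g') x * ?a g' = (if g' = g then ?a g else 0)" if "g' \<in> G" for g'
        using g that by (auto simp: facet_def indicator_def dest: less_asym)
      then have "(\<Sum>g\<in>G. indicator (facet G g) x * ?a g) = (\<Sum>g'\<in>G. if g' = g then ?a g else 0)"
        by (intro sum.cong) auto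
      with True g(1) finite_G show ?thesis by (simp add: d c)
    next
      case False
      then have "indicator (facet G g) x = (0 :: real)" for g by (auto simp: facet_def)
      with False show ?thesis by simp
    qed
  qed
  have "(LINT x:?\<Omega>|lebesgue. ?f x) = (LINT x|lebesgue. (\<Sum>g\<in>G. indicator (facet G g) x * ?a g))"
    unfolding set_lebesgue_integral_def
    using borel_measurable_integrable[OF int[unfolded set_integrable_def]] fmeasurableD[OF facet_lmeasurable]
    by (intro integral_cong_AE AE) auto
  with eq show ?thesis by (simp add: facet_measure_sum)
qed

text \<open>
  The cube lies inside the simplex with the vertices \<open>p0 = (- R, \<dots>, - R)\<close> and \<open>p0 + S e\<^sub>j\<close>. For \<open>w\<close> in the
  cube, the pyramid whose gradients point from \<open>w\<close> to the vertices makes \<open>F w\<close> a mean of the vertex values.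
  The affine interpolation of these values satisfies the same mean value identity, because the
  weighted sum of the gradients is zero.
\<close>

lemma pyramid_average_imp_affine_on_cube:
  fixes F :: "real^'n \<Rightarrow> real"
  assumes avg: "\<And>w G. bounded_pyramid G \<Longrightarrow>
      F w * measure lebesgue (pyramid_base G) = (\<Sum>g\<in>G. measure lebesgue (facet G g) * F (w + g))"
    and R: "0 < R"
  shows "\<exists>\<alpha> \<beta>. \<forall>w. (\<forall>i. \<bar>w $ i\<bar> < R) \<longrightarrow> F w = \<alpha> + \<beta> \<bullet> w"
proof -
  \<comment> \<open>The sum of the \<open>n\<close> numbers \<open>w $ j + R\<close> is less than \<open>S\<close>, so the cube fits into the simplex.\<close>
  define S where "S = 2 * R * real CARD('n)"
  have S: "0 < S" using R by (simp add: S_def)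
  define p0 :: "real^'n" where "p0 = (\<chi> i. - R)"
  define p where "p j = p0 + S *\<^sub>R axis j 1" for j
  define \<beta> where "\<beta> = (\<chi> j. (F (p j) - F p0) / S)"
  define \<alpha> where "\<alpha> = F p0 - \<beta> \<bullet> p0"
  have F_p0: "F p0 = \<alpha> + \<beta> \<bullet> p0" by (simp add: \<alpha>_def)
  have F_p: "F (p j) = \<alpha> + \<beta> \<bullet> p j" for j
    using S by (simp add: \<alpha>_def p_def inner_add_right inner_axis \<beta>_def)
  have "F w = \<alpha> + \<beta> \<bullet> w" if w: "\<And>i. \<bar>w $ i\<bar> < R" for w
  proof -
    define G where "G = insert (p0 - w) (range (\<lambda>j. p j - w))"
    \<comment> \<open>The barycentric coordinates of \<open>w\<close> with respect to the vertices \<open>p j\<close>.\<close>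
    define l where "l j = (w $ j + R) / S" for j
    have l_pos: "0 < l j" for j
      using w[of j] S by (simp add: l_def)
    have "(\<Sum>j\<in>UNIV. w $ j + R) < (\<Sum>j\<in>(UNIV :: 'n set). 2 * R)"
    proof (rule sum_strict_mono)
      show "w $ j + R < 2 * R" for j using w[of j] by simp
    qed auto
    then have l_sum: "(\<Sum>j\<in>UNIV. l j) < 1"
      using S by (simp add: l_def S_def mult_ac flip: sum_divide_distrib)
    have "bounded (pyramid_base G)"
    proof -
      define M where "M = (\<Sum>j\<in>UNIV. (1 / l j + 1 / (1 - (\<Sum>j\<in>UNIV. l j))) / S)"
      have "norm x \<le> M" if x: "x \<in> pyramid_base G" for x
      proof -
        define c0 where "c0 = 1 + (p0 - w) \<bullet> x"
        define c where "c j = 1 + (p j - w) \<bullet> x" for j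
        have pos: "0 < c0" "0 < c j" for j
          using x by (auto simp: pyramid_base_def G_def c0_def c_def)
        have c: "c j = c0 + S * x $ j" for j
          by (simp add: c_def c0_def p_def inner_diff_left inner_add_left inner_axis')
        \<comment> \<open>The barycentric coordinates of \<open>w\<close> express that these positive quantities have weighted mean 1.\<close>
        have "(\<Sum>j\<in>UNIV. l j * c j) + (1 - (\<Sum>j\<in>UNIV. l j)) * c0 = c0 + (\<Sum>j\<in>UNIV. l j * (S * x $ j))"
          by (simp add: c distrib_left sum.distrib left_diff_distrib sum_distrib_right)
        also have "(\<Sum>j\<in>UNIV. l j * (S * x $ j)) = (w - p0) \<bullet> x"
          using S by (simp add: l_def p0_def inner_vec_def)
        also have "c0 + (w - p0) \<bullet> x = 1" by (simp add: c0_def inner_diff_left)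
        finally have mean: "(\<Sum>j\<in>UNIV. l j * c j) + (1 - (\<Sum>j\<in>UNIV. l j)) * c0 = 1" .
        have lc: "0 \<le> l j * c j" for j using l_pos[of j] pos(2)[of j] by simp
        have "0 \<le> (\<Sum>j\<in>UNIV. l j * c j)" by (intro sum_nonneg lc)
        then have "(1 - (\<Sum>j\<in>UNIV. l j)) * c0 \<le> 1" using mean by linarith
        then have c0_le: "c0 \<le> 1 / (1 - (\<Sum>j\<in>UNIV. l j))" using l_sum by (simp add: field_simps)
        have c_le: "c j \<le> 1 / l j" for j
        proof -
          have "l j * c j \<le> (\<Sum>j\<in>UNIV. l j * c j)" by (intro member_le_sum lc) auto
          moreover have "0 \<le> (1 - (\<Sum>j\<in>UNIV. l j)) * c0" using l_sum pos(1) by simp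
          ultimately have "l j * c j \<le> 1" using mean by linarith
          then show ?thesis using l_pos[of j] by (simp add: field_simps)
        qed
        have "\<bar>x $ j\<bar> \<le> (1 / l j + 1 / (1 - (\<Sum>j\<in>UNIV. l j))) / S" for j
        proof -
          have "\<bar>S * x $ j\<bar> \<le> 1 / l j + 1 / (1 - (\<Sum>j\<in>UNIV. l j))"
            using c[of j] pos(1) pos(2)[of j] c0_le c_le[of j] by linarith
          then show ?thesis using S by (simp add: abs_mult field_simps)
        qed
        then have "(\<Sum>j\<in>UNIV. \<bar>x $ j\<bar>) \<le> M" unfolding M_def by (intro sum_mono)
        with norm_le_l1_cart[of x] show ?thesis by linarith
      qed
      then show ?thesis by (auto simp: bounded_iff)
    qed
    then have pyr: "bounded_pyramid G"
      by unfold_locales (auto simp: G_def)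
    interpret bounded_pyramid G by (rule pyr)
    let ?\<mu> = "\<lambda>g. measure lebesgue (facet G g)"
    have F_G: "F (w + g) = (\<alpha> + \<beta> \<bullet> w) + \<beta> \<bullet> g" if "g \<in> G" for g
      using that F_p0 F_p by (auto simp: G_def inner_diff_right)
    have zero: "(\<Sum>g\<in>G. ?\<mu> g * (\<beta> \<bullet> g)) = 0"
    proof -
      have "(\<Sum>g\<in>G. ?\<mu> g * (\<beta> \<bullet> g)) = (\<Sum>g\<in>G. \<Sum>i\<in>UNIV. \<beta> $ i * (?\<mu> g * g $ i))"
        by (simp add: inner_vec_def sum_distrib_left mult_ac)
      also have "\<dots> = (\<Sum>i\<in>UNIV. \<beta> $ i * (\<Sum>g\<in>G. ?\<mu> g * g $ i))"
        by (subst sum.swap) (simp add: sum_distrib_left)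
      also have "\<dots> = 0" by (simp add: sum_facet_gradients)
      finally show ?thesis .
    qed
    have "F w * measure lebesgue (pyramid_base G) = (\<Sum>g\<in>G. ?\<mu> g * ((\<alpha> + \<beta> \<bullet> w) + \<beta> \<bullet> g))"
      unfolding avg[OF pyr] by (intro sum.cong refl) (simp add: F_G)
    also have "\<dots> = (\<Sum>g\<in>G. ?\<mu> g) * (\<alpha> + \<beta> \<bullet> w) + (\<Sum>g\<in>G. ?\<mu> g * (\<beta> \<bullet> g))"
      unfolding distrib_left[of "?\<mu> _" "\<alpha> + \<beta> \<bullet> w"] sum.distrib sum_distrib_right ..
    finally have "F w * measure lebesgue (pyramid_base G) = (\<alpha> + \<beta> \<bullet> w) * measure lebesgue (pyramid_base G)"
      by (simp add: zero sum_facet_measures)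
    moreover have "measure lebesgue (pyramid_base G) \<noteq> 0"
    proof -
      have "0 \<in> pyramid_base G" by (simp add: pyramid_base_def)
      then have "\<not> negligible (pyramid_base G)"
        using open_not_negligible[OF open_base] by blast
      then show ?thesis using negligible_iff_measure0[OF base_lmeasurable] by simp
    qed
    ultimately show ?thesis by simp
  qed
  then show ?thesis by blast
qed

lemma quasiaffine_imp_one_affine:
  fixes f :: "'n::{finite,linorder} form \<times> 'n form \<Rightarrow> real"
  assumes f: "ext_int_quasiaffine k f" and k: "1 \<le> k"
  shows "ext_int_one_affine k f"
proof -
  have affine: "f (\<xi> + ((1 - s) * x + s * y) *\<^sub>R (one_form a \<and>\<^sub>\<Lambda> b), \<eta> + ((1 - s) * x + s * y) *\<^sub>R (a \<lrcorner> b))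
      = (1 - s) * f (\<xi> + x *\<^sub>R (one_form a \<and>\<^sub>\<Lambda> b), \<eta> + x *\<^sub>R (a \<lrcorner> b))
        + s * f (\<xi> + y *\<^sub>R (one_form a \<and>\<^sub>\<Lambda> b), \<eta> + y *\<^sub>R (a \<lrcorner> b))"
    if \<xi>: "\<xi> \<in> \<Lambda> (k + 1)" and \<eta>: "\<eta> \<in> \<Lambda> (k - 1)" and b: "b \<in> \<Lambda> k" for \<xi> \<eta> a b s x y
  proof -
    define F where "F w = f (\<xi> + one_form w \<and>\<^sub>\<Lambda> b, \<eta> + w \<lrcorner> b)" for w
    have avg: "F w * measure lebesgue (pyramid_base G) = (\<Sum>g\<in>G. measure lebesgue (facet G g) * F (w + g))"
      if G: "bounded_pyramid G" for w G
    proof -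
      have "\<xi> + one_form w \<and>\<^sub>\<Lambda> b \<in> \<Lambda> (k + 1)" "\<eta> + w \<lrcorner> b \<in> \<Lambda> (k - 1)"
        using \<xi> \<eta> one_form_wedge_Lam[OF b] int_prod_Lam[OF b k] by (auto intro: subspace_add[OF subspace_Lam])
      from quasiaffine_pyramid_average[OF f G this b] show ?thesis
        by (simp add: F_def linear_add[OF linear_one_form] wedge_add_left linear_add[OF linear_int_prod_left] add.assoc)
    qed
    have F_line: "f (\<xi> + t *\<^sub>R (one_form a \<and>\<^sub>\<Lambda> b), \<eta> + t *\<^sub>R (a \<lrcorner> b)) = F (t *\<^sub>R a)" for t
      by (simp add: F_def linear_scale[OF linear_one_form] wedge_scaleR_left linear_scale[OF linear_int_prod_left])
    define z where "z = (1 - s) * x + s * y"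
    define R where "R = 1 + (\<bar>x\<bar> + \<bar>y\<bar> + \<bar>z\<bar>) * norm a"
    have "0 < R" by (simp add: R_def add_pos_nonneg)
    then obtain \<alpha> \<beta> where \<alpha>\<beta>: "\<And>w. (\<And>i. \<bar>w $ i\<bar> < R) \<Longrightarrow> F w = \<alpha> + \<beta> \<bullet> w"
      using pyramid_average_imp_affine_on_cube[OF avg] by blast
    have F_eq: "F (t *\<^sub>R a) = \<alpha> + t * (\<beta> \<bullet> a)" if "\<bar>t\<bar> \<le> \<bar>x\<bar> + \<bar>y\<bar> + \<bar>z\<bar>" for t
    proof -
      have "\<bar>(t *\<^sub>R a) $ i\<bar> < R" for i
      proof -
        have "\<bar>(t *\<^sub>R a) $ i\<bar> \<le> (\<bar>x\<bar> + \<bar>y\<bar> + \<bar>z\<bar>) * norm a"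
          unfolding vector_scaleR_component real_scaleR_def abs_mult
          using that component_le_norm_cart[of a i] by (intro mult_mono) auto
        then show ?thesis by (simp add: R_def)
      qed
      from \<alpha>\<beta>[OF this] show ?thesis by simp
    qed
    show ?thesis
      unfolding F_line z_def[symmetric] using F_eq[of x] F_eq[of y] F_eq[of z] by (simp add: z_def algebra_simps)
  qed
  show ?thesis
    unfolding ext_int_one_affine_def ext_int_one_convex_def
    using affine by (auto intro!: convex_onI simp: algebra_simps)
qed

theorem theorem20:
  fixes k :: nat and f :: "'n::{finite,linorder} form \<times> 'n form \<Rightarrow> real"
  assumes "1 \<le> k" and "k \<le> CARD('n) - 1"
  shows "(ext_int_polyaffine k f \<longleftrightarrow> ext_int_quasiaffine k f) \<and>
    (ext_int_quasiaffine k f \<longleftrightarrow> ext_int_one_affine k f) \<and>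
    (ext_int_one_affine k f \<longleftrightarrow>
      (\<exists>c d :: nat \<Rightarrow> 'n form.
        (\<forall>s\<in>{0..CARD('n) div (k + 1)}. c s \<in> \<Lambda> ((k + 1) * s)) \<and>
        (\<forall>r\<in>{0..CARD('n) div (CARD('n) - k + 1)}. d r \<in> \<Lambda> ((CARD('n) - k + 1) * r)) \<and>
        (\<forall>\<xi>\<in>\<Lambda> (k + 1). \<forall>\<eta>\<in>\<Lambda> (k - 1).
          f (\<xi>, \<eta>) = (\<Sum>s=0..CARD('n) div (k + 1). c s \<bullet> wedge_power \<xi> s)
            + (\<Sum>r=0..CARD('n) div (CARD('n) - k + 1). d r \<bullet> wedge_power (\<star> \<eta>) r))))"
proof -
  have k: "k \<le> CARD('n)" using assms(2) by simp
  have "exterior_power_sum k f \<Longrightarrow> ext_int_polyaffine k f"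
    unfolding ext_int_polyaffine_def
    by (intro conjI exterior_power_sum_imp_polyconvex exterior_power_sum_uminus)
  moreover have "exterior_power_sum k f \<Longrightarrow> ext_int_quasiaffine k f"
    unfolding ext_int_quasiaffine_def
    by (intro conjI exterior_power_sum_imp_quasiconvex exterior_power_sum_uminus assms(1))
  moreover have "ext_int_polyaffine k f \<Longrightarrow> ext_int_one_affine k f"
    unfolding ext_int_polyaffine_def ext_int_one_affine_def
    using polyconvex_imp_one_convex[OF _ assms(1) k] by blast
  moreover have "ext_int_quasiaffine k f \<Longrightarrow> ext_int_one_affine k f"
    by (rule quasiaffine_imp_one_affine[OF _ assms(1)])
  moreover have "ext_int_one_affine k f \<Longrightarrow> exterior_power_sum k f"
    by (rule ext_int_one_affine_imp_power_sum[OF _ assms(1) k])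
  ultimately have "(ext_int_polyaffine k f \<longleftrightarrow> ext_int_quasiaffine k f) \<and>
      (ext_int_quasiaffine k f \<longleftrightarrow> ext_int_one_affine k f) \<and>
      (ext_int_one_affine k f \<longleftrightarrow> exterior_power_sum k f)"
    by blast
  then show ?thesis unfolding exterior_power_sum_def .
qed

end
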